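(* Let $n\ge0$, let $\mathcal C$ be an $n$-Frobenius category and let $f:M\to N$ be a morphism in $\mathcal C$. Then $f$ acts as invertible on $\operatorname{Ext}^{n+1}$ from the left if and only if it acts as invertible on $\operatorname{Ext}^{n+1}$ from the right.
   Context: Let $\mathcal A$ be an abelian category and $\mathcal C$ a full additive extension-closed subcategory with the inherited exact structure: conflations are short exact sequences of $\mathcal A$ with all terms in $\mathcal C$ (first map an inflation, second a deflation). $\operatorname{Ext}^t(A,B)=\operatorname{Ext}^t_{\mathcal C}(A,B)$ ($t\ge1$) is the abelian group (Baer sum) of equivalence classes of exact sequences $B\to X_{t-1}\to\cdots\to X_0\to A$ spliced from $t$ conflations. $P\in\mathcal C$ is $n$-projective (resp. $n$-injective) if $\operatorname{Ext}^i(P,X)=0$ (resp. $\operatorname{Ext}^i(X,P)=0$) for all $i>n$ and $X\in\mathcal C$. $\mathcal C$ is $n$-Frobenius if every object has a deflation from an $n$-projective and an inflation into an $n$-injective, and the $n$-projectives coincide with the $n$-injectives. A morphism $f:M\to N$ acts as invertible on $\operatorname{Ext}^i$ from the left (resp. right) if for every $X\in\mathcal C$ the push-out map $\operatorname{Ext}^i(X,M)\to\operatorname{Ext}^i(X,N)$, $\gamma\mapsto f\gamma$ (resp. the pull-back map $\operatorname{Ext}^i(N,X)\to\operatorname{Ext}^i(M,X)$, $\gamma\mapsto\gamma f$) is an isomorphism. *)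

theory Defs
  imports "HOL-Algebra.Group"
begin

section \<open>Abelian categories\<close>

record ('o, 'm) cat =
  Obj :: "'o set"
  Arr :: "'m set"
  Dom :: "'m \<Rightarrow> 'o"
  Cod :: "'m \<Rightarrow> 'o"
  Id :: "'o \<Rightarrow> 'm"
  Comp :: "'m \<Rightarrow> 'm \<Rightarrow> 'm"  (infixl "\<cdot>\<index>" 70)
  Plus :: "'m \<Rightarrow> 'm \<Rightarrow> 'm"  (infixl "\<boxplus>\<index>" 65)
  Zero :: "'o \<Rightarrow> 'o \<Rightarrow> 'm"

definition Hom :: "('o, 'm, 'z) cat_scheme \<Rightarrow> 'o \<Rightarrow> 'o \<Rightarrow> 'm set" where
  "Hom \<A> X Y = {f \<in> Arr \<A>. Dom \<A> f = X \<and> Cod \<A> f = Y}"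

definition hom_group :: "('o, 'm, 'z) cat_scheme \<Rightarrow> 'o \<Rightarrow> 'o \<Rightarrow> 'm monoid" where
  "hom_group \<A> X Y = \<lparr>carrier = Hom \<A> X Y, mult = Plus \<A>, one = Zero \<A> X Y\<rparr>"

definition zero_object :: "('o, 'm, 'z) cat_scheme \<Rightarrow> 'o \<Rightarrow> bool" where
  "zero_object \<A> Z \<longleftrightarrow> Z \<in> Obj \<A> \<and>
     (\<forall>X\<in>Obj \<A>. (\<exists>!f. f \<in> Hom \<A> X Z) \<and> (\<exists>!f. f \<in> Hom \<A> Z X))"

definition biproduct ::
  "('o, 'm, 'z) cat_scheme \<Rightarrow> 'o \<Rightarrow> 'o \<Rightarrow> 'o \<Rightarrow> 'm \<Rightarrow> 'm \<Rightarrow> 'm \<Rightarrow> 'm \<Rightarrow> bool" where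
  "biproduct \<A> X Y S j1 j2 p1 p2 \<longleftrightarrow>
     j1 \<in> Hom \<A> X S \<and> j2 \<in> Hom \<A> Y S \<and> p1 \<in> Hom \<A> S X \<and> p2 \<in> Hom \<A> S Y \<and>
     p1 \<cdot>\<^bsub>\<A>\<^esub> j1 = Id \<A> X \<and> p2 \<cdot>\<^bsub>\<A>\<^esub> j2 = Id \<A> Y \<and>
     p2 \<cdot>\<^bsub>\<A>\<^esub> j1 = Zero \<A> X Y \<and> p1 \<cdot>\<^bsub>\<A>\<^esub> j2 = Zero \<A> Y X \<and>
     j1 \<cdot>\<^bsub>\<A>\<^esub> p1 \<boxplus>\<^bsub>\<A>\<^esub> j2 \<cdot>\<^bsub>\<A>\<^esub> p2 = Id \<A> S"

definition is_kernel :: "('o, 'm, 'z) cat_scheme \<Rightarrow> 'm \<Rightarrow> 'm \<Rightarrow> bool" where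
  "is_kernel \<A> k f \<longleftrightarrow> k \<in> Arr \<A> \<and> f \<in> Arr \<A> \<and> Cod \<A> k = Dom \<A> f \<and>
     f \<cdot>\<^bsub>\<A>\<^esub> k = Zero \<A> (Dom \<A> k) (Cod \<A> f) \<and>
     (\<forall>g\<in>Arr \<A>. Cod \<A> g = Dom \<A> f \<and> f \<cdot>\<^bsub>\<A>\<^esub> g = Zero \<A> (Dom \<A> g) (Cod \<A> f) \<longrightarrow>
        (\<exists>!h. h \<in> Hom \<A> (Dom \<A> g) (Dom \<A> k) \<and> k \<cdot>\<^bsub>\<A>\<^esub> h = g))"

definition is_cokernel :: "('o, 'm, 'z) cat_scheme \<Rightarrow> 'm \<Rightarrow> 'm \<Rightarrow> bool" where
  "is_cokernel \<A> c f \<longleftrightarrow> c \<in> Arr \<A> \<and> f \<in> Arr \<A> \<and> Dom \<A> c = Cod \<A> f \<and>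
     c \<cdot>\<^bsub>\<A>\<^esub> f = Zero \<A> (Dom \<A> f) (Cod \<A> c) \<and>
     (\<forall>g\<in>Arr \<A>. Dom \<A> g = Cod \<A> f \<and> g \<cdot>\<^bsub>\<A>\<^esub> f = Zero \<A> (Dom \<A> f) (Cod \<A> g) \<longrightarrow>
        (\<exists>!h. h \<in> Hom \<A> (Cod \<A> c) (Cod \<A> g) \<and> h \<cdot>\<^bsub>\<A>\<^esub> c = g))"

definition is_mono :: "('o, 'm, 'z) cat_scheme \<Rightarrow> 'm \<Rightarrow> bool" where
  "is_mono \<A> f \<longleftrightarrow> f \<in> Arr \<A> \<and>
     (\<forall>g\<in>Arr \<A>. \<forall>h\<in>Arr \<A>. Dom \<A> g = Dom \<A> h \<and> Cod \<A> g = Dom \<A> f \<and> Cod \<A> h = Dom \<A> f \<and>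
        f \<cdot>\<^bsub>\<A>\<^esub> g = f \<cdot>\<^bsub>\<A>\<^esub> h \<longrightarrow> g = h)"

definition is_epi :: "('o, 'm, 'z) cat_scheme \<Rightarrow> 'm \<Rightarrow> bool" where
  "is_epi \<A> f \<longleftrightarrow> f \<in> Arr \<A> \<and>
     (\<forall>g\<in>Arr \<A>. \<forall>h\<in>Arr \<A>. Cod \<A> g = Cod \<A> h \<and> Dom \<A> g = Cod \<A> f \<and> Dom \<A> h = Cod \<A> f \<and>
        g \<cdot>\<^bsub>\<A>\<^esub> f = h \<cdot>\<^bsub>\<A>\<^esub> f \<longrightarrow> g = h)"

locale category =
  fixes \<A> :: "('o, 'm, 'z) cat_scheme" (structure)
  assumes dom_obj: "f \<in> Arr \<A> \<Longrightarrow> Dom \<A> f \<in> Obj \<A>"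
    and cod_obj: "f \<in> Arr \<A> \<Longrightarrow> Cod \<A> f \<in> Obj \<A>"
    and id_hom: "X \<in> Obj \<A> \<Longrightarrow> Id \<A> X \<in> Hom \<A> X X"
    and comp_hom: "\<lbrakk>f \<in> Hom \<A> X Y; g \<in> Hom \<A> Y Z\<rbrakk> \<Longrightarrow> g \<cdot> f \<in> Hom \<A> X Z"
    and comp_id_right: "f \<in> Hom \<A> X Y \<Longrightarrow> f \<cdot> Id \<A> X = f"
    and comp_id_left: "f \<in> Hom \<A> X Y \<Longrightarrow> Id \<A> Y \<cdot> f = f"
    and comp_assoc: "\<lbrakk>f \<in> Hom \<A> W X; g \<in> Hom \<A> X Y; h \<in> Hom \<A> Y Z\<rbrakk> \<Longrightarrow>
      (h \<cdot> g) \<cdot> f = h \<cdot> (g \<cdot> f)"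

locale preadditive_category = category +
  assumes hom_comm_group:
      "\<lbrakk>X \<in> Obj \<A>; Y \<in> Obj \<A>\<rbrakk> \<Longrightarrow> comm_group (hom_group \<A> X Y)"
    and comp_plus_left: "\<lbrakk>f \<in> Hom \<A> X Y; g \<in> Hom \<A> Y Z; g' \<in> Hom \<A> Y Z\<rbrakk> \<Longrightarrow>
      (g \<boxplus> g') \<cdot> f = g \<cdot> f \<boxplus> g' \<cdot> f"
    and comp_plus_right: "\<lbrakk>f \<in> Hom \<A> X Y; f' \<in> Hom \<A> X Y; g \<in> Hom \<A> Y Z\<rbrakk> \<Longrightarrow>
      g \<cdot> (f \<boxplus> f') = g \<cdot> f \<boxplus> g \<cdot> f'"

locale abelian_category = preadditive_category +
  assumes ex_zero_object: "\<exists>Z. zero_object \<A> Z"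
    and ex_biproduct: "\<lbrakk>X \<in> Obj \<A>; Y \<in> Obj \<A>\<rbrakk> \<Longrightarrow>
      \<exists>S j1 j2 p1 p2. biproduct \<A> X Y S j1 j2 p1 p2"
    and ex_kernel: "f \<in> Arr \<A> \<Longrightarrow> \<exists>k. is_kernel \<A> k f"
    and ex_cokernel: "f \<in> Arr \<A> \<Longrightarrow> \<exists>c. is_cokernel \<A> c f"
    and mono_is_kernel: "is_mono \<A> f \<Longrightarrow> \<exists>g. is_kernel \<A> f g"
    and epi_is_cokernel: "is_epi \<A> f \<Longrightarrow> \<exists>g. is_cokernel \<A> f g"

definition short_exact :: "('o, 'm, 'z) cat_scheme \<Rightarrow> 'm \<Rightarrow> 'm \<Rightarrow> bool" where
  "short_exact \<A> i p \<longleftrightarrow> is_kernel \<A> i p \<and> is_cokernel \<A> p i"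

text \<open>
  The square with \<open>i : M \<rightarrow> X\<close>, \<open>f : M \<rightarrow> N\<close>, \<open>f' : X \<rightarrow> Y\<close>, \<open>i' : N \<rightarrow> Y\<close> is a push-out.
\<close>

definition pushout :: "('o, 'm, 'z) cat_scheme \<Rightarrow> 'm \<Rightarrow> 'm \<Rightarrow> 'm \<Rightarrow> 'm \<Rightarrow> bool" where
  "pushout \<A> i f f' i' \<longleftrightarrow>
     i \<in> Arr \<A> \<and> f \<in> Arr \<A> \<and> Dom \<A> i = Dom \<A> f \<and>
     f' \<in> Arr \<A> \<and> i' \<in> Arr \<A> \<and> Dom \<A> f' = Cod \<A> i \<and> Dom \<A> i' = Cod \<A> f \<and>
     Cod \<A> f' = Cod \<A> i' \<and> f' \<cdot>\<^bsub>\<A>\<^esub> i = i' \<cdot>\<^bsub>\<A>\<^esub> f \<and>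
     (\<forall>u\<in>Arr \<A>. \<forall>v\<in>Arr \<A>. Dom \<A> u = Cod \<A> i \<and> Dom \<A> v = Cod \<A> f \<and> Cod \<A> u = Cod \<A> v \<and>
        u \<cdot>\<^bsub>\<A>\<^esub> i = v \<cdot>\<^bsub>\<A>\<^esub> f \<longrightarrow>
        (\<exists>!h. h \<in> Hom \<A> (Cod \<A> f') (Cod \<A> u) \<and> h \<cdot>\<^bsub>\<A>\<^esub> f' = u \<and> h \<cdot>\<^bsub>\<A>\<^esub> i' = v))"

text \<open>
  The square with \<open>p : X \<rightarrow> N\<close>, \<open>f : M \<rightarrow> N\<close>, \<open>f' : Y \<rightarrow> X\<close>, \<open>p' : Y \<rightarrow> M\<close> is a pull-back.
\<close>

definition pullback :: "('o, 'm, 'z) cat_scheme \<Rightarrow> 'm \<Rightarrow> 'm \<Rightarrow> 'm \<Rightarrow> 'm \<Rightarrow> bool" where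
  "pullback \<A> p f f' p' \<longleftrightarrow>
     p \<in> Arr \<A> \<and> f \<in> Arr \<A> \<and> Cod \<A> p = Cod \<A> f \<and>
     f' \<in> Arr \<A> \<and> p' \<in> Arr \<A> \<and> Cod \<A> f' = Dom \<A> p \<and> Cod \<A> p' = Dom \<A> f \<and>
     Dom \<A> f' = Dom \<A> p' \<and> p \<cdot>\<^bsub>\<A>\<^esub> f' = f \<cdot>\<^bsub>\<A>\<^esub> p' \<and>
     (\<forall>u\<in>Arr \<A>. \<forall>v\<in>Arr \<A>. Cod \<A> u = Dom \<A> p \<and> Cod \<A> v = Dom \<A> f \<and> Dom \<A> u = Dom \<A> v \<and>
        p \<cdot>\<^bsub>\<A>\<^esub> u = f \<cdot>\<^bsub>\<A>\<^esub> v \<longrightarrow>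
        (\<exists>!h. h \<in> Hom \<A> (Dom \<A> u) (Dom \<A> f') \<and> f' \<cdot>\<^bsub>\<A>\<^esub> h = u \<and> p' \<cdot>\<^bsub>\<A>\<^esub> h = v))"

section \<open>Extension-closed subcategories\<close>

text \<open>A full subcategory is represented by its set of objects.\<close>

locale extension_closed_subcategory = abelian_category +
  fixes \<C> :: "'o set"
  assumes sub_obj: "\<C> \<subseteq> Obj \<A>"
    and sub_zero: "\<exists>Z\<in>\<C>. zero_object \<A> Z"
    and sub_biproduct: "\<lbrakk>X \<in> \<C>; Y \<in> \<C>\<rbrakk> \<Longrightarrow>
      \<exists>S\<in>\<C>. \<exists>j1 j2 p1 p2. biproduct \<A> X Y S j1 j2 p1 p2"
    and sub_extension: "\<lbrakk>short_exact \<A> i p; Dom \<A> i \<in> \<C>; Cod \<A> p \<in> \<C>\<rbrakk> \<Longrightarrow> Cod \<A> i \<in> \<C>"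

definition conflation :: "('o, 'm, 'z) cat_scheme \<Rightarrow> 'o set \<Rightarrow> 'm \<Rightarrow> 'm \<Rightarrow> bool" where
  "conflation \<A> \<C> i p \<longleftrightarrow>
     short_exact \<A> i p \<and> Dom \<A> i \<in> \<C> \<and> Cod \<A> i \<in> \<C> \<and> Cod \<A> p \<in> \<C>"

definition inflation :: "('o, 'm, 'z) cat_scheme \<Rightarrow> 'o set \<Rightarrow> 'm \<Rightarrow> bool" where
  "inflation \<A> \<C> i \<longleftrightarrow> (\<exists>p. conflation \<A> \<C> i p)"

definition deflation :: "('o, 'm, 'z) cat_scheme \<Rightarrow> 'o set \<Rightarrow> 'm \<Rightarrow> bool" where
  "deflation \<A> \<C> p \<longleftrightarrow> (\<exists>i. conflation \<A> \<C> i p)"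

section \<open>Yoneda extension groups\<close>

text \<open>
  An exact sequence \<open>B \<rightarrow> X\<^bsub>t-1\<^esub> \<rightarrow> \<dots> \<rightarrow> X\<^sub>0 \<rightarrow> A\<close> spliced from \<open>t\<close> conflations is the list of its
  \<open>t + 1\<close> morphisms, from left to right. In \<open>step\<close>, the conflation \<open>B \<rightarrow> X \<rightarrow> K\<close> is spliced with a
  sequence that starts with \<open>j : K \<rightarrow> X'\<close>.
\<close>

inductive exact_seq :: "('o, 'm, 'z) cat_scheme \<Rightarrow> 'o set \<Rightarrow> nat \<Rightarrow> 'o \<Rightarrow> 'o \<Rightarrow> 'm list \<Rightarrow> bool"
  for \<A> :: "('o, 'm, 'z) cat_scheme" and \<C> :: "'o set" where
  base: "\<lbrakk>conflation \<A> \<C> i p; Dom \<A> i = B; Cod \<A> p = A\<rbrakk> \<Longrightarrow> exact_seq \<A> \<C> (Suc 0) A B [i, p]"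
| step: "\<lbrakk>conflation \<A> \<C> i p; Dom \<A> i = B; Cod \<A> p = K; exact_seq \<A> \<C> t A K (j # ds)\<rbrakk> \<Longrightarrow>
    exact_seq \<A> \<C> (Suc t) A B (i # (j \<cdot>\<^bsub>\<A>\<^esub> p) # ds)"

text \<open>
  \<open>h 0, \<dots>, h (t + 1)\<close> are the vertical maps of a commutative ladder; the outer two are identities.
\<close>

definition seq_morphism ::
  "('o, 'm, 'z) cat_scheme \<Rightarrow> 'o set \<Rightarrow> nat \<Rightarrow> 'o \<Rightarrow> 'o \<Rightarrow> 'm list \<Rightarrow> 'm list \<Rightarrow> bool" where
  "seq_morphism \<A> \<C> t A B E E' \<longleftrightarrow>
     exact_seq \<A> \<C> t A B E \<and> exact_seq \<A> \<C> t A B E' \<and>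
     (\<exists>h. h 0 = Id \<A> B \<and> h (Suc t) = Id \<A> A \<and>
        (\<forall>k\<le>t. h k \<in> Hom \<A> (Dom \<A> (E ! k)) (Dom \<A> (E' ! k)) \<and>
           E' ! k \<cdot>\<^bsub>\<A>\<^esub> h k = h (Suc k) \<cdot>\<^bsub>\<A>\<^esub> E ! k))"

definition ext_rel ::
  "('o, 'm, 'z) cat_scheme \<Rightarrow> 'o set \<Rightarrow> nat \<Rightarrow> 'o \<Rightarrow> 'o \<Rightarrow> ('m list \<times> 'm list) set" where
  "ext_rel \<A> \<C> t A B = {(E, E'). equivclp (seq_morphism \<A> \<C> t A B) E E'}"

text \<open>
  Push-out along \<open>f\<close> replaces the two leftmost morphisms \<open>i : M \<rightarrow> X\<close> and \<open>d\<close> of a sequence,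
  pull-back along \<open>f\<close> the two rightmost ones.
\<close>

definition seq_pushout :: "('o, 'm, 'z) cat_scheme \<Rightarrow> 'm \<Rightarrow> 'm list \<Rightarrow> 'm list \<Rightarrow> bool" where
  "seq_pushout \<A> f E E' \<longleftrightarrow>
     (\<exists>i d ds i' d' f'. E = i # d # ds \<and> E' = i' # d' # ds \<and> pushout \<A> i f f' i' \<and>
        d' \<in> Hom \<A> (Cod \<A> i') (Cod \<A> d) \<and> d' \<cdot>\<^bsub>\<A>\<^esub> f' = d \<and>
        d' \<cdot>\<^bsub>\<A>\<^esub> i' = Zero \<A> (Dom \<A> i') (Cod \<A> d))"

definition seq_pullback :: "('o, 'm, 'z) cat_scheme \<Rightarrow> 'm \<Rightarrow> 'm list \<Rightarrow> 'm list \<Rightarrow> bool" where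
  "seq_pullback \<A> f E E' \<longleftrightarrow>
     (\<exists>ds d p d' p' f'. E = ds @ [d, p] \<and> E' = ds @ [d', p'] \<and> pullback \<A> p f f' p' \<and>
        d' \<in> Hom \<A> (Dom \<A> d) (Dom \<A> p') \<and> f' \<cdot>\<^bsub>\<A>\<^esub> d' = d \<and>
        p' \<cdot>\<^bsub>\<A>\<^esub> d' = Zero \<A> (Dom \<A> d) (Cod \<A> p'))"

text \<open>
  The Baer sum of \<open>E\<close> and \<open>E'\<close> is \<open>\<nabla>\<^sub>B (E \<oplus> E') \<Delta>\<^sub>A\<close>. The biproducts \<open>S k\<close> are those of the
  \<open>k\<close>-th objects of \<open>E\<close> and \<open>E'\<close>, so \<open>S 0\<close> is \<open>B \<oplus> B\<close> with codiagonal \<open>p1 0 \<boxplus> p2 0\<close>, and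
  \<open>S (t + 1)\<close> is \<open>A \<oplus> A\<close> with diagonal \<open>j1 (t + 1) \<boxplus> j2 (t + 1)\<close>.
\<close>

definition seq_baer_sum ::
  "('o, 'm, 'z) cat_scheme \<Rightarrow> nat \<Rightarrow> 'o \<Rightarrow> 'm list \<Rightarrow> 'm list \<Rightarrow> 'm list \<Rightarrow> bool" where
  "seq_baer_sum \<A> t A E E' F \<longleftrightarrow>
     (\<exists>S j1 j2 p1 p2 G.
        (\<forall>k\<le>t. biproduct \<A> (Dom \<A> (E ! k)) (Dom \<A> (E' ! k)) (S k) (j1 k) (j2 k) (p1 k) (p2 k)) \<and>
        biproduct \<A> A A (S (Suc t)) (j1 (Suc t)) (j2 (Suc t)) (p1 (Suc t)) (p2 (Suc t)) \<and>
        seq_pushout \<A> (p1 0 \<boxplus>\<^bsub>\<A>\<^esub> p2 0)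
          (map (\<lambda>k. j1 (Suc k) \<cdot>\<^bsub>\<A>\<^esub> (E ! k \<cdot>\<^bsub>\<A>\<^esub> p1 k) \<boxplus>\<^bsub>\<A>\<^esub>
                    j2 (Suc k) \<cdot>\<^bsub>\<A>\<^esub> (E' ! k \<cdot>\<^bsub>\<A>\<^esub> p2 k)) [0..<Suc t]) G \<and>
        seq_pullback \<A> (j1 (Suc t) \<boxplus>\<^bsub>\<A>\<^esub> j2 (Suc t)) G F)"

text \<open>
  The neutral element is the class of \<open>B \<rightarrow> B \<oplus> A \<rightarrow> A\<close> for \<open>t = 1\<close> and of
  \<open>B = B \<rightarrow> 0 \<rightarrow> \<dots> \<rightarrow> 0 \<rightarrow> A = A\<close> for \<open>t \<ge> 2\<close>.
\<close>

definition seq_zero ::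
  "('o, 'm, 'z) cat_scheme \<Rightarrow> nat \<Rightarrow> 'o \<Rightarrow> 'o \<Rightarrow> 'm list \<Rightarrow> bool" where
  "seq_zero \<A> t A B E \<longleftrightarrow>
     (if t = 1 then \<exists>S j1 j2 p1 p2. biproduct \<A> B A S j1 j2 p1 p2 \<and> E = [j1, p2]
      else \<exists>Z. zero_object \<A> Z \<and>
        (let Xs = B # replicate (t - 2) Z @ [A] in
           E = Id \<A> B # map (\<lambda>k. Zero \<A> (Xs ! k) (Xs ! Suc k)) [0..<t - 1] @ [Id \<A> A]))"

definition Ext ::
  "('o, 'm, 'z) cat_scheme \<Rightarrow> 'o set \<Rightarrow> nat \<Rightarrow> 'o \<Rightarrow> 'o \<Rightarrow> 'm list set monoid" where
  "Ext \<A> \<C> t A B =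
     \<lparr>carrier = {E. exact_seq \<A> \<C> t A B E} // ext_rel \<A> \<C> t A B,
      mult = (\<lambda>\<gamma> \<delta>. ext_rel \<A> \<C> t A B `` {F. \<exists>E\<in>\<gamma>. \<exists>E'\<in>\<delta>. seq_baer_sum \<A> t A E E' F}),
      one = ext_rel \<A> \<C> t A B `` {E. seq_zero \<A> t A B E}\<rparr>"

text \<open>
  For \<open>f : M \<rightarrow> N\<close>, the maps \<open>\<gamma> \<mapsto> f\<gamma>\<close> from \<open>Ext\<^sup>t(X, M)\<close> to \<open>Ext\<^sup>t(X, N)\<close> and
  \<open>\<gamma> \<mapsto> \<gamma>f\<close> from \<open>Ext\<^sup>t(N, X)\<close> to \<open>Ext\<^sup>t(M, X)\<close>.
\<close>

definition Ext_pushout ::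
  "('o, 'm, 'z) cat_scheme \<Rightarrow> 'o set \<Rightarrow> nat \<Rightarrow> 'o \<Rightarrow> 'm \<Rightarrow> 'm list set \<Rightarrow> 'm list set" where
  "Ext_pushout \<A> \<C> t X f \<gamma> =
     ext_rel \<A> \<C> t X (Cod \<A> f) `` {F. \<exists>E\<in>\<gamma>. seq_pushout \<A> f E F}"

definition Ext_pullback ::
  "('o, 'm, 'z) cat_scheme \<Rightarrow> 'o set \<Rightarrow> nat \<Rightarrow> 'o \<Rightarrow> 'm \<Rightarrow> 'm list set \<Rightarrow> 'm list set" where
  "Ext_pullback \<A> \<C> t X f \<gamma> =
     ext_rel \<A> \<C> t (Dom \<A> f) X `` {F. \<exists>E\<in>\<gamma>. seq_pullback \<A> f E F}"

definition invertible_from_left ::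
  "('o, 'm, 'z) cat_scheme \<Rightarrow> 'o set \<Rightarrow> nat \<Rightarrow> 'm \<Rightarrow> bool" where
  "invertible_from_left \<A> \<C> t f \<longleftrightarrow>
     (\<forall>X\<in>\<C>. Ext_pushout \<A> \<C> t X f \<in> iso (Ext \<A> \<C> t X (Dom \<A> f)) (Ext \<A> \<C> t X (Cod \<A> f)))"

definition invertible_from_right ::
  "('o, 'm, 'z) cat_scheme \<Rightarrow> 'o set \<Rightarrow> nat \<Rightarrow> 'm \<Rightarrow> bool" where
  "invertible_from_right \<A> \<C> t f \<longleftrightarrow>
     (\<forall>X\<in>\<C>. Ext_pullback \<A> \<C> t X f \<in> iso (Ext \<A> \<C> t (Cod \<A> f) X) (Ext \<A> \<C> t (Dom \<A> f) X))"

section \<open>\<open>n\<close>-Frobenius categories\<close>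

definition n_projective :: "('o, 'm, 'z) cat_scheme \<Rightarrow> 'o set \<Rightarrow> nat \<Rightarrow> 'o \<Rightarrow> bool" where
  "n_projective \<A> \<C> n P \<longleftrightarrow> P \<in> \<C> \<and>
     (\<forall>i>n. \<forall>X\<in>\<C>. carrier (Ext \<A> \<C> i P X) = {\<one>\<^bsub>Ext \<A> \<C> i P X\<^esub>})"

definition n_injective :: "('o, 'm, 'z) cat_scheme \<Rightarrow> 'o set \<Rightarrow> nat \<Rightarrow> 'o \<Rightarrow> bool" where
  "n_injective \<A> \<C> n P \<longleftrightarrow> P \<in> \<C> \<and>
     (\<forall>i>n. \<forall>X\<in>\<C>. carrier (Ext \<A> \<C> i X P) = {\<one>\<^bsub>Ext \<A> \<C> i X P\<^esub>})"

locale n_Frobenius_category = extension_closed_subcategory +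
  fixes n :: nat
  assumes enough_n_projectives:
      "X \<in> \<C> \<Longrightarrow> \<exists>p. deflation \<A> \<C> p \<and> n_projective \<A> \<C> n (Dom \<A> p) \<and> Cod \<A> p = X"
    and enough_n_injectives:
      "X \<in> \<C> \<Longrightarrow> \<exists>i. inflation \<A> \<C> i \<and> Dom \<A> i = X \<and> n_injective \<A> \<C> n (Cod \<A> i)"
    and n_projective_iff_n_injective:
      "n_projective \<A> \<C> n X \<longleftrightarrow> n_injective \<A> \<C> n X"

end

theory Submission
  imports Defs
begin

text \<open>
  Choose an inflation \<open>M \<rightarrow> I\<close> into an \<open>n\<close>-injective object. Together with \<open>f\<close> it gives a conflation
  \<open>M \<rightarrow> N \<oplus> I \<rightarrow> L\<close> with first map \<open>u\<close>. As \<open>I\<close> is also \<open>n\<close>-projective, \<open>f\<close> acts as invertible on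
  \<open>Ext\<^sup>n\<^sup>+\<^sup>1\<close> from either side if and only if \<open>u\<close> does. If \<open>u\<close> does so from the left, then dimension shifting
  makes it injective on \<open>Ext\<^sup>n\<^sup>+\<^sup>2\<close>, so \<open>Ext\<^sup>i(-, L) = 0\<close> for \<open>i = n + 1\<close> and, by shifting again, for all
  \<open>i > n\<close>. Hence \<open>L\<close> is \<open>n\<close>-injective, therefore \<open>n\<close>-projective, and the contravariant exact sequence
  shows that \<open>u\<close> acts as invertible from the right. The converse is this statement in the opposite
  category.

  The exact sequences come from one principle: a class in \<open>Ext\<^sup>t\<^sup>+\<^sup>1\<close> is a splice of a conflation \<open>\<delta>\<close> with
  a class \<open>e\<close> in \<open>Ext\<^sup>t\<close>, and the equality of splices is generated by \<open>(\<delta>k)e = \<delta>(ke)\<close>. The property that \<open>e\<close>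
  is in the image of the deflation of \<open>\<delta>\<close> respects this relation because of a Mayer-Vietoris argument in
  degree \<open>t\<close>; it holds for \<open>e = 0\<close>, hence whenever the splice vanishes. This is exactness at the source of
  the connecting map in degree \<open>t\<close>, from which exactness in the middle follows in degree \<open>t + 1\<close>.
\<close>


section \<open>Opposite categories\<close>

text \<open>For \<open>n > 0\<close> there need not be enough projective or injective objects, so
  \<open>Ext\<close> cannot be computed from resolutions and is handled through exact sequences
  alone. Their classes have no canonical representatives; what has to be shown of equal classes is
  phrased as an invariant along zigzags of morphisms.

  The arrow \<open>f\<close> need not be an inflation, so no exact sequence is at hand for it. A
  second component into \<open>I\<close> repairs this. The added summand is invisible in degrees
  above \<open>n\<close> on both sides: in the covariant variable because \<open>I\<close> is
  \<open>n\<close>-injective, in the contravariant one because it is \<open>n\<close>-projective.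
  The Frobenius condition enters a second time for \<open>L\<close>.

  One degree suffices as hypothesis for this reason: if \<open>K\<close> is the kernel and
  \<open>G\<close> the quotient of a conflation with \<open>n\<close>-projective middle term, the
  shift from degree \<open>n + 1\<close> at \<open>K\<close> to degree \<open>n + 2\<close> at
  \<open>G\<close> is bijective and natural in the coefficients. Its injectivity uses that
  \<open>Ext\<close> of the middle term vanishes in degree \<open>n + 1\<close> already.\<close>

definition opcat :: "('o, 'm, 'z) cat_scheme \<Rightarrow> ('o, 'm, 'z) cat_scheme" where
  "opcat \<A> = \<A>\<lparr>Dom := Cod \<A>, Cod := Dom \<A>, Comp := \<lambda>g f. Comp \<A> f g,
     Zero := \<lambda>X Y. Zero \<A> Y X\<rparr>"

lemma opcat_simps [simp]:
  "Obj (opcat \<A>) = Obj \<A>" "Arr (opcat \<A>) = Arr \<A>"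
  "Dom (opcat \<A>) = Cod \<A>" "Cod (opcat \<A>) = Dom \<A>" "Id (opcat \<A>) = Id \<A>"
  "g \<cdot>\<^bsub>opcat \<A>\<^esub> f = f \<cdot>\<^bsub>\<A>\<^esub> g" "Plus (opcat \<A>) = Plus \<A>"
  "Zero (opcat \<A>) X Y = Zero \<A> Y X"
  by (simp_all add: opcat_def)

lemma Hom_opcat [simp]: "Hom (opcat \<A>) X Y = Hom \<A> Y X"
  by (auto simp: Hom_def)

lemma hom_group_opcat [simp]: "hom_group (opcat \<A>) X Y = hom_group \<A> Y X"
  by (simp add: hom_group_def)

text \<open>Duality is an involution up to equality and not just up to isomorphism. Facts brought
  back from the opposite category are therefore literally facts about \<A>.\<close>

lemma opcat_opcat [simp]: "opcat (opcat \<A>) = \<A>"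
  by (simp add: opcat_def)

lemma is_mono_opcat [simp]: "is_mono (opcat \<A>) f \<longleftrightarrow> is_epi \<A> f"
  by (simp add: is_mono_def is_epi_def)

lemma is_epi_opcat [simp]: "is_epi (opcat \<A>) f \<longleftrightarrow> is_mono \<A> f"
  by (simp add: is_mono_def is_epi_def)

lemma is_kernel_opcat [simp]: "is_kernel (opcat \<A>) k f \<longleftrightarrow> is_cokernel \<A> k f"
  by (simp add: is_kernel_def is_cokernel_def eq_commute[of "Cod \<A> f"])

lemma is_cokernel_opcat [simp]: "is_cokernel (opcat \<A>) k f \<longleftrightarrow> is_kernel \<A> k f"
  using is_kernel_opcat[of "opcat \<A>" k f] by simp

lemma zero_object_opcat [simp]: "zero_object (opcat \<A>) Z \<longleftrightarrow> zero_object \<A> Z"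
  by (auto simp: zero_object_def)

lemma biproduct_opcat [simp]:
  "biproduct (opcat \<A>) X Y S p1 p2 j1 j2 \<longleftrightarrow> biproduct \<A> X Y S j1 j2 p1 p2"
  by (auto simp: biproduct_def)

lemma short_exact_opcat [simp]: "short_exact (opcat \<A>) p i \<longleftrightarrow> short_exact \<A> i p"
  by (auto simp: short_exact_def)

lemma pullback_opcat [simp]: "pullback (opcat \<A>) i f f' i' \<longleftrightarrow> pushout \<A> i f f' i'"
  by (simp add: pullback_def pushout_def eq_commute)

lemma pushout_opcat [simp]: "pushout (opcat \<A>) i f f' i' \<longleftrightarrow> pullback \<A> i f f' i'"
  using pullback_opcat[of "opcat \<A>" i f f' i'] by simp

lemma category_opcat:
  assumes "category \<A>"
  shows "category (opcat \<A>)"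
proof -
  interpret category \<A> by fact
  show ?thesis
  proof unfold_locales
    show "h \<cdot>\<^bsub>opcat \<A>\<^esub> g \<cdot>\<^bsub>opcat \<A>\<^esub> f = h \<cdot>\<^bsub>opcat \<A>\<^esub> (g \<cdot>\<^bsub>opcat \<A>\<^esub> f)"
      if "f \<in> Hom (opcat \<A>) W X" "g \<in> Hom (opcat \<A>) X Y" "h \<in> Hom (opcat \<A>) Y Z"
      for f g h W X Y Z
      using that comp_assoc[of h Z Y g X f W] by simp
  qed (auto simp: dom_obj cod_obj id_hom comp_id_left comp_id_right intro: comp_hom)
qed

lemma preadditive_category_opcat:
  assumes "preadditive_category \<A>"
  shows "preadditive_category (opcat \<A>)"
proof -
  interpret preadditive_category \<A> by fact
  interpret op: category "opcat \<A>"
    by (rule category_opcat) unfold_locales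
  show ?thesis
  proof (intro preadditive_category.intro preadditive_category_axioms.intro op.category_axioms)
    fix X Y Z f f' g g'
    assume "f \<in> Hom (opcat \<A>) X Y" "g \<in> Hom (opcat \<A>) Y Z" "g' \<in> Hom (opcat \<A>) Y Z"
    then show "(g \<boxplus>\<^bsub>opcat \<A>\<^esub> g') \<cdot>\<^bsub>opcat \<A>\<^esub> f
        = g \<cdot>\<^bsub>opcat \<A>\<^esub> f \<boxplus>\<^bsub>opcat \<A>\<^esub> g' \<cdot>\<^bsub>opcat \<A>\<^esub> f"
      using comp_plus_right[of g Z Y g' f X] by simp
  next
    fix X Y Z f f' g
    assume "f \<in> Hom (opcat \<A>) X Y" "f' \<in> Hom (opcat \<A>) X Y" "g \<in> Hom (opcat \<A>) Y Z"
    then show "g \<cdot>\<^bsub>opcat \<A>\<^esub> (f \<boxplus>\<^bsub>opcat \<A>\<^esub> f')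
        = g \<cdot>\<^bsub>opcat \<A>\<^esub> f \<boxplus>\<^bsub>opcat \<A>\<^esub> g \<cdot>\<^bsub>opcat \<A>\<^esub> f'"
      using comp_plus_left[of g Z Y f X f'] by simp
  qed (simp add: hom_comm_group)
qed

lemma abelian_category_opcat:
  assumes "abelian_category \<A>"
  shows "abelian_category (opcat \<A>)"
proof -
  interpret abelian_category \<A> by fact
  interpret op: preadditive_category "opcat \<A>"
    by (rule preadditive_category_opcat) unfold_locales
  show ?thesis
  proof unfold_locales
    show "\<exists>S j1 j2 p1 p2. biproduct (opcat \<A>) X Y S j1 j2 p1 p2"
      if XY: "X \<in> Obj (opcat \<A>)" "Y \<in> Obj (opcat \<A>)" for X Y
    proof -
      obtain S j1 j2 p1 p2 where "biproduct \<A> X Y S j1 j2 p1 p2"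
        using ex_biproduct XY by fastforce
      then have "biproduct (opcat \<A>) X Y S p1 p2 j1 j2" by simp
      then show ?thesis by blast
    qed
  qed (use ex_zero_object ex_kernel ex_cokernel mono_is_kernel epi_is_cokernel in simp_all)
qed

lemma extension_closed_subcategory_opcat:
  assumes "extension_closed_subcategory \<A> \<C>"
  shows "extension_closed_subcategory (opcat \<A>) \<C>"
proof -
  interpret extension_closed_subcategory \<A> \<C> by fact
  interpret op: abelian_category "opcat \<A>"
    by (rule abelian_category_opcat) unfold_locales
  show ?thesis
  proof unfold_locales
    show "\<C> \<subseteq> Obj (opcat \<A>)" "\<exists>Z\<in>\<C>. zero_object (opcat \<A>) Z"
      using sub_obj sub_zero by auto
    show "\<exists>S\<in>\<C>. \<exists>j1 j2 p1 p2. biproduct (opcat \<A>) X Y S j1 j2 p1 p2"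
      if "X \<in> \<C>" "Y \<in> \<C>" for X Y
    proof -
      obtain S j1 j2 p1 p2 where "S \<in> \<C>" "biproduct \<A> X Y S j1 j2 p1 p2"
        using sub_biproduct \<open>X \<in> \<C>\<close> \<open>Y \<in> \<C>\<close> by blast
      then have "S \<in> \<C> \<and> biproduct (opcat \<A>) X Y S p1 p2 j1 j2" by simp
      then show ?thesis by blast
    qed
    show "Cod (opcat \<A>) i \<in> \<C>"
      if "short_exact (opcat \<A>) i p" "Dom (opcat \<A>) i \<in> \<C>" "Cod (opcat \<A>) p \<in> \<C>" for i p
    proof -
      have "short_exact \<A> p i" using that by simp
      \<comment> \<open>The middle object is \<open>Dom \<A> i\<close> in the goal but
        \<open>Cod \<A> p\<close> in \<open>sub_extension\<close>; the kernel condition identifies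
        them.\<close>
      moreover from this have "Cod \<A> p = Dom \<A> i"
        by (simp add: short_exact_def is_kernel_def)
      ultimately show ?thesis using sub_extension[of p i] that by simp
    qed
  qed
qed

section \<open>Preadditive categories\<close>

context category
begin

declare dom_obj [simp] cod_obj [simp]

lemma hom_iff: "f \<in> Hom \<A> X Y \<longleftrightarrow> f \<in> Arr \<A> \<and> Dom \<A> f = X \<and> Cod \<A> f = Y"
  by (auto simp: Hom_def)

text \<open>Types are tracked by equations for \<open>Dom\<close> and \<open>Cod\<close>, which
  rewriting can check. A rule on \<open>Hom\<close> would leave the middle object of a composite to
  be guessed.\<close>

lemma comp_arr [simp]:
  assumes "f \<in> Arr \<A>" "g \<in> Arr \<A>" "Dom \<A> g = Cod \<A> f"
  shows "g \<cdot> f \<in> Arr \<A>" "Dom \<A> (g \<cdot> f) = Dom \<A> f" "Cod \<A> (g \<cdot> f) = Cod \<A> g"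
  using comp_hom[of f "Dom \<A> f" "Cod \<A> f" g "Cod \<A> g"] assms by (auto simp: Hom_def)

lemma assoc [simp]:
  assumes "f \<in> Arr \<A>" "g \<in> Arr \<A>" "h \<in> Arr \<A>" "Dom \<A> g = Cod \<A> f" "Dom \<A> h = Cod \<A> g"
  shows "(h \<cdot> g) \<cdot> f = h \<cdot> (g \<cdot> f)"
  using comp_assoc[of f "Dom \<A> f" "Cod \<A> f" g "Cod \<A> g" h "Cod \<A> h"] assms
  by (auto simp: Hom_def)

lemma id_arr [simp]:
  assumes "X \<in> Obj \<A>"
  shows "Id \<A> X \<in> Arr \<A>" "Dom \<A> (Id \<A> X) = X" "Cod \<A> (Id \<A> X) = X"
  using id_hom[OF assms] by (auto simp: Hom_def)

lemma id_comp [simp]: "\<lbrakk>f \<in> Arr \<A>; Cod \<A> f = X\<rbrakk> \<Longrightarrow> Id \<A> X \<cdot> f = f"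
  using comp_id_left[of f "Dom \<A> f" X] by (auto simp: Hom_def)

lemma comp_id [simp]: "\<lbrakk>f \<in> Arr \<A>; Dom \<A> f = X\<rbrakk> \<Longrightarrow> f \<cdot> Id \<A> X = f"
  using comp_id_right[of f X "Cod \<A> f"] by (auto simp: Hom_def)

lemma hom_obj: "f \<in> Hom \<A> X Y \<Longrightarrow> X \<in> Obj \<A> \<and> Y \<in> Obj \<A>"
  using dom_obj cod_obj by (auto simp: Hom_def)

end

context preadditive_category
begin

lemma hom_comm_group': "f \<in> Hom \<A> X Y \<Longrightarrow> comm_group (hom_group \<A> X Y)"
  using hom_comm_group hom_obj by blast

lemma plus_hom: "\<lbrakk>f \<in> Hom \<A> X Y; g \<in> Hom \<A> X Y\<rbrakk> \<Longrightarrow> f \<boxplus> g \<in> Hom \<A> X Y"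
  using monoid.m_closed[of "hom_group \<A> X Y" f g] hom_comm_group'[of f X Y]
  by (simp add: hom_group_def comm_group_def group_def)

lemma plus_arr [simp]:
  assumes "f \<in> Arr \<A>" "g \<in> Arr \<A>" "Dom \<A> g = Dom \<A> f" "Cod \<A> g = Cod \<A> f"
  shows "f \<boxplus> g \<in> Arr \<A>" "Dom \<A> (f \<boxplus> g) = Dom \<A> f" "Cod \<A> (f \<boxplus> g) = Cod \<A> f"
  using plus_hom[of f "Dom \<A> f" "Cod \<A> f" g] assms by (auto simp: Hom_def)

lemma zero_hom: "\<lbrakk>X \<in> Obj \<A>; Y \<in> Obj \<A>\<rbrakk> \<Longrightarrow> Zero \<A> X Y \<in> Hom \<A> X Y"
  using monoid.one_closed[of "hom_group \<A> X Y"] hom_comm_group[of X Y]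
  by (simp add: hom_group_def comm_group_def group_def)

lemma zero_arr [simp]:
  assumes "X \<in> Obj \<A>" "Y \<in> Obj \<A>"
  shows "Zero \<A> X Y \<in> Arr \<A>" "Dom \<A> (Zero \<A> X Y) = X" "Cod \<A> (Zero \<A> X Y) = Y"
  using zero_hom[OF assms] by (auto simp: Hom_def)

lemma plus_assoc:
  assumes "f \<in> Hom \<A> X Y" "g \<in> Hom \<A> X Y" "h \<in> Hom \<A> X Y"
  shows "(f \<boxplus> g) \<boxplus> h = f \<boxplus> (g \<boxplus> h)"
  using monoid.m_assoc[of "hom_group \<A> X Y" f g h] hom_comm_group'[of f X Y] assms
  by (simp add: hom_group_def comm_group_def group_def)

lemma plus_commute:
  assumes "f \<in> Hom \<A> X Y" "g \<in> Hom \<A> X Y"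
  shows "f \<boxplus> g = g \<boxplus> f"
  using comm_monoid.m_comm[of "hom_group \<A> X Y" f g] hom_comm_group'[of f X Y] assms
  by (simp add: hom_group_def comm_group_def)

lemma plus_zero [simp]:
  assumes "f \<in> Arr \<A>" "Dom \<A> f = X" "Cod \<A> f = Y"
  shows "f \<boxplus> Zero \<A> X Y = f" "Zero \<A> X Y \<boxplus> f = f"
proof -
  have f: "f \<in> Hom \<A> X Y" using assms by (simp add: hom_iff)
  then show "f \<boxplus> Zero \<A> X Y = f" "Zero \<A> X Y \<boxplus> f = f"
    using monoid.r_one[of "hom_group \<A> X Y" f] monoid.l_one[of "hom_group \<A> X Y" f]
      hom_comm_group'[of f X Y]
    by (simp_all add: hom_group_def comm_group_def group_def)
qed

lemma plus_cancel:
  assumes "f \<boxplus> g = f \<boxplus> h" "f \<in> Hom \<A> X Y" "g \<in> Hom \<A> X Y" "h \<in> Hom \<A> X Y"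
  shows "g = h"
proof -
  interpret G: comm_group "hom_group \<A> X Y"
    using hom_comm_group' assms(2) .
  show ?thesis
    using G.Units_l_cancel[of f g h] assms by (simp add: hom_group_def G.Units_eq[unfolded hom_group_def])
qed

definition neg :: "'b \<Rightarrow> 'b" where
  "neg f = inv\<^bsub>hom_group \<A> (Dom \<A> f) (Cod \<A> f)\<^esub> f"

lemma neg_hom: "f \<in> Hom \<A> X Y \<Longrightarrow> neg f \<in> Hom \<A> X Y"
  using group.inv_closed[of "hom_group \<A> X Y" f] hom_comm_group'[of f X Y]
  by (auto simp: hom_group_def comm_group_def neg_def hom_iff)

lemma neg_arr [simp]:
  assumes "f \<in> Arr \<A>"
  shows "neg f \<in> Arr \<A>" "Dom \<A> (neg f) = Dom \<A> f" "Cod \<A> (neg f) = Cod \<A> f"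
  using neg_hom[of f "Dom \<A> f" "Cod \<A> f"] assms by (auto simp: Hom_def)

lemma plus_neg [simp]:
  assumes "f \<in> Arr \<A>"
  shows "f \<boxplus> neg f = Zero \<A> (Dom \<A> f) (Cod \<A> f)" "neg f \<boxplus> f = Zero \<A> (Dom \<A> f) (Cod \<A> f)"
proof -
  let ?G = "hom_group \<A> (Dom \<A> f) (Cod \<A> f)"
  have f: "f \<in> carrier ?G" using assms by (simp add: hom_group_def hom_iff)
  interpret G: comm_group ?G
    using hom_comm_group'[of f] f by (simp add: hom_group_def)
  show "f \<boxplus> neg f = Zero \<A> (Dom \<A> f) (Cod \<A> f)" "neg f \<boxplus> f = Zero \<A> (Dom \<A> f) (Cod \<A> f)"
    using G.r_inv[OF f] G.l_inv[OF f] by (simp_all add: hom_group_def neg_def)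
qed

lemma plus_comp [simp]:
  assumes "f \<in> Arr \<A>" "g \<in> Arr \<A>" "h \<in> Arr \<A>"
    "Dom \<A> g = Cod \<A> f" "Dom \<A> h = Cod \<A> f" "Cod \<A> g = Cod \<A> h"
  shows "(g \<boxplus> h) \<cdot> f = g \<cdot> f \<boxplus> h \<cdot> f"
  using comp_plus_left[of f "Dom \<A> f" "Cod \<A> f" g "Cod \<A> g" h] assms by (simp add: hom_iff)

lemma comp_plus [simp]:
  assumes "f \<in> Arr \<A>" "g \<in> Arr \<A>" "h \<in> Arr \<A>"
    "Dom \<A> f = Cod \<A> g" "Dom \<A> f = Cod \<A> h" "Dom \<A> g = Dom \<A> h"
  shows "f \<cdot> (g \<boxplus> h) = f \<cdot> g \<boxplus> f \<cdot> h"
  using comp_plus_right[of g "Dom \<A> g" "Dom \<A> f" h f "Cod \<A> f"] assms by (simp add: hom_iff)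

text \<open>Distributivity gives \<open>z \<boxplus> z = z\<close> for the composite
  \<open>z\<close>, and cancellation in the Hom group makes it zero.\<close>

lemma comp_zero [simp]:
  assumes "f \<in> Arr \<A>" "Dom \<A> f = Y" "X \<in> Obj \<A>"
  shows "f \<cdot> Zero \<A> X Y = Zero \<A> X (Cod \<A> f)"
proof -
  let ?z = "f \<cdot> Zero \<A> X Y"
  have o: "Y \<in> Obj \<A>" "Cod \<A> f \<in> Obj \<A>" using assms dom_obj cod_obj by auto
  then have "?z \<boxplus> ?z = ?z"
    using comp_plus[of f "Zero \<A> X Y" "Zero \<A> X Y"] assms by simp
  then show ?thesis
    using plus_cancel[of ?z ?z "Zero \<A> X (Cod \<A> f)" X "Cod \<A> f"] assms o by (simp add: hom_iff)
qed

lemma zero_comp [simp]: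
  assumes "f \<in> Arr \<A>" "Cod \<A> f = X" "Y \<in> Obj \<A>"
  shows "Zero \<A> X Y \<cdot> f = Zero \<A> (Dom \<A> f) Y"
proof -
  let ?z = "Zero \<A> X Y \<cdot> f"
  have o: "X \<in> Obj \<A>" "Dom \<A> f \<in> Obj \<A>" using assms dom_obj cod_obj by auto
  then have "?z \<boxplus> ?z = ?z"
    using plus_comp[of f "Zero \<A> X Y" "Zero \<A> X Y"] assms by simp
  then show ?thesis
    using plus_cancel[of ?z ?z "Zero \<A> (Dom \<A> f) Y" "Dom \<A> f" Y] assms o by (simp add: hom_iff)
qed

lemma neg_unique:
  assumes "f \<in> Hom \<A> X Y" "g \<in> Hom \<A> X Y" "f \<boxplus> g = Zero \<A> X Y"
  shows "g = neg f"
  by (rule plus_cancel[of f g "neg f" X Y])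
    (use assms in \<open>auto simp: hom_iff\<close>)

lemma neg_Zero [simp]: "\<lbrakk>X \<in> Obj \<A>; Y \<in> Obj \<A>\<rbrakk> \<Longrightarrow> neg (Zero \<A> X Y) = Zero \<A> X Y"
  using neg_unique[of "Zero \<A> X Y" X Y "Zero \<A> X Y"] by (simp add: zero_hom)

lemma comp_neg [simp]:
  assumes "f \<in> Arr \<A>" "g \<in> Arr \<A>" "Dom \<A> g = Cod \<A> f"
  shows "g \<cdot> neg f = neg (g \<cdot> f)"
proof (rule neg_unique)
  have "g \<cdot> f \<boxplus> g \<cdot> neg f = g \<cdot> (f \<boxplus> neg f)"
    using assms by (simp del: plus_neg)
  also have "\<dots> = Zero \<A> (Dom \<A> f) (Cod \<A> g)" using assms by simp
  finally show "g \<cdot> f \<boxplus> g \<cdot> neg f = Zero \<A> (Dom \<A> f) (Cod \<A> g)" .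
qed (use assms in \<open>simp_all add: hom_iff\<close>)

lemma neg_comp [simp]:
  assumes "f \<in> Arr \<A>" "g \<in> Arr \<A>" "Dom \<A> g = Cod \<A> f"
  shows "neg g \<cdot> f = neg (g \<cdot> f)"
proof (rule neg_unique)
  have "g \<cdot> f \<boxplus> neg g \<cdot> f = (g \<boxplus> neg g) \<cdot> f"
    using assms by (simp del: plus_neg)
  also have "\<dots> = Zero \<A> (Dom \<A> f) (Cod \<A> g)" using assms by simp
  finally show "g \<cdot> f \<boxplus> neg g \<cdot> f = Zero \<A> (Dom \<A> f) (Cod \<A> g)" .
qed (use assms in \<open>simp_all add: hom_iff\<close>)

lemma neg_zero_iff:
  assumes "f \<in> Hom \<A> X Y" "neg f = Zero \<A> X Y"
  shows "f = Zero \<A> X Y"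
  using plus_neg(1)[of f] assms by (auto simp: hom_iff)

lemma plus_neg_zero_eq:
  assumes "f \<in> Hom \<A> X Y" "g \<in> Hom \<A> X Y" "f \<boxplus> neg g = Zero \<A> X Y"
  shows "f = g"
proof (rule plus_cancel)
  show "neg g \<boxplus> f = neg g \<boxplus> g"
    using assms plus_commute[of f X Y "neg g"] by (simp add: hom_iff)
qed (use assms in \<open>simp_all add: hom_iff\<close>)

section \<open>Monomorphisms, epimorphisms, kernels and cokernels\<close>

lemma monoI_zero:
  assumes "i \<in> Arr \<A>"
    and "\<And>t. \<lbrakk>t \<in> Arr \<A>; Cod \<A> t = Dom \<A> i; i \<cdot> t = Zero \<A> (Dom \<A> t) (Cod \<A> i)\<rbrakk>
      \<Longrightarrow> t = Zero \<A> (Dom \<A> t) (Dom \<A> i)"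
  shows "is_mono \<A> i"
  unfolding is_mono_def
proof (intro conjI ballI impI assms(1))
  fix g h
  assume gh: "g \<in> Arr \<A>" "h \<in> Arr \<A>"
    and eq: "Dom \<A> g = Dom \<A> h \<and> Cod \<A> g = Dom \<A> i \<and> Cod \<A> h = Dom \<A> i \<and> i \<cdot> g = i \<cdot> h"
  have "i \<cdot> (g \<boxplus> neg h) = i \<cdot> h \<boxplus> neg (i \<cdot> h)"
    using gh eq assms(1) by simp
  then have "i \<cdot> (g \<boxplus> neg h) = Zero \<A> (Dom \<A> h) (Cod \<A> i)"
    using gh eq assms(1) by simp
  then have "g \<boxplus> neg h = Zero \<A> (Dom \<A> h) (Dom \<A> i)"
    using assms(2)[of "g \<boxplus> neg h"] gh eq by simp
  then show "g = h"
    using plus_neg_zero_eq[of g _ _ h] gh eq by (simp add: hom_iff)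
qed

lemma epiI_zero:
  assumes "p \<in> Arr \<A>"
    and "\<And>t. \<lbrakk>t \<in> Arr \<A>; Dom \<A> t = Cod \<A> p; t \<cdot> p = Zero \<A> (Dom \<A> p) (Cod \<A> t)\<rbrakk>
      \<Longrightarrow> t = Zero \<A> (Cod \<A> p) (Cod \<A> t)"
  shows "is_epi \<A> p"
proof -
  interpret op: preadditive_category "opcat \<A>"
    by (rule preadditive_category_opcat) unfold_locales
  have "is_mono (opcat \<A>) p"
  proof (rule op.monoI_zero)
    fix t
    assume "t \<in> Arr (opcat \<A>)" "Cod (opcat \<A>) t = Dom (opcat \<A>) p"
      "p \<cdot>\<^bsub>opcat \<A>\<^esub> t = Zero (opcat \<A>) (Dom (opcat \<A>) t) (Cod (opcat \<A>) p)"
    then show "t = Zero (opcat \<A>) (Dom (opcat \<A>) t) (Dom (opcat \<A>) p)"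
      using assms(2)[of t] by simp
  qed (simp add: assms(1))
  then show ?thesis by simp
qed

lemma mono_cancel:
  assumes "is_mono \<A> i" "i \<in> Hom \<A> X Y" "g \<in> Hom \<A> T X" "h \<in> Hom \<A> T X" "i \<cdot> g = i \<cdot> h"
  shows "g = h"
  using assms(1)[unfolded is_mono_def, THEN conjunct2, rule_format, of g h] assms(2-)
  by (simp add: hom_iff)

lemma epi_cancel:
  assumes "is_epi \<A> p" "p \<in> Hom \<A> X Y" "g \<in> Hom \<A> Y T" "h \<in> Hom \<A> Y T" "g \<cdot> p = h \<cdot> p"
  shows "g = h"
  using assms(1)[unfolded is_epi_def, THEN conjunct2, rule_format, of g h] assms(2-)
  by (simp add: hom_iff)

lemma mono_cancel_zero:
  assumes "is_mono \<A> i" "i \<in> Hom \<A> X Y" "g \<in> Hom \<A> T X" "i \<cdot> g = Zero \<A> T Y"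
  shows "g = Zero \<A> T X"
  by (rule mono_cancel[OF assms(1-3)]) (use assms hom_obj in \<open>auto simp: hom_iff\<close>)

lemma epi_cancel_zero:
  assumes "is_epi \<A> p" "p \<in> Hom \<A> X Y" "g \<in> Hom \<A> Y T" "g \<cdot> p = Zero \<A> X T"
  shows "g = Zero \<A> Y T"
  by (rule epi_cancel[OF assms(1-3)]) (use assms hom_obj in \<open>auto simp: hom_iff\<close>)

lemma kernelD:
  assumes "is_kernel \<A> k f"
  shows "k \<in> Arr \<A>" "f \<in> Arr \<A>" "Dom \<A> f = Cod \<A> k"
    "f \<cdot> k = Zero \<A> (Dom \<A> k) (Cod \<A> f)"
  using assms unfolding is_kernel_def by simp_all

lemma kernel_ex1:
  assumes "is_kernel \<A> k f" "k \<in> Hom \<A> K X" "f \<in> Hom \<A> X Y" "g \<in> Hom \<A> T X"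
    "f \<cdot> g = Zero \<A> T Y"
  shows "\<exists>!h. h \<in> Hom \<A> T K \<and> k \<cdot> h = g"
proof -
  have "g \<in> Arr \<A>" "Cod \<A> g = Dom \<A> f \<and> f \<cdot> g = Zero \<A> (Dom \<A> g) (Cod \<A> f)"
    using assms by (simp_all add: hom_iff)
  then have "\<exists>!h. h \<in> Hom \<A> (Dom \<A> g) (Dom \<A> k) \<and> k \<cdot> h = g"
    using assms(1) unfolding is_kernel_def by blast
  then show ?thesis using assms(2,4) by (simp add: hom_iff)
qed

lemma kernel_lift:
  assumes "is_kernel \<A> k f" "k \<in> Hom \<A> K X" "f \<in> Hom \<A> X Y" "g \<in> Hom \<A> T X" "f \<cdot> g = Zero \<A> T Y"
  obtains h where "h \<in> Hom \<A> T K" "k \<cdot> h = g"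
  using kernel_ex1[OF assms] by blast

lemma kernel_mono:
  assumes "is_kernel \<A> k f"
  shows "is_mono \<A> k"
  unfolding is_mono_def
proof (intro conjI ballI impI)
  fix g h
  assume gh: "g \<in> Arr \<A>" "h \<in> Arr \<A>"
    and "Dom \<A> g = Dom \<A> h \<and> Cod \<A> g = Dom \<A> k \<and> Cod \<A> h = Dom \<A> k \<and> k \<cdot> g = k \<cdot> h"
  then have eq: "Dom \<A> g = Dom \<A> h" "Cod \<A> g = Dom \<A> k" "Cod \<A> h = Dom \<A> k" "k \<cdot> g = k \<cdot> h"
    by simp_all
  note k = kernelD[OF assms]
  have "f \<cdot> (k \<cdot> g) = (f \<cdot> k) \<cdot> g" using gh eq k(1-3) by simp
  also have "\<dots> = Zero \<A> (Dom \<A> g) (Cod \<A> f)" unfolding k(4) using gh eq k(1-3) by simp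
  finally have "\<exists>!h. h \<in> Hom \<A> (Dom \<A> g) (Dom \<A> k) \<and> k \<cdot> h = k \<cdot> g"
    by (intro kernel_ex1[OF assms]) (use k(1-3) gh eq in \<open>simp_all add: hom_iff\<close>)
  moreover have "g \<in> Hom \<A> (Dom \<A> g) (Dom \<A> k) \<and> k \<cdot> g = k \<cdot> g"
    "h \<in> Hom \<A> (Dom \<A> g) (Dom \<A> k) \<and> k \<cdot> h = k \<cdot> g"
    using gh eq by (simp_all add: hom_iff)
  ultimately show "g = h" by blast
qed (rule kernelD(1)[OF assms])

lemma cokernel_epi: "is_cokernel \<A> c f \<Longrightarrow> is_epi \<A> c"
proof -
  interpret op: preadditive_category "opcat \<A>"
    by (rule preadditive_category_opcat) unfold_locales
  show "is_cokernel \<A> c f \<Longrightarrow> is_epi \<A> c" using op.kernel_mono[of c f] by simp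
qed

lemma cokernel_desc:
  assumes "is_cokernel \<A> c f" "c \<in> Hom \<A> X K" "f \<in> Hom \<A> Y X" "g \<in> Hom \<A> X T" "g \<cdot> f = Zero \<A> Y T"
  obtains h where "h \<in> Hom \<A> K T" "h \<cdot> c = g"
proof -
  interpret op: preadditive_category "opcat \<A>"
    by (rule preadditive_category_opcat) unfold_locales
  show ?thesis
    using op.kernel_ex1[of c f K X Y g T] assms that by auto
qed

text \<open>Factorizations through a mono are unique, so only their existence has to be
  tested.\<close>

lemma kernelI:
  assumes "is_mono \<A> k" "k \<in> Hom \<A> K X" "f \<in> Hom \<A> X Y" "f \<cdot> k = Zero \<A> K Y"
    and "\<And>g T. \<lbrakk>g \<in> Hom \<A> T X; f \<cdot> g = Zero \<A> T Y\<rbrakk> \<Longrightarrow> \<exists>h\<in>Hom \<A> T K. k \<cdot> h = g"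
  shows "is_kernel \<A> k f"
  unfolding is_kernel_def
proof (intro conjI ballI impI)
  note t = assms(2,3)[unfolded hom_iff]
  show "k \<in> Arr \<A>" "f \<in> Arr \<A>" "Cod \<A> k = Dom \<A> f" using t by simp_all
  show "f \<cdot> k = Zero \<A> (Dom \<A> k) (Cod \<A> f)" using t assms(4) by simp
  fix g
  assume g: "g \<in> Arr \<A>" "Cod \<A> g = Dom \<A> f \<and> f \<cdot> g = Zero \<A> (Dom \<A> g) (Cod \<A> f)"
  then have gh: "g \<in> Hom \<A> (Dom \<A> g) X" using t by (simp add: hom_iff)
  obtain h where h: "h \<in> Hom \<A> (Dom \<A> g) K" "k \<cdot> h = g"
    using assms(5)[OF gh] g t by auto
  have "h' = h" if "h' \<in> Hom \<A> (Dom \<A> g) K" "k \<cdot> h' = g" for h'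
    using mono_cancel[OF assms(1,2) that(1) h(1)] that h by simp
  then show "\<exists>!h. h \<in> Hom \<A> (Dom \<A> g) (Dom \<A> k) \<and> k \<cdot> h = g"
    using h t by blast
qed

lemma cokernelI:
  assumes "is_epi \<A> c" "c \<in> Hom \<A> X K" "f \<in> Hom \<A> Y X" "c \<cdot> f = Zero \<A> Y K"
    and "\<And>g T. \<lbrakk>g \<in> Hom \<A> X T; g \<cdot> f = Zero \<A> Y T\<rbrakk> \<Longrightarrow> \<exists>h\<in>Hom \<A> K T. h \<cdot> c = g"
  shows "is_cokernel \<A> c f"
proof -
  interpret op: preadditive_category "opcat \<A>"
    by (rule preadditive_category_opcat) unfold_locales
  have "is_kernel (opcat \<A>) c f"
    by (rule op.kernelI[of c K X f Y]) (use assms in simp_all)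
  then show ?thesis by simp
qed

end

section \<open>Short exact sequences\<close>

context category
begin

section \<open>The universal property of push-outs\<close>

lemma pushoutD:
  assumes "pushout \<A> i f f' i'"
  shows "i \<in> Arr \<A>" "f \<in> Arr \<A>" "Dom \<A> i = Dom \<A> f" "f' \<in> Arr \<A>" "i' \<in> Arr \<A>"
    "Dom \<A> f' = Cod \<A> i" "Dom \<A> i' = Cod \<A> f" "Cod \<A> f' = Cod \<A> i'" "f' \<cdot> i = i' \<cdot> f"
  using assms unfolding pushout_def by simp_all

lemma pushout_ex1:
  assumes "pushout \<A> i f f' i'" "f' \<in> Hom \<A> X P" "i' \<in> Hom \<A> Y P"
    "u \<in> Hom \<A> X T" "v \<in> Hom \<A> Y T" "u \<cdot> i = v \<cdot> f"
  shows "\<exists>!h. h \<in> Hom \<A> P T \<and> h \<cdot> f' = u \<and> h \<cdot> i' = v"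
proof -
  note t = assms(2-5)[unfolded hom_iff]
  have "u \<in> Arr \<A>" "v \<in> Arr \<A>"
    "Dom \<A> u = Cod \<A> i \<and> Dom \<A> v = Cod \<A> f \<and> Cod \<A> u = Cod \<A> v \<and> u \<cdot> i = v \<cdot> f"
    using t assms(6) pushoutD(6,7)[OF assms(1)] by simp_all
  then have "\<exists>!h. h \<in> Hom \<A> (Cod \<A> f') (Cod \<A> u) \<and> h \<cdot> f' = u \<and> h \<cdot> i' = v"
    using assms(1) unfolding pushout_def by blast
  then show ?thesis using t by simp
qed

lemma pushout_eqI:
  assumes "pushout \<A> i f f' i'" "f' \<in> Hom \<A> X P" "i' \<in> Hom \<A> Y P"
    "h \<in> Hom \<A> P T" "k \<in> Hom \<A> P T" "h \<cdot> f' = k \<cdot> f'" "h \<cdot> i' = k \<cdot> i'"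
  shows "h = k"
proof -
  note D = pushoutD[OF assms(1)] and t = assms(2-5)[unfolded hom_iff]
  have "(k \<cdot> f') \<cdot> i = (k \<cdot> i') \<cdot> f" using D t by simp
  then have "\<exists>!h. h \<in> Hom \<A> P T \<and> h \<cdot> f' = k \<cdot> f' \<and> h \<cdot> i' = k \<cdot> i'"
    by (intro pushout_ex1[OF assms(1-3)]) (use D t in \<open>simp_all add: hom_iff\<close>)
  then show ?thesis using assms(4-7) by blast
qed

end

context preadditive_category
begin

section \<open>Biproducts, and short exact sequences with named objects\<close>

lemma biproductD:
  assumes "biproduct \<A> X Y S j1 j2 p1 p2"
  shows "j1 \<in> Hom \<A> X S" "j2 \<in> Hom \<A> Y S" "p1 \<in> Hom \<A> S X" "p2 \<in> Hom \<A> S Y"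
    "p1 \<cdot> j1 = Id \<A> X" "p2 \<cdot> j2 = Id \<A> Y" "p2 \<cdot> j1 = Zero \<A> X Y" "p1 \<cdot> j2 = Zero \<A> Y X"
    "j1 \<cdot> p1 \<boxplus> j2 \<cdot> p2 = Id \<A> S"
  using assms unfolding biproduct_def by simp_all

text \<open>\<open>assoc\<close> nests composites to the right, so \<open>p1 \<cdot> j1\<close>
  usually occurs with a further factor behind it. These are the biproduct equations in that
  shape.\<close>

lemma biproduct_collapse:
  assumes "biproduct \<A> X Y S j1 j2 p1 p2" "f \<in> Arr \<A>"
  shows "Cod \<A> f = X \<Longrightarrow> p1 \<cdot> (j1 \<cdot> f) = f"
    "Cod \<A> f = Y \<Longrightarrow> p2 \<cdot> (j2 \<cdot> f) = f"
    "Cod \<A> f = X \<Longrightarrow> p2 \<cdot> (j1 \<cdot> f) = Zero \<A> (Dom \<A> f) Y"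
    "Cod \<A> f = Y \<Longrightarrow> p1 \<cdot> (j2 \<cdot> f) = Zero \<A> (Dom \<A> f) X"
proof -
  note b = biproductD[OF assms(1)] and t = biproductD(1-4)[OF assms(1), unfolded hom_iff]
  have o: "X \<in> Obj \<A>" "Y \<in> Obj \<A>" using b(1,2) hom_obj by blast+
  have "p1 \<cdot> (j1 \<cdot> f) = (p1 \<cdot> j1) \<cdot> f" if "Cod \<A> f = X" using t assms(2) that by simp
  then show "Cod \<A> f = X \<Longrightarrow> p1 \<cdot> (j1 \<cdot> f) = f" using b(5) assms(2) o by simp
  have "p2 \<cdot> (j2 \<cdot> f) = (p2 \<cdot> j2) \<cdot> f" if "Cod \<A> f = Y" using t assms(2) that by simp
  then show "Cod \<A> f = Y \<Longrightarrow> p2 \<cdot> (j2 \<cdot> f) = f" using b(6) assms(2) o by simp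
  have "p2 \<cdot> (j1 \<cdot> f) = (p2 \<cdot> j1) \<cdot> f" if "Cod \<A> f = X" using t assms(2) that by simp
  then show "Cod \<A> f = X \<Longrightarrow> p2 \<cdot> (j1 \<cdot> f) = Zero \<A> (Dom \<A> f) Y" using b(7) assms(2) o by simp
  have "p1 \<cdot> (j2 \<cdot> f) = (p1 \<cdot> j2) \<cdot> f" if "Cod \<A> f = Y" using t assms(2) that by simp
  then show "Cod \<A> f = Y \<Longrightarrow> p1 \<cdot> (j2 \<cdot> f) = Zero \<A> (Dom \<A> f) X" using b(8) assms(2) o by simp
qed

lemma biproduct_eqI:
  assumes "biproduct \<A> X Y S j1 j2 p1 p2" "g \<in> Hom \<A> S T" "h \<in> Hom \<A> S T"
    "g \<cdot> j1 = h \<cdot> j1" "g \<cdot> j2 = h \<cdot> j2"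
  shows "g = h"
proof -
  note b = biproductD[OF assms(1)] and t = biproductD(1-4)[OF assms(1), unfolded hom_iff]
    and t' = assms(2,3)[unfolded hom_iff]
  have "g = g \<cdot> (j1 \<cdot> p1 \<boxplus> j2 \<cdot> p2)" using b(9) t' by simp
  also have "\<dots> = (g \<cdot> j1) \<cdot> p1 \<boxplus> (g \<cdot> j2) \<cdot> p2" using t t' by simp
  also have "\<dots> = (h \<cdot> j1) \<cdot> p1 \<boxplus> (h \<cdot> j2) \<cdot> p2" using assms(4,5) by simp
  also have "\<dots> = h \<cdot> (j1 \<cdot> p1 \<boxplus> j2 \<cdot> p2)" using t t' by simp
  also have "\<dots> = h" using b(9) t' by simp
  finally show ?thesis .
qed

definition ses :: "'a \<Rightarrow> 'a \<Rightarrow> 'a \<Rightarrow> 'b \<Rightarrow> 'b \<Rightarrow> bool" where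
  "ses B X A i p \<longleftrightarrow> i \<in> Hom \<A> B X \<and> p \<in> Hom \<A> X A \<and> short_exact \<A> i p"

lemma short_exact_ses:
  "short_exact \<A> i p \<longleftrightarrow> ses (Dom \<A> i) (Cod \<A> i) (Cod \<A> p) i p"
  by (auto simp: ses_def short_exact_def hom_iff dest: kernelD)

lemma sesD:
  assumes "ses B X A i p"
  shows "i \<in> Hom \<A> B X" "p \<in> Hom \<A> X A" "is_mono \<A> i" "is_epi \<A> p" "p \<cdot> i = Zero \<A> B A"
  using assms kernelD(4)[of i p] unfolding ses_def short_exact_def
  by (auto simp: kernel_mono cokernel_epi hom_iff)

lemma ses_lift:
  assumes "ses B X A i p" "g \<in> Hom \<A> T X" "p \<cdot> g = Zero \<A> T A"
  obtains h where "h \<in> Hom \<A> T B" "i \<cdot> h = g"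
  using kernel_lift[of i p B X A g T] assms unfolding ses_def short_exact_def by blast

lemma ses_desc:
  assumes "ses B X A i p" "g \<in> Hom \<A> X T" "g \<cdot> i = Zero \<A> B T"
  obtains h where "h \<in> Hom \<A> A T" "h \<cdot> p = g"
  using cokernel_desc[of p i X A B g T] assms unfolding ses_def short_exact_def by blast

end

context abelian_category
begin

text \<open>In an abelian category the mono \<open>i\<close> is the kernel of some \<open>g\<close>.
  As \<open>g\<close> kills \<open>i\<close>, it factors through \<open>p\<close>; so an arrow
  killed by \<open>p\<close> is killed by \<open>g\<close> and lifts through \<open>i\<close>. Thus
  exactness of all later diagrams is checked by descent along \<open>p\<close> only.\<close>

lemma sesI_mono:
  assumes i: "is_mono \<A> i" "i \<in> Hom \<A> B X" and p: "is_epi \<A> p" "p \<in> Hom \<A> X A"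
    and z: "p \<cdot> i = Zero \<A> B A"
    and desc: "\<And>g T. \<lbrakk>g \<in> Hom \<A> X T; g \<cdot> i = Zero \<A> B T\<rbrakk> \<Longrightarrow> \<exists>h\<in>Hom \<A> A T. h \<cdot> p = g"
  shows "ses B X A i p"
proof -
  obtain g where g: "is_kernel \<A> i g" using mono_is_kernel[OF i(1)] by blast
  note ti = i(2)[unfolded hom_iff] and tp = p(2)[unfolded hom_iff]
  have gt: "g \<in> Hom \<A> X (Cod \<A> g)" "g \<cdot> i = Zero \<A> B (Cod \<A> g)"
    using kernelD[OF g] ti by (simp_all add: hom_iff)
  obtain g' where g': "g' \<in> Hom \<A> A (Cod \<A> g)" "g' \<cdot> p = g" using desc[OF gt] by blast
  note tg = gt(1)[unfolded hom_iff] g'(1)[unfolded hom_iff]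
  have "is_kernel \<A> i p"
  proof (rule kernelI[OF i p(2) z])
    fix t T
    assume t: "t \<in> Hom \<A> T X" "p \<cdot> t = Zero \<A> T A"
    have tt: "t \<in> Arr \<A>" "Dom \<A> t = T" "Cod \<A> t = X" "T \<in> Obj \<A>"
      using t(1) hom_obj by (auto simp: hom_iff)
    have "g \<cdot> t = g' \<cdot> (p \<cdot> t)" unfolding g'(2)[symmetric] using tt tp g'(1)[unfolded hom_iff] by simp
    also have "\<dots> = Zero \<A> T (Cod \<A> g)" using t(2) tt tg by simp
    finally obtain h where "h \<in> Hom \<A> T B" "i \<cdot> h = t"
      using kernel_lift[OF g i(2) gt(1) t(1)] by blast
    then show "\<exists>h\<in>Hom \<A> T B. i \<cdot> h = t" by blast
  qed
  moreover have "is_cokernel \<A> p i"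
    by (rule cokernelI[OF p i(2) z desc])
  ultimately show ?thesis using i p by (simp add: ses_def short_exact_def)
qed

text \<open>The push-out is the cokernel \<open>w\<close> of \<open>m = (f, - i)\<close>. Being
  mono, \<open>m\<close> is also the kernel of \<open>w\<close>. If \<open>i'\<close> kills
  \<open>t\<close>, then \<open>(t, 0)\<close> is in this kernel and equals
  \<open>m \<cdot> s\<close> with \<open>i \<cdot> s = 0\<close>; so \<open>s\<close> vanishes, and
  \<open>t\<close> with it.\<close>

lemma pushout_mono_exists:
  assumes imono: "is_mono \<A> i" and i: "i \<in> Hom \<A> B X" and f: "f \<in> Hom \<A> B B'"
  obtains X' i' f' where "is_mono \<A> i'" "f' \<in> Hom \<A> X X'" "i' \<in> Hom \<A> B' X'"
    "pushout \<A> i f f' i'"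
proof -
  have o: "B \<in> Obj \<A>" "X \<in> Obj \<A>" "B' \<in> Obj \<A>" using i f hom_obj by blast+
  obtain S j1 j2 p1 p2 where S: "biproduct \<A> B' X S j1 j2 p1 p2" using ex_biproduct o by blast
  note b = biproductD[OF S] and tb = biproductD(1-4)[OF S, unfolded hom_iff]
  note ti = i[unfolded hom_iff] and tf = f[unfolded hom_iff]
  \<comment> \<open>The sign turns commutativity of the square into the vanishing of
    \<open>w \<cdot> m\<close>.\<close>
  define m where "m = j1 \<cdot> f \<boxplus> neg (j2 \<cdot> i)"
  have m: "m \<in> Hom \<A> B S" using tb ti tf unfolding m_def by (simp add: hom_iff)
  note tm = m[unfolded hom_iff]
  have p2m: "p2 \<cdot> m = neg i"
    unfolding m_def using tb ti tf o by (simp add: biproduct_collapse[OF S])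
  have p1m: "p1 \<cdot> m = f"
    unfolding m_def using tb ti tf o by (simp add: biproduct_collapse[OF S])
  have mono: "is_mono \<A> m"
  proof (rule monoI_zero)
    fix t
    assume t: "t \<in> Arr \<A>" "Cod \<A> t = Dom \<A> m" "m \<cdot> t = Zero \<A> (Dom \<A> t) (Cod \<A> m)"
    have "neg (i \<cdot> t) = p2 \<cdot> m \<cdot> t" using p2m t ti tm by simp
    also have "\<dots> = p2 \<cdot> (m \<cdot> t)" using t tm tb by simp
    also have "\<dots> = Zero \<A> (Dom \<A> t) X" using t tm tb by simp
    finally have "i \<cdot> t = Zero \<A> (Dom \<A> t) X"
      using neg_zero_iff[of "i \<cdot> t"] t ti tm by (simp add: hom_iff)
    then show "t = Zero \<A> (Dom \<A> t) (Dom \<A> m)"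
      using mono_cancel_zero[OF imono i, of t "Dom \<A> t"] t tm by (simp add: hom_iff)
  qed (use tm in simp)
  obtain w where w: "is_cokernel \<A> w m" using ex_cokernel tm by blast
  define X' where "X' = Cod \<A> w"
  have wk: "is_kernel (opcat \<A>) w m" using w by simp
  interpret op: abelian_category "opcat \<A>" by (rule abelian_category_opcat) unfold_locales
  have wt: "w \<in> Hom \<A> S X'" "w \<cdot> m = Zero \<A> B X'"
    using op.kernelD[OF wk] tm by (simp_all add: hom_iff X'_def)
  note tw = wt(1)[unfolded hom_iff]
  have oX: "X' \<in> Obj \<A>" using wt(1) hom_obj by blast
  define i' f' where "i' = w \<cdot> j1" and "f' = w \<cdot> j2"
  have i': "i' \<in> Hom \<A> B' X'" and f': "f' \<in> Hom \<A> X X'"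
    using tb tw by (simp_all add: i'_def f'_def hom_iff)
  note ti' = i'[unfolded hom_iff] and tf' = f'[unfolded hom_iff]
  have comm: "f' \<cdot> i = i' \<cdot> f"
  proof -
    have "i' \<cdot> f \<boxplus> neg (f' \<cdot> i) = Zero \<A> B X'"
      using wt(2) tw tb ti tf unfolding m_def i'_def f'_def by simp
    then show ?thesis
      using plus_neg_zero_eq[of "i' \<cdot> f" B X' "f' \<cdot> i"] ti' tf' ti tf by (simp add: hom_iff)
  qed
  have univ: "\<exists>!h. h \<in> Hom \<A> X' T \<and> h \<cdot> f' = u \<and> h \<cdot> i' = v"
    if u: "u \<in> Hom \<A> X T" and v: "v \<in> Hom \<A> B' T" and eq: "u \<cdot> i = v \<cdot> f" for u v T
  proof -
    note tu = u[unfolded hom_iff] and tv = v[unfolded hom_iff]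
    define g where "g = v \<cdot> p1 \<boxplus> u \<cdot> p2"
    have g: "g \<in> Hom \<A> S T" using tu tv tb by (simp add: g_def hom_iff)
    have "g \<cdot> m = v \<cdot> (p1 \<cdot> m) \<boxplus> u \<cdot> (p2 \<cdot> m)" using tu tv tb tm by (simp add: g_def)
    also have "\<dots> = Zero \<A> B T" using p1m p2m eq tu tv ti tf by simp
    finally obtain h where h: "h \<in> Hom \<A> X' T" "h \<cdot> w = g"
      using cokernel_desc[OF w wt(1) m g] by blast
    note th = h(1)[unfolded hom_iff]
    have 1: "h \<cdot> f' = u" "h \<cdot> i' = v"
    proof -
      have "h \<cdot> f' = (h \<cdot> w) \<cdot> j2" "h \<cdot> i' = (h \<cdot> w) \<cdot> j1"
        using th tw tb by (simp_all add: f'_def i'_def)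
      moreover have "g \<cdot> j1 = v" "g \<cdot> j2 = u" unfolding g_def using tu tv tb b(5-8) o by simp_all
      ultimately show "h \<cdot> f' = u" "h \<cdot> i' = v" using h(2) by simp_all
    qed
    have 2: "k = h" if k: "k \<in> Hom \<A> X' T" "k \<cdot> f' = u" "k \<cdot> i' = v" for k
    proof -
      note tk = k(1)[unfolded hom_iff]
      have "k \<cdot> w = h \<cdot> w"
      proof (rule biproduct_eqI[OF S])
        have "(k \<cdot> w) \<cdot> j1 = k \<cdot> i'" "(h \<cdot> w) \<cdot> j1 = h \<cdot> i'" using tk th tw tb by (simp_all add: i'_def)
        then show "(k \<cdot> w) \<cdot> j1 = (h \<cdot> w) \<cdot> j1" using 1 k by simp
        have "(k \<cdot> w) \<cdot> j2 = k \<cdot> f'" "(h \<cdot> w) \<cdot> j2 = h \<cdot> f'" using tk th tw tb by (simp_all add: f'_def)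
        then show "(k \<cdot> w) \<cdot> j2 = (h \<cdot> w) \<cdot> j2" using 1 k by simp
      qed (use tk th tw in \<open>simp_all add: hom_iff\<close>)
      then show ?thesis
        using epi_cancel[OF cokernel_epi[OF w] wt(1) k(1) h(1)] by simp
    qed
    show ?thesis using 1 2 h(1) by blast
  qed
  have po: "pushout \<A> i f f' i'"
    unfolding pushout_def
  proof (intro conjI ballI impI)
    fix u v
    assume "u \<in> Arr \<A>" "v \<in> Arr \<A>"
      "Dom \<A> u = Cod \<A> i \<and> Dom \<A> v = Cod \<A> f \<and> Cod \<A> u = Cod \<A> v \<and> u \<cdot> i = v \<cdot> f"
    then show "\<exists>!h. h \<in> Hom \<A> (Cod \<A> f') (Cod \<A> u) \<and> h \<cdot> f' = u \<and> h \<cdot> i' = v"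
      using univ[of u "Cod \<A> u" v] ti tf tf' by (simp add: hom_iff)
  qed (use ti tf ti' tf' comm in simp_all)
  have "is_mono \<A> i'"
  proof (rule monoI_zero)
    fix t
    assume t: "t \<in> Arr \<A>" "Cod \<A> t = Dom \<A> i'" "i' \<cdot> t = Zero \<A> (Dom \<A> t) (Cod \<A> i')"
    have cok: "ses B S X' m w"
    proof (rule sesI_mono[OF mono m cokernel_epi[OF w] wt])
      show "\<exists>h\<in>Hom \<A> X' T. h \<cdot> w = g" if "g \<in> Hom \<A> S T" "g \<cdot> m = Zero \<A> B T" for g T
        using cokernel_desc[OF w wt(1) m that] by blast
    qed
    have "w \<cdot> (j1 \<cdot> t) = Zero \<A> (Dom \<A> t) X'" using t ti' tw tb by (simp add: i'_def)
    then obtain s where s: "s \<in> Hom \<A> (Dom \<A> t) B" "m \<cdot> s = j1 \<cdot> t"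
      using ses_lift[OF cok, of "j1 \<cdot> t" "Dom \<A> t"] t ti' tb by (auto simp: hom_iff)
    note ts = s(1)[unfolded hom_iff]
    have "neg (i \<cdot> s) = p2 \<cdot> m \<cdot> s" using p2m ts ti by simp
    also have "\<dots> = p2 \<cdot> (j1 \<cdot> t)" using s(2) ts tm tb by simp
    also have "\<dots> = Zero \<A> (Dom \<A> t) X" using t ti' by (simp add: biproduct_collapse[OF S])
    finally have "i \<cdot> s = Zero \<A> (Dom \<A> t) X"
      using neg_zero_iff[of "i \<cdot> s"] ts ti by (simp add: hom_iff)
    then have "s = Zero \<A> (Dom \<A> t) B" by (rule mono_cancel_zero[OF imono i s(1)])
    then have "j1 \<cdot> t = Zero \<A> (Dom \<A> t) S" using s(2) tm t by simp
    then have "p1 \<cdot> (j1 \<cdot> t) = Zero \<A> (Dom \<A> t) B'" using tb t by simp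
    then show "t = Zero \<A> (Dom \<A> t) (Dom \<A> i')"
      using t ti' biproduct_collapse[OF S] by simp
  qed (use ti' in simp)
  then show ?thesis using that f' i' po by blast
qed

text \<open>The push-out is an arbitrary one, not the one constructed above. Its \<open>i'\<close>
  is mono because the constructed mono \<open>i2\<close> factors as \<open>h \<cdot> i'\<close>. The
  map \<open>p'\<close> is induced by \<open>p\<close> and zero, and descent along \<open>p'\<close>
  is descent along \<open>p\<close> after composing with \<open>f'\<close>.\<close>

lemma pushout_ses:
  assumes E: "ses B X A i p" and po: "pushout \<A> i f f' i'"
  obtains p' where "ses (Cod \<A> f) (Cod \<A> i') A i' p'" "p' \<cdot> f' = p"
proof -
  note D = pushoutD[OF po] and i = sesD(1)[OF E] and p = sesD(2)[OF E]
  note ti = i[unfolded hom_iff] and tp = p[unfolded hom_iff]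
  define B' X' where "B' = Cod \<A> f" and "X' = Cod \<A> i'"
  have f: "f \<in> Hom \<A> B B'" and f': "f' \<in> Hom \<A> X X'" and i': "i' \<in> Hom \<A> B' X'"
    using D ti by (simp_all add: hom_iff B'_def X'_def)
  note tf = f[unfolded hom_iff] and tf' = f'[unfolded hom_iff] and ti' = i'[unfolded hom_iff]
  have o: "B' \<in> Obj \<A>" "A \<in> Obj \<A>" using i' p hom_obj by blast+
  obtain X2 i2 f2 where P2: "is_mono \<A> i2" "f2 \<in> Hom \<A> X X2" "pushout \<A> i f f2 i2"
    and i2: "i2 \<in> Hom \<A> B' X2"
    using pushout_mono_exists[OF sesD(3)[OF E] i f] by blast
  obtain h where h: "h \<in> Hom \<A> X' X2" "h \<cdot> i' = i2"
    using pushout_ex1[OF po f' i' P2(2) i2 pushoutD(9)[OF P2(3)]] by blast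
  note th = h(1)[unfolded hom_iff] and t2 = i2[unfolded hom_iff]
  have "p \<cdot> i = Zero \<A> B' A \<cdot> f" using sesD(5)[OF E] tf o by simp
  then obtain p' where p': "p' \<in> Hom \<A> X' A" "p' \<cdot> f' = p" "p' \<cdot> i' = Zero \<A> B' A"
    using pushout_ex1[OF po f' i' p, of "Zero \<A> B' A"] o zero_hom by blast
  note tp' = p'(1)[unfolded hom_iff]
  have "ses B' X' A i' p'"
  proof (rule sesI_mono[OF _ i' _ p'(1,3)])
    show "is_mono \<A> i'"
    proof (rule monoI_zero)
      fix t
      assume t: "t \<in> Arr \<A>" "Cod \<A> t = Dom \<A> i'" "i' \<cdot> t = Zero \<A> (Dom \<A> t) (Cod \<A> i')"
      have "i2 \<cdot> t = h \<cdot> (i' \<cdot> t)" unfolding h(2)[symmetric] using t th ti' by simp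
      also have "\<dots> = Zero \<A> (Dom \<A> t) X2" using t th ti' by simp
      finally show "t = Zero \<A> (Dom \<A> t) (Dom \<A> i')"
        using mono_cancel_zero[OF P2(1) i2, of t "Dom \<A> t"] t ti' by (simp add: hom_iff)
    qed (use ti' in simp)
    show "is_epi \<A> p'"
    proof (rule epiI_zero)
      fix t
      assume t: "t \<in> Arr \<A>" "Dom \<A> t = Cod \<A> p'" "t \<cdot> p' = Zero \<A> (Dom \<A> p') (Cod \<A> t)"
      have "t \<cdot> p = (t \<cdot> p') \<cdot> f'" using p'(2)[symmetric] t(1,2) tp' tf' by simp
      also have "\<dots> = Zero \<A> X (Cod \<A> t)" unfolding t(3) using t tp' tf' by simp
      finally show "t = Zero \<A> (Cod \<A> p') (Cod \<A> t)"
        using epi_cancel_zero[OF sesD(4,2)[OF E], of t "Cod \<A> t"] t tp' by (simp add: hom_iff)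
    qed (use tp' in simp)
    fix g T
    assume g: "g \<in> Hom \<A> X' T" "g \<cdot> i' = Zero \<A> B' T"
    note tg = g(1)[unfolded hom_iff]
    have oT: "T \<in> Obj \<A>" using g(1) hom_obj by blast
    have "(g \<cdot> f') \<cdot> i = (g \<cdot> i') \<cdot> f" using tg tf' ti D(9) ti' tf by simp
    also have "\<dots> = Zero \<A> B T" using g(2) tf oT by simp
    finally obtain h where h: "h \<in> Hom \<A> A T" "h \<cdot> p = g \<cdot> f'"
      using ses_desc[OF E, of "g \<cdot> f'" T] tg tf' by (auto simp: hom_iff)
    note th = h(1)[unfolded hom_iff]
    have "h \<cdot> p' = g"
    proof (rule pushout_eqI[OF po f' i'])
      show "(h \<cdot> p') \<cdot> f' = g \<cdot> f'" using th tp' tf' p' h(2) by simp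
      show "(h \<cdot> p') \<cdot> i' = g \<cdot> i'" using th tp' ti' p' g(2) o by simp
    qed (use th tp' g in \<open>simp_all add: hom_iff\<close>)
    then show "\<exists>h\<in>Hom \<A> A T. h \<cdot> p' = g" using h(1) by blast
  qed
  then show ?thesis using that p'(2) by (simp add: B'_def X'_def)
qed

lemma pushout_ses_exists:
  assumes E: "ses B X A i p" and f: "f \<in> Hom \<A> B B'"
  obtains X' i' p' f' where "ses B' X' A i' p'" "f' \<in> Hom \<A> X X'" "p' \<cdot> f' = p"
    "pushout \<A> i f f' i'"
proof -
  obtain X' i' f' where P: "f' \<in> Hom \<A> X X'" "i' \<in> Hom \<A> B' X'" "pushout \<A> i f f' i'"
    using pushout_mono_exists[OF sesD(3,1)[OF E] f] by blast
  obtain p' where "ses (Cod \<A> f) (Cod \<A> i') A i' p'" "p' \<cdot> f' = p"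
    using pushout_ses[OF E P(3)] by blast
  then show ?thesis using that[of X' i' p' f'] P f by (simp add: hom_iff)
qed

end

section \<open>Diagram lemmas for short exact sequences\<close>

context abelian_category
begin

text \<open>Reading \<open>A \<subseteq> B \<subseteq> Y\<close>, the push-out \<open>P\<close> is
  \<open>Y/A\<close>, with \<open>C = B/A\<close> inside it. An arrow on \<open>Y\<close> that
  vanishes on \<open>A\<close> restricts to \<open>B\<close> as an arrow through \<open>C\<close>,
  and the two together define an arrow on \<open>P\<close>.\<close>

lemma ses_comp_pushout:
  assumes D: "ses A B C u v" and F: "ses B Y K k q" and po: "pushout \<A> k v y k'"
    and y: "y \<in> Hom \<A> Y P" and k': "k' \<in> Hom \<A> C P"
  shows "ses A Y P (k \<cdot> u) y"
proof -
  obtain q' where P: "ses C P K k' q'" "q' \<cdot> y = q"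
    using pushout_ses[OF F po] sesD(2)[OF D] k' by (auto simp: hom_iff)
  note D' = sesD[OF D] and F' = sesD[OF F] and P' = sesD[OF P(1)]
  note tu = D'(1)[unfolded hom_iff] and tv = D'(2)[unfolded hom_iff]
    and tk = F'(1)[unfolded hom_iff] and tq = F'(2)[unfolded hom_iff]
    and tk' = k'[unfolded hom_iff] and ty = y[unfolded hom_iff] and tq' = P'(2)[unfolded hom_iff]
  have o: "A \<in> Obj \<A>" "P \<in> Obj \<A>" using D'(1) y hom_obj by blast+
  note comm = pushoutD(9)[OF po]
  show ?thesis
  proof (rule sesI_mono)
    show "is_mono \<A> (k \<cdot> u)"
    proof (rule monoI_zero)
      fix t
      assume t: "t \<in> Arr \<A>" "Cod \<A> t = Dom \<A> (k \<cdot> u)"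
        "(k \<cdot> u) \<cdot> t = Zero \<A> (Dom \<A> t) (Cod \<A> (k \<cdot> u))"
      then have "k \<cdot> (u \<cdot> t) = Zero \<A> (Dom \<A> t) Y" using tk tu by simp
      then have "u \<cdot> t = Zero \<A> (Dom \<A> t) B"
        using mono_cancel_zero[OF F'(3,1), of "u \<cdot> t" "Dom \<A> t"] t(1,2) tk tu by (simp add: hom_iff)
      then show "t = Zero \<A> (Dom \<A> t) (Dom \<A> (k \<cdot> u))"
        using mono_cancel_zero[OF D'(3,1), of t "Dom \<A> t"] t(1,2) tk tu by (simp add: hom_iff)
    qed (use tk tu in simp)
    have "y \<cdot> (k \<cdot> u) = (y \<cdot> k) \<cdot> u" using tu tk ty by simp
    also have "\<dots> = k' \<cdot> (v \<cdot> u)" unfolding comm using tu tv tk' by simp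
    also have "\<dots> = Zero \<A> A P" unfolding D'(5) using tk' o by simp
    finally show "y \<cdot> (k \<cdot> u) = Zero \<A> A P" .
    show "is_epi \<A> y"
    proof (rule epiI_zero)
      fix t
      assume t: "t \<in> Arr \<A>" "Dom \<A> t = Cod \<A> y" "t \<cdot> y = Zero \<A> (Dom \<A> y) (Cod \<A> t)"
      have "(t \<cdot> k') \<cdot> v = (t \<cdot> y) \<cdot> k" using comm t(1,2) tk tk' tv ty by simp
      also have "\<dots> = Zero \<A> B (Cod \<A> t)" unfolding t(3) using t(1) tk ty by simp
      finally have tz: "t \<cdot> k' = Zero \<A> C (Cod \<A> t)"
        using epi_cancel_zero[OF D'(4,2), of "t \<cdot> k'" "Cod \<A> t"] t(1,2) tk' ty by (simp add: hom_iff)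
      then obtain s where s: "s \<in> Hom \<A> K (Cod \<A> t)" "s \<cdot> q' = t"
        using ses_desc[OF P(1), of t "Cod \<A> t"] t(1,2) ty by (auto simp: hom_iff)
      have "s \<cdot> q = (s \<cdot> q') \<cdot> y" using P(2) s(1) tq' ty by (simp add: hom_iff)
      then have "s \<cdot> q = Zero \<A> Y (Cod \<A> t)" using s(2) t(3) ty by simp
      then have "s = Zero \<A> K (Cod \<A> t)" by (rule epi_cancel_zero[OF F'(4,2) s(1)])
      then show "t = Zero \<A> (Cod \<A> y) (Cod \<A> t)" using s tq' ty t(1) by (simp add: hom_iff)
    qed (use ty in simp)
    fix g T
    assume g: "g \<in> Hom \<A> Y T" "g \<cdot> (k \<cdot> u) = Zero \<A> A T"
    note tg = g(1)[unfolded hom_iff]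
    have "(g \<cdot> k) \<cdot> u = Zero \<A> A T" using g tk tu by (simp add: hom_iff)
    then obtain s where s: "s \<in> Hom \<A> C T" "s \<cdot> v = g \<cdot> k"
      using ses_desc[OF D, of "g \<cdot> k" T] tg tk by (auto simp: hom_iff)
    then show "\<exists>h\<in>Hom \<A> P T. h \<cdot> y = g"
      using pushout_ex1[OF po y k' g(1) s(1)] by auto
  qed (use tk tu ty in \<open>simp_all add: hom_iff\<close>)
qed

text \<open>Here \<open>P\<close> is \<open>Y\<close> and \<open>B\<close> glued along
  \<open>A\<close>, so \<open>P/A\<close> is the direct sum of \<open>Y/A = K\<close> and
  \<open>B/A = C\<close>. The arrow \<open>c\<close> collapses \<open>Y\<close> and is
  \<open>v\<close> on \<open>B\<close>; it is the second coordinate of the quotient map.\<close>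

lemma ses_pushout_sum:
  assumes D: "ses A B C u v" and F: "ses A Y K k q" and P: "ses B P K k' q'"
    and po: "pushout \<A> k u y k'" and y: "y \<in> Hom \<A> Y P" and qy: "q' \<cdot> y = q"
    and S: "biproduct \<A> K C S j1 j2 p1 p2"
  obtains c where "c \<in> Hom \<A> P C" "c \<cdot> y = Zero \<A> Y C" "c \<cdot> k' = v"
    "ses A P S (k' \<cdot> u) (j1 \<cdot> q' \<boxplus> j2 \<cdot> c)"
proof -
  note D' = sesD[OF D] and F' = sesD[OF F] and P' = sesD[OF P] and b = biproductD[OF S]
  note tu = D'(1)[unfolded hom_iff] and tv = D'(2)[unfolded hom_iff]
    and tk = F'(1)[unfolded hom_iff] and tq = F'(2)[unfolded hom_iff]
    and tk' = P'(1)[unfolded hom_iff] and ty = y[unfolded hom_iff] and tq' = P'(2)[unfolded hom_iff]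
    and tb = biproductD(1-4)[OF S, unfolded hom_iff]
  note comm = pushoutD(9)[OF po]
  have o: "A \<in> Obj \<A>" "B \<in> Obj \<A>" "C \<in> Obj \<A>" "Y \<in> Obj \<A>" "K \<in> Obj \<A>" "P \<in> Obj \<A>"
    using D'(1,2) F'(2) P'(1) hom_obj by blast+
  have "Zero \<A> Y C \<cdot> k = v \<cdot> u" using D'(5) tk o by simp
  then obtain c where c: "c \<in> Hom \<A> P C" "c \<cdot> y = Zero \<A> Y C" "c \<cdot> k' = v"
    using pushout_ex1[OF po y P'(1) zero_hom[OF o(4,3)] D'(2)] by blast
  note tc = c(1)[unfolded hom_iff]
  define w where "w = j1 \<cdot> q' \<boxplus> j2 \<cdot> c"
  have w: "w \<in> Hom \<A> P S" using tb tq' tc by (simp add: w_def hom_iff)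
  note tw = w[unfolded hom_iff]
  have wk: "w \<cdot> k' = j2 \<cdot> v"
    using tb tq' tc tk' tv P'(5) c(3) o by (simp add: w_def)
  have wy: "w \<cdot> y = j1 \<cdot> q"
    using tb tq' tc ty tq qy c(2) o by (simp add: w_def)
  have "ses A P S (k' \<cdot> u) w"
  proof (rule sesI_mono)
    show "is_mono \<A> (k' \<cdot> u)"
    proof (rule monoI_zero)
      fix t
      assume t: "t \<in> Arr \<A>" "Cod \<A> t = Dom \<A> (k' \<cdot> u)"
        "(k' \<cdot> u) \<cdot> t = Zero \<A> (Dom \<A> t) (Cod \<A> (k' \<cdot> u))"
      then have "k' \<cdot> (u \<cdot> t) = Zero \<A> (Dom \<A> t) P" using tk' tu by simp
      then have "u \<cdot> t = Zero \<A> (Dom \<A> t) B"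
        using mono_cancel_zero[OF P'(3,1), of "u \<cdot> t" "Dom \<A> t"] t(1,2) tk' tu by (simp add: hom_iff)
      then show "t = Zero \<A> (Dom \<A> t) (Dom \<A> (k' \<cdot> u))"
        using mono_cancel_zero[OF D'(3,1), of t "Dom \<A> t"] t(1,2) tk' tu by (simp add: hom_iff)
    qed (use tk' tu in simp)
    have "w \<cdot> (k' \<cdot> u) = (w \<cdot> k') \<cdot> u" using tu tk' tw by simp
    also have "\<dots> = j2 \<cdot> (v \<cdot> u)" unfolding wk using tu tv tb by simp
    also have "\<dots> = Zero \<A> A S" unfolding D'(5) using tb o by simp
    finally show "w \<cdot> (k' \<cdot> u) = Zero \<A> A S" .
    show "is_epi \<A> w"
    proof (rule epiI_zero)
      fix t
      assume t: "t \<in> Arr \<A>" "Dom \<A> t = Cod \<A> w" "t \<cdot> w = Zero \<A> (Dom \<A> w) (Cod \<A> t)"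
      note oT = cod_obj[OF t(1)]
      have "(t \<cdot> j1) \<cdot> q = (t \<cdot> w) \<cdot> y" using wy t(1,2) tw tb tq ty by simp
      also have "\<dots> = Zero \<A> Y (Cod \<A> t)" unfolding t(3) using t(1) tw ty by simp
      finally have 1: "t \<cdot> j1 = Zero \<A> K (Cod \<A> t)"
        using epi_cancel_zero[OF F'(4,2), of "t \<cdot> j1" "Cod \<A> t"] t(1,2) tb tw by (simp add: hom_iff)
      have "(t \<cdot> j2) \<cdot> v = (t \<cdot> w) \<cdot> k'" using wk t(1,2) tw tb tv tk' by simp
      also have "\<dots> = Zero \<A> B (Cod \<A> t)" unfolding t(3) using t(1) tw tk' by simp
      finally have 2: "t \<cdot> j2 = Zero \<A> C (Cod \<A> t)"
        using epi_cancel_zero[OF D'(4,2), of "t \<cdot> j2" "Cod \<A> t"] t(1,2) tb tw by (simp add: hom_iff)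
      show "t = Zero \<A> (Cod \<A> w) (Cod \<A> t)"
        by (rule biproduct_eqI[OF S]) (use 1 2 t(1,2) tw tb o hom_obj[OF b(1)] in \<open>simp_all add: hom_iff\<close>)
    qed (use tw in simp)
    fix g T
    assume g: "g \<in> Hom \<A> P T" "g \<cdot> (k' \<cdot> u) = Zero \<A> A T"
    note tg = g(1)[unfolded hom_iff]
    have "(g \<cdot> k') \<cdot> u = Zero \<A> A T" using g tk' tu by (simp add: hom_iff)
    then obtain s where s: "s \<in> Hom \<A> C T" "s \<cdot> v = g \<cdot> k'"
      using ses_desc[OF D, of "g \<cdot> k'" T] tg tk' by (auto simp: hom_iff)
    have "(g \<cdot> y) \<cdot> k = g \<cdot> (k' \<cdot> u)" using comm tg ty tk by simp
    then obtain r where r: "r \<in> Hom \<A> K T" "r \<cdot> q = g \<cdot> y"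
      using ses_desc[OF F, of "g \<cdot> y" T] tg ty g(2) by (auto simp: hom_iff)
    note ts = s(1)[unfolded hom_iff] and tr = r(1)[unfolded hom_iff]
    have oT: "T \<in> Obj \<A>" using g(1) hom_obj by blast
    define h where "h = r \<cdot> p1 \<boxplus> s \<cdot> p2"
    have h: "h \<in> Hom \<A> S T" using tr ts tb by (simp add: h_def hom_iff)
    note th = h[unfolded hom_iff]
    have h12: "h \<cdot> j1 = r" "h \<cdot> j2 = s"
      unfolding h_def using tr ts tb b(5-8) o by simp_all
    have "h \<cdot> w = g"
    proof (rule pushout_eqI[OF po y P'(1)])
      have "(h \<cdot> w) \<cdot> y = (h \<cdot> j1) \<cdot> q" using th tw ty wy tb tq by simp
      then show "(h \<cdot> w) \<cdot> y = g \<cdot> y" using h12 r(2) by simp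
      have "(h \<cdot> w) \<cdot> k' = (h \<cdot> j2) \<cdot> v" using th tw tk' wk tb tv by simp
      then show "(h \<cdot> w) \<cdot> k' = g \<cdot> k'" using h12 s(2) by simp
    qed (use th tw g in \<open>simp_all add: hom_iff\<close>)
    then show "\<exists>h\<in>Hom \<A> S T. h \<cdot> w = g" using h by blast
  qed (use tk' tu w in \<open>simp_all add: hom_iff\<close>)
  then show ?thesis using that c by (simp add: w_def)
qed

lemma neg_neg [simp]: "a \<in> Arr \<A> \<Longrightarrow> neg (neg a) = a"
  using neg_unique[of "neg a" "Dom \<A> a" "Cod \<A> a" a] by (simp add: hom_iff)

text \<open>Because both rows have the same kernel \<open>A\<close> and \<open>b\<close> respects
  it, the square of \<open>b\<close>, \<open>v\<close>, \<open>v'\<close> and \<open>k\<close> is a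
  push-out and a pull-back. The sequence is this square written in one row, with a sign to make the
  composite vanish.\<close>

lemma ses_mayer_vietoris:
  assumes D: "ses A B C u v" and D2: "ses A B' C' u' v'"
    and b: "b \<in> Hom \<A> B B'" and k: "k \<in> Hom \<A> C C'" and bu: "b \<cdot> u = u'" and vb: "v' \<cdot> b = k \<cdot> v"
    and S: "biproduct \<A> B' C S j1 j2 p1 p2"
  shows "ses B S C' (j1 \<cdot> b \<boxplus> j2 \<cdot> v) (neg (v' \<cdot> p1) \<boxplus> k \<cdot> p2)"
proof -
  note D' = sesD[OF D] and D2' = sesD[OF D2] and bi = biproductD[OF S]
  note tu = D'(1)[unfolded hom_iff] and tv = D'(2)[unfolded hom_iff]
    and tu' = D2'(1)[unfolded hom_iff] and tv' = D2'(2)[unfolded hom_iff]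
    and tk = k[unfolded hom_iff] and tbb = b[unfolded hom_iff]
    and tb = biproductD(1-4)[OF S, unfolded hom_iff]
  have o: "A \<in> Obj \<A>" "B \<in> Obj \<A>" "C \<in> Obj \<A>" "B' \<in> Obj \<A>" "C' \<in> Obj \<A>" "S \<in> Obj \<A>"
    using D'(1,2) D2'(2) bi(1) hom_obj by blast+
  define m where "m = j1 \<cdot> b \<boxplus> j2 \<cdot> v"
  define w where "w = neg (v' \<cdot> p1) \<boxplus> k \<cdot> p2"
  have m: "m \<in> Hom \<A> B S" using tb tbb tv by (simp add: m_def hom_iff)
  have w: "w \<in> Hom \<A> S C'" using tb tk tv' by (simp add: w_def hom_iff)
  note tm = m[unfolded hom_iff] and tw = w[unfolded hom_iff]
  have pm: "p1 \<cdot> m = b" "p2 \<cdot> m = v"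
    unfolding m_def using tb tbb tv o by (simp_all add: biproduct_collapse[OF S])
  have wj: "w \<cdot> j1 = neg v'" "w \<cdot> j2 = k"
    unfolding w_def using tb tk tv' bi(5-8) o by simp_all
  have "ses B S C' m w"
  proof (rule sesI_mono[OF _ m _ w])
    show "is_mono \<A> m"
    proof (rule monoI_zero)
      fix t
      assume t: "t \<in> Arr \<A>" "Cod \<A> t = Dom \<A> m" "m \<cdot> t = Zero \<A> (Dom \<A> t) (Cod \<A> m)"
      have "b \<cdot> t = p1 \<cdot> (m \<cdot> t)" "v \<cdot> t = p2 \<cdot> (m \<cdot> t)"
        unfolding pm[symmetric] using t(1,2) tm tb by simp_all
      then have bt: "b \<cdot> t = Zero \<A> (Dom \<A> t) B'" "v \<cdot> t = Zero \<A> (Dom \<A> t) C"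
        unfolding t(3) using t(1) tm tb by simp_all
      then obtain s where s: "s \<in> Hom \<A> (Dom \<A> t) A" "u \<cdot> s = t"
        using ses_lift[OF D, of t "Dom \<A> t"] t(1,2) tm by (auto simp: hom_iff)
      note ts = s(1)[unfolded hom_iff]
      have "u' \<cdot> s = b \<cdot> (u \<cdot> s)" unfolding bu[symmetric] using ts tu tbb by simp
      then have "u' \<cdot> s = Zero \<A> (Dom \<A> t) B'" using s(2) bt by simp
      then have "s = Zero \<A> (Dom \<A> t) A" by (rule mono_cancel_zero[OF D2'(3,1) s(1)])
      then show "t = Zero \<A> (Dom \<A> t) (Dom \<A> m)" using s(2) tu tm t(1) by simp
    qed (use tm in simp)
    have "w \<cdot> m = neg (v' \<cdot> (p1 \<cdot> m)) \<boxplus> k \<cdot> (p2 \<cdot> m)"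
      unfolding w_def using tm tb tk tv' by simp
    also have "\<dots> = Zero \<A> B C'" unfolding pm vb using tk tv by simp
    finally show "w \<cdot> m = Zero \<A> B C'" .
    show "is_epi \<A> w"
    proof (rule epiI_zero)
      fix t
      assume t: "t \<in> Arr \<A>" "Dom \<A> t = Cod \<A> w" "t \<cdot> w = Zero \<A> (Dom \<A> w) (Cod \<A> t)"
      have "neg (t \<cdot> v') = t \<cdot> (w \<cdot> j1)" unfolding wj(1) using t(1,2) tw tv' by simp
      also have "\<dots> = (t \<cdot> w) \<cdot> j1" using t(1,2) tw tb by simp
      also have "\<dots> = Zero \<A> B' (Cod \<A> t)" unfolding t(3) using t(1) tw tb by simp
      finally have "t \<cdot> v' = Zero \<A> B' (Cod \<A> t)"
        using neg_zero_iff[of "t \<cdot> v'" B' "Cod \<A> t"] t(1,2) tv' tw by (simp add: hom_iff)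
      then show "t = Zero \<A> (Cod \<A> w) (Cod \<A> t)"
        using epi_cancel_zero[OF D2'(4,2), of t "Cod \<A> t"] t(1,2) tw by (simp add: hom_iff)
    qed (use tw in simp)
    fix g T
    assume g: "g \<in> Hom \<A> S T" "g \<cdot> m = Zero \<A> B T"
    note tg = g(1)[unfolded hom_iff]
    have oT: "T \<in> Obj \<A>" using g(1) hom_obj by blast
    have s0: "(g \<cdot> j1) \<cdot> b \<boxplus> (g \<cdot> j2) \<cdot> v = Zero \<A> B T"
      using g(2) tg tb tbb tv unfolding m_def by simp
    have "((g \<cdot> j1) \<cdot> b \<boxplus> (g \<cdot> j2) \<cdot> v) \<cdot> u = (g \<cdot> j1) \<cdot> u' \<boxplus> (g \<cdot> j2) \<cdot> (v \<cdot> u)"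
      unfolding bu[symmetric] using tg tb tbb tv tu by simp
    then have gu: "(g \<cdot> j1) \<cdot> u' = Zero \<A> A T"
      unfolding s0 D'(5) using tg tb tu tu' o oT by simp
    have "neg (g \<cdot> j1) \<cdot> u' = neg ((g \<cdot> j1) \<cdot> u')" using tg tb tu' by simp
    then have "neg (g \<cdot> j1) \<cdot> u' = Zero \<A> A T" unfolding gu using o oT by simp
    then obtain h where h: "h \<in> Hom \<A> C' T" "h \<cdot> v' = neg (g \<cdot> j1)"
      using ses_desc[OF D2, of "neg (g \<cdot> j1)" T] tg tb by (auto simp: hom_iff)
    note th = h(1)[unfolded hom_iff]
    have "(h \<cdot> k) \<cdot> v = (h \<cdot> v') \<cdot> b" using vb th tk tv tv' tbb by simp
    also have "\<dots> = neg ((g \<cdot> j1) \<cdot> b)" unfolding h(2) using tg tb tbb by simp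
    also have "\<dots> = (g \<cdot> j2) \<cdot> v"
      by (rule neg_unique[OF _ _ s0, symmetric]) (use tg tb tbb tv in \<open>simp_all add: hom_iff\<close>)
    finally have hk: "h \<cdot> k = g \<cdot> j2"
      by (rule epi_cancel[OF D'(4,2), rotated 2]) (use tg tb th tk in \<open>simp_all add: hom_iff\<close>)
    have "h \<cdot> w = g"
    proof (rule biproduct_eqI[OF S _ g(1)])
      have "(h \<cdot> w) \<cdot> j1 = h \<cdot> (w \<cdot> j1)" using th tw tb by simp
      also have "\<dots> = neg (h \<cdot> v')" unfolding wj(1) using th tv' by simp
      also have "\<dots> = g \<cdot> j1" unfolding h(2) using tg tb by simp
      finally show "(h \<cdot> w) \<cdot> j1 = g \<cdot> j1" .
      have "(h \<cdot> w) \<cdot> j2 = h \<cdot> (w \<cdot> j2)" using th tw tb by simp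
      then show "(h \<cdot> w) \<cdot> j2 = g \<cdot> j2" using wj(2) hk by simp
    qed (use th tw in \<open>simp_all add: hom_iff\<close>)
    then show "\<exists>h\<in>Hom \<A> C' T. h \<cdot> w = g" using h(1) by blast
  qed
  then show ?thesis by (simp add: m_def w_def)
qed

text \<open>The push-out \<open>L\<close> of \<open>a\<close> along \<open>f\<close> is the cokernel
  of \<open>(f, - a)\<close>, which is mono because \<open>a\<close> is. Both rows of the push-out
  diagram end in \<open>Q\<close>, so in the opposite category it is a diagram for
  \<open>ses_mayer_vietoris\<close>. The sequence from \<open>N\<close> to \<open>Q\<close> exhibits
  \<open>L\<close> as an extension, which later puts \<open>L\<close> into \<C>.\<close>

lemma ses_graph:
  assumes D: "ses M I Q a b" and f: "f \<in> Hom \<A> M N" and S: "biproduct \<A> N I S j1 j2 p1 p2"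
  obtains L i' p' u v where "ses N L Q i' p'" "ses M S L u v" "p1 \<cdot> u = f"
proof -
  interpret op: abelian_category "opcat \<A>" by (rule abelian_category_opcat) unfold_locales
  have op_ses: "op.ses X Y Z p i \<longleftrightarrow> ses Z Y X i p" for X Y Z i p
    by (auto simp: ses_def op.ses_def)
  obtain L i' p' f' where P: "ses N L Q i' p'" "f' \<in> Hom \<A> I L" "p' \<cdot> f' = b" "pushout \<A> a f f' i'"
    using pushout_ses_exists[OF D f] by blast
  note t = sesD(1)[OF D, unfolded hom_iff] f[unfolded hom_iff] biproductD(1-4)[OF S, unfolded hom_iff]
  \<comment> \<open>In the opposite diagram \<open>I\<close> takes the place of the first
    summand.\<close>
  have "biproduct \<A> I N S j2 j1 p2 p1"
    using S plus_commute[of "j1 \<cdot> p1" S S "j2 \<cdot> p2"] t unfolding biproduct_def by (simp add: hom_iff)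
  then have "op.ses L S M (p2 \<cdot>\<^bsub>opcat \<A>\<^esub> f' \<boxplus>\<^bsub>opcat \<A>\<^esub> p1 \<cdot>\<^bsub>opcat \<A>\<^esub> i')
      (op.neg (a \<cdot>\<^bsub>opcat \<A>\<^esub> j2) \<boxplus>\<^bsub>opcat \<A>\<^esub> f \<cdot>\<^bsub>opcat \<A>\<^esub> j1)"
    by (intro op.ses_mayer_vietoris[where u = p' and A = Q and u' = b and C = N and B' = I])
      (use D f P pushoutD(9)[OF P(4)] in \<open>simp_all add: op_ses\<close>)
  \<comment> \<open>\<open>op.neg\<close> is \<open>neg\<close>, as the Hom groups of the opposite
    category are the same groups.\<close>
  then have "ses M S L (neg (j2 \<cdot> a) \<boxplus> j1 \<cdot> f) (f' \<cdot> p2 \<boxplus> i' \<cdot> p1)"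
    by (simp add: op_ses op.neg_def neg_def)
  moreover have "p1 \<cdot> (neg (j2 \<cdot> a) \<boxplus> j1 \<cdot> f) = f"
    using t hom_obj[OF f] by (simp add: biproduct_collapse[OF S])
  ultimately show ?thesis using that P(1) by blast
qed

end

section \<open>Chains of conflations\<close>

lemma is_kernel_composable:
  "is_kernel \<A> k f \<Longrightarrow> k \<in> Arr \<A> \<and> f \<in> Arr \<A> \<and> Dom \<A> f = Cod \<A> k"
  unfolding is_kernel_def by simp

lemma conflation_opcat [simp]: "conflation (opcat \<A>) \<C> p i \<longleftrightarrow> conflation \<A> \<C> i p"
  using is_kernel_composable[of \<A> i p] by (auto simp: conflation_def short_exact_def)

definition cmor :: "('o, 'm, 'z) cat_scheme \<Rightarrow> 'm \<times> 'm \<Rightarrow> 'm \<times> 'm \<Rightarrow> 'm \<Rightarrow> 'm \<Rightarrow> bool" where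
  "cmor \<A> d d' a c \<longleftrightarrow> (\<exists>b. a \<in> Hom \<A> (Dom \<A> (fst d)) (Dom \<A> (fst d')) \<and>
     b \<in> Hom \<A> (Cod \<A> (fst d)) (Cod \<A> (fst d')) \<and> c \<in> Hom \<A> (Cod \<A> (snd d)) (Cod \<A> (snd d')) \<and>
     b \<cdot>\<^bsub>\<A>\<^esub> fst d = fst d' \<cdot>\<^bsub>\<A>\<^esub> a \<and> snd d' \<cdot>\<^bsub>\<A>\<^esub> b = c \<cdot>\<^bsub>\<A>\<^esub> snd d)"

text \<open>The empty chain joins an object of \<C> to itself. It serves \<open>chain_append\<close>
  and the inductions on the tail; in positive degree, classes come from nonempty chains.\<close>

primrec chain :: "('o, 'm, 'z) cat_scheme \<Rightarrow> 'o set \<Rightarrow> ('m \<times> 'm) list \<Rightarrow> 'o \<Rightarrow> 'o \<Rightarrow> bool" where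
  "chain \<A> \<C> [] B A \<longleftrightarrow> B = A \<and> A \<in> \<C>"
| "chain \<A> \<C> (d # cs) B A \<longleftrightarrow> conflation \<A> \<C> (fst d) (snd d) \<and> Dom \<A> (fst d) = B \<and>
     chain \<A> \<C> cs (Cod \<A> (snd d)) A"

text \<open>
  A morphism of spliced sequences is recorded by its maps on the two ends and on the objects at which
  the conflations are spliced. The maps between the middle terms are quantified away in \<open>cmor\<close>.
\<close>

primrec ladder :: "('o, 'm, 'z) cat_scheme \<Rightarrow> ('m \<times> 'm) list \<Rightarrow> ('m \<times> 'm) list \<Rightarrow> 'm \<Rightarrow> 'm \<Rightarrow> bool" where
  "ladder \<A> [] ds a c \<longleftrightarrow> ds = [] \<and> a = c"
| "ladder \<A> (d # cs) ds a c \<longleftrightarrow>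
     (\<exists>d' ds' k. ds = d' # ds' \<and> cmor \<A> d d' a k \<and> ladder \<A> cs ds' k c)"

text \<open>At a splice the deflation and the next inflation merge into one arrow. So
  \<open>t\<close> conflations give \<open>t + 1\<close> arrows, the splicing objects are forgotten,
  and only the last deflation survives as it is.\<close>

definition seqof :: "('o, 'm, 'z) cat_scheme \<Rightarrow> ('m \<times> 'm) list \<Rightarrow> 'm list" where
  "seqof \<A> cs = rec_list [] (\<lambda>d cs E. if cs = [] then [fst d, snd d]
     else fst d # (hd E \<cdot>\<^bsub>\<A>\<^esub> snd d) # tl E) cs"

definition dch :: "('m \<times> 'm) list \<Rightarrow> ('m \<times> 'm) list" where
  "dch cs = rev (map prod.swap cs)"

lemma dch_simps [simp]:
  "dch [] = []" "dch (d # cs) = dch cs @ [prod.swap d]" "dch (cs @ ds) = dch ds @ dch cs"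
  "length (dch cs) = length cs" "dch (dch cs) = cs" "dch cs = [] \<longleftrightarrow> cs = []"
  by (simp_all add: dch_def rev_map)

lemma seqof_simps [simp]:
  "seqof \<A> [] = []" "seqof \<A> [d] = [fst d, snd d]"
  "cs \<noteq> [] \<Longrightarrow> seqof \<A> (d # cs) = fst d # (hd (seqof \<A> cs) \<cdot>\<^bsub>\<A>\<^esub> snd d) # tl (seqof \<A> cs)"
  by (simp_all add: seqof_def)

lemma seqof_Nil_iff [simp]: "seqof \<A> cs = [] \<longleftrightarrow> cs = []"
  by (induction cs) (auto simp: seqof_def)

lemma length_seqof [simp]: "cs \<noteq> [] \<Longrightarrow> length (seqof \<A> cs) = Suc (length cs)"
proof (induction cs)
  case (Cons d cs)
  then show ?case by (cases "cs = []") (auto simp: Suc_diff_Suc)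
qed simp

lemma hd_seqof [simp]: "cs \<noteq> [] \<Longrightarrow> hd (seqof \<A> cs) = fst (hd cs)"
  by (cases cs; cases "tl cs = []") auto

lemma last_seqof [simp]: "cs \<noteq> [] \<Longrightarrow> last (seqof \<A> cs) = snd (last cs)"
proof (induction cs)
  case (Cons d cs)
  show ?case
  proof (cases "cs = []")
    case False
    then have "length (seqof \<A> cs) = Suc (length cs)" "length cs > 0" by simp_all
    then have "tl (seqof \<A> cs) \<noteq> []" by (cases "seqof \<A> cs") auto
    then show ?thesis using False Cons.IH by (simp add: last_tl)
  qed simp
qed simp

text \<open>The recursion read from the right end, which is the left end of the dual chain in
  \<open>seqof_opcat\<close>.\<close>

lemma seqof_snoc:
  "cs \<noteq> [] \<Longrightarrow> seqof \<A> (cs @ [d])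
     = butlast (seqof \<A> cs) @ [fst d \<cdot>\<^bsub>\<A>\<^esub> snd (last cs), snd d]"
proof (induction cs)
  case (Cons e cs)
  show ?case
  proof (cases "cs = []")
    case False
    then have "length (seqof \<A> cs) = Suc (length cs)" "length cs > 0" by simp_all
    then obtain x y zs where "seqof \<A> cs = x # y # zs"
      by (metis Suc_length_conv gr0_conv_Suc)
    then show ?thesis using False Cons.IH by simp
  qed simp
qed simp

lemma seqof_opcat: "seqof (opcat \<A>) (dch cs) = rev (seqof \<A> cs)"
proof (induction cs)
  case (Cons d cs)
  show ?case
  proof (cases "cs = []")
    case False
    then have "seqof \<A> cs \<noteq> []" by simp
    then have "butlast (rev (seqof \<A> cs)) = rev (tl (seqof \<A> cs))"
      by (simp add: butlast_rev)
    moreover have "snd (last (dch cs)) = fst (hd cs)"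
      using False by (cases cs) auto
    ultimately show ?thesis using False Cons.IH by (simp add: seqof_snoc)
  qed simp
qed simp

text \<open>\<open>cmor\<close> finds the middle objects as codomains of inflations. In the opposite
  category these codomains turn into domains of deflations, and the two assumptions reconcile both
  readings.\<close>

lemma cmor_opcat [simp]:
  "cmor (opcat \<A>) (prod.swap d') (prod.swap d) c a \<longleftrightarrow>
     cmor \<A> d d' a c" if "Dom \<A> (snd d) = Cod \<A> (fst d)" "Dom \<A> (snd d') = Cod \<A> (fst d')"
  unfolding cmor_def using that by (auto simp: eq_commute)

lemma ladder_length: "ladder \<A> cs ds a c \<Longrightarrow> length ds = length cs"
  by (induction cs arbitrary: ds a) auto

lemma ladder_append:
  "ladder \<A> (cs @ es) gs a c \<longleftrightarrow>
     (\<exists>ds fs k. gs = ds @ fs \<and> ladder \<A> cs ds a k \<and> ladder \<A> es fs k c)"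
proof (induction cs arbitrary: gs a)
  case (Cons d cs)
  show ?case (is "?l \<longleftrightarrow> ?r")
  proof
    assume ?l
    then obtain d' ds fs k l where "gs = d' # ds @ fs" "cmor \<A> d d' a k" "ladder \<A> cs ds k l"
      "ladder \<A> es fs l c" by (auto simp: Cons.IH)
    then have "gs = (d' # ds) @ fs \<and> ladder \<A> (d # cs) (d' # ds) a l \<and> ladder \<A> es fs l c"
      by auto
    then show ?r by blast
  next
    assume ?r
    then obtain ds fs k where *: "gs = ds @ fs" "ladder \<A> (d # cs) ds a k" "ladder \<A> es fs k c"
      by blast
    then obtain d' ds' l where **: "ds = d' # ds'" "cmor \<A> d d' a l" "ladder \<A> cs ds' l k"
      by auto
    have "ladder \<A> (cs @ es) (ds' @ fs) l c"
      using *(3) **(3) by (auto simp: Cons.IH)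
    then show ?l using * ** by auto
  qed
qed auto

lemma ladder_append_same:
  assumes "length ds = length cs"
  shows "ladder \<A> (cs @ es) (ds @ fs) a c \<longleftrightarrow> (\<exists>k. ladder \<A> cs ds a k \<and> ladder \<A> es fs k c)"
proof
  assume "ladder \<A> (cs @ es) (ds @ fs) a c"
  then obtain ds' fs' k where *: "ds @ fs = ds' @ fs'" "ladder \<A> cs ds' a k" "ladder \<A> es fs' k c"
    by (auto simp: ladder_append)
  then have "ds = ds'" "fs = fs'" using ladder_length[OF *(2)] assms by auto
  then show "\<exists>k. ladder \<A> cs ds a k \<and> ladder \<A> es fs k c" using * by blast
qed (auto simp: ladder_append)

lemma chain_append:
  "chain \<A> \<C> (cs @ es) B A \<longleftrightarrow> (\<exists>K. chain \<A> \<C> cs B K \<and> chain \<A> \<C> es K A)"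
proof -
  have "chain \<A> \<C> es K A \<Longrightarrow> K \<in> \<C>" for K
    by (cases es) (auto simp: conflation_def)
  then show ?thesis by (induction cs arbitrary: B) auto
qed

lemma conflationD:
  assumes "conflation \<A> \<C> i p"
  shows "Dom \<A> i \<in> \<C>" "Cod \<A> i \<in> \<C>" "Cod \<A> p \<in> \<C>" "Dom \<A> p = Cod \<A> i" "i \<in> Arr \<A>" "p \<in> Arr \<A>"
  using assms is_kernel_composable[of \<A> i p] by (simp_all add: conflation_def short_exact_def)

lemma chain_ends:
  assumes "chain \<A> \<C> cs B A"
  shows "B \<in> \<C>" "A \<in> \<C>"
proof -
  show "A \<in> \<C>" using assms by (induction cs arbitrary: B) auto
  show "B \<in> \<C>" using assms by (cases cs) (auto simp: conflation_def)
qed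

lemma chain_hd_last:
  assumes "chain \<A> \<C> cs B A" "cs \<noteq> []"
  shows "Dom \<A> (fst (hd cs)) = B" "Cod \<A> (snd (last cs)) = A"
proof -
  show "Dom \<A> (fst (hd cs)) = B" using assms by (cases cs) auto
  show "Cod \<A> (snd (last cs)) = A" using assms by (induction cs arbitrary: B) auto
qed

lemma chain_opcat [simp]: "chain (opcat \<A>) \<C> (dch cs) A B \<longleftrightarrow> chain \<A> \<C> cs B A"
proof (induction cs arbitrary: B)
  case (Cons d cs)
  show ?case
    using conflationD[of \<A> \<C> "fst d" "snd d"] by (auto simp: chain_append Cons.IH)
qed auto

lemma ladder_opcat:
  assumes "chain \<A> \<C> cs B A" "chain \<A> \<C> ds B' A'"
  shows "ladder (opcat \<A>) (dch ds) (dch cs) c a \<longleftrightarrow> ladder \<A> cs ds a c"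
  using assms
proof (induction cs arbitrary: ds a B B')
  case Nil
  show ?case by (cases ds) (auto simp: ladder_append)
next
  case (Cons d cs)
  show ?case
  proof (cases ds)
    case Nil
    then show ?thesis by auto
  next
    case (Cons d' ds')
    have IH: "ladder (opcat \<A>) (dch ds') (dch cs) c k \<longleftrightarrow> ladder \<A> cs ds' k c" for k
      using Cons.IH[of _ ds'] Cons.prems \<open>ds = d' # ds'\<close> by auto
    show ?thesis
    proof (cases "length ds' = length cs")
      case True
      have "Dom \<A> (snd d) = Cod \<A> (fst d)" "Dom \<A> (snd d') = Cod \<A> (fst d')"
        using Cons.prems \<open>ds = d' # ds'\<close> by (auto dest: conflationD)
      then show ?thesis using True \<open>ds = d' # ds'\<close>
        by (auto simp: ladder_append_same IH)
    next
      case False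
      then show ?thesis using \<open>ds = d' # ds'\<close> by (auto dest!: ladder_length)
    qed
  qed
qed

context extension_closed_subcategory
begin

lemma extension_closed_opcat: "extension_closed_subcategory (opcat \<A>) \<C>"
  by (rule extension_closed_subcategory_opcat) unfold_locales

lemma conflation_ses:
  assumes "conflation \<A> \<C> i p"
  shows "ses (Dom \<A> i) (Cod \<A> i) (Cod \<A> p) i p"
  using assms by (simp add: conflation_def flip: short_exact_ses)

lemma ses_conflation:
  assumes "ses B X A i p" "B \<in> \<C>" "A \<in> \<C>"
  shows "conflation \<A> \<C> i p" "X \<in> \<C>"
proof -
  have "Dom \<A> i = B" "Cod \<A> i = X" "Cod \<A> p = A" "short_exact \<A> i p"
    using assms(1) by (simp_all add: ses_def hom_iff)
  then show "conflation \<A> \<C> i p" "X \<in> \<C>"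
    using sub_extension[of i p] assms by (simp_all add: conflation_def)
qed

lemma C_obj: "X \<in> \<C> \<Longrightarrow> X \<in> Obj \<A>"
  using sub_obj by blast

lemma conflationE:
  assumes "conflation \<A> \<C> (fst d) (snd d)"
  obtains B X A i p where "d = (i, p)" "ses B X A i p" "B \<in> \<C>" "X \<in> \<C>" "A \<in> \<C>"
    "Dom \<A> i = B" "Cod \<A> i = X" "Dom \<A> p = X" "Cod \<A> p = A" "i \<in> Arr \<A>" "p \<in> Arr \<A>"
  using that[of "fst d" "snd d"] conflation_ses[OF assms] conflationD[OF assms] by simp

section \<open>Morphisms of conflations\<close>

lemma cmor_id:
  assumes "conflation \<A> \<C> (fst d) (snd d)"
  shows "cmor \<A> d d (Id \<A> (Dom \<A> (fst d))) (Id \<A> (Cod \<A> (snd d)))"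
  unfolding cmor_def
  by (rule exI[of _ "Id \<A> (Cod \<A> (fst d))"])
    (use conflationD[OF assms] C_obj in \<open>simp_all add: hom_iff\<close>)

lemma cmor_comp:
  assumes d: "conflation \<A> \<C> (fst d) (snd d)" "conflation \<A> \<C> (fst d') (snd d')"
    "conflation \<A> \<C> (fst d'') (snd d'')"
    and "cmor \<A> d d' a c" "cmor \<A> d' d'' a' c'"
  shows "cmor \<A> d d'' (a' \<cdot> a) (c' \<cdot> c)"
proof -
  obtain i p where 1: "d = (i, p)" by (cases d)
  obtain i' p' where 2: "d' = (i', p')" by (cases d')
  obtain i'' p'' where 3: "d'' = (i'', p'')" by (cases d'')
  obtain b where b: "a \<in> Hom \<A> (Dom \<A> i) (Dom \<A> i')" "b \<in> Hom \<A> (Cod \<A> i) (Cod \<A> i')"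
    "c \<in> Hom \<A> (Cod \<A> p) (Cod \<A> p')" "b \<cdot> i = i' \<cdot> a" "p' \<cdot> b = c \<cdot> p"
    using assms(4) unfolding cmor_def 1 2 by auto
  obtain b' where b': "a' \<in> Hom \<A> (Dom \<A> i') (Dom \<A> i'')" "b' \<in> Hom \<A> (Cod \<A> i') (Cod \<A> i'')"
    "c' \<in> Hom \<A> (Cod \<A> p') (Cod \<A> p'')" "b' \<cdot> i' = i'' \<cdot> a'" "p'' \<cdot> b' = c' \<cdot> p'"
    using assms(5) unfolding cmor_def 2 3 by auto
  note D = d[unfolded 1 2 3, simplified, THEN conflationD(4)]
    d[unfolded 1 2 3, simplified, THEN conflationD(5)] d[unfolded 1 2 3, simplified, THEN conflationD(6)]
  note t = b(1-3)[unfolded hom_iff] b'(1-3)[unfolded hom_iff]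
  have "(b' \<cdot> b) \<cdot> i = b' \<cdot> (i' \<cdot> a)" using b(4) t D by simp
  also have "\<dots> = (i'' \<cdot> a') \<cdot> a" using b'(4)[symmetric] t D by simp
  also have "\<dots> = i'' \<cdot> (a' \<cdot> a)" using t D by simp
  finally have e1: "(b' \<cdot> b) \<cdot> i = i'' \<cdot> (a' \<cdot> a)" .
  have "p'' \<cdot> (b' \<cdot> b) = (p'' \<cdot> b') \<cdot> b" using t D by simp
  also have "\<dots> = c' \<cdot> (p' \<cdot> b)" unfolding b'(5) using t D by simp
  also have "\<dots> = (c' \<cdot> c) \<cdot> p" unfolding b(5) using t D by simp
  finally have "p'' \<cdot> (b' \<cdot> b) = (c' \<cdot> c) \<cdot> p" .
  then show ?thesis unfolding cmor_def 1 3
    by (intro exI[of _ "b' \<cdot> b"]) (use e1 t D in \<open>simp_all add: hom_iff\<close>)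
qed

lemma cmor_plus:
  assumes d: "conflation \<A> \<C> (fst d) (snd d)" "conflation \<A> \<C> (fst d') (snd d')"
    and "cmor \<A> d d' a c" "cmor \<A> d d' a' c'"
  shows "cmor \<A> d d' (a \<boxplus> a') (c \<boxplus> c')"
proof -
  obtain i p where 1: "d = (i, p)" by (cases d)
  obtain i' p' where 2: "d' = (i', p')" by (cases d')
  obtain b where b: "a \<in> Hom \<A> (Dom \<A> i) (Dom \<A> i')" "b \<in> Hom \<A> (Cod \<A> i) (Cod \<A> i')"
    "c \<in> Hom \<A> (Cod \<A> p) (Cod \<A> p')" "b \<cdot> i = i' \<cdot> a" "p' \<cdot> b = c \<cdot> p"
    using assms(3) unfolding cmor_def 1 2 by auto
  obtain b' where b': "a' \<in> Hom \<A> (Dom \<A> i) (Dom \<A> i')" "b' \<in> Hom \<A> (Cod \<A> i) (Cod \<A> i')"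
    "c' \<in> Hom \<A> (Cod \<A> p) (Cod \<A> p')" "b' \<cdot> i = i' \<cdot> a'" "p' \<cdot> b' = c' \<cdot> p"
    using assms(4) unfolding cmor_def 1 2 by auto
  note D = d[unfolded 1 2, simplified, THEN conflationD(4)]
    d[unfolded 1 2, simplified, THEN conflationD(5)] d[unfolded 1 2, simplified, THEN conflationD(6)]
  note t = b(1-3)[unfolded hom_iff] b'(1-3)[unfolded hom_iff]
  have "(b \<boxplus> b') \<cdot> i = i' \<cdot> (a \<boxplus> a')" "p' \<cdot> (b \<boxplus> b') = (c \<boxplus> c') \<cdot> p"
    using b(4,5) b'(4,5) t D by simp_all
  then show ?thesis unfolding cmor_def 1 2
    by (intro exI[of _ "b \<boxplus> b'"]) (use t D in \<open>simp_all add: hom_iff\<close>)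
qed

text \<open>The push-out of \<open>d\<close> along \<open>f\<close> comes with its universal
  property: a morphism from \<open>d\<close> whose left map factors through \<open>f\<close> factors
  through the push-out, with the same right map. The comparison of different push-outs of a class
  rests on this.\<close>

lemma cmor_push:
  assumes d: "conflation \<A> \<C> (fst d) (snd d)" and f: "f \<in> Hom \<A> (Dom \<A> (fst d)) B'" "B' \<in> \<C>"
  obtains d1 where "conflation \<A> \<C> (fst d1) (snd d1)" "Dom \<A> (fst d1) = B'"
    "Cod \<A> (snd d1) = Cod \<A> (snd d)" "cmor \<A> d d1 f (Id \<A> (Cod \<A> (snd d)))"
    "\<And>d' a' l. \<lbrakk>conflation \<A> \<C> (fst d') (snd d'); a' \<in> Hom \<A> B' (Dom \<A> (fst d'));
       cmor \<A> d d' (a' \<cdot> f) l\<rbrakk> \<Longrightarrow> cmor \<A> d1 d' a' l"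
proof -
  obtain B X A i p where dd: "d = (i, p)" "ses B X A i p" "B \<in> \<C>" "X \<in> \<C>" "A \<in> \<C>"
    "Dom \<A> i = B" "Cod \<A> i = X" "Dom \<A> p = X" "Cod \<A> p = A" "i \<in> Arr \<A>" "p \<in> Arr \<A>"
    by (rule conflationE[OF d])
  have fB: "f \<in> Hom \<A> B B'" using f(1) dd(1,6) by simp
  obtain X' i' p' f' where P: "ses B' X' A i' p'" "f' \<in> Hom \<A> X X'" "p' \<cdot> f' = p"
    "pushout \<A> i f f' i'"
    using pushout_ses_exists[OF dd(2) fB] by blast
  note P' = sesD[OF P(1)]
  note t = P'(1,2)[unfolded hom_iff] P(2)[unfolded hom_iff] and tf = fB[unfolded hom_iff]
  have o: "A \<in> Obj \<A>" "B' \<in> Obj \<A>" using dd f C_obj by auto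
  show ?thesis
  proof (rule that[of "(i', p')"])
    show "conflation \<A> \<C> (fst (i', p')) (snd (i', p'))"
      using ses_conflation[OF P(1) f(2) dd(5)] by simp
    show "cmor \<A> d (i', p') f (Id \<A> (Cod \<A> (snd d)))"
      unfolding cmor_def dd(1)
      by (rule exI[of _ f']) (use t tf dd P pushoutD(9)[OF P(4)] o in \<open>simp_all add: hom_iff\<close>)
    fix d' a' l
    assume d': "conflation \<A> \<C> (fst d') (snd d')" and a': "a' \<in> Hom \<A> B' (Dom \<A> (fst d'))"
      and m: "cmor \<A> d d' (a' \<cdot> f) l"
    obtain B2 X2 A2 k q where dk: "d' = (k, q)" "ses B2 X2 A2 k q" "B2 \<in> \<C>" "X2 \<in> \<C>" "A2 \<in> \<C>"
      "Dom \<A> k = B2" "Cod \<A> k = X2" "Dom \<A> q = X2" "Cod \<A> q = A2" "k \<in> Arr \<A>" "q \<in> Arr \<A>"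
      by (rule conflationE[OF d'])
    obtain b where b: "b \<in> Hom \<A> X X2" "l \<in> Hom \<A> A A2" "b \<cdot> i = k \<cdot> (a' \<cdot> f)" "q \<cdot> b = l \<cdot> p"
      using m unfolding cmor_def dd(1) dk(1) using dd dk by auto
    have a2: "a' \<in> Hom \<A> B' B2" using a' dk by simp
    note ta = a2[unfolded hom_iff] and tb = b(1,2)[unfolded hom_iff]
    have "b \<cdot> i = (k \<cdot> a') \<cdot> f" using b(3) ta tf dk by simp
    then obtain h where h: "h \<in> Hom \<A> X' X2" "h \<cdot> f' = b" "h \<cdot> i' = k \<cdot> a'"
      using pushout_ex1[OF P(4,2) P'(1) b(1), of "k \<cdot> a'"] ta dk by (auto simp: hom_iff)
    note th = h(1)[unfolded hom_iff]
    \<comment> \<open>Checked on both legs of the push-out; on \<open>i'\<close> the two sides are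
      zero.\<close>
    have "q \<cdot> h = l \<cdot> p'"
    proof (rule pushout_eqI[OF P(4,2) P'(1)])
      have "(q \<cdot> h) \<cdot> f' = q \<cdot> b" using h(2) th t dk by simp
      also have "\<dots> = (l \<cdot> p') \<cdot> f'" using b(4) P(3) tb t dk by simp
      finally show "(q \<cdot> h) \<cdot> f' = (l \<cdot> p') \<cdot> f'" .
      have "(q \<cdot> h) \<cdot> i' = q \<cdot> (k \<cdot> a')" using h(3) th t dk by simp
      also have "\<dots> = (q \<cdot> k) \<cdot> a'" using ta dk by simp
      also have "\<dots> = Zero \<A> B' A2" unfolding sesD(5)[OF dk(2)] using ta dk C_obj by simp
      also have "\<dots> = l \<cdot> (p' \<cdot> i')" unfolding P'(5) using tb t o by simp
      finally show "(q \<cdot> h) \<cdot> i' = (l \<cdot> p') \<cdot> i'" using tb t by simp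
    qed (use th tb t dk in \<open>simp_all add: hom_iff\<close>)
    then show "cmor \<A> (i', p') d' a' l"
      unfolding cmor_def dk(1)
      by (intro exI[of _ h]) (use th h tb t ta dk in \<open>simp_all add: hom_iff\<close>)
  qed (use t dd in simp_all)
qed

section \<open>Ladders between chains, their push-outs and pull-backs\<close>

lemma ladder_hom:
  assumes "ladder \<A> cs ds a c" "chain \<A> \<C> cs B A" "chain \<A> \<C> ds B' A'" "cs \<noteq> []"
  shows "a \<in> Hom \<A> B B'" "c \<in> Hom \<A> A A'"
proof -
  show "a \<in> Hom \<A> B B'"
    using assms by (cases cs) (auto simp: cmor_def)
  show "c \<in> Hom \<A> A A'"
    using assms
  proof (induction cs arbitrary: ds a B B')
    case (Cons d cs)
    then obtain d' ds' k where *: "ds = d' # ds'" "cmor \<A> d d' a k" "ladder \<A> cs ds' k c" by auto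
    show ?case
    proof (cases "cs = []")
      case True
      then show ?thesis using Cons.prems * by (auto simp: cmor_def)
    next
      case False
      then show ?thesis using Cons.IH[OF *(3)] Cons.prems * by auto
    qed
  qed simp
qed

lemma ladder_refl:
  "chain \<A> \<C> cs B A \<Longrightarrow> ladder \<A> cs cs (Id \<A> B) (Id \<A> A)"
  by (induction cs arbitrary: B) (auto intro: cmor_id)

lemma ladder_comp:
  assumes "ladder \<A> cs ds a c" "ladder \<A> ds es a' c'"
    "chain \<A> \<C> cs B A" "chain \<A> \<C> ds B' A'" "chain \<A> \<C> es B'' A''"
  shows "ladder \<A> cs es (a' \<cdot> a) (c' \<cdot> c)"
  using assms
proof (induction cs arbitrary: ds es a a' B B' B'')
  case (Cons d cs)
  obtain d' ds' k where 1: "ds = d' # ds'" "cmor \<A> d d' a k" "ladder \<A> cs ds' k c"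
    using Cons.prems(1) by auto
  obtain d'' es' k' where 2: "es = d'' # es'" "cmor \<A> d' d'' a' k'" "ladder \<A> ds' es' k' c'"
    using Cons.prems(2) 1(1) by auto
  have "ladder \<A> cs es' (k' \<cdot> k) (c' \<cdot> c)"
    using Cons.IH[OF 1(3) 2(3)] Cons.prems 1 2 by auto
  moreover have "cmor \<A> d d'' (a' \<cdot> a) (k' \<cdot> k)"
    using cmor_comp[OF _ _ _ 1(2) 2(2)] Cons.prems 1 2 by auto
  ultimately show ?case using 2(1) by auto
qed auto

lemma ladder_plus:
  assumes "ladder \<A> cs ds a c" "ladder \<A> cs ds a' c'" "chain \<A> \<C> cs B A" "chain \<A> \<C> ds B' A'"
  shows "ladder \<A> cs ds (a \<boxplus> a') (c \<boxplus> c')"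
  using assms
proof (induction cs arbitrary: ds a a' B B')
  case (Cons d cs)
  obtain d' ds' k where 1: "ds = d' # ds'" "cmor \<A> d d' a k" "ladder \<A> cs ds' k c"
    using Cons.prems(1) by auto
  obtain k' where 2: "cmor \<A> d d' a' k'" "ladder \<A> cs ds' k' c'"
    using Cons.prems(2) 1(1) by auto
  have "ladder \<A> cs ds' (k \<boxplus> k') (c \<boxplus> c')"
    using Cons.IH[OF 1(3) 2(2)] Cons.prems 1 by auto
  moreover have "cmor \<A> d d' (a \<boxplus> a') (k \<boxplus> k')"
    using cmor_plus[OF _ _ 1(2) 2(1)] Cons.prems 1 by auto
  ultimately show ?case using 1(1) by auto
qed auto

text \<open>Only the first conflation of the chain is pushed out; the others are kept with identity
  maps. The universal property is therefore that of \<open>cmor_push\<close>.\<close>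

lemma ladder_push:
  assumes "chain \<A> \<C> cs B A" "cs \<noteq> []" "f \<in> Hom \<A> B B'" "B' \<in> \<C>"
  obtains ps where "chain \<A> \<C> ps B' A" "length ps = length cs" "ladder \<A> cs ps f (Id \<A> A)"
    "\<And>ds B'' A'' a z. \<lbrakk>chain \<A> \<C> ds B'' A''; a \<in> Hom \<A> B' B''; ladder \<A> cs ds (a \<cdot> f) z\<rbrakk>
       \<Longrightarrow> ladder \<A> ps ds a z"
proof -
  obtain d cs' where cs: "cs = d # cs'" using assms(2) by (cases cs) auto
  have d: "conflation \<A> \<C> (fst d) (snd d)" "Dom \<A> (fst d) = B" "chain \<A> \<C> cs' (Cod \<A> (snd d)) A"
    using assms(1) cs by auto
  obtain d1 where d1: "conflation \<A> \<C> (fst d1) (snd d1)" "Dom \<A> (fst d1) = B'"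
    "Cod \<A> (snd d1) = Cod \<A> (snd d)" "cmor \<A> d d1 f (Id \<A> (Cod \<A> (snd d)))"
    "\<And>d' a' l. \<lbrakk>conflation \<A> \<C> (fst d') (snd d'); a' \<in> Hom \<A> B' (Dom \<A> (fst d'));
       cmor \<A> d d' (a' \<cdot> f) l\<rbrakk> \<Longrightarrow> cmor \<A> d1 d' a' l"
    using cmor_push[OF d(1), of f B'] assms(3,4) d(2) by blast
  show ?thesis
  proof (rule that[of "d1 # cs'"])
    show "ladder \<A> cs (d1 # cs') f (Id \<A> A)"
      using d1(4) ladder_refl[OF d(3)] cs by auto
    fix ds B'' A'' a z
    assume "chain \<A> \<C> ds B'' A''" "a \<in> Hom \<A> B' B''" "ladder \<A> cs ds (a \<cdot> f) z"
    then obtain d' ds' l where *: "ds = d' # ds'" "cmor \<A> d d' (a \<cdot> f) l" "ladder \<A> cs' ds' l z"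
      and "conflation \<A> \<C> (fst d') (snd d')" "a \<in> Hom \<A> B' (Dom \<A> (fst d'))"
      using cs by auto
    then have "cmor \<A> d1 d' a l" using d1(5) by blast
    then show "ladder \<A> (d1 # cs') ds a z" using * by auto
  qed (use d d1 cs in auto)
qed

text \<open>This is \<open>ladder_push\<close> in the opposite category, where the initial property
  of the push-out becomes a terminal one.\<close>

lemma ladder_pull:
  assumes "chain \<A> \<C> ds B A" "ds \<noteq> []" "g \<in> Hom \<A> A' A" "A' \<in> \<C>"
  obtains qs where "chain \<A> \<C> qs B A'" "length qs = length ds" "ladder \<A> qs ds (Id \<A> B) g"
    "\<And>cs B'' A'' a z. \<lbrakk>chain \<A> \<C> cs B'' A''; z \<in> Hom \<A> A'' A'; ladder \<A> cs ds a (g \<cdot> z)\<rbrakk>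
       \<Longrightarrow> ladder \<A> cs qs a z"
proof -
  interpret op: extension_closed_subcategory "opcat \<A>" \<C> by (rule extension_closed_opcat)
  have "chain (opcat \<A>) \<C> (dch ds) A B" "dch ds \<noteq> []" "g \<in> Hom (opcat \<A>) A A'"
    using assms by simp_all
  then obtain ps where ps: "chain (opcat \<A>) \<C> ps A' B" "length ps = length (dch ds)"
    "ladder (opcat \<A>) (dch ds) ps g (Id (opcat \<A>) B)"
    "\<And>ds' B'' A'' a z. \<lbrakk>chain (opcat \<A>) \<C> ds' B'' A''; a \<in> Hom (opcat \<A>) A' B'';
       ladder (opcat \<A>) (dch ds) ds' (a \<cdot>\<^bsub>opcat \<A>\<^esub> g) z\<rbrakk> \<Longrightarrow> ladder (opcat \<A>) ps ds' a z"
    using op.ladder_push[of "dch ds" A B g A'] assms(4) by metis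
  have q: "chain \<A> \<C> (dch ps) B A'"
    using ps(1) chain_opcat[of \<A> \<C> "dch ps" A' B] by simp
  show ?thesis
  proof (rule that[of "dch ps"])
    show "ladder \<A> (dch ps) ds (Id \<A> B) g"
      using ps(3) ladder_opcat[OF q assms(1), of g "Id \<A> B"] by simp
    fix cs B'' A'' a z
    assume c: "chain \<A> \<C> cs B'' A''" "z \<in> Hom \<A> A'' A'" "ladder \<A> cs ds a (g \<cdot> z)"
    have "ladder (opcat \<A>) ps (dch cs) z a"
      using ps(4)[of "dch cs" A'' B'' z a] c ladder_opcat[OF c(1) assms(1), of "g \<cdot> z" a] by simp
    then show "ladder \<A> cs (dch ps) a z"
      using ladder_opcat[OF c(1) q, of z a] by simp
  qed (use q ps in simp_all)
qed

end

section \<open>Yoneda classes\<close>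

definition cls :: "('o, 'm, 'z) cat_scheme \<Rightarrow> 'o set \<Rightarrow> ('m \<times> 'm) list \<Rightarrow> 'm list set" where
  "cls \<A> \<C> cs =
     ext_rel \<A> \<C> (length cs) (Cod \<A> (snd (last cs))) (Dom \<A> (fst (hd cs))) `` {seqof \<A> cs}"

text \<open>In positive degree this is the carrier of \<open>Ext\<close>, see
  \<open>carrier_Ext\<close>. For \<open>t = 0\<close> it is not the Hom group, so the operations
  below are studied under \<open>0 < t\<close>.\<close>

definition Yext :: "('o, 'm, 'z) cat_scheme \<Rightarrow> 'o set \<Rightarrow> nat \<Rightarrow> 'o \<Rightarrow> 'o \<Rightarrow> 'm list set set" where
  "Yext \<A> \<C> t A B = {cls \<A> \<C> cs |cs. chain \<A> \<C> cs B A \<and> length cs = t}"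

text \<open>
  The choice is independent of the representatives by \<open>push_cls\<close>; on a set that is not an extension
  class the value is arbitrary.
\<close>

definition push :: "('o, 'm, 'z) cat_scheme \<Rightarrow> 'o set \<Rightarrow> 'm \<Rightarrow> 'm list set \<Rightarrow> 'm list set" where
  "push \<A> \<C> f x = (SOME y. \<exists>cs ds B A B'. cs \<noteq> [] \<and> chain \<A> \<C> cs B A \<and> chain \<A> \<C> ds B' A \<and>
     ladder \<A> cs ds f (Id \<A> A) \<and> x = cls \<A> \<C> cs \<and> y = cls \<A> \<C> ds)"

definition pull :: "('o, 'm, 'z) cat_scheme \<Rightarrow> 'o set \<Rightarrow> 'm \<Rightarrow> 'm list set \<Rightarrow> 'm list set" where
  "pull \<A> \<C> g x = rev ` push (opcat \<A>) \<C> g (rev ` x)"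

lemma equivclp_map:
  assumes "equivclp R x y" "\<And>x y. R x y \<Longrightarrow> R' (g x) (g y) \<or> R' (g y) (g x)"
  shows "equivclp R' (g x) (g y)"
  using assms(1)
proof (induction rule: equivclp_induct)
  case (step y z)
  then have "R' (g y) (g z) \<or> R' (g z) (g y)" using assms(2) by blast
  then have "equivclp R' (g y) (g z)" by (auto intro: equivclp_sym)
  then show ?case by (rule equivclp_trans[OF step(3)])
qed simp

context extension_closed_subcategory
begin

section \<open>Exact sequences as spliced chains\<close>

lemma exact_seq_chain:
  assumes "exact_seq \<A> \<C> t A B E"
  obtains cs where "cs \<noteq> []" "length cs = t" "chain \<A> \<C> cs B A" "E = seqof \<A> cs"
proof -
  have "\<exists>cs. cs \<noteq> [] \<and> length cs = t \<and> chain \<A> \<C> cs B A \<and> E = seqof \<A> cs"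
    using assms
  proof (induction rule: exact_seq.induct)
    case (base i p B A)
    then have "chain \<A> \<C> [(i, p)] B A" by (auto dest: conflationD)
    then show ?case by (intro exI[of _ "[(i, p)]"]) simp
  next
    case (step i p B K t A j ds)
    then obtain cs where cs: "cs \<noteq> []" "length cs = t" "chain \<A> \<C> cs K A" "j # ds = seqof \<A> cs"
      by auto
    then have "seqof \<A> ((i, p) # cs) = i # (j \<cdot> p) # ds"
      by (simp flip: cs(4))
    then show ?case using step cs by (intro exI[of _ "(i, p) # cs"]) simp
  qed
  then show ?thesis using that by blast
qed

lemma chain_exact_seq:
  assumes "chain \<A> \<C> cs B A" "cs \<noteq> []"
  shows "exact_seq \<A> \<C> (length cs) A B (seqof \<A> cs)"
  using assms
proof (induction cs arbitrary: B)
  case (Cons d cs)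
  show ?case
  proof (cases "cs = []")
    case True
    then show ?thesis using Cons.prems exact_seq.base[of \<A> \<C> "fst d" "snd d"] by auto
  next
    case False
    then have "seqof \<A> cs = fst (hd cs) # tl (seqof \<A> cs)"
      by (metis hd_seqof list.collapse seqof_Nil_iff)
    then have "exact_seq \<A> \<C> (length cs) A (Cod \<A> (snd d)) (fst (hd cs) # tl (seqof \<A> cs))"
      using Cons.IH[OF _ False, of "Cod \<A> (snd d)"] Cons.prems(1) by simp
    then show ?thesis
      using exact_seq.step[of \<A> \<C> "fst d" "snd d" B "Cod \<A> (snd d)"] Cons.prems False by simp
  qed
qed simp

lemma seqof_nth_0: "cs \<noteq> [] \<Longrightarrow> seqof \<A> cs ! 0 = fst (hd cs)"
  by (metis hd_conv_nth hd_seqof seqof_Nil_iff)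

lemma seqof_nth_Suc_Suc:
  "cs \<noteq> [] \<Longrightarrow> m < length cs \<Longrightarrow> seqof \<A> (d # cs) ! Suc (Suc m) = seqof \<A> cs ! Suc m"
  by (simp add: nth_tl)

lemma seqof_types:
  assumes "chain \<A> \<C> cs B A" "cs \<noteq> []"
  shows "k \<le> length cs \<Longrightarrow> seqof \<A> cs ! k \<in> Arr \<A>"
    "k < length cs \<Longrightarrow> Cod \<A> (seqof \<A> cs ! k) = Dom \<A> (seqof \<A> cs ! Suc k)"
    "Dom \<A> (seqof \<A> cs ! 0) = B" "Cod \<A> (seqof \<A> cs ! length cs) = A"
proof -
  show "Dom \<A> (seqof \<A> cs ! 0) = B"
    using assms chain_hd_last(1) seqof_nth_0 by metis
  have "seqof \<A> cs ! length cs = last (seqof \<A> cs)"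
    using assms(2) by (simp add: last_conv_nth)
  then show "Cod \<A> (seqof \<A> cs ! length cs) = A"
    using assms chain_hd_last(2) by simp
  have "(k \<le> length cs \<longrightarrow> seqof \<A> cs ! k \<in> Arr \<A>) \<and>
    (k < length cs \<longrightarrow> Cod \<A> (seqof \<A> cs ! k) = Dom \<A> (seqof \<A> cs ! Suc k))"
    using assms
  proof (induction cs arbitrary: B k)
    case (Cons d cs)
    have d: "conflation \<A> \<C> (fst d) (snd d)" "Dom \<A> (fst d) = B" "chain \<A> \<C> cs (Cod \<A> (snd d)) A"
      using Cons.prems by auto
    note cd = conflationD[OF d(1)]
    show ?case
    proof (cases "cs = []")
      case True
      then show ?thesis using cd by (cases k) auto
    next
      case False
      then have e: "conflation \<A> \<C> (fst (hd cs)) (snd (hd cs))" "Dom \<A> (fst (hd cs)) = Cod \<A> (snd d)"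
        using d(3) by (cases cs; auto)+
      note ce = conflationD[OF e(1)]
      have j: "fst (hd cs) \<cdot> snd d \<in> Arr \<A>" "Dom \<A> (fst (hd cs) \<cdot> snd d) = Cod \<A> (fst d)"
        "Cod \<A> (fst (hd cs) \<cdot> snd d) = Cod \<A> (fst (hd cs))"
        using cd ce e by auto
      note IH = Cons.IH[OF d(3) False]
      consider "k = 0" | "k = 1" | m where "k = Suc (Suc m)" by (metis One_nat_def not0_implies_Suc)
      then show ?thesis
      proof cases
        case 1
        then show ?thesis using cd j False by simp
      next
        case 2
        then show ?thesis using j False IH[of 0] seqof_nth_0[OF False] seqof_nth_Suc_Suc[OF False, of 0 d]
          by auto
      next
        case (3 m)
        then show ?thesis
          using IH[of "Suc m"] seqof_nth_Suc_Suc[OF False, of m d] seqof_nth_Suc_Suc[OF False, of "Suc m" d]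
          by (auto simp del: seqof_simps)
      qed
    qed
  qed simp
  then show "k \<le> length cs \<Longrightarrow> seqof \<A> cs ! k \<in> Arr \<A>"
    "k < length cs \<Longrightarrow> Cod \<A> (seqof \<A> cs ! k) = Dom \<A> (seqof \<A> cs ! Suc k)" by blast+
qed

text \<open>The ladder condition of \<open>seq_morphism\<close> with free end maps. In an induction
  along the chain the left end becomes a splicing object, where the map is no identity.\<close>

definition squares :: "nat \<Rightarrow> 'a list \<Rightarrow> 'a list \<Rightarrow> (nat \<Rightarrow> 'a) \<Rightarrow> bool" where
  "squares t E E' h \<longleftrightarrow> (\<forall>k\<le>t. h k \<in> Hom \<A> (Dom \<A> (E ! k)) (Dom \<A> (E' ! k)) \<and>
     E' ! k \<cdot> h k = h (Suc k) \<cdot> E ! k)"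

lemma ladder_imp_squares:
  assumes "ladder \<A> cs ds a c" "chain \<A> \<C> cs B A" "chain \<A> \<C> ds B' A'" "cs \<noteq> []"
  shows "\<exists>h. h 0 = a \<and> h (Suc (length cs)) = c \<and> squares (length cs) (seqof \<A> cs) (seqof \<A> ds) h"
  using assms
proof (induction cs arbitrary: ds a B B')
  case (Cons d cs)
  obtain d' ds' l where ds: "ds = d' # ds'" and m: "cmor \<A> d d' a l" and L: "ladder \<A> cs ds' l c"
    using Cons.prems(1) by auto
  have d: "conflation \<A> \<C> (fst d) (snd d)" "Dom \<A> (fst d) = B" "chain \<A> \<C> cs (Cod \<A> (snd d)) A"
    and d': "conflation \<A> \<C> (fst d') (snd d')" "Dom \<A> (fst d') = B'" "chain \<A> \<C> ds' (Cod \<A> (snd d')) A'"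
    using Cons.prems ds by auto
  note cd = conflationD[OF d(1)] conflationD[OF d'(1)]
  obtain b where b: "a \<in> Hom \<A> (Dom \<A> (fst d)) (Dom \<A> (fst d'))"
    "b \<in> Hom \<A> (Cod \<A> (fst d)) (Cod \<A> (fst d'))" "l \<in> Hom \<A> (Cod \<A> (snd d)) (Cod \<A> (snd d'))"
    "b \<cdot> fst d = fst d' \<cdot> a" "snd d' \<cdot> b = l \<cdot> snd d"
    using m unfolding cmor_def by blast
  show ?case
  proof (cases "cs = []")
    case True
    then have [simp]: "ds' = []" "l = c" using L by auto
    define h where "h = (\<lambda>k::nat. if k = 0 then a else if k = 1 then b else c)"
    have "squares 1 (seqof \<A> (d # cs)) (seqof \<A> ds) h"
      unfolding squares_def
    proof (intro allI impI)
      fix k :: nat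
      assume "k \<le> 1"
      then consider "k = 0" | "k = 1" by linarith
      then show "h k \<in> Hom \<A> (Dom \<A> (seqof \<A> (d # cs) ! k)) (Dom \<A> (seqof \<A> ds ! k)) \<and>
        seqof \<A> ds ! k \<cdot> h k = h (Suc k) \<cdot> seqof \<A> (d # cs) ! k"
        by cases (use True ds b cd in \<open>simp_all add: h_def\<close>)
    qed
    then show ?thesis using True by (intro exI[of _ h]) (simp add: h_def)
  next
    case False
    then have F': "ds' \<noteq> []" using ladder_length[OF L] by auto
    obtain h where h: "h 0 = l" "h (Suc (length cs)) = c"
      "squares (length cs) (seqof \<A> cs) (seqof \<A> ds') h"
      using Cons.IH[OF L d(3) d'(3) False] by blast
    \<comment> \<open>\<open>h 0 = l\<close> lives on the splicing object, which is not a term of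
      the longer sequence. It is replaced by \<open>a\<close> and \<open>b\<close>, and the
      remaining maps keep their places after an index shift by one.\<close>
    define g where "g = (\<lambda>k. if k = 0 then a else if k = 1 then b else h (k - 1))"
    have sq: "h k \<in> Hom \<A> (Dom \<A> (seqof \<A> cs ! k)) (Dom \<A> (seqof \<A> ds' ! k))"
      "seqof \<A> ds' ! k \<cdot> h k = h (Suc k) \<cdot> seqof \<A> cs ! k" if "k \<le> length cs" for k
      using h(3) that unfolding squares_def by blast+
    note len = ladder_length[OF L]
    have "squares (Suc (length cs)) (seqof \<A> (d # cs)) (seqof \<A> ds) g"
      unfolding squares_def
    proof (intro allI impI)
      fix k :: nat
      assume k: "k \<le> Suc (length cs)"
      consider "k = 0" | "k = 1" | m where "k = Suc (Suc m)" by (metis One_nat_def not0_implies_Suc)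
      then show "g k \<in> Hom \<A> (Dom \<A> (seqof \<A> (d # cs) ! k)) (Dom \<A> (seqof \<A> ds ! k)) \<and>
        seqof \<A> ds ! k \<cdot> g k = g (Suc k) \<cdot> seqof \<A> (d # cs) ! k"
      proof cases
        case 1
        then show ?thesis using b cd False F' ds by (simp add: g_def)
      next
        case 2
        note t0 = seqof_types[OF d(3) False] seqof_types[OF d'(3) F']
        define j j' where "j = fst (hd cs)" and "j' = fst (hd ds')"
        have jj: "seqof \<A> cs ! 0 = j" "seqof \<A> ds' ! 0 = j'"
          using seqof_nth_0 False F' by (simp_all add: j_def j'_def)
        have tj: "j \<in> Arr \<A>" "Dom \<A> j = Cod \<A> (snd d)" "Cod \<A> j = Dom \<A> (seqof \<A> cs ! 1)"
          "j' \<in> Arr \<A>" "Dom \<A> j' = Cod \<A> (snd d')"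
          using seqof_types(1)[OF d(3) False, of 0] seqof_types(2)[OF d(3) False, of 0]
            seqof_types(3)[OF d(3) False] seqof_types(1)[OF d'(3) F', of 0] seqof_types(3)[OF d'(3) F']
            jj False by simp_all
        have h1: "j' \<cdot> l = h 1 \<cdot> j" using sq(2)[of 0] h(1) jj by simp
        have "1 \<le> length cs" using False by (cases cs) auto
        then have th: "h 1 \<in> Arr \<A>" "Dom \<A> (h 1) = Cod \<A> j"
          using sq(1)[of 1] tj by (simp_all add: hom_iff)
        note tb = b(1-3)[unfolded hom_iff]
        have "(j' \<cdot> snd d') \<cdot> b = j' \<cdot> (l \<cdot> snd d)" using b(5) tb tj cd by simp
        also have "\<dots> = (j' \<cdot> l) \<cdot> snd d" using tb tj cd by simp
        also have "\<dots> = h 1 \<cdot> (j \<cdot> snd d)" unfolding h1 using tj th cd by simp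
        finally show ?thesis
          using 2 False F' ds b cd tj by (simp add: g_def flip: j_def j'_def)
      next
        case (3 m)
        then have "seqof \<A> (d # cs) ! k = seqof \<A> cs ! Suc m" "seqof \<A> ds ! k = seqof \<A> ds' ! Suc m"
          using seqof_nth_Suc_Suc[OF False, of m d] seqof_nth_Suc_Suc[OF F', of m d'] k len ds by auto
        then show ?thesis using sq[of "Suc m"] 3 k by (simp add: g_def)
      qed
    qed
    then show ?thesis using h(2) by (intro exI[of _ g]) (simp add: g_def)
  qed
qed simp

text \<open>The map on a splicing object is not given and has to be recovered. The middle map
  \<open>h 1\<close> carries one inflation into the other, so it descends along the deflation to
  \<open>l\<close>; the next square commutes with \<open>l\<close> because the deflation is
  epi.\<close>

lemma squares_imp_ladder:
  assumes "squares (length cs) (seqof \<A> cs) (seqof \<A> ds) h" "h 0 = a" "h (Suc (length cs)) = c"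
    "chain \<A> \<C> cs B A" "chain \<A> \<C> ds B' A'" "cs \<noteq> []" "length ds = length cs" "c \<in> Hom \<A> A A'"
  shows "ladder \<A> cs ds a c"
  using assms
proof (induction cs arbitrary: ds a B B' h)
  case (Cons d cs)
  obtain d' ds' where ds: "ds = d' # ds'" "length ds' = length cs"
    using Cons.prems(7) by (cases ds) auto
  have d: "conflation \<A> \<C> (fst d) (snd d)" "Dom \<A> (fst d) = B" "chain \<A> \<C> cs (Cod \<A> (snd d)) A"
    and d': "conflation \<A> \<C> (fst d') (snd d')" "Dom \<A> (fst d') = B'" "chain \<A> \<C> ds' (Cod \<A> (snd d')) A'"
    using Cons.prems ds by auto
  note cd = conflationD[OF d(1)] conflationD[OF d'(1)]
  note S = conflation_ses[OF d(1)] and S' = conflation_ses[OF d'(1)]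
  have sq: "h k \<in> Hom \<A> (Dom \<A> (seqof \<A> (d # cs) ! k)) (Dom \<A> (seqof \<A> ds ! k))"
    "seqof \<A> ds ! k \<cdot> h k = h (Suc k) \<cdot> seqof \<A> (d # cs) ! k" if "k \<le> Suc (length cs)" for k
    using Cons.prems(1) that unfolding squares_def by auto
  show ?case
  proof (cases "cs = []")
    case True
    then have [simp]: "ds' = []" using ds by auto
    have "cmor \<A> d d' a c"
      unfolding cmor_def
      using sq[of 0] sq[of 1] True ds Cons.prems cd by (intro exI[of _ "h 1"]) simp
    then show ?thesis using True ds by simp
  next
    case False
    then have F': "ds' \<noteq> []" using ds by auto
    define b where "b = h 1"
    define j j' where "j = fst (hd cs)" and "j' = fst (hd ds')"
    have jj: "seqof \<A> cs ! 0 = j" "seqof \<A> ds' ! 0 = j'"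
      using seqof_nth_0 False F' by (simp_all add: j_def j'_def)
    have tj: "j \<in> Arr \<A>" "Dom \<A> j = Cod \<A> (snd d)" "Cod \<A> j = Dom \<A> (seqof \<A> cs ! 1)"
      "j' \<in> Arr \<A>" "Dom \<A> j' = Cod \<A> (snd d')"
      using seqof_types(1)[OF d(3) False, of 0] seqof_types(2)[OF d(3) False, of 0]
        seqof_types(3)[OF d(3) False] seqof_types(1)[OF d'(3) F', of 0] seqof_types(3)[OF d'(3) F']
        jj False by simp_all
    have a: "a \<in> Hom \<A> B B'" "fst d' \<cdot> a = b \<cdot> fst d"
      using sq[of 0] Cons.prems(2) ds False F' d d' by (simp_all add: b_def)
    have b: "b \<in> Hom \<A> (Cod \<A> (fst d)) (Cod \<A> (fst d'))" "(j' \<cdot> snd d') \<cdot> b = h 2 \<cdot> (j \<cdot> snd d)"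
      using sq[of 1] ds False F' cd tj by (simp_all add: b_def j_def j'_def numeral_2_eq_2)
    note tb = b(1)[unfolded hom_iff] and ta = a(1)[unfolded hom_iff]
    have tail: "h (Suc (Suc m)) \<in> Hom \<A> (Dom \<A> (seqof \<A> cs ! Suc m)) (Dom \<A> (seqof \<A> ds' ! Suc m))"
      "seqof \<A> ds' ! Suc m \<cdot> h (Suc (Suc m)) = h (Suc (Suc (Suc m))) \<cdot> seqof \<A> cs ! Suc m"
      if "Suc m \<le> length cs" for m
      using sq[of "Suc (Suc m)"] seqof_nth_Suc_Suc[OF False, of m d] seqof_nth_Suc_Suc[OF F', of m d']
        that ds by auto
    have "1 \<le> length cs" using False by (cases cs) auto
    then have th: "h 2 \<in> Arr \<A>" "Dom \<A> (h 2) = Cod \<A> j"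
      using tail(1)[of 0] tj by (simp_all add: hom_iff numeral_2_eq_2)
    have "(snd d' \<cdot> b) \<cdot> fst d = snd d' \<cdot> (fst d' \<cdot> a)" unfolding a(2) using tb cd by simp
    also have "\<dots> = (snd d' \<cdot> fst d') \<cdot> a" using ta cd d' by simp
    also have "\<dots> = Zero \<A> (Dom \<A> (fst d)) (Cod \<A> (snd d'))"
      unfolding sesD(5)[OF S'] using ta cd d d' by simp
    finally obtain l where l: "l \<in> Hom \<A> (Cod \<A> (snd d)) (Cod \<A> (snd d'))" "l \<cdot> snd d = snd d' \<cdot> b"
      using ses_desc[OF S, of "snd d' \<cdot> b" "Cod \<A> (snd d')"] tb cd by (auto simp: hom_iff)
    note tl = l(1)[unfolded hom_iff]
    have "(j' \<cdot> l) \<cdot> snd d = (j' \<cdot> snd d') \<cdot> b" using l(2) tl tj tb cd by simp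
    then have "(j' \<cdot> l) \<cdot> snd d = (h 2 \<cdot> j) \<cdot> snd d" using b(2) tj th cd by simp
    moreover have "Cod \<A> (h 2 \<cdot> j) = Cod \<A> (j' \<cdot> l)"
    proof -
      have "Cod \<A> ((j' \<cdot> l) \<cdot> snd d) = Cod \<A> ((h 2 \<cdot> j) \<cdot> snd d)"
        using \<open>(j' \<cdot> l) \<cdot> snd d = (h 2 \<cdot> j) \<cdot> snd d\<close> by simp
      then show ?thesis using tl tj th cd by (simp del: assoc)
    qed
    ultimately have jl: "j' \<cdot> l = h 2 \<cdot> j"
      by (intro epi_cancel[OF sesD(4,2)[OF S], of "j' \<cdot> l" "Cod \<A> (j' \<cdot> l)"])
        (use tl tj th cd in \<open>simp_all add: hom_iff\<close>)
    define g where "g = (\<lambda>k. if k = 0 then l else h (Suc k))"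
    have "squares (length cs) (seqof \<A> cs) (seqof \<A> ds') g"
      unfolding squares_def
    proof (intro allI impI)
      fix k
      assume k: "k \<le> length cs"
      show "g k \<in> Hom \<A> (Dom \<A> (seqof \<A> cs ! k)) (Dom \<A> (seqof \<A> ds' ! k)) \<and>
        seqof \<A> ds' ! k \<cdot> g k = g (Suc k) \<cdot> seqof \<A> cs ! k"
      proof (cases k)
        case 0
        then show ?thesis using l(1) jj jl tj by (simp add: g_def numeral_2_eq_2)
      next
        case (Suc m)
        then show ?thesis using tail[of m] k by (simp add: g_def)
      qed
    qed
    then have "ladder \<A> cs ds' l c"
      using Cons.IH[of ds' g l] d(3) d'(3) False ds Cons.prems(3,8) by (simp add: g_def)
    moreover have "cmor \<A> d d' a l"
      unfolding cmor_def using a b(1) l d d' by (intro exI[of _ b]) simp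
    ultimately show ?thesis using ds by auto
  qed
qed simp

lemma seq_morphism_iff:
  assumes "chain \<A> \<C> cs B A" "chain \<A> \<C> ds B A" "cs \<noteq> []" "length ds = length cs"
  shows "seq_morphism \<A> \<C> (length cs) A B (seqof \<A> cs) (seqof \<A> ds)
    \<longleftrightarrow> ladder \<A> cs ds (Id \<A> B) (Id \<A> A)"
proof -
  have "ds \<noteq> []" using assms by auto
  then have "exact_seq \<A> \<C> (length cs) A B (seqof \<A> cs)" "exact_seq \<A> \<C> (length cs) A B (seqof \<A> ds)"
    using chain_exact_seq[OF assms(1,3)] chain_exact_seq[OF assms(2)] assms(4) by simp_all
  moreover have "Id \<A> A \<in> Hom \<A> A A" using chain_ends[OF assms(1)] C_obj id_hom by blast
  ultimately show ?thesis
    using ladder_imp_squares[OF _ assms(1-3), of "Id \<A> B" "Id \<A> A"]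
      squares_imp_ladder[OF _ _ _ assms, of _ "Id \<A> B" "Id \<A> A"]
    unfolding seq_morphism_def squares_def by blast
qed

text \<open>Since \<open>seqof\<close> forgets the splicing objects, equal sequences may come from
  different chains. The identities on the terms still induce a ladder; the extra value
  \<open>Id \<A> A\<close> belongs to the right end, which is the domain of no arrow of the
  list.\<close>

lemma seqof_eq_ladder:
  assumes "chain \<A> \<C> cs B A" "chain \<A> \<C> ds B A" "cs \<noteq> []" "seqof \<A> ds = seqof \<A> cs"
  shows "ladder \<A> cs ds (Id \<A> B) (Id \<A> A)"
proof -
  have "ds \<noteq> []" using assms(3,4) seqof_Nil_iff by metis
  then have "Suc (length ds) = Suc (length cs)" using assms(3,4) length_seqof by metis
  then have len: "length ds = length cs" by simp
  define h where "h = (\<lambda>k. if k \<le> length cs then Id \<A> (Dom \<A> (seqof \<A> cs ! k)) else Id \<A> A)"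
  note t = seqof_types[OF assms(1,3)]
  have "squares (length cs) (seqof \<A> cs) (seqof \<A> ds) h"
    unfolding squares_def assms(4)
  proof (intro allI impI)
    fix k
    assume k: "k \<le> length cs"
    have "h (Suc k) = Id \<A> (Cod \<A> (seqof \<A> cs ! k))"
      using t(2)[of k] t(4) k by (cases "k = length cs") (auto simp: h_def)
    then show "h k \<in> Hom \<A> (Dom \<A> (seqof \<A> cs ! k)) (Dom \<A> (seqof \<A> cs ! k)) \<and>
      seqof \<A> cs ! k \<cdot> h k = h (Suc k) \<cdot> seqof \<A> cs ! k"
      using t(1)[OF k] k by (simp add: h_def hom_iff)
  qed
  moreover have "h 0 = Id \<A> B" "h (Suc (length cs)) = Id \<A> A"
    using t(3) by (simp_all add: h_def)
  ultimately show ?thesis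
    using squares_imp_ladder[OF _ _ _ assms(1-3) len] chain_ends[OF assms(1)] C_obj id_hom by blast
qed

section \<open>Equality of classes and invariants along zigzags\<close>

lemma equivclp_exact:
  assumes "equivclp (seq_morphism \<A> \<C> t A B) E E'" "exact_seq \<A> \<C> t A B E"
  shows "exact_seq \<A> \<C> t A B E'"
  using assms by (induction rule: equivclp_induct) (auto simp: seq_morphism_def)

lemma cls_alt:
  assumes "chain \<A> \<C> cs B A" "cs \<noteq> []"
  shows "cls \<A> \<C> cs = {E. equivclp (seq_morphism \<A> \<C> (length cs) A B) (seqof \<A> cs) E}"
  using chain_hd_last[OF assms] by (auto simp: cls_def ext_rel_def)

lemma cls_self: "seqof \<A> cs \<in> cls \<A> \<C> cs"
  by (simp add: cls_def ext_rel_def)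

lemma cls_eq_ends:
  assumes "cls \<A> \<C> cs = cls \<A> \<C> ds" "chain \<A> \<C> cs B A" "chain \<A> \<C> ds B' A'" "cs \<noteq> []" "ds \<noteq> []"
  shows "B' = B" "A' = A" "length ds = length cs"
proof -
  have "seqof \<A> ds \<in> cls \<A> \<C> cs" using assms(1) cls_self by simp
  then have "exact_seq \<A> \<C> (length cs) A B (seqof \<A> ds)"
    unfolding cls_alt[OF assms(2,4)] using equivclp_exact chain_exact_seq[OF assms(2,4)] by blast
  then obtain es where es: "es \<noteq> []" "length es = length cs" "chain \<A> \<C> es B A" "seqof \<A> ds = seqof \<A> es"
    using exact_seq_chain by metis
  then have "hd (seqof \<A> ds) = hd (seqof \<A> es)" "last (seqof \<A> ds) = last (seqof \<A> es)"
    "length (seqof \<A> ds) = length (seqof \<A> es)" by simp_all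
  then show "B' = B" "A' = A" "length ds = length cs"
    using chain_hd_last[OF es(3,1)] chain_hd_last[OF assms(3,5)] es(1,2) assms(5) by simp_all
qed

lemma cls_eqI:
  assumes "ladder \<A> cs ds (Id \<A> B) (Id \<A> A)" "chain \<A> \<C> cs B A" "chain \<A> \<C> ds B A" "cs \<noteq> []"
  shows "cls \<A> \<C> cs = cls \<A> \<C> ds"
proof -
  note len = ladder_length[OF assms(1)]
  then have ne: "ds \<noteq> []" using assms(4) by auto
  have "equivclp (seq_morphism \<A> \<C> (length cs) A B) (seqof \<A> cs) (seqof \<A> ds)"
    using seq_morphism_iff[OF assms(2-4) len] assms(1) by blast
  then show ?thesis
    unfolding cls_alt[OF assms(2,4)] cls_alt[OF assms(3) ne] len
    by (auto intro: equivclp_trans equivclp_sym)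
qed

text \<open>The induction principle for equal classes. The zigzag consists of sequences while
  \<open>P\<close> speaks of chains, so a chain is chosen for each sequence on the way. At the end
  the chosen chain is compared with \<open>ds\<close> by \<open>seqof_eq_ladder\<close>.\<close>

lemma cls_invariant:
  assumes "cls \<A> \<C> cs = cls \<A> \<C> ds" "chain \<A> \<C> cs B A" "chain \<A> \<C> ds B A" "cs \<noteq> []" "ds \<noteq> []"
    and inv: "\<And>es fs. \<lbrakk>chain \<A> \<C> es B A; chain \<A> \<C> fs B A; length es = length cs; length fs = length cs;
      ladder \<A> es fs (Id \<A> B) (Id \<A> A)\<rbrakk> \<Longrightarrow> P es \<longleftrightarrow> P fs"
    and "P cs"
  shows "P ds"
proof -
  have "equivclp (seq_morphism \<A> \<C> (length cs) A B) (seqof \<A> cs) (seqof \<A> ds)"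
    using cls_self[of ds] assms(1) cls_alt[OF assms(2,4)] by auto
  then have "\<exists>es. chain \<A> \<C> es B A \<and> length es = length cs \<and> seqof \<A> ds = seqof \<A> es \<and> P es"
  proof (induction rule: equivclp_induct)
    case base
    then show ?case using assms(2) \<open>P cs\<close> by blast
  next
    case (step y z)
    then obtain es where es: "chain \<A> \<C> es B A" "length es = length cs" "y = seqof \<A> es" "P es" by blast
    have "exact_seq \<A> \<C> (length cs) A B z" using step(2) by (auto simp: seq_morphism_def)
    then obtain fs where fs: "fs \<noteq> []" "length fs = length cs" "chain \<A> \<C> fs B A" "z = seqof \<A> fs"
      using exact_seq_chain by metis
    have "es \<noteq> []" using es(2) assms(4) by auto
    then have "ladder \<A> es fs (Id \<A> B) (Id \<A> A) \<or> ladder \<A> fs es (Id \<A> B) (Id \<A> A)"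
      using step(2) es fs seq_morphism_iff[OF es(1) fs(3)] seq_morphism_iff[OF fs(3) es(1)] by auto
    then have "P fs" using inv es fs by metis
    then show ?case using fs by blast
  qed
  then obtain es where es: "chain \<A> \<C> es B A" "length es = length cs" "seqof \<A> ds = seqof \<A> es" "P es"
    by blast
  have "es \<noteq> []" using es(2) assms(4) by auto
  then have "ladder \<A> es ds (Id \<A> B) (Id \<A> A)"
    using seqof_eq_ladder[OF es(1) assms(3)] es(3) by simp
  moreover have "length ds = length cs" using cls_eq_ends[OF assms(1-5)] by simp
  ultimately show ?thesis using inv[OF es(1) assms(3) es(2)] es(4) by blast
qed

text \<open>Let \<open>p0\<close> be the universal push-out of \<open>cs\<close> along
  \<open>a\<close> and \<open>q0\<close> the universal pull-back of \<open>ds\<close> along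
  \<open>c\<close>. The given ladder factors through a ladder from \<open>p0\<close> to
  \<open>q0\<close> with identities at both ends, and \<open>ps\<close> and \<open>qs\<close> are
  compared with \<open>p0\<close> and \<open>q0\<close> in the same way. With \<open>c\<close> an
  identity this shows that any two push-outs agree.\<close>

lemma ladder_cls:
  assumes L: "ladder \<A> cs ds a c" "ladder \<A> cs ps a (Id \<A> A)" "ladder \<A> qs ds (Id \<A> B') c"
    and ch: "chain \<A> \<C> cs B A" "chain \<A> \<C> ds B' A'" "chain \<A> \<C> ps B' A" "chain \<A> \<C> qs B' A"
    and ne: "cs \<noteq> []"
  shows "cls \<A> \<C> ps = cls \<A> \<C> qs"
proof -
  have len: "length ds = length cs" "length ps = length cs" "length ds = length qs"
    using L[THEN ladder_length] by simp_all
  then have ne': "ds \<noteq> []" "ps \<noteq> []" "qs \<noteq> []" using ne by auto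
  have a: "a \<in> Hom \<A> B B'" and c: "c \<in> Hom \<A> A A'" using ladder_hom[OF L(1) ch(1,2) ne] .
  have C: "B \<in> \<C>" "A \<in> \<C>" "B' \<in> \<C>" "A' \<in> \<C>"
    using chain_ends[OF ch(1)] chain_ends[OF ch(2)] by simp_all
  have i: "Id \<A> B' \<in> Hom \<A> B' B'" "Id \<A> A \<in> Hom \<A> A A" using C C_obj id_hom by blast+
  have a1: "Id \<A> B' \<cdot> a = a" "c \<cdot> Id \<A> A = c" using a c by (simp_all add: hom_iff)
  obtain p0 where p0: "chain \<A> \<C> p0 B' A" "length p0 = length cs"
    "\<And>ds B'' A'' a' z. \<lbrakk>chain \<A> \<C> ds B'' A''; a' \<in> Hom \<A> B' B''; ladder \<A> cs ds (a' \<cdot> a) z\<rbrakk>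
       \<Longrightarrow> ladder \<A> p0 ds a' z"
    using ladder_push[OF ch(1) ne a C(3)] by metis
  obtain q0 where q0: "chain \<A> \<C> q0 B' A" "length q0 = length ds"
    "\<And>cs B'' A'' a z. \<lbrakk>chain \<A> \<C> cs B'' A''; z \<in> Hom \<A> A'' A; ladder \<A> cs ds a (c \<cdot> z)\<rbrakk>
       \<Longrightarrow> ladder \<A> cs q0 a z"
    using ladder_pull[OF ch(2) ne'(1) c C(2)] by metis
  have 1: "ladder \<A> p0 ps (Id \<A> B') (Id \<A> A)" using p0(3)[OF ch(3) i(1)] L(2) a1 by simp
  have 2: "ladder \<A> qs q0 (Id \<A> B') (Id \<A> A)" using q0(3)[OF ch(4) i(2)] L(3) a1 by simp
  have "ladder \<A> p0 ds (Id \<A> B') c" using p0(3)[OF ch(2) i(1)] L(1) a1 by simp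
  then have 3: "ladder \<A> p0 q0 (Id \<A> B') (Id \<A> A)" using q0(3)[OF p0(1) i(2)] a1 by simp
  have "p0 \<noteq> []" using p0(2) ne by auto
  then show ?thesis
    using cls_eqI[OF 1 p0(1) ch(3)] cls_eqI[OF 2 ch(4) q0(1)] cls_eqI[OF 3 p0(1) q0(1)] ne' by simp
qed

text \<open>Independence of the representative: the property that all push-outs of a chain lie in
  the class of \<open>ds\<close> is invariant along zigzags, because a ladder into \<open>fs\<close>
  composes with a push-out of \<open>fs\<close>.\<close>

lemma push_cls:
  assumes L: "ladder \<A> cs ds f (Id \<A> A)" and ch: "chain \<A> \<C> cs B A" "chain \<A> \<C> ds B' A" and ne: "cs \<noteq> []"
  shows "push \<A> \<C> f (cls \<A> \<C> cs) = cls \<A> \<C> ds"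
proof -
  have f: "f \<in> Hom \<A> B B'" using ladder_hom(1)[OF L ch ne] .
  have C: "B \<in> \<C>" "A \<in> \<C>" "B' \<in> \<C>"
    using chain_ends[OF ch(1)] chain_ends[OF ch(2)] by simp_all
  have idI: "ladder \<A> fs fs (Id \<A> B') (Id \<A> A)" if "chain \<A> \<C> fs B' A" for fs
    using ladder_refl[OF that] .
  define P where "P = (\<lambda>es. \<forall>fs. chain \<A> \<C> fs B' A \<longrightarrow> ladder \<A> es fs f (Id \<A> A) \<longrightarrow>
    cls \<A> \<C> fs = cls \<A> \<C> ds)"
  have "P es" if e: "cls \<A> \<C> cs = cls \<A> \<C> es" "chain \<A> \<C> es B A" "es \<noteq> []" for es
  proof (rule cls_invariant[OF e(1) ch(1) e(2) ne e(3)])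
    show "P cs" unfolding P_def
      using ladder_cls[OF L _ idI[OF ch(2)] ch(1,2) _ ch(2) ne] by blast
    fix es fs
    assume E: "chain \<A> \<C> es B A" "chain \<A> \<C> fs B A" "length es = length cs" "length fs = length cs"
      "ladder \<A> es fs (Id \<A> B) (Id \<A> A)"
    have ne': "es \<noteq> []" "fs \<noteq> []" using E ne by auto
    have tr: "ladder \<A> es gs f (Id \<A> A)" if "chain \<A> \<C> gs B' A" "ladder \<A> fs gs f (Id \<A> A)" for gs
      using ladder_comp[OF E(5) that(2) E(1,2) that(1)] f C C_obj by (simp add: hom_iff)
    show "P es \<longleftrightarrow> P fs"
    proof
      assume "P es"
      then show "P fs" unfolding P_def using tr by blast
    next
      assume "P fs"
      \<comment> \<open>This direction needs one push-out of \<open>fs\<close> to exist. It is a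
        push-out of \<open>es\<close> too, and any two of these are equivalent.\<close>
      obtain gs where gs: "chain \<A> \<C> gs B' A" "ladder \<A> fs gs f (Id \<A> A)"
        using ladder_push[OF E(2) ne'(2) f C(3)] by metis
      then have g: "cls \<A> \<C> gs = cls \<A> \<C> ds" using \<open>P fs\<close> unfolding P_def by blast
      show "P es" unfolding P_def
        using ladder_cls[OF tr[OF gs] _ idI[OF gs(1)] E(1) gs(1) _ gs(1) ne'(1)] g by simp
    qed
  qed
  then have *: "cls \<A> \<C> fs = cls \<A> \<C> ds" if "cls \<A> \<C> cs = cls \<A> \<C> es" "chain \<A> \<C> es B2 A2"
    "chain \<A> \<C> fs B2' A2" "es \<noteq> []" "ladder \<A> es fs f (Id \<A> A2)" for es fs B2 A2 B2'
  proof -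
    have "B2 = B" "A2 = A" using cls_eq_ends[OF that(1) ch(1) that(2) ne that(4)] by auto
    moreover have "B2' = B'"
      using ladder_hom(1)[OF that(5,2,3,4)] f by (auto simp: hom_iff)
    ultimately show ?thesis
      using that(2,3,5) \<open>\<And>es. \<lbrakk>cls \<A> \<C> cs = cls \<A> \<C> es; chain \<A> \<C> es B A; es \<noteq> []\<rbrakk> \<Longrightarrow> P es\<close>[OF that(1) _ that(4)]
      unfolding P_def by simp
  qed
  have "\<exists>y cs' ds' B A B'. cs' \<noteq> [] \<and> chain \<A> \<C> cs' B A \<and> chain \<A> \<C> ds' B' A \<and>
     ladder \<A> cs' ds' f (Id \<A> A) \<and> cls \<A> \<C> cs = cls \<A> \<C> cs' \<and> y = cls \<A> \<C> ds'"
    using L ch ne by blast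
  then show ?thesis
    unfolding push_def
  proof (rule someI2_ex)
    fix y
    assume "\<exists>cs' ds' B A B'. cs' \<noteq> [] \<and> chain \<A> \<C> cs' B A \<and> chain \<A> \<C> ds' B' A \<and>
     ladder \<A> cs' ds' f (Id \<A> A) \<and> cls \<A> \<C> cs = cls \<A> \<C> cs' \<and> y = cls \<A> \<C> ds'"
    then show "y = cls \<A> \<C> ds"
    proof (elim exE conjE)
      fix cs' ds' B2 A2 B2'
      assume "cs' \<noteq> []" "chain \<A> \<C> cs' B2 A2" "chain \<A> \<C> ds' B2' A2"
        "ladder \<A> cs' ds' f (Id \<A> A2)" "cls \<A> \<C> cs = cls \<A> \<C> cs'" "y = cls \<A> \<C> ds'"
      then show ?thesis using *[of cs' B2 A2 ds' B2'] by simp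
    qed
  qed
qed

lemma seq_morphism_opcat:
  assumes "seq_morphism \<A> \<C> t A B E E'"
  shows "seq_morphism (opcat \<A>) \<C> t B A (rev E') (rev E)"
proof -
  interpret op: extension_closed_subcategory "opcat \<A>" \<C> by (rule extension_closed_opcat)
  obtain cs where cs: "cs \<noteq> []" "length cs = t" "chain \<A> \<C> cs B A" "E = seqof \<A> cs"
    using exact_seq_chain assms unfolding seq_morphism_def by metis
  obtain ds where ds: "ds \<noteq> []" "length ds = t" "chain \<A> \<C> ds B A" "E' = seqof \<A> ds"
    using exact_seq_chain assms unfolding seq_morphism_def by metis
  have "ladder \<A> cs ds (Id \<A> B) (Id \<A> A)"
    using assms seq_morphism_iff[OF cs(3) ds(3) cs(1)] cs ds by simp
  then have "ladder (opcat \<A>) (dch ds) (dch cs) (Id \<A> A) (Id \<A> B)"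
    using ladder_opcat[OF cs(3) ds(3)] by simp
  then show ?thesis
    using op.seq_morphism_iff[of "dch ds" A B "dch cs"] cs ds by (simp add: seqof_opcat)
qed

end

lemma cls_opcat:
  assumes "extension_closed_subcategory \<A> \<C>" "chain \<A> \<C> cs B A" "cs \<noteq> []"
  shows "cls (opcat \<A>) \<C> (dch cs) = rev ` cls \<A> \<C> cs"
proof -
  interpret extension_closed_subcategory \<A> \<C> by fact
  interpret op: extension_closed_subcategory "opcat \<A>" \<C> by (rule extension_closed_opcat)
  have 1: "equivclp (seq_morphism (opcat \<A>) \<C> t B A) (rev E) (rev E')"
    if "equivclp (seq_morphism \<A> \<C> t A B) E E'" for t E E'
    using that by (rule equivclp_map) (auto dest: seq_morphism_opcat)
  have 2: "equivclp (seq_morphism \<A> \<C> t A B) (rev E) (rev E')"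
    if "equivclp (seq_morphism (opcat \<A>) \<C> t B A) E E'" for t E E'
    using that by (rule equivclp_map) (auto dest: op.seq_morphism_opcat)
  have "cls (opcat \<A>) \<C> (dch cs)
    = {E. equivclp (seq_morphism (opcat \<A>) \<C> (length cs) B A) (rev (seqof \<A> cs)) E}"
    using op.cls_alt[of "dch cs" A B] assms by (simp add: seqof_opcat)
  also have "\<dots> = rev ` {E. equivclp (seq_morphism \<A> \<C> (length cs) A B) (seqof \<A> cs) E}"
  proof (intro equalityI subsetI)
    fix E
    assume "E \<in> {E. equivclp (seq_morphism (opcat \<A>) \<C> (length cs) B A) (rev (seqof \<A> cs)) E}"
    then have "rev E \<in> {E. equivclp (seq_morphism \<A> \<C> (length cs) A B) (seqof \<A> cs) E}"
      using 2[of "length cs" "rev (seqof \<A> cs)" E] by simp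
    then show "E \<in> rev ` {E. equivclp (seq_morphism \<A> \<C> (length cs) A B) (seqof \<A> cs) E}"
      using image_eqI[of E rev "rev E"] by simp
  qed (use 1 in auto)
  finally show ?thesis unfolding cls_alt[OF assms(2,3)] .
qed

context extension_closed_subcategory
begin

lemma pull_cls:
  assumes L: "ladder \<A> cs ds (Id \<A> B) g" and ch: "chain \<A> \<C> cs B A" "chain \<A> \<C> ds B A'" and ne: "cs \<noteq> []"
  shows "pull \<A> \<C> g (cls \<A> \<C> ds) = cls \<A> \<C> cs"
proof -
  interpret op: extension_closed_subcategory "opcat \<A>" \<C> by (rule extension_closed_opcat)
  note e = extension_closed_subcategory_axioms
  have ne': "ds \<noteq> []" using ladder_length[OF L] ne by auto
  have "ladder (opcat \<A>) (dch ds) (dch cs) g (Id \<A> B)"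
    using ladder_opcat[OF ch] L by blast
  then have "push (opcat \<A>) \<C> g (cls (opcat \<A>) \<C> (dch ds)) = cls (opcat \<A>) \<C> (dch cs)"
    using op.push_cls[of "dch ds" "dch cs" g B A' A] ch ne' by simp
  then show ?thesis
    unfolding pull_def cls_opcat[OF e ch(1) ne] cls_opcat[OF e ch(2) ne'] by (simp add: image_image)
qed

end

section \<open>The group structure on extension classes\<close>

context preadditive_category
begin

lemma biproduct_eqI':
  assumes "biproduct \<A> X Y S j1 j2 p1 p2" "g \<in> Hom \<A> T S" "h \<in> Hom \<A> T S"
    "p1 \<cdot> g = p1 \<cdot> h" "p2 \<cdot> g = p2 \<cdot> h"
  shows "g = h"
proof -
  interpret op: preadditive_category "opcat \<A>"
    by (rule preadditive_category_opcat) unfold_locales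
  show ?thesis
    using op.biproduct_eqI[of X Y S p1 p2 j1 j2 g T h] assms by simp
qed

text \<open>The direct sum of two arrows, bracketed exactly as in \<open>seq_baer_sum\<close>, so
  that sums of chains match the sequences there literally.\<close>

lemma biproduct_map:
  assumes S: "biproduct \<A> X Y S j1 j2 p1 p2" and S': "biproduct \<A> X' Y' S' k1 k2 q1 q2"
    and f: "f \<in> Hom \<A> X X'" and g: "g \<in> Hom \<A> Y Y'"
  defines "m \<equiv> k1 \<cdot> (f \<cdot> p1) \<boxplus> k2 \<cdot> (g \<cdot> p2)"
  shows "m \<in> Hom \<A> S S'" "m \<cdot> j1 = k1 \<cdot> f" "m \<cdot> j2 = k2 \<cdot> g" "q1 \<cdot> m = f \<cdot> p1" "q2 \<cdot> m = g \<cdot> p2"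
proof -
  note b = biproductD[OF S] biproductD[OF S']
  note t = biproductD(1-4)[OF S, unfolded hom_iff] biproductD(1-4)[OF S', unfolded hom_iff]
    f[unfolded hom_iff] g[unfolded hom_iff]
  have o: "X \<in> Obj \<A>" "Y \<in> Obj \<A>" "X' \<in> Obj \<A>" "Y' \<in> Obj \<A>" "S \<in> Obj \<A>" "S' \<in> Obj \<A>"
    using hom_obj f g b(1) b(10) by blast+
  show "m \<in> Hom \<A> S S'" using t by (simp add: m_def hom_iff)
  show "m \<cdot> j1 = k1 \<cdot> f" "m \<cdot> j2 = k2 \<cdot> g"
    unfolding m_def using t o b(5-8) by simp_all
  show "q1 \<cdot> m = f \<cdot> p1" "q2 \<cdot> m = g \<cdot> p2"
    unfolding m_def using t o by (simp_all add: biproduct_collapse[OF S'])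
qed

end

context abelian_category
begin

lemma ses_biproduct:
  assumes S: "biproduct \<A> X Y S j1 j2 p1 p2"
  shows "ses X S Y j1 p2"
proof -
  note b = biproductD[OF S] and t = biproductD(1-4)[OF S, unfolded hom_iff]
  have o: "X \<in> Obj \<A>" "Y \<in> Obj \<A>" "S \<in> Obj \<A>" using b(1,2) hom_obj by blast+
  show ?thesis
  proof (rule sesI_mono[OF _ b(1) _ b(4,7)])
    show "is_mono \<A> j1"
    proof (rule monoI_zero)
      fix t
      assume u: "t \<in> Arr \<A>" "Cod \<A> t = Dom \<A> j1" "j1 \<cdot> t = Zero \<A> (Dom \<A> t) (Cod \<A> j1)"
      have "t = p1 \<cdot> (j1 \<cdot> t)" using biproduct_collapse(1)[OF S u(1)] u(2) t by simp
      then show "t = Zero \<A> (Dom \<A> t) (Dom \<A> j1)" unfolding u(3) using t u(1) by simp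
    qed (use t in simp)
    show "is_epi \<A> p2"
    proof (rule epiI_zero)
      fix t
      assume u: "t \<in> Arr \<A>" "Dom \<A> t = Cod \<A> p2" "t \<cdot> p2 = Zero \<A> (Dom \<A> p2) (Cod \<A> t)"
      have "t = (t \<cdot> p2) \<cdot> j2" using u(1,2) t b(6) o by simp
      then show "t = Zero \<A> (Cod \<A> p2) (Cod \<A> t)" unfolding u(3) using t u(1) by simp
    qed (use t in simp)
    fix g T
    assume g: "g \<in> Hom \<A> S T" "g \<cdot> j1 = Zero \<A> X T"
    note tg = g(1)[unfolded hom_iff]
    have oT: "T \<in> Obj \<A>" using g(1) hom_obj by blast
    have "(g \<cdot> j2) \<cdot> p2 = g"
    proof (rule biproduct_eqI[OF S _ g(1)])
      show "((g \<cdot> j2) \<cdot> p2) \<cdot> j1 = g \<cdot> j1" using g tg t b(7) o oT by simp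
      show "((g \<cdot> j2) \<cdot> p2) \<cdot> j2 = g \<cdot> j2" using tg t b(6) o by simp
    qed (use tg t in \<open>simp add: hom_iff\<close>)
    then show "\<exists>h\<in>Hom \<A> Y T. h \<cdot> p2 = g" using tg t by (intro bexI[of _ "g \<cdot> j2"]) (simp_all add: hom_iff)
  qed
qed

lemma ses_sum:
  assumes D: "ses B X A i p" and D': "ses B' X' A' i' p'"
    and S: "biproduct \<A> B B' S j1 j2 p1 p2" and T: "biproduct \<A> X X' T k1 k2 q1 q2"
    and U: "biproduct \<A> A A' U l1 l2 r1 r2"
  shows "ses S T U (k1 \<cdot> (i \<cdot> p1) \<boxplus> k2 \<cdot> (i' \<cdot> p2)) (l1 \<cdot> (p \<cdot> q1) \<boxplus> l2 \<cdot> (p' \<cdot> q2))"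
proof -
  note d = sesD[OF D] and d' = sesD[OF D']
  define m where "m = k1 \<cdot> (i \<cdot> p1) \<boxplus> k2 \<cdot> (i' \<cdot> p2)"
  define w where "w = l1 \<cdot> (p \<cdot> q1) \<boxplus> l2 \<cdot> (p' \<cdot> q2)"
  note m = biproduct_map[OF S T d(1) d'(1), folded m_def]
  note w = biproduct_map[OF T U d(2) d'(2), folded w_def]
  note t = biproductD(1-4)[OF S, unfolded hom_iff] biproductD(1-4)[OF T, unfolded hom_iff]
    biproductD(1-4)[OF U, unfolded hom_iff] d(1,2)[unfolded hom_iff] d'(1,2)[unfolded hom_iff]
    m(1)[unfolded hom_iff] w(1)[unfolded hom_iff]
  have o: "B \<in> Obj \<A>" "X \<in> Obj \<A>" "A \<in> Obj \<A>" "B' \<in> Obj \<A>" "X' \<in> Obj \<A>" "A' \<in> Obj \<A>"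
    "S \<in> Obj \<A>" "T \<in> Obj \<A>" "U \<in> Obj \<A>"
    using hom_obj d(1,2) d'(1,2) m(1) w(1) by blast+
  have "ses S T U m w"
  proof (rule sesI_mono[OF _ m(1) _ w(1)])
    show "is_mono \<A> m"
    proof (rule monoI_zero)
      fix x
      assume u: "x \<in> Arr \<A>" "Cod \<A> x = Dom \<A> m" "m \<cdot> x = Zero \<A> (Dom \<A> x) (Cod \<A> m)"
      have "i \<cdot> (p1 \<cdot> x) = (q1 \<cdot> m) \<cdot> x" unfolding m(4) using u(1,2) t by simp
      also have "\<dots> = q1 \<cdot> (m \<cdot> x)" using u(1,2) t by simp
      also have "\<dots> = Zero \<A> (Dom \<A> x) X" unfolding u(3) using u(1) t by simp
      finally have 1: "p1 \<cdot> x = Zero \<A> (Dom \<A> x) B"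
        using mono_cancel_zero[OF d(3,1), of "p1 \<cdot> x" "Dom \<A> x"] u(1,2) t by (simp add: hom_iff)
      have "i' \<cdot> (p2 \<cdot> x) = (q2 \<cdot> m) \<cdot> x" unfolding m(5) using u(1,2) t by simp
      also have "\<dots> = q2 \<cdot> (m \<cdot> x)" using u(1,2) t by simp
      also have "\<dots> = Zero \<A> (Dom \<A> x) X'" unfolding u(3) using u(1) t by simp
      finally have 2: "p2 \<cdot> x = Zero \<A> (Dom \<A> x) B'"
        using mono_cancel_zero[OF d'(3,1), of "p2 \<cdot> x" "Dom \<A> x"] u(1,2) t by (simp add: hom_iff)
      show "x = Zero \<A> (Dom \<A> x) (Dom \<A> m)"
        by (rule biproduct_eqI'[OF S]) (use 1 2 u(1,2) t o in \<open>simp_all add: hom_iff\<close>)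
    qed (use t in simp)
    show "w \<cdot> m = Zero \<A> S U"
    proof (rule biproduct_eqI[OF S])
      have "(w \<cdot> m) \<cdot> j1 = w \<cdot> (k1 \<cdot> i)" using m(2) t by simp
      also have "\<dots> = (w \<cdot> k1) \<cdot> i" using t by simp
      also have "\<dots> = l1 \<cdot> (p \<cdot> i)" unfolding w(2) using t by simp
      finally show "(w \<cdot> m) \<cdot> j1 = Zero \<A> S U \<cdot> j1" unfolding d(5) using t o by simp
      have "(w \<cdot> m) \<cdot> j2 = w \<cdot> (k2 \<cdot> i')" using m(3) t by simp
      also have "\<dots> = (w \<cdot> k2) \<cdot> i'" using t by simp
      also have "\<dots> = l2 \<cdot> (p' \<cdot> i')" unfolding w(3) using t by simp
      finally show "(w \<cdot> m) \<cdot> j2 = Zero \<A> S U \<cdot> j2" unfolding d'(5) using t o by simp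
    qed (use t o in \<open>simp_all add: hom_iff\<close>)
    show "is_epi \<A> w"
    proof (rule epiI_zero)
      fix x
      assume u: "x \<in> Arr \<A>" "Dom \<A> x = Cod \<A> w" "x \<cdot> w = Zero \<A> (Dom \<A> w) (Cod \<A> x)"
      note oc = cod_obj[OF u(1)]
      have "(x \<cdot> l1) \<cdot> p = x \<cdot> (w \<cdot> k1)" unfolding w(2) using u(1,2) t by simp
      also have "\<dots> = (x \<cdot> w) \<cdot> k1" using u(1,2) t by simp
      also have "\<dots> = Zero \<A> X (Cod \<A> x)" unfolding u(3) using u(1) t by simp
      finally have 1: "x \<cdot> l1 = Zero \<A> A (Cod \<A> x)"
        using epi_cancel_zero[OF d(4,2), of "x \<cdot> l1" "Cod \<A> x"] u(1,2) t by (simp add: hom_iff)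
      have "(x \<cdot> l2) \<cdot> p' = x \<cdot> (w \<cdot> k2)" unfolding w(3) using u(1,2) t by simp
      also have "\<dots> = (x \<cdot> w) \<cdot> k2" using u(1,2) t by simp
      also have "\<dots> = Zero \<A> X' (Cod \<A> x)" unfolding u(3) using u(1) t by simp
      finally have 2: "x \<cdot> l2 = Zero \<A> A' (Cod \<A> x)"
        using epi_cancel_zero[OF d'(4,2), of "x \<cdot> l2" "Cod \<A> x"] u(1,2) t by (simp add: hom_iff)
      show "x = Zero \<A> (Cod \<A> w) (Cod \<A> x)"
        by (rule biproduct_eqI[OF U]) (use 1 2 u(1,2) t o in \<open>simp_all add: hom_iff\<close>)
    qed (use t in simp)
    fix g V
    assume g: "g \<in> Hom \<A> T V" "g \<cdot> m = Zero \<A> S V"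
    note tg = g(1)[unfolded hom_iff]
    have oV: "V \<in> Obj \<A>" using g(1) hom_obj by blast
    have "(g \<cdot> k1) \<cdot> i = g \<cdot> (m \<cdot> j1)" unfolding m(2) using tg t by simp
    also have "\<dots> = (g \<cdot> m) \<cdot> j1" using tg t by simp
    also have "\<dots> = Zero \<A> B V" unfolding g(2) using t oV by simp
    finally obtain h1 where h1: "h1 \<in> Hom \<A> A V" "h1 \<cdot> p = g \<cdot> k1"
      using ses_desc[OF D, of "g \<cdot> k1" V] tg t by (auto simp: hom_iff)
    have "(g \<cdot> k2) \<cdot> i' = g \<cdot> (m \<cdot> j2)" unfolding m(3) using tg t by simp
    also have "\<dots> = (g \<cdot> m) \<cdot> j2" using tg t by simp
    also have "\<dots> = Zero \<A> B' V" unfolding g(2) using t oV by simp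
    finally obtain h2 where h2: "h2 \<in> Hom \<A> A' V" "h2 \<cdot> p' = g \<cdot> k2"
      using ses_desc[OF D', of "g \<cdot> k2" V] tg t by (auto simp: hom_iff)
    note th = h1(1)[unfolded hom_iff] h2(1)[unfolded hom_iff]
    define h where "h = h1 \<cdot> r1 \<boxplus> h2 \<cdot> r2"
    have h: "h \<in> Hom \<A> U V" using th t by (simp add: h_def hom_iff)
    note tt = h[unfolded hom_iff]
    have hl: "h \<cdot> l1 = h1" "h \<cdot> l2 = h2"
      unfolding h_def using th t o biproductD(5-8)[OF U] by simp_all
    have "h \<cdot> w = g"
    proof (rule biproduct_eqI[OF T _ g(1)])
      have "(h \<cdot> w) \<cdot> k1 = h \<cdot> (l1 \<cdot> p)" using w(2) tt t by simp
      also have "\<dots> = (h \<cdot> l1) \<cdot> p" using tt t by simp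
      finally show "(h \<cdot> w) \<cdot> k1 = g \<cdot> k1" using hl h1 by simp
      have "(h \<cdot> w) \<cdot> k2 = h \<cdot> (l2 \<cdot> p')" using w(3) tt t by simp
      also have "\<dots> = (h \<cdot> l2) \<cdot> p'" using tt t by simp
      finally show "(h \<cdot> w) \<cdot> k2 = g \<cdot> k2" using hl h2 by simp
    qed (use tt t in \<open>simp add: hom_iff\<close>)
    then show "\<exists>h\<in>Hom \<A> U V. h \<cdot> w = g" using h by blast
  qed
  then show ?thesis by (simp add: m_def w_def)
qed

end

context extension_closed_subcategory
begin

lemma biproduct_in_C:
  "\<lbrakk>biproduct \<A> X Y S j1 j2 p1 p2; X \<in> \<C>; Y \<in> \<C>\<rbrakk> \<Longrightarrow> S \<in> \<C>"
  using ses_conflation(2)[OF ses_biproduct] by blast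

lemma conflation_sum:
  assumes d: "conflation \<A> \<C> i p" and d': "conflation \<A> \<C> i' p'"
    and S: "biproduct \<A> (Dom \<A> i) (Dom \<A> i') S j1 j2 p1 p2"
    and T: "biproduct \<A> (Cod \<A> i) (Cod \<A> i') T k1 k2 q1 q2"
    and U: "biproduct \<A> (Cod \<A> p) (Cod \<A> p') U l1 l2 r1 r2"
  defines "e \<equiv> (k1 \<cdot> (i \<cdot> p1) \<boxplus> k2 \<cdot> (i' \<cdot> p2), l1 \<cdot> (p \<cdot> q1) \<boxplus> l2 \<cdot> (p' \<cdot> q2))"
  shows "conflation \<A> \<C> (fst e) (snd e)" "fst e \<in> Hom \<A> S T" "snd e \<in> Hom \<A> T U"
    "cmor \<A> (i, p) e j1 l1" "cmor \<A> (i', p') e j2 l2" "cmor \<A> e (i, p) p1 r1" "cmor \<A> e (i', p') p2 r2"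
proof -
  note s = conflation_ses[OF d] conflation_ses[OF d'] and cd = conflationD[OF d] conflationD[OF d']
  note E = ses_sum[OF s S T U]
  have C: "S \<in> \<C>" "U \<in> \<C>" using biproduct_in_C[OF S] biproduct_in_C[OF U] cd by simp_all
  show "conflation \<A> \<C> (fst e) (snd e)" using ses_conflation(1)[OF E C] by (simp add: e_def)
  show e: "fst e \<in> Hom \<A> S T" "snd e \<in> Hom \<A> T U" using sesD(1,2)[OF E] by (simp_all add: e_def)
  note m = biproduct_map[OF S T sesD(1)[OF s(1)] sesD(1)[OF s(2)]]
    and w = biproduct_map[OF T U sesD(2)[OF s(1)] sesD(2)[OF s(2)]]
  note t = biproductD(1-4)[OF S] biproductD(1-4)[OF T] biproductD(1-4)[OF U]
  have h: "Dom \<A> (fst e) = S" "Cod \<A> (fst e) = T" "Dom \<A> (snd e) = T" "Cod \<A> (snd e) = U"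
    using e by (simp_all add: hom_iff)
  show "cmor \<A> (i, p) e j1 l1"
    unfolding cmor_def by (rule exI[of _ k1]) (use t h m w in \<open>simp add: e_def\<close>)
  show "cmor \<A> (i', p') e j2 l2"
    unfolding cmor_def by (rule exI[of _ k2]) (use t h m w in \<open>simp add: e_def\<close>)
  show "cmor \<A> e (i, p) p1 r1"
    unfolding cmor_def by (rule exI[of _ q1]) (use t h m w in \<open>simp add: e_def\<close>)
  show "cmor \<A> e (i', p') p2 r2"
    unfolding cmor_def by (rule exI[of _ q2]) (use t h m w in \<open>simp add: e_def\<close>)
qed

text \<open>The biproducts of the terms are prescribed, as they are in \<open>seq_baer_sum\<close>.
  The splicing objects are not terms, so their biproducts are chosen in the course of the induction.
  The four ladders record that the result is a direct sum.\<close>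

lemma chain_sum:
  assumes "chain \<A> \<C> cs B A" "chain \<A> \<C> ds B' A'" "cs \<noteq> []" "length ds = length cs"
    and "\<And>k. k \<le> length cs \<Longrightarrow> biproduct \<A> (Dom \<A> (seqof \<A> cs ! k)) (Dom \<A> (seqof \<A> ds ! k))
      (S k) (j1 k) (j2 k) (p1 k) (p2 k)"
    and "biproduct \<A> A A' (S (Suc (length cs))) (j1 (Suc (length cs))) (j2 (Suc (length cs)))
      (p1 (Suc (length cs))) (p2 (Suc (length cs)))"
  shows "\<exists>es. chain \<A> \<C> es (S 0) (S (Suc (length cs))) \<and> length es = length cs \<and>
    seqof \<A> es = map (\<lambda>k. j1 (Suc k) \<cdot> (seqof \<A> cs ! k \<cdot> p1 k) \<boxplus> j2 (Suc k) \<cdot> (seqof \<A> ds ! k \<cdot> p2 k))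
      [0..<Suc (length cs)] \<and>
    ladder \<A> cs es (j1 0) (j1 (Suc (length cs))) \<and> ladder \<A> ds es (j2 0) (j2 (Suc (length cs))) \<and>
    ladder \<A> es cs (p1 0) (p1 (Suc (length cs))) \<and> ladder \<A> es ds (p2 0) (p2 (Suc (length cs)))"
  using assms
proof (induction cs arbitrary: ds B B' S j1 j2 p1 p2)
  case (Cons d cs)
  obtain d' ds' where ds: "ds = d' # ds'" "length ds' = length cs"
    using Cons.prems(4) by (cases ds) auto
  obtain i p where di: "d = (i, p)" by (cases d)
  obtain i' p' where di': "d' = (i', p')" by (cases d')
  have c: "conflation \<A> \<C> i p" "Dom \<A> i = B" "chain \<A> \<C> cs (Cod \<A> p) A"
    using Cons.prems(1) di by auto
  have c': "conflation \<A> \<C> i' p'" "Dom \<A> i' = B'" "chain \<A> \<C> ds' (Cod \<A> p') A'"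
    using Cons.prems(2) ds di' by auto
  note cd = conflationD[OF c(1)] conflationD[OF c'(1)]
  have d0: "seqof \<A> (d # cs) ! 0 = i" "seqof \<A> ds ! 0 = i'"
    using seqof_nth_0[of "d # cs"] seqof_nth_0[of ds] di di' ds by auto
  have S0: "biproduct \<A> (Dom \<A> i) (Dom \<A> i') (S 0) (j1 0) (j2 0) (p1 0) (p2 0)"
    using Cons.prems(5)[of 0] unfolding d0 by simp
  show ?case
  proof (cases "cs = []")
    case True
    then have ds': "ds' = []" using ds by simp
    have A: "Cod \<A> p = A" "Cod \<A> p' = A'" using c(3) c'(3) True ds' by auto
    have S1: "biproduct \<A> (Cod \<A> i) (Cod \<A> i') (S 1) (j1 1) (j2 1) (p1 1) (p2 1)"
      using Cons.prems(5)[of 1] cd True ds' ds di di' by simp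
    have S2: "biproduct \<A> (Cod \<A> p) (Cod \<A> p') (S 2) (j1 2) (j2 2) (p1 2) (p2 2)"
      using Cons.prems(6) A True by (simp add: numeral_2_eq_2)
    note E = conflation_sum[OF c(1) c'(1) S0 S1 S2]
    let ?e = "(j1 1 \<cdot> (i \<cdot> p1 0) \<boxplus> j2 1 \<cdot> (i' \<cdot> p2 0), j1 2 \<cdot> (p \<cdot> p1 1) \<boxplus> j2 2 \<cdot> (p' \<cdot> p2 1))"
    have "S 2 \<in> \<C>" using E(1,3) by (auto simp: hom_iff dest: conflationD)
    then have "chain \<A> \<C> [?e] (S 0) (S 2)" using E(1-3) by (simp add: hom_iff)
    moreover have "seqof \<A> [?e] = map (\<lambda>k. j1 (Suc k) \<cdot> (seqof \<A> (d # cs) ! k \<cdot> p1 k) \<boxplus>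
        j2 (Suc k) \<cdot> (seqof \<A> ds ! k \<cdot> p2 k)) [0..<Suc (length (d # cs))]"
      using True ds' ds di di' by (simp add: numeral_2_eq_2)
    ultimately show ?thesis
      using E(4-7) True ds' ds di di'
      by (intro exI[of _ "[?e]"]) (simp add: numeral_2_eq_2)
  next
    case False
    then have ne': "ds' \<noteq> []" using ds by auto
    note nth = seqof_nth_Suc_Suc[OF False, of _ d] seqof_nth_Suc_Suc[OF ne', of _ d']
    define j j' where "j = fst (hd cs)" and "j' = fst (hd ds')"
    have jj: "seqof \<A> cs ! 0 = j" "seqof \<A> ds' ! 0 = j'" "hd (seqof \<A> cs) = j" "hd (seqof \<A> ds') = j'"
      using seqof_nth_0 False ne' by (simp_all add: j_def j'_def)
    note ty = seqof_types[OF c(3) False] and ty' = seqof_types[OF c'(3) ne']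
    have tj: "j \<in> Arr \<A>" "Dom \<A> j = Cod \<A> p" "Cod \<A> j = Dom \<A> (seqof \<A> cs ! 1)"
      "j' \<in> Arr \<A>" "Dom \<A> j' = Cod \<A> p'" "Cod \<A> j' = Dom \<A> (seqof \<A> ds' ! 1)"
      using ty(1)[of 0] ty(2)[of 0] ty(3) ty'(1)[of 0] ty'(2)[of 0] ty'(3) jj False ne' by simp_all
    have q1: "seqof \<A> (d # cs) ! 1 = j \<cdot> p" "seqof \<A> ds ! 1 = j' \<cdot> p'"
      using False ne' jj ds di di' by (simp_all add: j_def j'_def)
    have S1: "biproduct \<A> (Cod \<A> i) (Cod \<A> i') (S 1) (j1 1) (j2 1) (p1 1) (p2 1)"
      using Cons.prems(5)[of 1] unfolding q1 using cd tj False by simp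
    obtain T k1 k2 q1' q2' where T: "biproduct \<A> (Cod \<A> p) (Cod \<A> p') T k1 k2 q1' q2'"
      using sub_biproduct cd by meson
    note E = conflation_sum[OF c(1) c'(1) S0 S1 T]
    define e where "e = (j1 1 \<cdot> (i \<cdot> p1 0) \<boxplus> j2 1 \<cdot> (i' \<cdot> p2 0), k1 \<cdot> (p \<cdot> p1 1) \<boxplus> k2 \<cdot> (p' \<cdot> p2 1))"
    \<comment> \<open>The sequence of the tail starts at the splicing object. Its index 0 thus
      belongs to \<open>T\<close>, and every later index \<open>k\<close> to the given biproduct at
      \<open>k + 1\<close>.\<close>
    define shift where "shift = (\<lambda>(x::'a) (f::nat \<Rightarrow> 'a) k. if k = 0 then x else f (Suc k))"
    define S' where "S' = (\<lambda>k. if k = 0 then T else S (Suc k))"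
    have b1: "biproduct \<A> (Dom \<A> (seqof \<A> cs ! k)) (Dom \<A> (seqof \<A> ds' ! k))
      (S' k) (shift k1 j1 k) (shift k2 j2 k) (shift q1' p1 k) (shift q2' p2 k)" if k: "k \<le> length cs" for k
    proof (cases k)
      case 0
      then show ?thesis using T jj tj by (simp add: S'_def shift_def)
    next
      case (Suc m)
      then show ?thesis using Cons.prems(5)[of "Suc k"] k nth[of m] ds by (simp add: S'_def shift_def)
    qed
    have b2: "biproduct \<A> A A' (S' (Suc (length cs))) (shift k1 j1 (Suc (length cs)))
      (shift k2 j2 (Suc (length cs))) (shift q1' p1 (Suc (length cs))) (shift q2' p2 (Suc (length cs)))"
      using Cons.prems(6) by (simp add: S'_def shift_def)
    obtain es where es: "chain \<A> \<C> es T (S (Suc (Suc (length cs))))" "length es = length cs"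
      "seqof \<A> es = map (\<lambda>k. shift k1 j1 (Suc k) \<cdot> (seqof \<A> cs ! k \<cdot> shift q1' p1 k) \<boxplus>
        shift k2 j2 (Suc k) \<cdot> (seqof \<A> ds' ! k \<cdot> shift q2' p2 k)) [0..<Suc (length cs)]"
      "ladder \<A> cs es k1 (j1 (Suc (Suc (length cs))))" "ladder \<A> ds' es k2 (j2 (Suc (Suc (length cs))))"
      "ladder \<A> es cs q1' (p1 (Suc (Suc (length cs))))" "ladder \<A> es ds' q2' (p2 (Suc (Suc (length cs))))"
      using Cons.IH[OF c(3) c'(3) False ds(2) b1 b2] by (auto simp: S'_def shift_def)
    have nees: "es \<noteq> []" using es(2) False by auto
    have ch: "chain \<A> \<C> (e # es) (S 0) (S (Suc (Suc (length cs))))"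
      using E(1-3) es(1) by (simp add: e_def hom_iff)
    have hdes: "hd (seqof \<A> es) = j1 2 \<cdot> (j \<cdot> q1') \<boxplus> j2 2 \<cdot> (j' \<cdot> q2')"
      unfolding es(3) using jj by (simp add: shift_def hd_map numeral_2_eq_2 del: upt_Suc)
    have S2: "biproduct \<A> (Cod \<A> j) (Cod \<A> j') (S 2) (j1 2) (j2 2) (p1 2) (p2 2)"
    proof -
      have "1 \<le> length cs" using False by (cases cs) auto
      then show ?thesis using b1[of 1] tj by (simp add: S'_def shift_def numeral_2_eq_2)
    qed
    note t = biproductD(1-4)[OF S1, unfolded hom_iff] biproductD(1-4)[OF T, unfolded hom_iff]
      biproductD(1-4)[OF S2, unfolded hom_iff]
    have oo: "Cod \<A> p \<in> Obj \<A>" "Cod \<A> p' \<in> Obj \<A>" "S 1 \<in> Obj \<A>" "S 2 \<in> Obj \<A>"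
      using cd hom_obj[OF biproductD(1)[OF S1]] hom_obj[OF biproductD(1)[OF S2]] by simp_all
    \<comment> \<open>The injections and projections of \<open>T\<close> cancel, so the splice of
      the direct sums is the direct sum of the splices and no trace of \<open>T\<close>
      remains.\<close>
    have hd2: "hd (seqof \<A> es) \<cdot> snd e = j1 2 \<cdot> ((j \<cdot> p) \<cdot> p1 1) \<boxplus> j2 2 \<cdot> ((j' \<cdot> p') \<cdot> p2 1)"
      unfolding hdes e_def snd_conv using t tj cd oo
      by (simp add: biproduct_collapse[OF T])
    have "seqof \<A> (e # es) = map (\<lambda>k. j1 (Suc k) \<cdot> (seqof \<A> (d # cs) ! k \<cdot> p1 k) \<boxplus>
        j2 (Suc k) \<cdot> (seqof \<A> ds ! k \<cdot> p2 k)) [0..<Suc (length (d # cs))]"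
    proof (rule nth_equalityI)
      show "length (seqof \<A> (e # es)) = length (map (\<lambda>k. j1 (Suc k) \<cdot> (seqof \<A> (d # cs) ! k \<cdot> p1 k) \<boxplus>
        j2 (Suc k) \<cdot> (seqof \<A> ds ! k \<cdot> p2 k)) [0..<Suc (length (d # cs))])"
        using length_seqof[of "e # es" \<A>] es(2) by (simp del: seqof_simps)
      fix k
      assume "k < length (seqof \<A> (e # es))"
      then have k: "k < Suc (Suc (length cs))"
        using length_seqof[of "e # es" \<A>] es(2) by (simp del: seqof_simps)
      consider "k = 0" | "k = 1" | m where "k = Suc (Suc m)" by (metis One_nat_def not0_implies_Suc)
      then have "seqof \<A> (e # es) ! k = j1 (Suc k) \<cdot> (seqof \<A> (d # cs) ! k \<cdot> p1 k) \<boxplus>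
        j2 (Suc k) \<cdot> (seqof \<A> ds ! k \<cdot> p2 k)"
      proof cases
        case 1
        then show ?thesis using d0 seqof_nth_0[of "e # es"] by (simp add: e_def del: seqof_simps)
      next
        case 2
        have "seqof \<A> (e # es) ! 1 = hd (seqof \<A> es) \<cdot> snd e" using nees by simp
        then show ?thesis using 2 hd2 q1 by (simp add: numeral_2_eq_2 del: seqof_simps)
      next
        case (3 m)
        have "seqof \<A> (e # es) ! k = seqof \<A> es ! Suc m"
          using seqof_nth_Suc_Suc[OF nees, of m e] 3 k es(2) by simp
        also have "\<dots> = j1 (Suc k) \<cdot> (seqof \<A> cs ! Suc m \<cdot> p1 k) \<boxplus> j2 (Suc k) \<cdot> (seqof \<A> ds' ! Suc m \<cdot> p2 k)"
          unfolding es(3) using 3 k by (simp add: shift_def del: upt_Suc)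
        finally show ?thesis using nth[of m] 3 k ds by simp
      qed
      moreover have "map (\<lambda>k. j1 (Suc k) \<cdot> (seqof \<A> (d # cs) ! k \<cdot> p1 k) \<boxplus>
        j2 (Suc k) \<cdot> (seqof \<A> ds ! k \<cdot> p2 k)) [0..<Suc (length (d # cs))] ! k
        = j1 (Suc k) \<cdot> (seqof \<A> (d # cs) ! k \<cdot> p1 k) \<boxplus> j2 (Suc k) \<cdot> (seqof \<A> ds ! k \<cdot> p2 k)"
        using k nth_map_upt[of k "Suc (length (d # cs))" 0] by (simp del: upt_Suc seqof_simps)
      ultimately show "seqof \<A> (e # es) ! k = map (\<lambda>k. j1 (Suc k) \<cdot> (seqof \<A> (d # cs) ! k \<cdot> p1 k) \<boxplus>
        j2 (Suc k) \<cdot> (seqof \<A> ds ! k \<cdot> p2 k)) [0..<Suc (length (d # cs))] ! k" by simp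
    qed
    then show ?thesis
      using ch es E(4-7)[folded e_def] di di' ds
      by (intro exI[of _ "e # es"]) (auto simp del: seqof_simps upt_Suc)
  qed
qed simp

text \<open>Besides the biproducts at the two ends, this is what the arguments on Baer sums use of a
  direct sum of chains; its middle terms do not enter.\<close>

definition is_sum :: "('a \<times> 'a) list \<Rightarrow> ('a \<times> 'a) list \<Rightarrow> ('a \<times> 'a) list \<Rightarrow>
    'a \<Rightarrow> 'a \<Rightarrow> 'a \<Rightarrow> 'a \<Rightarrow> 'a \<Rightarrow> 'a \<Rightarrow> 'a \<Rightarrow> 'a \<Rightarrow> bool" where
  "is_sum cs ds es j1 j2 p1 p2 k1 k2 q1 q2 \<longleftrightarrow>
     ladder \<A> cs es j1 k1 \<and> ladder \<A> ds es j2 k2 \<and> ladder \<A> es cs p1 q1 \<and> ladder \<A> es ds p2 q2"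

lemma biproduct_family:
  assumes "chain \<A> \<C> cs B A" "chain \<A> \<C> ds B' A'" "cs \<noteq> []" "length ds = length cs"
  obtains S j1 j2 p1 p2 where
    "\<forall>k\<le>length cs. biproduct \<A> (Dom \<A> (seqof \<A> cs ! k)) (Dom \<A> (seqof \<A> ds ! k))
      (S k) (j1 k) (j2 k) (p1 k) (p2 k)"
    "biproduct \<A> A A' (S (Suc (length cs))) (j1 (Suc (length cs))) (j2 (Suc (length cs)))
      (p1 (Suc (length cs))) (p2 (Suc (length cs)))"
proof -
  have "ds \<noteq> []" using assms(3,4) by auto
  note t = seqof_types[OF assms(1,3)] seqof_types[OF assms(2) this]
  have C: "A \<in> Obj \<A>" "A' \<in> Obj \<A>" using chain_ends[OF assms(1)] chain_ends[OF assms(2)] C_obj by auto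
  define X Y where "X = (\<lambda>k. if k \<le> length cs then Dom \<A> (seqof \<A> cs ! k) else A)"
    and "Y = (\<lambda>k. if k \<le> length cs then Dom \<A> (seqof \<A> ds ! k) else A')"
  have "X k \<in> Obj \<A>" "Y k \<in> Obj \<A>" for k
    using t(1,5) C assms(4) by (auto simp: X_def Y_def)
  then have "\<forall>k. \<exists>b. case b of (S, j1, j2, p1, p2) \<Rightarrow> biproduct \<A> (X k) (Y k) S j1 j2 p1 p2"
    using ex_biproduct by (simp add: split_paired_Ex)
  then obtain b where b: "\<And>k. case b k of (S, j1, j2, p1, p2) \<Rightarrow> biproduct \<A> (X k) (Y k) S j1 j2 p1 p2"
    by metis
  define S j1 j2 p1 p2 where "S = (\<lambda>k. fst (b k))" and "j1 = (\<lambda>k. fst (snd (b k)))"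
    and "j2 = (\<lambda>k. fst (snd (snd (b k))))" and "p1 = (\<lambda>k. fst (snd (snd (snd (b k)))))"
    and "p2 = (\<lambda>k. snd (snd (snd (snd (b k)))))"
  have B: "biproduct \<A> (X k) (Y k) (S k) (j1 k) (j2 k) (p1 k) (p2 k)" for k
    using b[of k] by (simp add: S_def j1_def j2_def p1_def p2_def case_prod_unfold)
  have 1: "biproduct \<A> (Dom \<A> (seqof \<A> cs ! k)) (Dom \<A> (seqof \<A> ds ! k))
      (S k) (j1 k) (j2 k) (p1 k) (p2 k)" if "k \<le> length cs" for k
    using B[of k] that by (simp add: X_def Y_def)
  have 2: "biproduct \<A> A A' (S (Suc (length cs))) (j1 (Suc (length cs))) (j2 (Suc (length cs)))
      (p1 (Suc (length cs))) (p2 (Suc (length cs)))"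
    using B[of "Suc (length cs)"] by (simp add: X_def Y_def)
  show ?thesis using that[of S j1 j2 p1 p2] 1 2 by blast
qed

lemma chain_sum_exists:
  assumes "chain \<A> \<C> cs B A" "chain \<A> \<C> ds B' A'" "cs \<noteq> []" "length ds = length cs"
  obtains es S j1 j2 p1 p2 T k1 k2 q1 q2 where "biproduct \<A> B B' S j1 j2 p1 p2"
    "biproduct \<A> A A' T k1 k2 q1 q2" "chain \<A> \<C> es S T" "length es = length cs"
    "is_sum cs ds es j1 j2 p1 p2 k1 k2 q1 q2"
proof -
  obtain S j1 j2 p1 p2 where f: "\<forall>k\<le>length cs.
      biproduct \<A> (Dom \<A> (seqof \<A> cs ! k)) (Dom \<A> (seqof \<A> ds ! k)) (S k) (j1 k) (j2 k) (p1 k) (p2 k)"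
    and 2: "biproduct \<A> A A' (S (Suc (length cs))) (j1 (Suc (length cs))) (j2 (Suc (length cs)))
      (p1 (Suc (length cs))) (p2 (Suc (length cs)))"
    by (rule biproduct_family[OF assms])
  note 1 = f[rule_format]
  have "ds \<noteq> []" using assms(3,4) by auto
  note t = seqof_types[OF assms(1,3)] seqof_types[OF assms(2) this]
  have 3: "biproduct \<A> B B' (S 0) (j1 0) (j2 0) (p1 0) (p2 0)" using 1[of 0] t by simp
  obtain es where "chain \<A> \<C> es (S 0) (S (Suc (length cs)))" "length es = length cs"
    "is_sum cs ds es (j1 0) (j2 0) (p1 0) (p2 0) (j1 (Suc (length cs))) (j2 (Suc (length cs)))
      (p1 (Suc (length cs))) (p2 (Suc (length cs)))"
    using chain_sum[OF assms 1 2] unfolding is_sum_def by blast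
  then show ?thesis using that[OF 3 2] by blast
qed

end

text \<open>Every class becomes the neutral one when pulled back along zero, whatever class is
  chosen (\<open>pull_Zero_eq\<close>). In contrast to \<open>seq_zero\<close> this treats all
  degrees alike.\<close>

definition yzero :: "('o, 'm, 'z) cat_scheme \<Rightarrow> 'o set \<Rightarrow> nat \<Rightarrow> 'o \<Rightarrow> 'o \<Rightarrow> 'm list set" where
  "yzero \<A> \<C> t A B = pull \<A> \<C> (Zero \<A> A A) (SOME x. x \<in> Yext \<A> \<C> t A B)"

text \<open>Independent of the representative by \<open>splice_cls\<close>, as \<open>push\<close>
  is by \<open>push_cls\<close>. For \<open>x\<close> a class and \<open>d\<close> a conflation this
  is the connecting map of \<open>d\<close>.\<close>

definition splice :: "('o, 'm, 'z) cat_scheme \<Rightarrow> 'o set \<Rightarrow> 'm \<times> 'm \<Rightarrow> 'm list set \<Rightarrow> 'm list set" where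
  "splice \<A> \<C> d x = (SOME y. \<exists>cs A. cs \<noteq> [] \<and> chain \<A> \<C> cs (Cod \<A> (snd d)) A \<and> x = cls \<A> \<C> cs \<and>
     y = cls \<A> \<C> (d # cs))"

context extension_closed_subcategory
begin

abbreviation YE :: "nat \<Rightarrow> 'o \<Rightarrow> 'o \<Rightarrow> 'a list set set" where
  "YE t A B \<equiv> Yext \<A> \<C> t A B"

abbreviation push_op (infixr "\<rhd>" 75) where "f \<rhd> x \<equiv> push \<A> \<C> f x"

abbreviation pull_op (infixl "\<lhd>" 75) where "x \<lhd> g \<equiv> pull \<A> \<C> g x"

abbreviation cl where "cl cs \<equiv> cls \<A> \<C> cs"

abbreviation chn where "chn cs B A \<equiv> chain \<A> \<C> cs B A"

section \<open>Functoriality of push-out and pull-back on classes\<close>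

lemma YextE:
  assumes "x \<in> YE t A B" "0 < t"
  obtains cs where "chn cs B A" "length cs = t" "cs \<noteq> []" "x = cl cs"
  using assms by (auto simp: Yext_def)

lemma YextI: "chn cs B A \<Longrightarrow> cl cs \<in> YE (length cs) A B"
  by (auto simp: Yext_def)

lemma Yext_ends:
  assumes "x \<in> YE t A B"
  shows "A \<in> \<C>" "B \<in> \<C>"
proof -
  obtain cs where "chn cs B A" using assms by (auto simp: Yext_def)
  then show "A \<in> \<C>" "B \<in> \<C>" by (simp_all add: chain_ends[of \<A> \<C> cs B A])
qed

lemma push_rep:
  assumes "chn cs B A" "cs \<noteq> []" "f \<in> Hom \<A> B B'" "B' \<in> \<C>"
  obtains ds where "chn ds B' A" "length ds = length cs" "ladder \<A> cs ds f (Id \<A> A)" "f \<rhd> cl cs = cl ds"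
proof -
  obtain ds where ds: "chn ds B' A" "length ds = length cs" "ladder \<A> cs ds f (Id \<A> A)"
    using ladder_push[OF assms] by metis
  show ?thesis by (rule that[OF ds push_cls[OF ds(3) assms(1) ds(1) assms(2)]])
qed

lemma pull_rep:
  assumes "chn cs B A" "cs \<noteq> []" "g \<in> Hom \<A> A' A" "A' \<in> \<C>"
  obtains qs where "chn qs B A'" "length qs = length cs" "ladder \<A> qs cs (Id \<A> B) g" "cl cs \<lhd> g = cl qs"
proof -
  obtain qs where qs: "chn qs B A'" "length qs = length cs" "ladder \<A> qs cs (Id \<A> B) g"
    using ladder_pull[OF assms] by metis
  then have "qs \<noteq> []" using assms(2) by auto
  show ?thesis by (rule that[OF qs pull_cls[OF qs(3,1) assms(1) \<open>qs \<noteq> []\<close>]])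
qed

lemma push_in:
  assumes "x \<in> YE t A B" "0 < t" "f \<in> Hom \<A> B B'" "B' \<in> \<C>"
  shows "f \<rhd> x \<in> YE t A B'"
proof -
  obtain cs where cs: "chn cs B A" "length cs = t" "cs \<noteq> []" "x = cl cs" by (rule YextE[OF assms(1,2)])
  obtain ds where "chn ds B' A" "length ds = length cs" "f \<rhd> cl cs = cl ds"
    by (rule push_rep[OF cs(1,3) assms(3,4)])
  then show ?thesis using YextI[of ds B' A] cs by simp
qed

lemma pull_in:
  assumes "x \<in> YE t A B" "0 < t" "g \<in> Hom \<A> A' A" "A' \<in> \<C>"
  shows "x \<lhd> g \<in> YE t A' B"
proof -
  obtain cs where cs: "chn cs B A" "length cs = t" "cs \<noteq> []" "x = cl cs" by (rule YextE[OF assms(1,2)])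
  obtain ds where "chn ds B A'" "length ds = length cs" "cl cs \<lhd> g = cl ds"
    by (rule pull_rep[OF cs(1,3) assms(3,4)])
  then show ?thesis using YextI[of ds B A'] cs by simp
qed

lemma push_comp:
  assumes "x \<in> YE t A B" "0 < t" "f \<in> Hom \<A> B B'" "B' \<in> \<C>" "g \<in> Hom \<A> B' B''" "B'' \<in> \<C>"
  shows "g \<rhd> f \<rhd> x = (g \<cdot> f) \<rhd> x"
proof -
  obtain cs where cs: "chn cs B A" "length cs = t" "cs \<noteq> []" "x = cl cs" by (rule YextE[OF assms(1,2)])
  obtain ds where ds: "chn ds B' A" "length ds = length cs" "ladder \<A> cs ds f (Id \<A> A)" "f \<rhd> cl cs = cl ds"
    by (rule push_rep[OF cs(1,3) assms(3,4)])
  have "ds \<noteq> []" using ds(2) cs(3) by auto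
  then obtain es where es: "chn es B'' A" "ladder \<A> ds es g (Id \<A> A)" "g \<rhd> cl ds = cl es"
    using push_rep[OF ds(1) _ assms(5,6)] by metis
  have "ladder \<A> cs es (g \<cdot> f) (Id \<A> A)"
    using ladder_comp[OF ds(3) es(2) cs(1) ds(1) es(1)] C_obj[OF chain_ends(2)[OF cs(1)]] by simp
  then show ?thesis using push_cls[OF _ cs(1) es(1) cs(3)] cs ds es by simp
qed

lemma pull_comp:
  assumes "x \<in> YE t A B" "0 < t" "g \<in> Hom \<A> A' A" "A' \<in> \<C>" "h \<in> Hom \<A> A'' A'" "A'' \<in> \<C>"
  shows "x \<lhd> g \<lhd> h = x \<lhd> (g \<cdot> h)"
proof -
  obtain cs where cs: "chn cs B A" "length cs = t" "cs \<noteq> []" "x = cl cs" by (rule YextE[OF assms(1,2)])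
  obtain ds where ds: "chn ds B A'" "length ds = length cs" "ladder \<A> ds cs (Id \<A> B) g" "cl cs \<lhd> g = cl ds"
    by (rule pull_rep[OF cs(1,3) assms(3,4)])
  have ne: "ds \<noteq> []" using ds(2) cs(3) by auto
  then obtain es where es: "chn es B A''" "length es = length ds" "ladder \<A> es ds (Id \<A> B) h"
    "cl ds \<lhd> h = cl es"
    using pull_rep[OF ds(1) _ assms(5,6)] by metis
  have "es \<noteq> []" using es(2) ne by auto
  moreover have "ladder \<A> es cs (Id \<A> B) (g \<cdot> h)"
    using ladder_comp[OF es(3) ds(3) es(1) ds(1) cs(1)] C_obj[OF chain_ends(1)[OF cs(1)]] by simp
  ultimately show ?thesis using pull_cls[OF _ es(1) cs(1)] cs ds es by simp
qed

lemma push_id: "\<lbrakk>x \<in> YE t A B; 0 < t\<rbrakk> \<Longrightarrow> Id \<A> B \<rhd> x = x"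
  using push_cls[OF ladder_refl] by (elim YextE) auto

lemma pull_id: "\<lbrakk>x \<in> YE t A B; 0 < t\<rbrakk> \<Longrightarrow> x \<lhd> Id \<A> A = x"
  using pull_cls[OF ladder_refl] by (elim YextE) auto

text \<open>The universal push-out and pull-back meet in the middle of any ladder, by
  \<open>ladder_cls\<close>. Most equations between classes below are obtained by exhibiting a
  ladder.\<close>

lemma ladder_push_pull:
  assumes L: "ladder \<A> cs ds a c" and ch: "chn cs B A" "chn ds B' A'" and ne: "cs \<noteq> []"
  shows "a \<rhd> cl cs = cl ds \<lhd> c"
proof -
  have ne': "ds \<noteq> []" using ladder_length[OF L] ne by auto
  note h = ladder_hom[OF L ch ne]
  note C = chain_ends[OF ch(1)] chain_ends[OF ch(2)]
  obtain ps where ps: "chn ps B' A" "ladder \<A> cs ps a (Id \<A> A)" "a \<rhd> cl cs = cl ps"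
    using push_rep[OF ch(1) ne h(1) C(3)] by metis
  obtain qs where qs: "chn qs B' A" "ladder \<A> qs ds (Id \<A> B') c" "cl ds \<lhd> c = cl qs"
    using pull_rep[OF ch(2) ne' h(2) C(2)] by metis
  show ?thesis using ladder_cls[OF L ps(2) qs(2) ch ps(1) qs(1) ne] ps qs by simp
qed

lemma push_pull:
  assumes "x \<in> YE t A B" "0 < t" "f \<in> Hom \<A> B B'" "B' \<in> \<C>" "g \<in> Hom \<A> A' A" "A' \<in> \<C>"
  shows "(f \<rhd> x) \<lhd> g = f \<rhd> (x \<lhd> g)"
proof -
  obtain cs where cs: "chn cs B A" "length cs = t" "cs \<noteq> []" "x = cl cs" by (rule YextE[OF assms(1,2)])
  obtain ds where ds: "chn ds B' A" "length ds = length cs" "ladder \<A> cs ds f (Id \<A> A)" "f \<rhd> cl cs = cl ds"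
    by (rule push_rep[OF cs(1,3) assms(3,4)])
  obtain qs where qs: "chn qs B A'" "length qs = length cs" "ladder \<A> qs cs (Id \<A> B) g" "cl cs \<lhd> g = cl qs"
    by (rule pull_rep[OF cs(1,3) assms(5,6)])
  have "qs \<noteq> []" using qs(2) cs(3) by auto
  moreover have "ladder \<A> qs ds f g"
    using ladder_comp[OF qs(3) ds(3) qs(1) cs(1) ds(1)] assms by (simp add: hom_iff)
  ultimately show ?thesis using ladder_push_pull[OF _ qs(1) ds(1)] cs ds qs by simp
qed

section \<open>The Baer sum of classes\<close>

definition sum_rel :: "('a \<times> 'a) list \<Rightarrow> ('a \<times> 'a) list \<Rightarrow> 'o \<Rightarrow> 'o \<Rightarrow> 'a list set \<Rightarrow> bool" where
  "sum_rel cs ds B A z \<longleftrightarrow> (\<exists>es S j1 j2 p1 p2 T k1 k2 q1 q2. biproduct \<A> B B S j1 j2 p1 p2 \<and>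
     biproduct \<A> A A T k1 k2 q1 q2 \<and> chn es S T \<and> length es = length cs \<and>
     is_sum cs ds es j1 j2 p1 p2 k1 k2 q1 q2 \<and> z = ((p1 \<boxplus> p2) \<rhd> cl es) \<lhd> (k1 \<boxplus> k2))"

lemma sum_rel_exists:
  assumes "chn cs B A" "chn ds B A" "cs \<noteq> []" "length ds = length cs"
  obtains z where "sum_rel cs ds B A z"
  using chain_sum_exists[OF assms] unfolding sum_rel_def by metis

text \<open>Two direct sums are linked by the ladder with ends
  \<open>j1' \<cdot> p1 \<boxplus> j2' \<cdot> p2\<close> and
  \<open>k1' \<cdot> q1 \<boxplus> k2' \<cdot> q2\<close>. These maps respect the codiagonals and
  the diagonals, so the sums coincide.\<close>

lemma sum_rel_cong:
  assumes r: "sum_rel cs ds B A z" "sum_rel cs' ds' B A z'"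
    and ch: "chn cs B A" "chn ds B A" "chn cs' B A" "chn ds' B A" and ne: "cs \<noteq> []"
    and L: "ladder \<A> cs cs' (Id \<A> B) (Id \<A> A)" "ladder \<A> ds ds' (Id \<A> B) (Id \<A> A)"
  shows "z = z'"
proof -
  obtain es S j1 j2 p1 p2 T k1 k2 q1 q2 where 1: "biproduct \<A> B B S j1 j2 p1 p2"
     "biproduct \<A> A A T k1 k2 q1 q2" "chn es S T" "length es = length cs"
     "is_sum cs ds es j1 j2 p1 p2 k1 k2 q1 q2" "z = ((p1 \<boxplus> p2) \<rhd> cl es) \<lhd> (k1 \<boxplus> k2)"
    using r(1) unfolding sum_rel_def by blast
  obtain es' S' j1' j2' p1' p2' T' k1' k2' q1' q2' where 2: "biproduct \<A> B B S' j1' j2' p1' p2'"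
     "biproduct \<A> A A T' k1' k2' q1' q2'" "chn es' S' T'" "length es' = length cs'"
     "is_sum cs' ds' es' j1' j2' p1' p2' k1' k2' q1' q2'" "z' = ((p1' \<boxplus> p2') \<rhd> cl es') \<lhd> (k1' \<boxplus> k2')"
    using r(2) unfolding sum_rel_def by blast
  note b = biproductD[OF 1(1)] biproductD[OF 1(2)] biproductD[OF 2(1)] biproductD[OF 2(2)]
  note t = biproductD(1-4)[OF 1(1), unfolded hom_iff] biproductD(1-4)[OF 1(2), unfolded hom_iff]
    biproductD(1-4)[OF 2(1), unfolded hom_iff] biproductD(1-4)[OF 2(2), unfolded hom_iff]
  note C = chain_ends[OF ch(1)] chain_ends[OF 1(3)] chain_ends[OF 2(3)]
  note O = C[THEN C_obj]
  have ne': "es \<noteq> []" "es' \<noteq> []" using 1(4) 2(4) ne ladder_length[OF L(1)] by auto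
  have s: "ladder \<A> es cs p1 q1" "ladder \<A> es ds p2 q2"
    "ladder \<A> cs' es' j1' k1'" "ladder \<A> ds' es' j2' k2'"
    using 1(5) 2(5) unfolding is_sum_def by auto
  have "ladder \<A> es cs' p1 q1" "ladder \<A> es ds' p2 q2"
    using ladder_comp[OF s(1) L(1) 1(3) ch(1,3)] ladder_comp[OF s(2) L(2) 1(3) ch(2,4)] t by simp_all
  then have "ladder \<A> es es' (j1' \<cdot> p1) (k1' \<cdot> q1)" "ladder \<A> es es' (j2' \<cdot> p2) (k2' \<cdot> q2)"
    using ladder_comp[OF _ s(3) 1(3) ch(3) 2(3)] ladder_comp[OF _ s(4) 1(3) ch(4) 2(3)] by simp_all
  then have L': "ladder \<A> es es' (j1' \<cdot> p1 \<boxplus> j2' \<cdot> p2) (k1' \<cdot> q1 \<boxplus> k2' \<cdot> q2)"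
    (is "ladder \<A> es es' ?a ?c")
    using ladder_plus[OF _ _ 1(3) 2(3)] by blast
  have nc: "(p1' \<boxplus> p2') \<cdot> ?a = p1 \<boxplus> p2"
    using t O by (simp add: biproduct_collapse[OF 2(1)])
  have cd: "?c \<cdot> (k1 \<boxplus> k2) = k1' \<boxplus> k2'"
    using t O b(14-17) by (simp add: biproduct_collapse[OF 2(2)])
  have h: "p1 \<boxplus> p2 \<in> Hom \<A> S B" "p1' \<boxplus> p2' \<in> Hom \<A> S' B" "k1 \<boxplus> k2 \<in> Hom \<A> A T"
    "?a \<in> Hom \<A> S S'" "?c \<in> Hom \<A> T T'"
    using t by (simp_all add: hom_iff)
  have e: "cl es \<in> YE (length es) T S" "cl es' \<in> YE (length es') T' S'"
    using YextI 1(3) 2(3) by blast+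
  have len: "0 < length es" "0 < length es'" using ne' by auto
  have ae: "?a \<rhd> cl es = cl es' \<lhd> ?c" by (rule ladder_push_pull[OF L' 1(3) 2(3) ne'(1)])
  have c2: "cl es' \<lhd> ?c \<in> YE (length es') T S'" by (rule pull_in[OF e(2) len(2) h(5) C(4)])
  have c3: "(p1' \<boxplus> p2') \<rhd> cl es' \<in> YE (length es') T' B" by (rule push_in[OF e(2) len(2) h(2) C(1)])
  have "z = (((p1' \<boxplus> p2') \<cdot> ?a) \<rhd> cl es) \<lhd> (k1 \<boxplus> k2)" using 1(6) nc by simp
  also have "\<dots> = ((p1' \<boxplus> p2') \<rhd> ?a \<rhd> cl es) \<lhd> (k1 \<boxplus> k2)"
    using push_comp[OF e(1) len(1) h(4) C(5) h(2) C(1)] by simp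
  also have "\<dots> = ((p1' \<boxplus> p2') \<rhd> (cl es' \<lhd> ?c)) \<lhd> (k1 \<boxplus> k2)" by (simp only: ae)
  also have "\<dots> = ((p1' \<boxplus> p2') \<rhd> cl es') \<lhd> ?c \<lhd> (k1 \<boxplus> k2)"
    using push_pull[OF e(2) len(2) h(2) C(1) h(5) C(4)] by simp
  also have "\<dots> = ((p1' \<boxplus> p2') \<rhd> cl es') \<lhd> (?c \<cdot> (k1 \<boxplus> k2))"
    by (rule pull_comp[OF c3 len(2) h(5) C(4) h(3) C(2)])
  also have "\<dots> = z'" unfolding cd 2(6) ..
  finally show ?thesis .
qed

definition yadd :: "'a list set \<Rightarrow> 'a list set \<Rightarrow> 'a list set" (infixl "\<oplus>" 65) where
  "x \<oplus> y = (SOME z. \<exists>cs ds B A. cs \<noteq> [] \<and> chn cs B A \<and> chn ds B A \<and> length ds = length cs \<and>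
     x = cl cs \<and> y = cl ds \<and> sum_rel cs ds B A z)"

text \<open>One summand is varied at a time, so that each step along a zigzag is a case of
  \<open>sum_rel_cong\<close> with an identity ladder in the other summand.\<close>

lemma sum_rel_cls:
  assumes r: "sum_rel cs ds B A z" "sum_rel cs' ds' B A z'"
    and ch: "chn cs B A" "chn ds B A" "chn cs' B A" "chn ds' B A" and ne: "cs \<noteq> []" "ds \<noteq> []"
      "cs' \<noteq> []" "ds' \<noteq> []" and len: "length ds = length cs"
    and eq: "cl cs = cl cs'" "cl ds = cl ds'"
  shows "z = z'"
proof -
  have refl: "ladder \<A> es es (Id \<A> B) (Id \<A> A)" if "chn es B A" for es
    by (rule ladder_refl[OF that])
  have len': "length cs' = length cs" "length ds' = length ds"
    using cls_eq_ends(3)[OF eq(1) ch(1,3) ne(1,3)] cls_eq_ends(3)[OF eq(2) ch(2,4) ne(2,4)] by auto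
  have 1: "\<forall>z1. sum_rel cs' ds B A z1 \<longrightarrow> z1 = z"
  proof (rule cls_invariant[OF eq(1) ch(1,3) ne(1,3)])
    show "\<forall>z1. sum_rel cs ds B A z1 \<longrightarrow> z1 = z"
      using sum_rel_cong[OF _ r(1) ch(1,2,1,2) ne(1) refl[OF ch(1)] refl[OF ch(2)]] by blast
    fix es fs
    assume E: "chn es B A" "chn fs B A" "length es = length cs" "length fs = length cs"
      "ladder \<A> es fs (Id \<A> B) (Id \<A> A)"
    have ne': "es \<noteq> []" "fs \<noteq> []" using E ne by auto
    obtain z1 z2 where z: "sum_rel es ds B A z1" "sum_rel fs ds B A z2"
      using sum_rel_exists[OF E(1) ch(2) ne'(1)] sum_rel_exists[OF E(2) ch(2) ne'(2)] E len by metis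
    have "z1' = z2'" if "sum_rel es ds B A z1'" "sum_rel fs ds B A z2'" for z1' z2'
      using sum_rel_cong[OF that E(1) ch(2) E(2) ch(2) ne'(1) E(5) refl[OF ch(2)]] .
    then show "(\<forall>z1. sum_rel es ds B A z1 \<longrightarrow> z1 = z) \<longleftrightarrow> (\<forall>z1. sum_rel fs ds B A z1 \<longrightarrow> z1 = z)"
      using z by metis
  qed
  have 2: "\<forall>z1. sum_rel cs' ds' B A z1 \<longrightarrow> z1 = z"
  proof (rule cls_invariant[OF eq(2) ch(2,4) ne(2,4)])
    show "\<forall>z1. sum_rel cs' ds B A z1 \<longrightarrow> z1 = z" by (rule 1)
    fix es fs
    assume E: "chn es B A" "chn fs B A" "length es = length ds" "length fs = length ds"
      "ladder \<A> es fs (Id \<A> B) (Id \<A> A)"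
    obtain z1 z2 where z: "sum_rel cs' es B A z1" "sum_rel cs' fs B A z2"
      using sum_rel_exists[OF ch(3) E(1) ne(3)] sum_rel_exists[OF ch(3) E(2) ne(3)] E len len' by metis
    have "z1' = z2'" if "sum_rel cs' es B A z1'" "sum_rel cs' fs B A z2'" for z1' z2'
      using sum_rel_cong[OF that ch(3) E(1) ch(3) E(2) ne(3) refl[OF ch(3)] E(5)] .
    then show "(\<forall>z1. sum_rel cs' es B A z1 \<longrightarrow> z1 = z) \<longleftrightarrow> (\<forall>z1. sum_rel cs' fs B A z1 \<longrightarrow> z1 = z)"
      using z by metis
  qed
  show ?thesis using 2 r(2) by blast
qed

lemma yadd_cls:
  assumes r: "sum_rel cs ds B A z" and ch: "chn cs B A" "chn ds B A" and ne: "cs \<noteq> []" "length ds = length cs"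
  shows "cl cs \<oplus> cl ds = z"
proof -
  have ne2: "ds \<noteq> []" using ne by auto
  have "\<exists>z cs' ds' B A. cs' \<noteq> [] \<and> chn cs' B A \<and> chn ds' B A \<and> length ds' = length cs' \<and>
     cl cs = cl cs' \<and> cl ds = cl ds' \<and> sum_rel cs' ds' B A z"
    using r ch ne by blast
  then show ?thesis
    unfolding yadd_def
  proof (rule someI2_ex)
    fix y
    assume "\<exists>cs' ds' B A. cs' \<noteq> [] \<and> chn cs' B A \<and> chn ds' B A \<and> length ds' = length cs' \<and>
     cl cs = cl cs' \<and> cl ds = cl ds' \<and> sum_rel cs' ds' B A y"
    then show "y = z"
    proof (elim exE conjE)
      fix cs' ds' B' A'
      assume 1: "cs' \<noteq> []" "chn cs' B' A'" "chn ds' B' A'" "length ds' = length cs'"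
        "cl cs = cl cs'" "cl ds = cl ds'" "sum_rel cs' ds' B' A' y"
      have ne': "ds' \<noteq> []" using 1(1,4) by auto
      have eq: "B' = B" "A' = A"
        using cls_eq_ends[OF 1(5) ch(1) 1(2) ne(1) 1(1)] by auto
      show ?thesis
        using sum_rel_cls[OF r 1(7)[unfolded eq] ch 1(2,3)[unfolded eq] ne(1) ne2 1(1) ne' ne(2) 1(5,6)]
        by simp
    qed
  qed
qed

lemma yadd_in:
  assumes "x \<in> YE t A B" "y \<in> YE t A B" "0 < t"
  shows "x \<oplus> y \<in> YE t A B"
proof -
  obtain cs where cs: "chn cs B A" "length cs = t" "cs \<noteq> []" "x = cl cs" by (rule YextE[OF assms(1,3)])
  obtain ds where ds: "chn ds B A" "length ds = t" "ds \<noteq> []" "y = cl ds" by (rule YextE[OF assms(2,3)])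
  obtain z where z: "sum_rel cs ds B A z" using sum_rel_exists cs ds by metis
  obtain es S j1 j2 p1 p2 T k1 k2 q1 q2 where 1: "biproduct \<A> B B S j1 j2 p1 p2"
     "biproduct \<A> A A T k1 k2 q1 q2" "chn es S T" "length es = length cs"
     "z = ((p1 \<boxplus> p2) \<rhd> cl es) \<lhd> (k1 \<boxplus> k2)"
    using z unfolding sum_rel_def by blast
  have "p1 \<boxplus> p2 \<in> Hom \<A> S B" "k1 \<boxplus> k2 \<in> Hom \<A> A T"
    using biproductD(1-4)[OF 1(1)] biproductD(1-4)[OF 1(2)] by (simp_all add: hom_iff)
  then have "z \<in> YE t A B"
    using pull_in[OF push_in[OF YextI[OF 1(3)], of "p1 \<boxplus> p2" B], of "k1 \<boxplus> k2" A] 1(4,5) cs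
      chain_ends[OF cs(1)] assms(3) by simp
  then show ?thesis using yadd_cls[OF z cs(1) ds(1)] cs ds by simp
qed

text \<open>The ladders from the direct sum to \<open>ds\<close> over \<open>p1\<close> and
  \<open>p2\<close> can be added. The left end of the sum is the codiagonal, so pushing out along it
  amounts to pulling \<open>ds\<close> back along
  \<open>g \<cdot> q1 \<boxplus> g' \<cdot> q2\<close>; the diagonal then leaves
  \<open>g \<boxplus> g'\<close>.\<close>

lemma pull_plus:
  assumes x: "x \<in> YE t A B" "0 < t" and g: "g \<in> Hom \<A> A' A" "g' \<in> Hom \<A> A' A" "A' \<in> \<C>"
  shows "x \<lhd> g \<oplus> x \<lhd> g' = x \<lhd> (g \<boxplus> g')"
proof -
  obtain ds where ds: "chn ds B A" "length ds = t" "ds \<noteq> []" "x = cl ds" by (rule YextE[OF x])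
  obtain qs where qs: "chn qs B A'" "length qs = length ds" "ladder \<A> qs ds (Id \<A> B) g" "cl ds \<lhd> g = cl qs"
    by (rule pull_rep[OF ds(1,3) g(1,3)])
  obtain rs where rs: "chn rs B A'" "length rs = length ds" "ladder \<A> rs ds (Id \<A> B) g'" "cl ds \<lhd> g' = cl rs"
    by (rule pull_rep[OF ds(1,3) g(2,3)])
  have ne: "qs \<noteq> []" "length rs = length qs" using qs(2) rs(2) ds(3) by auto
  obtain es S j1 j2 p1 p2 T k1 k2 q1 q2 where 1: "biproduct \<A> B B S j1 j2 p1 p2"
     "biproduct \<A> A' A' T k1 k2 q1 q2" "chn es S T" "length es = length qs"
     "is_sum qs rs es j1 j2 p1 p2 k1 k2 q1 q2"
    by (rule chain_sum_exists[OF qs(1) rs(1) ne])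
  have ne': "es \<noteq> []" using 1(4) ne by auto
  note b = biproductD[OF 1(2)]
  note t = biproductD(1-4)[OF 1(1), unfolded hom_iff] biproductD(1-4)[OF 1(2), unfolded hom_iff]
    g(1,2)[unfolded hom_iff]
  note C = chain_ends[OF ds(1)] chain_ends[OF 1(3)]
  note O = C[THEN C_obj] C_obj[OF g(3)]
  have s: "ladder \<A> es qs p1 q1" "ladder \<A> es rs p2 q2" using 1(5) unfolding is_sum_def by auto
  have "ladder \<A> es ds p1 (g \<cdot> q1)" "ladder \<A> es ds p2 (g' \<cdot> q2)"
    using ladder_comp[OF s(1) qs(3) 1(3) qs(1) ds(1)] ladder_comp[OF s(2) rs(3) 1(3) rs(1) ds(1)] t
    by simp_all
  then have L: "ladder \<A> es ds (p1 \<boxplus> p2) (g \<cdot> q1 \<boxplus> g' \<cdot> q2)" (is "ladder \<A> es ds ?a ?c")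
    using ladder_plus[OF _ _ 1(3) ds(1)] by blast
  have h: "?c \<in> Hom \<A> T A" "k1 \<boxplus> k2 \<in> Hom \<A> A' T" using t by (simp_all add: hom_iff)
  have c: "?c \<cdot> (k1 \<boxplus> k2) = g \<boxplus> g'" using t O b(5-8) by simp
  have "sum_rel qs rs B A' (((p1 \<boxplus> p2) \<rhd> cl es) \<lhd> (k1 \<boxplus> k2))"
    unfolding sum_rel_def using 1 by blast
  then have "cl qs \<oplus> cl rs = ((p1 \<boxplus> p2) \<rhd> cl es) \<lhd> (k1 \<boxplus> k2)"
    by (rule yadd_cls[OF _ qs(1) rs(1) ne])
  also have "\<dots> = cl ds \<lhd> ?c \<lhd> (k1 \<boxplus> k2)"
    by (simp only: ladder_push_pull[OF L 1(3) ds(1) ne'])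
  also have "\<dots> = cl ds \<lhd> (g \<boxplus> g')"
    using pull_comp[OF x h(1) C(4) h(2) g(3)] ds(4) c by simp
  finally show ?thesis using qs rs ds by simp
qed

text \<open>The mirror image of \<open>pull_plus\<close>, with ladders into the direct sum. It is
  argued directly, as the Baer sums of \<A> and of its opposite are not compared with each
  other.\<close>

lemma push_plus:
  assumes x: "x \<in> YE t A B" "0 < t" and f: "f \<in> Hom \<A> B B'" "f' \<in> Hom \<A> B B'" "B' \<in> \<C>"
  shows "f \<rhd> x \<oplus> f' \<rhd> x = (f \<boxplus> f') \<rhd> x"
proof -
  obtain ds where ds: "chn ds B A" "length ds = t" "ds \<noteq> []" "x = cl ds" by (rule YextE[OF x])
  obtain qs where qs: "chn qs B' A" "length qs = length ds" "ladder \<A> ds qs f (Id \<A> A)" "f \<rhd> cl ds = cl qs"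
    by (rule push_rep[OF ds(1,3) f(1,3)])
  obtain rs where rs: "chn rs B' A" "length rs = length ds" "ladder \<A> ds rs f' (Id \<A> A)" "f' \<rhd> cl ds = cl rs"
    by (rule push_rep[OF ds(1,3) f(2,3)])
  have ne: "qs \<noteq> []" "length rs = length qs" using qs(2) rs(2) ds(3) by auto
  obtain es S j1 j2 p1 p2 T k1 k2 q1 q2 where 1: "biproduct \<A> B' B' S j1 j2 p1 p2"
     "biproduct \<A> A A T k1 k2 q1 q2" "chn es S T" "length es = length qs"
     "is_sum qs rs es j1 j2 p1 p2 k1 k2 q1 q2"
    by (rule chain_sum_exists[OF qs(1) rs(1) ne])
  have len: "0 < length es" using 1(4) ne by auto
  note b = biproductD[OF 1(1)]
  note t = biproductD(1-4)[OF 1(1), unfolded hom_iff] biproductD(1-4)[OF 1(2), unfolded hom_iff]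
    f(1,2)[unfolded hom_iff]
  note C = chain_ends[OF ds(1)] chain_ends[OF 1(3)]
  note O = C[THEN C_obj] C_obj[OF f(3)]
  have s: "ladder \<A> qs es j1 k1" "ladder \<A> rs es j2 k2" using 1(5) unfolding is_sum_def by auto
  have "ladder \<A> ds es (j1 \<cdot> f) k1" "ladder \<A> ds es (j2 \<cdot> f') k2"
    using ladder_comp[OF qs(3) s(1) ds(1) qs(1) 1(3)] ladder_comp[OF rs(3) s(2) ds(1) rs(1) 1(3)] t
    by simp_all
  then have L: "ladder \<A> ds es (j1 \<cdot> f \<boxplus> j2 \<cdot> f') (k1 \<boxplus> k2)" (is "ladder \<A> ds es ?a ?c")
    using ladder_plus[OF _ _ ds(1) 1(3)] by blast
  have h: "?a \<in> Hom \<A> B S" "p1 \<boxplus> p2 \<in> Hom \<A> S B'" "?c \<in> Hom \<A> A T" using t by (simp_all add: hom_iff)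
  have c: "(p1 \<boxplus> p2) \<cdot> ?a = f \<boxplus> f'" using t O by (simp add: biproduct_collapse[OF 1(1)])
  have e: "cl es \<in> YE (length es) T S" using YextI 1(3) by blast
  have "sum_rel qs rs B' A (((p1 \<boxplus> p2) \<rhd> cl es) \<lhd> (k1 \<boxplus> k2))"
    unfolding sum_rel_def using 1 by blast
  then have "cl qs \<oplus> cl rs = ((p1 \<boxplus> p2) \<rhd> cl es) \<lhd> (k1 \<boxplus> k2)"
    by (rule yadd_cls[OF _ qs(1) rs(1) ne])
  also have "\<dots> = (p1 \<boxplus> p2) \<rhd> (cl es \<lhd> (k1 \<boxplus> k2))"
    by (rule push_pull[OF e len h(2) f(3) h(3) C(2)])
  also have "\<dots> = (p1 \<boxplus> p2) \<rhd> ?a \<rhd> cl ds"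
    by (simp only: ladder_push_pull[OF L ds(1) 1(3) ds(3)])
  also have "\<dots> = (f \<boxplus> f') \<rhd> cl ds"
    using push_comp[OF x h(1) C(3) h(2) f(3)] ds(4) c by simp
  finally show ?thesis using qs rs ds by simp
qed

text \<open>
  Any finite family of classes consists of pull-backs of a single class \<open>w\<close>. Since
  \<open>w \<lhd> g \<oplus> w \<lhd> g' = w \<lhd> (g \<boxplus> g')\<close>, the group laws for classes reduce to those of the Hom groups.
\<close>

lemma Yext_glue:
  assumes x: "x \<in> YE t A B" and y: "y \<in> YE t A' B" and t: "0 < t"
  obtains T k1 k2 q1 q2 w where "biproduct \<A> A A' T k1 k2 q1 q2" "T \<in> \<C>" "w \<in> YE t T B"
    "w \<lhd> k1 = x" "w \<lhd> k2 = y"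
proof -
  obtain cs where cs: "chn cs B A" "length cs = t" "cs \<noteq> []" "x = cl cs" by (rule YextE[OF x t])
  obtain ds where ds: "chn ds B A'" "length ds = t" "ds \<noteq> []" "y = cl ds" by (rule YextE[OF y t])
  obtain es S j1 j2 p1 p2 T k1 k2 q1 q2 where 1: "biproduct \<A> B B S j1 j2 p1 p2"
     "biproduct \<A> A A' T k1 k2 q1 q2" "chn es S T" "length es = length cs"
     "is_sum cs ds es j1 j2 p1 p2 k1 k2 q1 q2"
    using chain_sum_exists[OF cs(1) ds(1) cs(3)] cs(2) ds(2) by metis
  note b = biproductD[OF 1(1)]
  note ty = biproductD(1-4)[OF 1(1), unfolded hom_iff] biproductD(1-4)[OF 1(2), unfolded hom_iff]
  note C = chain_ends[OF cs(1)] chain_ends[OF 1(3)] chain_ends[OF ds(1)]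
  note O = C[THEN C_obj]
  have s: "ladder \<A> cs es j1 k1" "ladder \<A> ds es j2 k2" using 1(5) unfolding is_sum_def by auto
  have h: "p1 \<boxplus> p2 \<in> Hom \<A> S B" using ty by (simp add: hom_iff)
  have pj: "(p1 \<boxplus> p2) \<cdot> j1 = Id \<A> B" "(p1 \<boxplus> p2) \<cdot> j2 = Id \<A> B"
    using ty b(5-8) O by simp_all
  have e: "cl es \<in> YE t T S" using YextI[OF 1(3)] 1(4) cs(2) by simp
  have "((p1 \<boxplus> p2) \<rhd> cl es) \<lhd> k1 = (p1 \<boxplus> p2) \<rhd> (cl es \<lhd> k1)"
    by (rule push_pull[OF e t h C(1) biproductD(1)[OF 1(2)] C(2)])
  also have "\<dots> = (p1 \<boxplus> p2) \<rhd> j1 \<rhd> x"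
    using ladder_push_pull[OF s(1) cs(1) 1(3) cs(3)] cs(4) by simp
  also have "\<dots> = x"
    using push_comp[OF x t b(1) C(3) h C(1)] pj push_id[OF x t] by simp
  finally have 2: "((p1 \<boxplus> p2) \<rhd> cl es) \<lhd> k1 = x" .
  have "((p1 \<boxplus> p2) \<rhd> cl es) \<lhd> k2 = (p1 \<boxplus> p2) \<rhd> (cl es \<lhd> k2)"
    by (rule push_pull[OF e t h C(1) biproductD(2)[OF 1(2)] C(6)])
  also have "\<dots> = (p1 \<boxplus> p2) \<rhd> j2 \<rhd> y"
    using ladder_push_pull[OF s(2) ds(1) 1(3) ds(3)] ds(4) by simp
  also have "\<dots> = y"
    using push_comp[OF y t b(2) C(3) h C(1)] pj push_id[OF y t] by simp
  finally show ?thesis using that[OF 1(2) C(4) push_in[OF e t h C(1)] 2] by blast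
qed

lemma pull_yadd:
  assumes "x \<in> YE t A B" "y \<in> YE t A B" "0 < t" "g \<in> Hom \<A> A' A" "A' \<in> \<C>"
  shows "(x \<oplus> y) \<lhd> g = x \<lhd> g \<oplus> y \<lhd> g"
proof -
  note C = Yext_ends[OF assms(1)]
  obtain T k1 k2 q1 q2 w where T: "biproduct \<A> A A T k1 k2 q1 q2" "T \<in> \<C>" "w \<in> YE t T B"
    "w \<lhd> k1 = x" "w \<lhd> k2 = y"
    by (rule Yext_glue[OF assms(1-3)])
  note k = biproductD(1,2)[OF T(1)]
  have h: "k1 \<cdot> g \<in> Hom \<A> A' T" "k2 \<cdot> g \<in> Hom \<A> A' T" "k1 \<boxplus> k2 \<in> Hom \<A> A T"
    using k assms(4) by (simp_all add: hom_iff)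
  have "(x \<oplus> y) \<lhd> g = w \<lhd> (k1 \<boxplus> k2) \<lhd> g" using pull_plus[OF T(3) assms(3) k C(1)] T(4,5) by simp
  also have "\<dots> = w \<lhd> (k1 \<cdot> g \<boxplus> k2 \<cdot> g)"
    using pull_comp[OF T(3) assms(3) h(3) C(1) assms(4,5)] k assms(4) by (simp add: hom_iff)
  also have "\<dots> = w \<lhd> (k1 \<cdot> g) \<oplus> w \<lhd> (k2 \<cdot> g)" using pull_plus[OF T(3) assms(3) h(1,2) assms(5)] by simp
  also have "\<dots> = x \<lhd> g \<oplus> y \<lhd> g"
    using pull_comp[OF T(3) assms(3) k(1) C(1) assms(4,5)] pull_comp[OF T(3) assms(3) k(2) C(1) assms(4,5)]
      T(4,5) by simp
  finally show ?thesis .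
qed

lemma push_yadd:
  assumes "x \<in> YE t A B" "y \<in> YE t A B" "0 < t" "f \<in> Hom \<A> B B'" "B' \<in> \<C>"
  shows "f \<rhd> (x \<oplus> y) = f \<rhd> x \<oplus> f \<rhd> y"
proof -
  note C = Yext_ends[OF assms(1)]
  obtain T k1 k2 q1 q2 w where T: "biproduct \<A> A A T k1 k2 q1 q2" "T \<in> \<C>" "w \<in> YE t T B"
    "w \<lhd> k1 = x" "w \<lhd> k2 = y"
    by (rule Yext_glue[OF assms(1-3)])
  note k = biproductD(1,2)[OF T(1)]
  have h: "k1 \<boxplus> k2 \<in> Hom \<A> A T" using k by (simp_all add: hom_iff)
  note p = push_pull[OF T(3) assms(3-5) _ C(1)] and fw = push_in[OF T(3) assms(3-5)]
  have "f \<rhd> (x \<oplus> y) = f \<rhd> (w \<lhd> (k1 \<boxplus> k2))" using pull_plus[OF T(3) assms(3) k C(1)] T(4,5) by simp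
  also have "\<dots> = (f \<rhd> w) \<lhd> k1 \<oplus> (f \<rhd> w) \<lhd> k2"
    using p[OF h] pull_plus[OF fw assms(3) k C(1)] by simp
  also have "\<dots> = f \<rhd> x \<oplus> f \<rhd> y" using p[OF k(1)] p[OF k(2)] T(4,5) by simp
  finally show ?thesis .
qed

lemma yadd_commute:
  assumes "x \<in> YE t A B" "y \<in> YE t A B" "0 < t"
  shows "x \<oplus> y = y \<oplus> x"
proof -
  note C = Yext_ends[OF assms(1)]
  obtain T k1 k2 q1 q2 w where T: "biproduct \<A> A A T k1 k2 q1 q2" "T \<in> \<C>" "w \<in> YE t T B"
    "w \<lhd> k1 = x" "w \<lhd> k2 = y"
    by (rule Yext_glue[OF assms])
  note k = biproductD(1,2)[OF T(1)]
  show ?thesis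
    using pull_plus[OF T(3) assms(3) k C(1)] pull_plus[OF T(3) assms(3) k(2,1) C(1)]
      plus_commute[OF k] T(4,5) by simp
qed

lemma yadd_assoc:
  assumes "x \<in> YE t A B" "y \<in> YE t A B" "z \<in> YE t A B" "0 < t"
  shows "(x \<oplus> y) \<oplus> z = x \<oplus> (y \<oplus> z)"
proof -
  note C = Yext_ends[OF assms(1)]
  obtain T k1 k2 q1 q2 w where T: "biproduct \<A> A A T k1 k2 q1 q2" "T \<in> \<C>" "w \<in> YE t T B"
    "w \<lhd> k1 = x" "w \<lhd> k2 = y"
    by (rule Yext_glue[OF assms(1,2,4)])
  obtain U l1 l2 r1 r2 v where U: "biproduct \<A> T A U l1 l2 r1 r2" "U \<in> \<C>" "v \<in> YE t U B"
    "v \<lhd> l1 = w" "v \<lhd> l2 = z"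
    by (rule Yext_glue[OF T(3) assms(3,4)])
  note k = biproductD(1,2)[OF T(1)] and l = biproductD(1,2)[OF U(1)]
  define a b where "a = l1 \<cdot> k1" and "b = l1 \<cdot> k2"
  have h: "a \<in> Hom \<A> A U" "b \<in> Hom \<A> A U" using k l by (simp_all add: a_def b_def hom_iff)
  have e: "v \<lhd> a = x" "v \<lhd> b = y"
    using pull_comp[OF U(3) assms(4) l(1) T(2) _ C(1)] k U(4) T(4,5) by (simp_all add: a_def b_def)
  have s: "a \<boxplus> b \<in> Hom \<A> A U" "b \<boxplus> l2 \<in> Hom \<A> A U" using h l by (simp_all add: hom_iff)
  note p = pull_plus[OF U(3) assms(4) _ _ C(1)]
  have "(x \<oplus> y) \<oplus> z = v \<lhd> ((a \<boxplus> b) \<boxplus> l2)" using p[OF h] p[OF s(1) l(2)] e U(5) by simp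
  also have "\<dots> = v \<lhd> (a \<boxplus> (b \<boxplus> l2))" using plus_assoc[OF h l(2)] by simp
  also have "\<dots> = x \<oplus> (y \<oplus> z)" using p[OF h(2) l(2)] p[OF h(1) s(2)] e U(5) by simp
  finally show ?thesis .
qed

text \<open>Both sides are the pull-back of one glued class along the same zero arrow into
  \<open>T\<close>.\<close>

lemma pull_Zero_eq:
  assumes "x \<in> YE t A B" "y \<in> YE t A' B" "0 < t" "A'' \<in> \<C>"
  shows "x \<lhd> Zero \<A> A'' A = y \<lhd> Zero \<A> A'' A'"
proof -
  note C = Yext_ends[OF assms(1)] Yext_ends(1)[OF assms(2)] and O = C_obj
  obtain T k1 k2 q1 q2 w where T: "biproduct \<A> A A' T k1 k2 q1 q2" "T \<in> \<C>" "w \<in> YE t T B"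
    "w \<lhd> k1 = x" "w \<lhd> k2 = y"
    by (rule Yext_glue[OF assms(1-3)])
  note k = biproductD(1,2)[OF T(1)]
  have z: "Zero \<A> A'' A \<in> Hom \<A> A'' A" "Zero \<A> A'' A' \<in> Hom \<A> A'' A'"
    using zero_hom O C assms(4) by auto
  have "k1 \<cdot> Zero \<A> A'' A = k2 \<cdot> Zero \<A> A'' A'" using k O assms(4) by (simp add: hom_iff)
  then show ?thesis
    using pull_comp[OF T(3) assms(3) k(1) C(1) z(1) assms(4)]
      pull_comp[OF T(3) assms(3) k(2) C(3) z(2) assms(4)] T(4,5) by simp
qed

abbreviation yz where "yz t A B \<equiv> yzero \<A> \<C> t A B"

section \<open>Zero objects and the neutral class\<close>

lemma biproduct_zero_object:
  assumes "zero_object \<A> Z" "X \<in> Obj \<A>"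
  shows "biproduct \<A> Z X X (Zero \<A> Z X) (Id \<A> X) (Zero \<A> X Z) (Id \<A> X)"
    "biproduct \<A> X Z X (Id \<A> X) (Zero \<A> Z X) (Id \<A> X) (Zero \<A> X Z)"
proof -
  have Z: "Z \<in> Obj \<A>" using assms(1) by (simp add: zero_object_def)
  have "\<exists>!f. f \<in> Hom \<A> Z Z" using assms(1) Z unfolding zero_object_def by blast
  then have e: "Id \<A> Z = Zero \<A> Z Z" using id_hom[OF Z] zero_hom[OF Z Z] by blast
  show "biproduct \<A> Z X X (Zero \<A> Z X) (Id \<A> X) (Zero \<A> X Z) (Id \<A> X)"
    "biproduct \<A> X Z X (Id \<A> X) (Zero \<A> Z X) (Id \<A> X) (Zero \<A> X Z)"
    unfolding biproduct_def using Z assms(2) e by (simp_all add: hom_iff)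
qed

text \<open>Any zero object \<open>Z\<close> is a biproduct of two copies of the zero object
  \<open>W\<close> of \<C>, hence an extension of \<open>W\<close> by itself. This matters because
  \<open>seq_zero\<close> admits every zero object of \<A>.\<close>

lemma zero_object_C: "zero_object \<A> Z \<Longrightarrow> Z \<in> \<C>"
proof -
  assume Z: "zero_object \<A> Z"
  obtain W where W: "W \<in> \<C>" "zero_object \<A> W" using sub_zero by blast
  have oZ: "Z \<in> Obj \<A>" using Z by (simp add: zero_object_def)
  have "biproduct \<A> W Z Z (Zero \<A> W Z) (Id \<A> Z) (Zero \<A> Z W) (Id \<A> Z)"
    by (rule biproduct_zero_object[OF W(2) oZ])
  moreover have "biproduct \<A> W Z W (Id \<A> W) (Zero \<A> Z W) (Id \<A> W) (Zero \<A> W Z)"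
    by (rule biproduct_zero_object(2)[OF Z C_obj[OF W(1)]])
  moreover have "Zero \<A> Z W \<cdot> Zero \<A> W Z = Id \<A> W"
  proof -
    have "\<exists>!f. f \<in> Hom \<A> W W" using W C_obj unfolding zero_object_def by blast
    then show ?thesis using id_hom[OF C_obj[OF W(1)]] zero_hom[OF C_obj[OF W(1)] C_obj[OF W(1)]] oZ
      C_obj[OF W(1)] by (metis comp_zero zero_arr(1,2,3))
  qed
  moreover have "Zero \<A> W Z \<cdot> Zero \<A> Z W = Id \<A> Z"
  proof -
    have "\<exists>!f. f \<in> Hom \<A> Z Z" using Z oZ unfolding zero_object_def by blast
    then show ?thesis using id_hom[OF oZ] zero_hom[OF oZ oZ] oZ C_obj[OF W(1)]
      by (metis comp_zero zero_arr(1,2,3))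
  qed
  ultimately have "biproduct \<A> W W Z (Zero \<A> W Z) (Zero \<A> W Z) (Zero \<A> Z W) (Zero \<A> Z W)"
    unfolding biproduct_def
    using oZ C_obj[OF W(1)] by (simp add: hom_iff)
  then show ?thesis using biproduct_in_C W(1) by blast
qed

lemma conflation_split:
  assumes "biproduct \<A> X Y S j1 j2 p1 p2" "X \<in> \<C>" "Y \<in> \<C>"
  shows "conflation \<A> \<C> j1 p2"
  using ses_conflation(1)[OF ses_biproduct[OF assms(1)] assms(2,3)] .

lemma conflation_trivial:
  assumes "zero_object \<A> Z" "X \<in> \<C>"
  shows "conflation \<A> \<C> (Id \<A> X) (Zero \<A> X Z)" "conflation \<A> \<C> (Zero \<A> Z X) (Id \<A> X)"
  using conflation_split[OF biproduct_zero_object(1)[OF assms(1) C_obj[OF assms(2)]]]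
    conflation_split[OF biproduct_zero_object(2)[OF assms(1) C_obj[OF assms(2)]]]
    zero_object_C[OF assms(1)] assms(2) by simp_all

lemma Yext_nonempty:
  assumes "0 < t" "A \<in> \<C>" "B \<in> \<C>"
  shows "YE t A B \<noteq> {}"
proof -
  obtain Z where Z: "zero_object \<A> Z" using ex_zero_object by blast
  have "\<exists>cs. chn cs B A \<and> length cs = Suc m" for m
    using assms(3)
  proof (induction m arbitrary: B)
    case 0
    obtain S j1 j2 p1 p2 where S: "biproduct \<A> B A S j1 j2 p1 p2"
      using ex_biproduct C_obj 0 assms(2) by metis
    note b = biproductD(1-4)[OF S]
    have "chn [(j1, p2)] B A" using conflation_split[OF S 0 assms(2)] b assms(2) by (simp add: hom_iff)
    then show ?case by (intro exI[of _ "[(j1, p2)]"]) simp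
  next
    case (Suc m)
    note ZC = zero_object_C[OF Z]
    obtain cs where "chn cs Z A" "length cs = Suc m" using Suc.IH[OF ZC] by blast
    then have "chn ((Id \<A> B, Zero \<A> B Z) # cs) B A \<and> length ((Id \<A> B, Zero \<A> B Z) # cs) = Suc (Suc m)"
      using conflation_trivial(1)[OF Z Suc.prems] C_obj ZC Suc.prems by simp
    then show ?case by blast
  qed
  then obtain cs where "chn cs B A" "length cs = Suc (t - 1)" by blast
  then show ?thesis using YextI[of cs B A] assms(1) by auto
qed

lemma yz_in:
  assumes "0 < t" "A \<in> \<C>" "B \<in> \<C>"
  shows "yz t A B \<in> YE t A B"
proof -
  have "(SOME x. x \<in> YE t A B) \<in> YE t A B" using Yext_nonempty[OF assms] some_in_eq by blast
  then show ?thesis unfolding yzero_def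
    using pull_in[OF _ assms(1) zero_hom[of A A] assms(2)] C_obj[OF assms(2)] by blast
qed

lemma pull_Zero:
  assumes "x \<in> YE t A B" "0 < t" "A' \<in> \<C>"
  shows "x \<lhd> Zero \<A> A' A = yz t A' B"
proof -
  have "YE t A' B \<noteq> {}" using Yext_nonempty[OF assms(2,3)] Yext_ends[OF assms(1)] by blast
  then have "(SOME x. x \<in> YE t A' B) \<in> YE t A' B" using some_in_eq by blast
  then show ?thesis unfolding yzero_def using pull_Zero_eq[OF assms(1) _ assms(2,3)] by blast
qed

lemma pull_yz:
  assumes "0 < t" "g \<in> Hom \<A> A' A" "A \<in> \<C>" "A' \<in> \<C>" "B \<in> \<C>"
  shows "yz t A B \<lhd> g = yz t A' B"
proof -
  note z = yz_in[OF assms(1,3,5)] and o = C_obj[OF assms(3)]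
  have "yz t A B \<lhd> g = yz t A B \<lhd> Zero \<A> A A \<lhd> g"
    using pull_Zero[OF z assms(1,3)] by simp
  also have "\<dots> = yz t A B \<lhd> (Zero \<A> A A \<cdot> g)"
    by (rule pull_comp[OF z assms(1) zero_hom[OF o o] assms(3,2,4)])
  also have "\<dots> = yz t A' B" using pull_Zero[OF z assms(1,4)] assms(2) o by (simp add: hom_iff)
  finally show ?thesis .
qed

lemma yadd_zero:
  assumes "x \<in> YE t A B" "0 < t"
  shows "x \<oplus> yz t A B = x" "yz t A B \<oplus> x = x"
proof -
  note C = Yext_ends(1)[OF assms(1)] and O = C_obj[OF Yext_ends(1)[OF assms(1)]]
  have "x \<lhd> Id \<A> A \<oplus> x \<lhd> Zero \<A> A A = x \<lhd> (Id \<A> A \<boxplus> Zero \<A> A A)"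
    by (rule pull_plus[OF assms id_hom[OF O] zero_hom[OF O O] C])
  then show 1: "x \<oplus> yz t A B = x"
    using pull_id[OF assms] pull_Zero[OF assms C] O by simp
  show "yz t A B \<oplus> x = x"
    using 1 yadd_commute[OF assms(1) yz_in[OF assms(2) Yext_ends[OF assms(1)]] assms(2)] by simp
qed

lemma yadd_neg:
  assumes "x \<in> YE t A B" "0 < t"
  obtains y where "y \<in> YE t A B" "x \<oplus> y = yz t A B" "y \<oplus> x = yz t A B"
proof -
  note C = Yext_ends(1)[OF assms(1)] and O = C_obj[OF Yext_ends(1)[OF assms(1)]]
  have n: "neg (Id \<A> A) \<in> Hom \<A> A A" using neg_hom[OF id_hom[OF O]] .
  have "x \<lhd> Id \<A> A \<oplus> x \<lhd> neg (Id \<A> A) = x \<lhd> (Id \<A> A \<boxplus> neg (Id \<A> A))"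
    by (rule pull_plus[OF assms id_hom[OF O] n C])
  then have 1: "x \<oplus> x \<lhd> neg (Id \<A> A) = yz t A B"
    using pull_id[OF assms] pull_Zero[OF assms C] O by simp
  have 2: "x \<lhd> neg (Id \<A> A) \<in> YE t A B" by (rule pull_in[OF assms n C])
  show ?thesis using that[OF 2 1] yadd_commute[OF assms(1) 2 assms(2)] 1 by simp
qed

lemma yadd_idem:
  assumes "x \<in> YE t A B" "0 < t" "x \<oplus> x = x"
  shows "x = yz t A B"
proof -
  obtain y where y: "y \<in> YE t A B" "x \<oplus> y = yz t A B" by (rule yadd_neg[OF assms(1,2)])
  have "yz t A B = (x \<oplus> x) \<oplus> y" using assms(3) y(2) by simp
  also have "\<dots> = x" using yadd_assoc[OF assms(1,1) y(1) assms(2)] y(2) yadd_zero[OF assms(1,2)] by simp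
  finally show ?thesis by simp
qed

text \<open>\<open>yz\<close> is defined through pull-backs. The push-out along zero is identified
  with it because it is idempotent for the Baer sum.\<close>

lemma push_Zero:
  assumes "x \<in> YE t A B" "0 < t" "B' \<in> \<C>"
  shows "Zero \<A> B B' \<rhd> x = yz t A B'"
proof -
  note O = C_obj[OF Yext_ends(2)[OF assms(1)]] C_obj[OF assms(3)]
  note z = zero_hom[OF O]
  show ?thesis
  proof (rule yadd_idem[OF push_in[OF assms(1,2) z assms(3)] assms(2)])
    show "Zero \<A> B B' \<rhd> x \<oplus> Zero \<A> B B' \<rhd> x = Zero \<A> B B' \<rhd> x"
      using push_plus[OF assms(1,2) z z assms(3)] O by simp
  qed
qed

lemma push_yz:
  assumes "0 < t" "A \<in> \<C>" "f \<in> Hom \<A> B B'" "B \<in> \<C>" "B' \<in> \<C>"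
  shows "f \<rhd> yz t A B = yz t A B'"
proof -
  note z = yz_in[OF assms(1,2,4)]
  have "f \<rhd> yz t A B = f \<rhd> (yz t A B \<lhd> Zero \<A> A A)"
    using pull_Zero[OF z assms(1,2)] by simp
  also have "\<dots> = (f \<rhd> yz t A B) \<lhd> Zero \<A> A A"
    using push_pull[OF z assms(1,3,5) zero_hom[of A A] assms(2)] C_obj[OF assms(2)] by simp
  also have "\<dots> = yz t A B'" by (rule pull_Zero[OF push_in[OF z assms(1,3,5)] assms(1,2)])
  finally show ?thesis .
qed

lemma yadd_zero_eq:
  assumes "x \<in> YE t A B" "y \<in> YE t A B" "z \<in> YE t A B" "0 < t" "x \<oplus> z = yz t A B" "y \<oplus> z = yz t A B"
  shows "x = y"
proof -
  have "x = x \<oplus> (y \<oplus> z)" using assms(6) yadd_zero(1)[OF assms(1,4)] by simp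
  also have "\<dots> = x \<oplus> (z \<oplus> y)" using yadd_commute[OF assms(2,3,4)] by simp
  also have "\<dots> = (x \<oplus> z) \<oplus> y" using yadd_assoc[OF assms(1,3,2,4)] by simp
  also have "\<dots> = y" using assms(5) yadd_zero(2)[OF assms(2,4)] by simp
  finally show ?thesis .
qed

section \<open>Splicing classes with a conflation\<close>

lemma splice_cls:
  assumes d: "conflation \<A> \<C> (fst d) (snd d)" and ch: "chn cs (Cod \<A> (snd d)) A" and ne: "cs \<noteq> []"
  shows "splice \<A> \<C> d (cl cs) = cl (d # cs)"
proof -
  have *: "cl (d # cs) = cl (d # ds)" if "cl cs = cl ds" "chn ds (Cod \<A> (snd d)) A'" "ds \<noteq> []" for ds A'
  proof -
    have A: "A' = A" using cls_eq_ends[OF that(1) ch that(2) ne that(3)] by simp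
    show ?thesis
    proof (rule cls_invariant[OF that(1) ch that(2)[unfolded A] ne that(3)])
      fix es fs
      assume E: "chn es (Cod \<A> (snd d)) A" "chn fs (Cod \<A> (snd d)) A" "length es = length cs"
        "length fs = length cs" "ladder \<A> es fs (Id \<A> (Cod \<A> (snd d))) (Id \<A> A)"
      have "ladder \<A> (d # es) (d # fs) (Id \<A> (Dom \<A> (fst d))) (Id \<A> A)"
        using E(5) cmor_id[OF d] by auto
      then have "cl (d # es) = cl (d # fs)"
        by (rule cls_eqI) (use d E in auto)
      then show "(cl (d # cs) = cl (d # es)) = (cl (d # cs) = cl (d # fs))" by simp
    qed simp
  qed
  have "\<exists>y cs' A. cs' \<noteq> [] \<and> chn cs' (Cod \<A> (snd d)) A \<and> cl cs = cl cs' \<and> y = cl (d # cs')"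
    using ch ne by blast
  then show ?thesis
    unfolding splice_def
  proof (rule someI2_ex)
    fix y
    assume "\<exists>cs' A. cs' \<noteq> [] \<and> chn cs' (Cod \<A> (snd d)) A \<and> cl cs = cl cs' \<and> y = cl (d # cs')"
    then show "y = cl (d # cs)" using * by (elim exE conjE) simp
  qed
qed

abbreviation splice_op (infixr "\<star>" 75) where "d \<star> x \<equiv> splice \<A> \<C> d x"

lemma splice_in:
  assumes "conflation \<A> \<C> (fst d) (snd d)" "x \<in> YE t A (Cod \<A> (snd d))" "0 < t"
  shows "d \<star> x \<in> YE (Suc t) A (Dom \<A> (fst d))"
proof -
  obtain cs where cs: "chn cs (Cod \<A> (snd d)) A" "length cs = t" "cs \<noteq> []" "x = cl cs"
    by (rule YextE[OF assms(2,3)])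
  then have "chn (d # cs) (Dom \<A> (fst d)) A" using assms(1) by simp
  then show ?thesis using YextI[of "d # cs"] splice_cls[OF assms(1) cs(1,3)] cs by simp
qed

text \<open>A morphism of conflations put in front of a push-out ladder is again a ladder. For
  \<open>a\<close> an identity this is the relation that generates the equality of splices; for
  general \<open>a\<close> it makes the connecting map natural.\<close>

lemma push_splice:
  assumes d: "conflation \<A> \<C> (fst d) (snd d)" "conflation \<A> \<C> (fst d') (snd d')"
    and x: "x \<in> YE t A (Cod \<A> (snd d))" "0 < t" and m: "cmor \<A> d d' a k"
  shows "a \<rhd> (d \<star> x) = d' \<star> (k \<rhd> x)"
proof -
  obtain cs where cs: "chn cs (Cod \<A> (snd d)) A" "length cs = t" "cs \<noteq> []" "x = cl cs"
    by (rule YextE[OF x])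
  have k: "k \<in> Hom \<A> (Cod \<A> (snd d)) (Cod \<A> (snd d'))" using m unfolding cmor_def by blast
  have kc: "Cod \<A> (snd d') \<in> \<C>" using conflationD(3)[OF d(2)] .
  obtain ds where ds: "chn ds (Cod \<A> (snd d')) A" "length ds = length cs" "ladder \<A> cs ds k (Id \<A> A)"
    "k \<rhd> cl cs = cl ds"
    by (rule push_rep[OF cs(1,3) k kc])
  have ne: "ds \<noteq> []" using ds(2) cs(3) by auto
  have "ladder \<A> (d # cs) (d' # ds) a (Id \<A> A)" using m ds(3) by auto
  then have "a \<rhd> cl (d # cs) = cl (d' # ds)"
    by (rule push_cls) (use d cs ds in auto)
  then show ?thesis using splice_cls[OF d(1) cs(1,3)] splice_cls[OF d(2) ds(1) ne] cs ds by simp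
qed

lemma splice_pull:
  assumes d: "conflation \<A> \<C> (fst d) (snd d)" and x: "x \<in> YE t A (Cod \<A> (snd d))" "0 < t"
    and g: "g \<in> Hom \<A> A' A" "A' \<in> \<C>"
  shows "(d \<star> x) \<lhd> g = d \<star> (x \<lhd> g)"
proof -
  obtain cs where cs: "chn cs (Cod \<A> (snd d)) A" "length cs = t" "cs \<noteq> []" "x = cl cs"
    by (rule YextE[OF x])
  obtain qs where qs: "chn qs (Cod \<A> (snd d)) A'" "length qs = length cs"
    "ladder \<A> qs cs (Id \<A> (Cod \<A> (snd d))) g" "cl cs \<lhd> g = cl qs"
    by (rule pull_rep[OF cs(1,3) g])
  have ne: "qs \<noteq> []" using qs(2) cs(3) by auto
  have "ladder \<A> (d # qs) (d # cs) (Id \<A> (Dom \<A> (fst d))) g" using cmor_id[OF d] qs(3) by auto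
  then have "cl (d # cs) \<lhd> g = cl (d # qs)"
    by (rule pull_cls) (use d cs qs in auto)
  then show ?thesis using splice_cls[OF d cs(1,3)] splice_cls[OF d qs(1) ne] cs qs by simp
qed

text \<open>Both classes are pull-backs of one glued class, and splicing on the left commutes with
  pulling back on the right.\<close>

lemma splice_yadd:
  assumes d: "conflation \<A> \<C> (fst d) (snd d)"
    and x: "x \<in> YE t A (Cod \<A> (snd d))" and y: "y \<in> YE t A (Cod \<A> (snd d))" and t: "0 < t"
  shows "d \<star> (x \<oplus> y) = d \<star> x \<oplus> d \<star> y"
proof -
  note C = Yext_ends[OF x]
  obtain T k1 k2 q1 q2 w where T: "biproduct \<A> A A T k1 k2 q1 q2" "T \<in> \<C>" "w \<in> YE t T (Cod \<A> (snd d))"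
    "w \<lhd> k1 = x" "w \<lhd> k2 = y"
    by (rule Yext_glue[OF x y t])
  note k = biproductD(1,2)[OF T(1)]
  have h: "k1 \<boxplus> k2 \<in> Hom \<A> A T" using k by (simp add: hom_iff)
  note s = splice_pull[OF d T(3) t _ C(1)]
  have "d \<star> (x \<oplus> y) = d \<star> (w \<lhd> (k1 \<boxplus> k2))" using pull_plus[OF T(3) t k C(1)] T(4,5) by simp
  also have "\<dots> = (d \<star> w) \<lhd> k1 \<oplus> (d \<star> w) \<lhd> k2"
    using s[OF h] pull_plus[OF splice_in[OF d T(3) t] _ k C(1)] by simp
  also have "\<dots> = d \<star> x \<oplus> d \<star> y" using s[OF k(1)] s[OF k(2)] T(4,5) by simp
  finally show ?thesis .
qed

lemma splice_yz:
  assumes d: "conflation \<A> \<C> (fst d) (snd d)" and t: "0 < t" "A \<in> \<C>"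
  shows "d \<star> yz t A (Cod \<A> (snd d)) = yz (Suc t) A (Dom \<A> (fst d))"
proof -
  note K = conflationD(3)[OF d] and O = C_obj[OF t(2)]
  note z = yz_in[OF t K]
  have "d \<star> yz t A (Cod \<A> (snd d)) = d \<star> (yz t A (Cod \<A> (snd d)) \<lhd> Zero \<A> A A)"
    using pull_Zero[OF z t] by simp
  also have "\<dots> = (d \<star> yz t A (Cod \<A> (snd d))) \<lhd> Zero \<A> A A"
    using splice_pull[OF d z t(1) zero_hom[OF O O] t(2)] by simp
  also have "\<dots> = yz (Suc t) A (Dom \<A> (fst d))"
    by (rule pull_Zero[OF splice_in[OF d z t(1)] _ t(2)]) simp
  finally show ?thesis .
qed

lemma splice_exists:
  assumes "y \<in> YE (Suc t) A B" "0 < t"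
  obtains d x where "conflation \<A> \<C> (fst d) (snd d)" "Dom \<A> (fst d) = B" "x \<in> YE t A (Cod \<A> (snd d))"
    "y = d \<star> x"
proof -
  obtain cs where cs: "chn cs B A" "length cs = Suc t" "cs \<noteq> []" "y = cl cs"
    by (rule YextE[OF assms(1)]) simp
  then obtain d es where es: "cs = d # es" by (cases cs) auto
  then have e: "conflation \<A> \<C> (fst d) (snd d)" "Dom \<A> (fst d) = B" "chn es (Cod \<A> (snd d)) A"
    "length es = t" "es \<noteq> []" using cs assms(2) by auto
  show ?thesis
    using that[OF e(1,2)] YextI[OF e(3)] e(4) splice_cls[OF e(1,3,5)] cs(4) es by auto
qed

text \<open>
  Two splices are equal only if they are linked by morphisms of conflations that are the identity on
  the left end.
\<close>

lemma splice_invariant: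
  assumes eq: "d \<star> x = d' \<star> x'"
    and d: "conflation \<A> \<C> (fst d) (snd d)" "conflation \<A> \<C> (fst d') (snd d')"
      "Dom \<A> (fst d) = B" "Dom \<A> (fst d') = B"
    and x: "x \<in> YE t A (Cod \<A> (snd d))" "x' \<in> YE t A (Cod \<A> (snd d'))" "0 < t"
    and inv: "\<And>d d' k x. \<lbrakk>conflation \<A> \<C> (fst d) (snd d); conflation \<A> \<C> (fst d') (snd d');
      Dom \<A> (fst d) = B; Dom \<A> (fst d') = B; cmor \<A> d d' (Id \<A> B) k; x \<in> YE t A (Cod \<A> (snd d))\<rbrakk>
      \<Longrightarrow> P d x \<longleftrightarrow> P d' (k \<rhd> x)"
    and P: "P d x"
  shows "P d' x'"
proof -
  obtain cs where cs: "chn cs (Cod \<A> (snd d)) A" "length cs = t" "cs \<noteq> []" "x = cl cs"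
    by (rule YextE[OF x(1,3)])
  obtain ds where ds: "chn ds (Cod \<A> (snd d')) A" "length ds = t" "ds \<noteq> []" "x' = cl ds"
    by (rule YextE[OF x(2,3)])
  have e: "cl (d # cs) = cl (d' # ds)"
    using eq splice_cls[OF d(1) cs(1,3)] splice_cls[OF d(2) ds(1,3)] cs ds by simp
  have ch: "chn (d # cs) B A" "chn (d' # ds) B A" using d cs ds by auto
  \<comment> \<open>\<open>Q\<close> transports \<open>P\<close> to chains: the first conflation,
    and the class of the others.\<close>
  define Q where "Q = (\<lambda>es. P (hd es) (cl (tl es)))"
  have "Q (d' # ds)"
  proof (rule cls_invariant[OF e ch])
    show "Q (d # cs)" using P cs by (simp add: Q_def)
    fix es fs
    assume E: "chn es B A" "chn fs B A" "length es = length (d # cs)" "length fs = length (d # cs)"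
      "ladder \<A> es fs (Id \<A> B) (Id \<A> A)"
    obtain a as where a: "es = a # as" using E(3) by (cases es) auto
    obtain b bs k where b: "fs = b # bs" "cmor \<A> a b (Id \<A> B) k" "ladder \<A> as bs k (Id \<A> A)"
      using E(5) a by auto
    have 1: "conflation \<A> \<C> (fst a) (snd a)" "Dom \<A> (fst a) = B" "chn as (Cod \<A> (snd a)) A"
      "conflation \<A> \<C> (fst b) (snd b)" "Dom \<A> (fst b) = B" "chn bs (Cod \<A> (snd b)) A"
      using E(1,2) a b by auto
    have 2: "as \<noteq> []" "cl as \<in> YE t A (Cod \<A> (snd a))"
      using E(3) a cs(2) x(3) YextI[OF 1(3)] by auto
    have "k \<rhd> cl as = cl bs" by (rule push_cls[OF b(3) 1(3,6) 2(1)])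
    then show "Q es \<longleftrightarrow> Q fs"
      using inv[OF 1(1,4,2,5) b(2) 2(2)] a b by (simp add: Q_def)
  qed simp_all
  then show ?thesis using ds by (simp add: Q_def)
qed

end

section \<open>Exactness\<close>

text \<open>The splice with the conflation on the right-hand side, that is, the connecting map of
  the contravariant exact sequence.\<close>

definition rsplice :: "('o, 'm, 'z) cat_scheme \<Rightarrow> 'o set \<Rightarrow> 'm list set \<Rightarrow> 'm \<times> 'm \<Rightarrow> 'm list set" where
  "rsplice \<A> \<C> x d = rev ` splice (opcat \<A>) \<C> (prod.swap d) (rev ` x)"

context abelian_category
begin

lemma ses_section_retraction:
  assumes E: "ses B X A i p" and s: "s \<in> Hom \<A> A X" "p \<cdot> s = Id \<A> A"
  obtains r where "r \<in> Hom \<A> X B" "r \<cdot> i = Id \<A> B"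
proof -
  note d = sesD[OF E]
  note t = d(1,2)[unfolded hom_iff] s(1)[unfolded hom_iff]
  have o: "B \<in> Obj \<A>" "X \<in> Obj \<A>" "A \<in> Obj \<A>" using hom_obj d(1,2) by blast+
  define g where "g = Id \<A> X \<boxplus> neg (s \<cdot> p)"
  have g: "g \<in> Hom \<A> X X" using t o by (simp add: g_def hom_iff)
  have ps: "p \<cdot> (s \<cdot> p) = p"
  proof -
    have "p \<cdot> (s \<cdot> p) = (p \<cdot> s) \<cdot> p" using t by simp
    then show ?thesis using s(2) t by simp
  qed
  have "p \<cdot> g = Zero \<A> X A" using t o ps by (simp add: g_def)
  then obtain r where r: "r \<in> Hom \<A> X B" "i \<cdot> r = g" using ses_lift[OF E g] by blast
  note tr = r(1)[unfolded hom_iff] and tg = g[unfolded hom_iff]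
  have "i \<cdot> (r \<cdot> i) = g \<cdot> i" unfolding r(2)[symmetric] using tr t by simp
  also have "\<dots> = i \<boxplus> neg (s \<cdot> (p \<cdot> i))" using t o by (simp add: g_def)
  also have "\<dots> = i" unfolding d(5) using t o by simp
  finally have "i \<cdot> (r \<cdot> i) = i \<cdot> Id \<A> B" using t by simp
  then have "r \<cdot> i = Id \<A> B"
    by (rule mono_cancel[OF d(3,1), rotated 2]) (use tr t o in \<open>simp_all add: hom_iff\<close>)
  then show ?thesis using that r(1) by blast
qed

lemma ses_retraction_section:
  assumes E: "ses B X A i p" and r: "r \<in> Hom \<A> X B" "r \<cdot> i = Id \<A> B"
  obtains s where "s \<in> Hom \<A> A X" "p \<cdot> s = Id \<A> A"
proof -
  interpret op: abelian_category "opcat \<A>" by (rule abelian_category_opcat) unfold_locales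
  have "op.ses A X B p i" using E by (simp add: ses_def op.ses_def)
  then show ?thesis using op.ses_section_retraction[of A X B p i r] r that by auto
qed

end

context extension_closed_subcategory
begin

text \<open>Quantified over all conflations and all \<open>G\<close>, because the passage between
  degrees applies it to Mayer-Vietoris conflations, and \<open>exact_connecting\<close> to
  push-outs.\<close>

definition exact_middle :: "nat \<Rightarrow> bool" where
  "exact_middle t \<longleftrightarrow> (\<forall>u v G e. conflation \<A> \<C> u v \<longrightarrow> e \<in> YE t G (Cod \<A> u) \<longrightarrow>
     v \<rhd> e = yz t G (Cod \<A> v) \<longrightarrow> (\<exists>e'\<in>YE t G (Dom \<A> u). e = u \<rhd> e'))"

definition exact_connecting :: "nat \<Rightarrow> bool" where
  "exact_connecting t \<longleftrightarrow> (\<forall>u v G e. conflation \<A> \<C> u v \<longrightarrow> e \<in> YE t G (Cod \<A> v) \<longrightarrow>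
     (u, v) \<star> e = yz (Suc t) G (Dom \<A> u) \<longrightarrow> (\<exists>e'\<in>YE t G (Cod \<A> u). e = v \<rhd> e'))"

lemma conflation_pair:
  assumes "conflation \<A> \<C> u v"
  obtains A B C where "ses A B C u v" "A \<in> \<C>" "B \<in> \<C>" "C \<in> \<C>" "u \<in> Hom \<A> A B" "v \<in> Hom \<A> B C"
    "Dom \<A> u = A" "Cod \<A> u = B" "Dom \<A> v = B" "Cod \<A> v = C" "u \<in> Arr \<A>" "v \<in> Arr \<A>"
  using that[OF conflation_ses[OF assms]] conflationD[OF assms] sesD(1,2)[OF conflation_ses[OF assms]]
  by simp

lemma conflation_push_pushout:
  assumes F: "conflation \<A> \<C> k q" and v: "v \<in> Hom \<A> (Dom \<A> k) C" "C \<in> \<C>"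
  obtains P k' q' y where "conflation \<A> \<C> k' q'" "ses C P (Cod \<A> q) k' q'" "P \<in> \<C>"
    "y \<in> Hom \<A> (Cod \<A> k) P" "q' \<cdot> y = q" "pushout \<A> k v y k'"
    "cmor \<A> (k, q) (k', q') v (Id \<A> (Cod \<A> q))"
proof -
  note c = conflationD[OF F]
  obtain P k' q' y where P: "ses C P (Cod \<A> q) k' q'" "y \<in> Hom \<A> (Cod \<A> k) P" "q' \<cdot> y = q"
    "pushout \<A> k v y k'"
    using pushout_ses_exists[OF conflation_ses[OF F] v(1)] by blast
  note p = sesD(1,2)[OF P(1), unfolded hom_iff] and o = C_obj[OF c(3)]
  have "cmor \<A> (k, q) (k', q') v (Id \<A> (Cod \<A> q))"
    unfolding cmor_def
    by (rule exI[of _ y]) (use P p c v o pushoutD(9)[OF P(4)] in \<open>simp add: hom_iff\<close>)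
  then show ?thesis using that[OF ses_conflation(1)[OF P(1) v(2) c(3)] P(1) ses_conflation(2)[OF P(1) v(2) c(3)]] P by blast
qed

text \<open>
  The property of \<open>(d, x)\<close> that \<open>x\<close> is the push-out of a class along \<open>snd d\<close> is invariant in the sense of
  \<open>splice_invariant\<close>, by exactness in the middle for the Mayer-Vietoris conflation \<open>B \<rightarrow> B' \<oplus> C \<rightarrow> C'\<close>.
\<close>

lemma exact_connecting_if_middle:
  assumes mid: "exact_middle t" and t: "0 < t"
  shows "exact_connecting t"
  unfolding exact_connecting_def
proof (intro allI impI)
  fix u v G e
  assume uv: "conflation \<A> \<C> u v" and e: "e \<in> YE t G (Cod \<A> v)"
    and z: "(u, v) \<star> e = yz (Suc t) G (Dom \<A> u)"
  obtain A B C where D: "ses A B C u v" "A \<in> \<C>" "B \<in> \<C>" "C \<in> \<C>" "u \<in> Hom \<A> A B" "v \<in> Hom \<A> B C"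
    "Dom \<A> u = A" "Cod \<A> u = B" "Dom \<A> v = B" "Cod \<A> v = C" "u \<in> Arr \<A>" "v \<in> Arr \<A>"
    by (rule conflation_pair[OF uv])
  note G = Yext_ends(1)[OF e]
  define P where "P = (\<lambda>d x. \<exists>e1\<in>YE t G (Cod \<A> (fst d)). x = snd d \<rhd> e1)"
  have "P (u, v) e"
  proof (rule splice_invariant[where d = "(u, v)" and x = "yz t G C" and B = A and t = t and A = G])
    show "(u, v) \<star> yz t G C = (u, v) \<star> e"
      using splice_yz[of "(u, v)" t G] uv t G D z by simp
    show "P (u, v) (yz t G C)"
      unfolding P_def using push_yz[OF t G D(6,3,4)] yz_in[OF t G D(3)] D
      by (intro bexI[of _ "yz t G B"]) simp_all
    show "yz t G C \<in> YE t G (Cod \<A> (snd (u, v)))" using yz_in[OF t G D(4)] D by simp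
    fix d d' k x
    assume d: "conflation \<A> \<C> (fst d) (snd d)" "conflation \<A> \<C> (fst d') (snd d')"
      "Dom \<A> (fst d) = A" "Dom \<A> (fst d') = A" "cmor \<A> d d' (Id \<A> A) k" "x \<in> YE t G (Cod \<A> (snd d))"
    obtain u1 v1 where d1: "d = (u1, v1)" by (cases d)
    obtain u2 v2 where d2: "d' = (u2, v2)" by (cases d')
    obtain A1 B1 C1 where 1: "ses A1 B1 C1 u1 v1" "A1 \<in> \<C>" "B1 \<in> \<C>" "C1 \<in> \<C>" "u1 \<in> Hom \<A> A1 B1"
      "v1 \<in> Hom \<A> B1 C1" "Dom \<A> u1 = A1" "Cod \<A> u1 = B1" "Dom \<A> v1 = B1" "Cod \<A> v1 = C1"
      "u1 \<in> Arr \<A>" "v1 \<in> Arr \<A>"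
      using d(1) d1 by (auto elim: conflation_pair)
    obtain A2 B2 C2 where 2: "ses A2 B2 C2 u2 v2" "A2 \<in> \<C>" "B2 \<in> \<C>" "C2 \<in> \<C>" "u2 \<in> Hom \<A> A2 B2"
      "v2 \<in> Hom \<A> B2 C2" "Dom \<A> u2 = A2" "Cod \<A> u2 = B2" "Dom \<A> v2 = B2" "Cod \<A> v2 = C2"
      "u2 \<in> Arr \<A>" "v2 \<in> Arr \<A>"
      using d(2) d2 by (auto elim: conflation_pair)
    have A12: "A1 = A" "A2 = A" using d(3,4) d1 d2 1 2 by simp_all
    obtain b where b: "b \<in> Hom \<A> B1 B2" "k \<in> Hom \<A> C1 C2" "b \<cdot> u1 = u2 \<cdot> Id \<A> A" "v2 \<cdot> b = k \<cdot> v1"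
      using d(5) 1 2 unfolding cmor_def d1 d2 by auto
    have bu: "b \<cdot> u1 = u2" using b(3) 2 A12 by simp
    have x: "x \<in> YE t G C1" using d(6) d1 1 by simp
    note tb = b(1,2)[unfolded hom_iff]
    show "P d x \<longleftrightarrow> P d' (k \<rhd> x)"
    proof
      assume "P d x"
      then obtain e1 where e1: "e1 \<in> YE t G B1" "x = v1 \<rhd> e1" using d1 1 unfolding P_def by auto
      have "k \<rhd> x = (k \<cdot> v1) \<rhd> e1"
        using push_comp[OF e1(1) t 1(6,4) b(2) 2(4)] e1(2) by simp
      also have "\<dots> = v2 \<rhd> b \<rhd> e1"
        using push_comp[OF e1(1) t b(1) 2(3) 2(6,4)] b(4) by simp
      finally show "P d' (k \<rhd> x)"
        unfolding P_def d2 using push_in[OF e1(1) t b(1) 2(3)] 2 by auto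
    next
      assume "P d' (k \<rhd> x)"
      then obtain e1 where e1: "e1 \<in> YE t G B2" "k \<rhd> x = v2 \<rhd> e1" using d2 2 unfolding P_def by auto
      obtain S j1 j2 p1 p2 where S: "biproduct \<A> B2 C1 S j1 j2 p1 p2" "S \<in> \<C>"
        using sub_biproduct[OF 2(3) 1(4)] by blast
      note bi = biproductD[OF S(1)]
      note ty = biproductD(1-4)[OF S(1), unfolded hom_iff]
      define m w where "m = j1 \<cdot> b \<boxplus> j2 \<cdot> v1" and "w = neg (v2 \<cdot> p1) \<boxplus> k \<cdot> p2"
      have MV: "ses B1 S C2 m w"
        unfolding m_def w_def
        by (rule ses_mayer_vietoris[OF 1(1)[unfolded A12] 2(1)[unfolded A12] b(1,2) bu b(4) S(1)])
      note c = ses_conflation(1)[OF MV 1(3) 2(4)] and mw = sesD(1,2)[OF MV]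
      have o: "B2 \<in> Obj \<A>" "C1 \<in> Obj \<A>" "B1 \<in> Obj \<A>" "C2 \<in> Obj \<A>" using 1 2 C_obj by auto
      have w: "w \<cdot> j1 = neg v2" "w \<cdot> j2 = k" "p2 \<cdot> m = v1"
        using ty tb bi(5-8) 1 2 o by (simp_all add: m_def w_def biproduct_collapse[OF S(1)])
      \<comment> \<open>\<open>w\<close> sends \<open>z\<close> to \<open>- v2 \<rhd> e1\<close>
        plus \<open>k \<rhd> x\<close>, which is zero by the choice of \<open>e1\<close>. So
        \<open>z\<close> comes from a class \<open>e2\<close> along \<open>m\<close>, and comparing
        second coordinates gives \<open>x = v1 \<rhd> e2\<close>.\<close>
      define z where "z = j1 \<rhd> e1 \<oplus> j2 \<rhd> x"
      note i1 = push_in[OF e1(1) t bi(1) S(2)] and i2 = push_in[OF x t bi(2) S(2)]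
      have nv: "neg v2 \<in> Hom \<A> B2 C2" using neg_hom[OF 2(6)] .
      have zi: "z \<in> YE t G S" unfolding z_def by (rule yadd_in[OF i1 i2 t])
      have "w \<rhd> z = w \<rhd> j1 \<rhd> e1 \<oplus> w \<rhd> j2 \<rhd> x"
        unfolding z_def by (rule push_yadd[OF i1 i2 t mw(2) 2(4)])
      also have "\<dots> = neg v2 \<rhd> e1 \<oplus> v2 \<rhd> e1"
        using push_comp[OF e1(1) t bi(1) S(2) mw(2) 2(4)] push_comp[OF x t bi(2) S(2) mw(2) 2(4)] w e1
        by simp
      also have "\<dots> = yz t G C2"
        using push_plus[OF e1(1) t nv 2(6,4)] push_Zero[OF e1(1) t 2(4)] 2 by simp
      finally obtain e2 where e2: "e2 \<in> YE t G B1" "z = m \<rhd> e2"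
        using mid[unfolded exact_middle_def, rule_format, OF c, of z G] mw zi by (auto simp: hom_iff)
      have "v1 \<rhd> e2 = p2 \<rhd> z"
        using push_comp[OF e2(1) t mw(1) S(2) bi(4) 1(4)] e2(2) w(3) by simp
      also have "\<dots> = p2 \<rhd> j1 \<rhd> e1 \<oplus> p2 \<rhd> j2 \<rhd> x"
        unfolding z_def by (rule push_yadd[OF i1 i2 t bi(4) 1(4)])
      also have "\<dots> = yz t G C1 \<oplus> x"
        using push_comp[OF e1(1) t bi(1) S(2) bi(4) 1(4)] push_comp[OF x t bi(2) S(2) bi(4) 1(4)]
          bi(6,7) push_Zero[OF e1(1) t 1(4)] push_id[OF x t] by simp
      also have "\<dots> = x" by (rule yadd_zero(2)[OF x t])
      finally show "P d x" unfolding P_def d1 using e2(1) 1 by auto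
    qed
  qed (use uv e t D in auto)
  then show "\<exists>e'\<in>YE t G (Cod \<A> u). e = v \<rhd> e'" by (simp add: P_def)
qed

text \<open>
  With \<open>push_splice\<close> this gives \<open>(k, q) \<star> (q' \<rhd> x) = u \<rhd> ((k \<cdot> u, y) \<star> x)\<close>: a class that is spliced from
  \<open>(k, q)\<close> and a push-out along \<open>q'\<close> comes from \<open>u\<close>.
\<close>

lemma comp_pushout_cmor:
  assumes D: "ses A B C u v" "A \<in> \<C>" "C \<in> \<C>" and F: "ses B Y K k q"
    and P: "ses C P K k' q'" "K \<in> \<C>" and po: "pushout \<A> k v y k'" and y: "y \<in> Hom \<A> Y P" "q' \<cdot> y = q"
  shows "conflation \<A> \<C> (k \<cdot> u) y" "ses A Y P (k \<cdot> u) y" "cmor \<A> (k \<cdot> u, y) (k, q) u q'"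
proof -
  show s: "ses A Y P (k \<cdot> u) y" by (rule ses_comp_pushout[OF D(1) F po y(1) sesD(1)[OF P(1)]])
  have "P \<in> \<C>" using ses_conflation(2)[OF P(1) D(3) P(2)] .
  then show "conflation \<A> \<C> (k \<cdot> u) y" using ses_conflation(1)[OF s D(2)] by blast
  note t = sesD(1,2)[OF D(1), unfolded hom_iff] sesD(1,2)[OF F, unfolded hom_iff]
    sesD(1,2)[OF P(1), unfolded hom_iff] y(1)[unfolded hom_iff]
  have o: "Y \<in> Obj \<A>" using hom_obj[OF y(1)] by blast
  show "cmor \<A> (k \<cdot> u, y) (k, q) u q'"
    unfolding cmor_def by (rule exI[of _ "Id \<A> Y"]) (use t o y in \<open>simp add: hom_iff\<close>)
qed

text \<open>The arrow \<open>j1 \<cdot> p1\<close> on the middle term is an endomorphism of the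
  split conflation that is the identity on \<open>B\<close> and zero on \<open>A\<close>. Hence the
  class is its own pull-back along zero.\<close>

lemma yz_1_split:
  assumes "biproduct \<A> B A S j1 j2 p1 p2" "B \<in> \<C>" "A \<in> \<C>"
  shows "cl [(j1, p2)] = yz 1 A B"
proof -
  note b = biproductD[OF assms(1)] and t = biproductD(1-4)[OF assms(1), unfolded hom_iff]
  have c: "conflation \<A> \<C> j1 p2" by (rule conflation_split[OF assms])
  have ch: "chn [(j1, p2)] B A" using c t assms(3) by simp
  have o: "A \<in> Obj \<A>" "B \<in> Obj \<A>" using assms C_obj by auto
  have "cmor \<A> (j1, p2) (j1, p2) (Id \<A> B) (Zero \<A> A A)"
    unfolding cmor_def
    by (rule exI[of _ "j1 \<cdot> p1"])
      (use t b(5) o in \<open>simp add: hom_iff biproduct_collapse[OF assms(1)]\<close>)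
  then have "ladder \<A> [(j1, p2)] [(j1, p2)] (Id \<A> B) (Zero \<A> A A)" by simp
  then have "cl [(j1, p2)] \<lhd> Zero \<A> A A = cl [(j1, p2)]" by (rule pull_cls[OF _ ch ch]) simp
  moreover have "cl [(j1, p2)] \<in> YE 1 A B" using YextI[OF ch] by simp
  ultimately show ?thesis using pull_Zero[of _ 1 A B A] assms(3) by simp
qed

text \<open>Having a section is an invariant of zigzags that start at a split conflation. A section
  moves forward along a morphism by composition. To move backward it is turned into a retraction,
  which composes in the other direction, and then turned back.\<close>

lemma yz_1_section:
  assumes "cl [(i, p)] = yz 1 A B" "chn [(i, p)] B A"
  obtains s where "s \<in> Hom \<A> A (Cod \<A> i)" "p \<cdot> s = Id \<A> A"
proof -
  note C = chain_ends[OF assms(2)]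
  obtain S j1 j2 p1 p2 where S: "biproduct \<A> B A S j1 j2 p1 p2" using sub_biproduct[OF C] by blast
  note b = biproductD[OF S]
  have c: "conflation \<A> \<C> j1 p2" by (rule conflation_split[OF S C])
  have ch: "chn [(j1, p2)] B A" using c b(1-4) C by (simp add: hom_iff)
  have eq: "cl [(j1, p2)] = cl [(i, p)]" using yz_1_split[OF S C] assms(1) by simp
  define Q where "Q = (\<lambda>es::('a \<times> 'a) list. \<exists>s\<in>Hom \<A> A (Dom \<A> (snd (hd es))). snd (hd es) \<cdot> s = Id \<A> A)"
  have "Q [(i, p)]"
  proof (rule cls_invariant[OF eq ch assms(2)])
    show "Q [(j1, p2)]" unfolding Q_def using b(2,4,6) by (auto simp: hom_iff)
    fix es fs
    assume E: "chn es B A" "chn fs B A" "length es = length [(j1, p2)]" "length fs = length [(j1, p2)]"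
      "ladder \<A> es fs (Id \<A> B) (Id \<A> A)"
    obtain i1 q1 i2 q2 where ef: "es = [(i1, q1)]" "fs = [(i2, q2)]"
      using E(3,4) by (auto simp: length_Suc_conv)
    have c1: "conflation \<A> \<C> i1 q1" "Dom \<A> i1 = B" "Cod \<A> q1 = A"
      and c2: "conflation \<A> \<C> i2 q2" "Dom \<A> i2 = B" "Cod \<A> q2 = A"
      using E(1,2) ef by auto
    note d = conflationD[OF c1(1)] conflationD[OF c2(1)]
    note s1 = conflation_ses[OF c1(1), unfolded c1] and s2 = conflation_ses[OF c2(1), unfolded c2]
    have o: "A \<in> Obj \<A>" "B \<in> Obj \<A>" using C C_obj by auto
    obtain m where m: "m \<in> Hom \<A> (Cod \<A> i1) (Cod \<A> i2)" "m \<cdot> i1 = i2 \<cdot> Id \<A> B" "q2 \<cdot> m = Id \<A> A \<cdot> q1"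
    proof -
      have "cmor \<A> (i1, q1) (i2, q2) (Id \<A> B) (Id \<A> A)" using E(5) ef by simp
      then show ?thesis using that unfolding cmor_def fst_conv snd_conv by blast
    qed
    note tm = m(1)[unfolded hom_iff]
    have m': "m \<cdot> i1 = i2" "q2 \<cdot> m = q1" using m(2,3) d c1 c2 by simp_all
    show "Q es \<longleftrightarrow> Q fs"
    proof
      assume "Q es"
      then obtain s where s: "s \<in> Hom \<A> A (Cod \<A> i1)" "q1 \<cdot> s = Id \<A> A" using ef d by (auto simp: Q_def)
      note ts = s(1)[unfolded hom_iff]
      have "q2 \<cdot> (m \<cdot> s) = (q2 \<cdot> m) \<cdot> s" using tm ts d by simp
      then have "q2 \<cdot> (m \<cdot> s) = Id \<A> A" using m' s by simp
      then show "Q fs" unfolding Q_def ef using tm ts d by (intro bexI[of _ "m \<cdot> s"]) (simp_all add: hom_iff)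
    next
      assume "Q fs"
      then obtain s where s: "s \<in> Hom \<A> A (Cod \<A> i2)" "q2 \<cdot> s = Id \<A> A" using ef d by (auto simp: Q_def)
      obtain r where r: "r \<in> Hom \<A> (Cod \<A> i2) B" "r \<cdot> i2 = Id \<A> B"
        using ses_section_retraction[OF s2 s] by blast
      note tr = r(1)[unfolded hom_iff]
      have "(r \<cdot> m) \<cdot> i1 = r \<cdot> (m \<cdot> i1)" using tr tm d by simp
      then have "(r \<cdot> m) \<cdot> i1 = Id \<A> B" using m' r by simp
      moreover have "r \<cdot> m \<in> Hom \<A> (Cod \<A> i1) B" using tr tm by (simp add: hom_iff)
      ultimately obtain s' where "s' \<in> Hom \<A> A (Cod \<A> i1)" "q1 \<cdot> s' = Id \<A> A"
        using ses_retraction_section[OF s1] by blast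
      then show "Q es" unfolding Q_def ef using d by auto
    qed
  qed simp_all
  then show ?thesis using that assms(2) conflationD(4)[of \<A> \<C> i p] by (auto simp: Q_def)
qed

text \<open>The base case has no lower degree to fall back on. The section \<open>s\<close> of the
  pushed-out conflation replaces the class in degree zero: \<open>e\<close> pulled back along
  \<open>q'\<close> comes from \<open>u\<close>, and pulling back along \<open>s\<close> recovers
  \<open>e\<close>.\<close>

lemma exact_middle_1: "exact_middle 1"
  unfolding exact_middle_def
proof (intro allI impI)
  fix u v G e
  assume uv: "conflation \<A> \<C> u v" and e: "e \<in> YE 1 G (Cod \<A> u)"
    and z: "v \<rhd> e = yz 1 G (Cod \<A> v)"
  obtain A B C where D: "ses A B C u v" "A \<in> \<C>" "B \<in> \<C>" "C \<in> \<C>" "u \<in> Hom \<A> A B" "v \<in> Hom \<A> B C"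
    "Dom \<A> u = A" "Cod \<A> u = B" "Dom \<A> v = B" "Cod \<A> v = C" "u \<in> Arr \<A>" "v \<in> Arr \<A>"
    by (rule conflation_pair[OF uv])
  obtain cs where cs: "chn cs B G" "length cs = 1" "cs \<noteq> []" "e = cl cs"
    using YextE[OF e] D by auto
  then obtain k q where kq: "cs = [(k, q)]" by (auto simp: length_Suc_conv)
  have F: "conflation \<A> \<C> k q" "Dom \<A> k = B" "Cod \<A> q = G" "G \<in> \<C>" using cs kq by auto
  note cd = conflationD[OF F(1)]
  have v': "v \<in> Hom \<A> (Dom \<A> k) C" using D F by simp
  obtain P k' q' y where P: "conflation \<A> \<C> k' q'" "ses C P (Cod \<A> q) k' q'" "P \<in> \<C>"
    "y \<in> Hom \<A> (Cod \<A> k) P" "q' \<cdot> y = q" "pushout \<A> k v y k'"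
    "cmor \<A> (k, q) (k', q') v (Id \<A> (Cod \<A> q))"
    by (rule conflation_push_pushout[OF F(1) v' D(4)])
  note p = sesD(1,2)[OF P(2), unfolded hom_iff]
  have ch': "chn [(k', q')] C G" using P(1) p F by simp
  have "v \<rhd> e = cl [(k', q')]"
    unfolding cs(4) kq using push_cls[of "[(k, q)]" "[(k', q')]" v G B C] P(7) F ch' cs kq by simp
  then have "cl [(k', q')] = yz 1 G C" using z D by simp
  then obtain s where s: "s \<in> Hom \<A> G P" "q' \<cdot> s = Id \<A> G"
    using yz_1_section[OF _ ch'] p by auto
  note eps = comp_pushout_cmor[OF D(1,2,4) conflation_ses[OF F(1), unfolded F(2)] P(2) cd(3) P(6,4,5)]
  have chE: "chn [(k \<cdot> u, y)] A P" using eps(1) sesD(1,2)[OF eps(2)] P(3) by (simp add: hom_iff)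
  have E: "cl [(k \<cdot> u, y)] \<in> YE 1 P A" using YextI[OF chE] by simp
  have q': "q' \<in> Hom \<A> P G" using sesD(2)[OF P(2)] F by simp
  have "ladder \<A> [(k \<cdot> u, y)] [(k, q)] u q'" using eps(3) by simp
  then have 1: "u \<rhd> cl [(k \<cdot> u, y)] = e \<lhd> q'"
    using ladder_push_pull[OF _ chE cs(1)[unfolded kq]] cs(4) kq by simp
  have e': "e \<in> YE 1 G B" using e D by simp
  have "u \<rhd> (cl [(k \<cdot> u, y)] \<lhd> s) = (u \<rhd> cl [(k \<cdot> u, y)]) \<lhd> s"
    using push_pull[OF E _ D(5,3) s(1) F(4)] by simp
  also have "\<dots> = e \<lhd> (q' \<cdot> s)" unfolding 1 using pull_comp[OF e' _ q' P(3) s(1) F(4)] by simp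
  also have "\<dots> = e" using s(2) pull_id[OF e'] by simp
  finally show "\<exists>e'\<in>YE 1 G (Dom \<A> u). e = u \<rhd> e'"
    using pull_in[OF E _ s(1) F(4)] D by (intro bexI[of _ "cl [(k \<cdot> u, y)] \<lhd> s"]) simp_all
qed

text \<open>Write \<open>e\<close> as \<open>(k, q) \<star> \<tau>\<close>. Its push-out along
  \<open>v\<close> is the splice of the pushed-out conflation \<open>(k', q')\<close> with the same
  \<open>\<tau>\<close>, so exactness for \<open>(k', q')\<close>, not for \<open>(u, v)\<close>,
  shows that \<open>\<tau>\<close> comes from \<open>q'\<close>.\<close>

lemma exact_middle_Suc:
  assumes con: "exact_connecting t" and t: "0 < t"
  shows "exact_middle (Suc t)"
  unfolding exact_middle_def
proof (intro allI impI)
  fix u v G e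
  assume uv: "conflation \<A> \<C> u v" and e: "e \<in> YE (Suc t) G (Cod \<A> u)"
    and z: "v \<rhd> e = yz (Suc t) G (Cod \<A> v)"
  obtain A B C where D: "ses A B C u v" "A \<in> \<C>" "B \<in> \<C>" "C \<in> \<C>" "u \<in> Hom \<A> A B" "v \<in> Hom \<A> B C"
    "Dom \<A> u = A" "Cod \<A> u = B" "Dom \<A> v = B" "Cod \<A> v = C" "u \<in> Arr \<A>" "v \<in> Arr \<A>"
    by (rule conflation_pair[OF uv])
  obtain d \<tau> where d: "conflation \<A> \<C> (fst d) (snd d)" "Dom \<A> (fst d) = Cod \<A> u"
    "\<tau> \<in> YE t G (Cod \<A> (snd d))" "e = d \<star> \<tau>"
    by (rule splice_exists[OF e t])
  obtain k q where kq: "d = (k, q)" by (cases d)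
  have F: "conflation \<A> \<C> k q" "Dom \<A> k = B" and \<tau>: "\<tau> \<in> YE t G (Cod \<A> q)" using d kq D by auto
  note cd = conflationD[OF F(1)]
  have v': "v \<in> Hom \<A> (Dom \<A> k) C" using D F by simp
  obtain P k' q' y where P: "conflation \<A> \<C> k' q'" "ses C P (Cod \<A> q) k' q'" "P \<in> \<C>"
    "y \<in> Hom \<A> (Cod \<A> k) P" "q' \<cdot> y = q" "pushout \<A> k v y k'"
    "cmor \<A> (k, q) (k', q') v (Id \<A> (Cod \<A> q))"
    by (rule conflation_push_pushout[OF F(1) v' D(4)])
  note p = sesD(1,2)[OF P(2), unfolded hom_iff]
  have "v \<rhd> e = (k', q') \<star> (Id \<A> (Cod \<A> q) \<rhd> \<tau>)"
    unfolding d(4) kq using push_splice[of "(k, q)" "(k', q')" \<tau> t G v] P(1,7) F \<tau> t by simp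
  then have "(k', q') \<star> \<tau> = yz (Suc t) G C" using push_id[OF \<tau> t] z D by simp
  then obtain \<tau>' where \<tau>': "\<tau>' \<in> YE t G P" "\<tau> = q' \<rhd> \<tau>'"
    using con[unfolded exact_connecting_def, rule_format, OF P(1), of \<tau> G] \<tau> p by auto
  note eps = comp_pushout_cmor[OF D(1,2,4) conflation_ses[OF F(1), unfolded F(2)] P(2) cd(3) P(6,4,5)]
  have ty: "Dom \<A> (k \<cdot> u) = A" "Cod \<A> y = P" using sesD(1,2)[OF eps(2)] by (simp_all add: hom_iff)
  have "u \<rhd> ((k \<cdot> u, y) \<star> \<tau>') = e"
    using push_splice[of "(k \<cdot> u, y)" "(k, q)" \<tau>' t G u q'] eps F(1) \<tau>' t d(4) kq ty by simp
  then show "\<exists>e'\<in>YE (Suc t) G (Dom \<A> u). e = u \<rhd> e'"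
    using splice_in[of "(k \<cdot> u, y)" \<tau>' t G] eps(1) \<tau>'(1) t ty D
    by (intro bexI[of _ "(k \<cdot> u, y) \<star> \<tau>'"]) simp_all
qed

lemma exact_middle: "0 < t \<Longrightarrow> exact_middle t"
proof (induction t)
  case (Suc t)
  show ?case
  proof (cases "t = 0")
    case True
    then show ?thesis using exact_middle_1 by simp
  next
    case False
    then show ?thesis
      using Suc.IH exact_connecting_if_middle exact_middle_Suc by simp
  qed
qed simp

lemma push_exact_middle:
  assumes "conflation \<A> \<C> u v" "0 < t" "e \<in> YE t G (Cod \<A> u)" "v \<rhd> e = yz t G (Cod \<A> v)"
  obtains e' where "e' \<in> YE t G (Dom \<A> u)" "e = u \<rhd> e'"
  using exact_middle[OF assms(2)] assms(1,3,4) unfolding exact_middle_def by blast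

lemma push_exact_connecting:
  assumes "conflation \<A> \<C> u v" "0 < t" "e \<in> YE t G (Cod \<A> v)" "(u, v) \<star> e = yz (Suc t) G (Dom \<A> u)"
  obtains e' where "e' \<in> YE t G (Cod \<A> u)" "e = v \<rhd> e'"
  using exact_connecting_if_middle[OF exact_middle[OF assms(2)] assms(2)] assms(1,3,4)
  unfolding exact_connecting_def by blast

text \<open>
  Let \<open>P\<close> be the push-out of the first conflation \<open>A \<rightarrow> Y \<rightarrow> K\<close> of \<open>e\<close> along \<open>u\<close>. Both this conflation and
  \<open>(u, v)\<close> are pull-backs of a conflation \<open>A \<rightarrow> P \<rightarrow> K \<oplus> C\<close>, whose splice with any class from \<open>P\<close> vanishes.
\<close>

lemma push_exact_splice:
  assumes uv: "conflation \<A> \<C> u v" and t: "0 < t" and e: "e \<in> YE (Suc t) G (Dom \<A> u)"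
    and z: "u \<rhd> e = yz (Suc t) G (Cod \<A> u)"
  obtains e' where "e' \<in> YE t G (Cod \<A> v)" "e = (u, v) \<star> e'"
proof -
  obtain A B C where D: "ses A B C u v" "A \<in> \<C>" "B \<in> \<C>" "C \<in> \<C>" "u \<in> Hom \<A> A B" "v \<in> Hom \<A> B C"
    "Dom \<A> u = A" "Cod \<A> u = B" "Dom \<A> v = B" "Cod \<A> v = C" "u \<in> Arr \<A>" "v \<in> Arr \<A>"
    by (rule conflation_pair[OF uv])
  obtain d \<tau> where d: "conflation \<A> \<C> (fst d) (snd d)" "Dom \<A> (fst d) = Dom \<A> u"
    "\<tau> \<in> YE t G (Cod \<A> (snd d))" "e = d \<star> \<tau>"
    by (rule splice_exists[OF e t])
  obtain k q where kq: "d = (k, q)" by (cases d)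
  have F: "conflation \<A> \<C> k q" "Dom \<A> k = A" and \<tau>: "\<tau> \<in> YE t G (Cod \<A> q)" using d kq D by auto
  note cd = conflationD[OF F(1)]
  define Y K where "Y = Cod \<A> k" and "K = Cod \<A> q"
  have FS: "ses A Y K k q" using conflation_ses[OF F(1)] F(2) by (simp add: Y_def K_def)
  have K: "K \<in> \<C>" using cd by (simp add: K_def)
  note G = Yext_ends(1)[OF e]
  have u': "u \<in> Hom \<A> (Dom \<A> k) B" using D F by simp
  obtain P k' q' y where P: "conflation \<A> \<C> k' q'" "ses B P K k' q'" "P \<in> \<C>"
    "y \<in> Hom \<A> Y P" "q' \<cdot> y = q" "pushout \<A> k u y k'"
    "cmor \<A> (k, q) (k', q') u (Id \<A> K)"
    unfolding Y_def K_def by (rule conflation_push_pushout[OF F(1) u' D(3)])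
  note p = sesD(1,2)[OF P(2), unfolded hom_iff]
  have \<tau>K: "\<tau> \<in> YE t G K" using \<tau> by (simp add: K_def)
  have "u \<rhd> e = (k', q') \<star> (Id \<A> K \<rhd> \<tau>)"
    unfolding d(4) kq using push_splice[of "(k, q)" "(k', q')" \<tau> t G u] P(1,7) F \<tau> t by simp
  then have "(k', q') \<star> \<tau> = yz (Suc t) G B" using push_id[OF \<tau>K t] z D by simp
  then obtain \<tau>' where \<tau>': "\<tau>' \<in> YE t G P" "\<tau> = q' \<rhd> \<tau>'"
    using push_exact_connecting[OF P(1) t, of \<tau> G] \<tau>K p by auto
  obtain S j1 j2 p1 p2 where S: "biproduct \<A> K C S j1 j2 p1 p2" "S \<in> \<C>"
    using sub_biproduct[OF K D(4)] by blast
  note bi = biproductD[OF S(1)] and ty = biproductD(1-4)[OF S(1), unfolded hom_iff]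
  obtain c where c: "c \<in> Hom \<A> P C" "c \<cdot> y = Zero \<A> Y C" "c \<cdot> k' = v"
    "ses A P S (k' \<cdot> u) (j1 \<cdot> q' \<boxplus> j2 \<cdot> c)"
    by (rule ses_pushout_sum[OF D(1) FS P(2) P(6) P(4) P(5) S(1)])
  define w where "w = j1 \<cdot> q' \<boxplus> j2 \<cdot> c"
  note WS = c(4)[folded w_def]
  note W = ses_conflation(1)[OF WS D(2) S(2)] and w = sesD(2)[OF WS] and ku = sesD(1)[OF WS]
  note tt = p c(1)[unfolded hom_iff] w[unfolded hom_iff] ku[unfolded hom_iff] P(4)[unfolded hom_iff]
    sesD(1,2)[OF FS, unfolded hom_iff]
  have o: "A \<in> Obj \<A>" "B \<in> Obj \<A>" "C \<in> Obj \<A>" "K \<in> Obj \<A>" "P \<in> Obj \<A>" "Y \<in> Obj \<A>" "S \<in> Obj \<A>"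
    using D K P(3) S(2) cd C_obj by (auto simp: Y_def)
  have wy: "w \<cdot> y = j1 \<cdot> q" using tt ty c(2) P(5) o by (simp add: w_def)
  have wk: "w \<cdot> k' = j2 \<cdot> v" using tt ty c(3) sesD(5)[OF P(2)] o D by (simp add: w_def)
  have m1: "cmor \<A> (k, q) (k' \<cdot> u, w) (Id \<A> A) j1"
    unfolding cmor_def
    by (rule exI[of _ y]) (use tt ty o wy D pushoutD(9)[OF P(6)] in \<open>simp add: hom_iff\<close>)
  have m2: "cmor \<A> (u, v) (k' \<cdot> u, w) (Id \<A> A) j2"
    unfolding cmor_def
    by (rule exI[of _ k']) (use tt ty o wk D in \<open>simp add: hom_iff\<close>)
  note e1 = push_in[OF \<tau>K t bi(1) S(2)]
  have cin: "c \<rhd> \<tau>' \<in> YE t G C" by (rule push_in[OF \<tau>'(1) t c(1) D(4)])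
  note e2 = push_in[OF cin t bi(2) S(2)]
  have eA: "e \<in> YE (Suc t) G A" using e D by simp
  have s1: "(k' \<cdot> u, w) \<star> (j1 \<rhd> \<tau>) = e"
    using push_splice[of "(k, q)" "(k' \<cdot> u, w)" \<tau> t G, OF _ _ _ t m1] F W \<tau> push_id[OF eA] d(4) kq by simp
  have din: "(u, v) \<star> (c \<rhd> \<tau>') \<in> YE (Suc t) G A"
    using splice_in[of "(u, v)" "c \<rhd> \<tau>'" t G] uv cin t D by simp
  have s2: "(k' \<cdot> u, w) \<star> (j2 \<rhd> c \<rhd> \<tau>') = (u, v) \<star> (c \<rhd> \<tau>')"
    using push_splice[of "(u, v)" "(k' \<cdot> u, w)" "c \<rhd> \<tau>'" t G, OF _ _ _ t m2] uv W cin push_id[OF din] D by simp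
  have "w \<rhd> \<tau>' = (j1 \<cdot> q') \<rhd> \<tau>' \<oplus> (j2 \<cdot> c) \<rhd> \<tau>'"
    using push_plus[OF \<tau>'(1) t, of "j1 \<cdot> q'" S "j2 \<cdot> c"] S(2) tt ty by (simp add: w_def hom_iff)
  also have "\<dots> = j1 \<rhd> \<tau> \<oplus> j2 \<rhd> c \<rhd> \<tau>'"
    using push_comp[OF \<tau>'(1) t sesD(2)[OF P(2)] K bi(1) S(2)] push_comp[OF \<tau>'(1) t c(1) D(4) bi(2) S(2)] \<tau>'(2)
    by simp
  finally have wt: "w \<rhd> \<tau>' = j1 \<rhd> \<tau> \<oplus> j2 \<rhd> c \<rhd> \<tau>'" .
  have cdS: "Cod \<A> w = S" using tt by simp
  have "(k' \<cdot> u, w) \<star> (w \<rhd> \<tau>') = e \<oplus> (u, v) \<star> (c \<rhd> \<tau>')"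
    unfolding wt using splice_yadd[of "(k' \<cdot> u, w)" "j1 \<rhd> \<tau>" t G "j2 \<rhd> c \<rhd> \<tau>'"] W e1 e2 t s1 s2 cdS by simp
  moreover have "(k' \<cdot> u, w) \<star> (w \<rhd> \<tau>') = yz (Suc t) G A"
  proof -
    \<comment> \<open>The splice with \<open>w \<rhd> \<tau>'\<close> is a push-out from a class
      with coefficients in \<open>Z\<close>: the trivial conflation from \<open>Z\<close> to
      \<open>P\<close> maps to the conflation at hand by the identity on \<open>P\<close> and by
      \<open>w\<close> on the quotients.\<close>
    obtain Z where Z: "zero_object \<A> Z" using ex_zero_object by blast
    note ZC = zero_object_C[OF Z] and d0 = conflation_trivial(2)[OF Z P(3)]
    have "cmor \<A> (Zero \<A> Z P, Id \<A> P) (k' \<cdot> u, w) (Zero \<A> Z A) w"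
      unfolding cmor_def
      by (rule exI[of _ "Id \<A> P"]) (use tt o D C_obj[OF ZC] in \<open>simp add: hom_iff\<close>)
    moreover have "(Zero \<A> Z P, Id \<A> P) \<star> \<tau>' \<in> YE (Suc t) G Z"
      using splice_in[of "(Zero \<A> Z P, Id \<A> P)" \<tau>' t G] d0 \<tau>'(1) t o C_obj[OF ZC] by simp
    ultimately show ?thesis
      using push_splice[of "(Zero \<A> Z P, Id \<A> P)" "(k' \<cdot> u, w)" \<tau>' t G "Zero \<A> Z A" w] d0 W \<tau>'(1) t o
        push_Zero[of _ "Suc t" G Z A] D(2) by simp
  qed
  ultimately have sum: "e \<oplus> (u, v) \<star> (c \<rhd> \<tau>') = yz (Suc t) G A" by simp
  \<comment> \<open>The sum just found shows \<open>e\<close> to be the negative of a splice with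
    \<open>(u, v)\<close>, so the class sought is the negative of
    \<open>c \<rhd> \<tau>'\<close>.\<close>
  obtain n where n: "n \<in> YE t G C" "n \<oplus> (c \<rhd> \<tau>') = yz t G C"
    using yadd_neg[OF cin t] by metis
  have nin: "(u, v) \<star> n \<in> YE (Suc t) G A"
    using splice_in[of "(u, v)" n t G] uv n(1) t D by simp
  have "(u, v) \<star> n \<oplus> (u, v) \<star> (c \<rhd> \<tau>') = yz (Suc t) G A"
    using splice_yadd[of "(u, v)" n t G "c \<rhd> \<tau>'"] uv n cin t D splice_yz[of "(u, v)" t G] G by simp
  then have "e = (u, v) \<star> n" using yadd_zero_eq[OF eA nin din _ sum] by simp
  then show ?thesis using that n(1) D by simp
qed

section \<open>Duality for classes and the contravariant exact sequence\<close>

lemma Yext_opcat: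
  assumes "x \<in> YE t A B" "0 < t"
  shows "rev ` x \<in> Yext (opcat \<A>) \<C> t B A"
proof -
  obtain cs where cs: "chn cs B A" "length cs = t" "cs \<noteq> []" "x = cl cs" by (rule YextE[OF assms])
  have "chain (opcat \<A>) \<C> (dch cs) A B" "length (dch cs) = t" using cs by simp_all
  then show ?thesis
    unfolding Yext_def cs(4) cls_opcat[OF extension_closed_subcategory_axioms cs(1,3), symmetric] by blast
qed

lemma rev_rev_image [simp]: "rev ` rev ` x = x"
  by (simp add: image_image)

lemma Yext_opcatD:
  assumes "x \<in> Yext (opcat \<A>) \<C> t B A" "0 < t"
  shows "rev ` x \<in> YE t A B"
proof -
  interpret op: extension_closed_subcategory "opcat \<A>" \<C> by (rule extension_closed_opcat)
  show ?thesis using op.Yext_opcat[OF assms] by simp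
qed

lemma push_opcat: "push (opcat \<A>) \<C> f (rev ` x) = rev ` (x \<lhd> f)"
  by (simp add: pull_def)

lemma pull_opcat: "pull (opcat \<A>) \<C> f (rev ` x) = rev ` (f \<rhd> x)"
  by (simp add: pull_def)

lemma splice_opcat: "splice (opcat \<A>) \<C> (v, u) (rev ` x) = rev ` rsplice \<A> \<C> x (u, v)"
  by (simp add: rsplice_def)

text \<open>A pull-back along zero in the opposite category is a push-out along zero here, and
  \<open>push_Zero\<close> says that it yields the same neutral class.\<close>

lemma yzero_opcat:
  assumes "0 < t" "A \<in> \<C>" "B \<in> \<C>"
  shows "yzero (opcat \<A>) \<C> t B A = rev ` yz t A B"
proof -
  interpret op: extension_closed_subcategory "opcat \<A>" \<C> by (rule extension_closed_opcat)
  note z = yz_in[OF assms]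
  have "pull (opcat \<A>) \<C> (Zero (opcat \<A>) B B) (rev ` yz t A B) = yzero (opcat \<A>) \<C> t B A"
    by (rule op.pull_Zero[OF Yext_opcat[OF z assms(1)] assms(1,3)])
  then show ?thesis using push_Zero[OF z assms(1,3)] by (simp add: pull_opcat)
qed

lemma rev_image_eq: "rev ` x = rev ` y \<Longrightarrow> x = y"
  using rev_rev_image by metis

lemma pull_exact_middle:
  assumes uv: "conflation \<A> \<C> u v" and t: "0 < t" and s: "s \<in> YE t (Cod \<A> u) G"
    and z: "s \<lhd> u = yz t (Dom \<A> u) G"
  obtains s' where "s' \<in> YE t (Cod \<A> v) G" "s = s' \<lhd> v"
proof -
  interpret op: extension_closed_subcategory "opcat \<A>" \<C> by (rule extension_closed_opcat)
  note c = conflationD[OF uv] and G = Yext_ends(2)[OF s]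
  have 1: "conflation (opcat \<A>) \<C> v u" using uv by simp
  have 2: "rev ` s \<in> Yext (opcat \<A>) \<C> t G (Cod (opcat \<A>) v)" using Yext_opcat[OF s t] c by simp
  have 3: "push (opcat \<A>) \<C> u (rev ` s) = yzero (opcat \<A>) \<C> t G (Cod (opcat \<A>) u)"
    using z c G t by (simp add: push_opcat yzero_opcat)
  obtain e where e: "e \<in> Yext (opcat \<A>) \<C> t G (Dom (opcat \<A>) v)" "rev ` s = push (opcat \<A>) \<C> v e"
    by (rule op.push_exact_middle[OF 1 t 2 3])
  have "rev ` e \<in> YE t (Cod \<A> v) G" using Yext_opcatD[OF e(1) t] by simp
  moreover have "s = rev ` e \<lhd> v"
    by (rule rev_image_eq) (use e(2) push_opcat[of v "rev ` e"] in simp)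
  ultimately show ?thesis using that by blast
qed

lemma pull_exact_connecting:
  assumes uv: "conflation \<A> \<C> u v" and t: "0 < t" and s: "s \<in> YE t (Dom \<A> u) G"
    and z: "rsplice \<A> \<C> s (u, v) = yz (Suc t) (Cod \<A> v) G"
  obtains s' where "s' \<in> YE t (Cod \<A> u) G" "s = s' \<lhd> u"
proof -
  interpret op: extension_closed_subcategory "opcat \<A>" \<C> by (rule extension_closed_opcat)
  note c = conflationD[OF uv] and G = Yext_ends(2)[OF s]
  have 1: "conflation (opcat \<A>) \<C> v u" using uv by simp
  have 2: "rev ` s \<in> Yext (opcat \<A>) \<C> t G (Cod (opcat \<A>) u)" using Yext_opcat[OF s t] by simp
  have 3: "splice (opcat \<A>) \<C> (v, u) (rev ` s) = yzero (opcat \<A>) \<C> (Suc t) G (Dom (opcat \<A>) v)"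
    using z c G by (simp add: splice_opcat yzero_opcat)
  obtain e where e: "e \<in> Yext (opcat \<A>) \<C> t G (Cod (opcat \<A>) v)" "rev ` s = push (opcat \<A>) \<C> u e"
    by (rule op.push_exact_connecting[OF 1 t 2 3])
  have "rev ` e \<in> YE t (Cod \<A> u) G" using Yext_opcatD[OF e(1) t] c by simp
  moreover have "s = rev ` e \<lhd> u"
    by (rule rev_image_eq) (use e(2) push_opcat[of u "rev ` e"] in simp)
  ultimately show ?thesis using that by blast
qed

lemma pull_exact_splice:
  assumes uv: "conflation \<A> \<C> u v" and t: "0 < t" and s: "s \<in> YE (Suc t) (Cod \<A> v) G"
    and z: "s \<lhd> v = yz (Suc t) (Cod \<A> u) G"
  obtains s' where "s' \<in> YE t (Dom \<A> u) G" "s = rsplice \<A> \<C> s' (u, v)"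
proof -
  interpret op: extension_closed_subcategory "opcat \<A>" \<C> by (rule extension_closed_opcat)
  note c = conflationD[OF uv] and G = Yext_ends(2)[OF s]
  have 1: "conflation (opcat \<A>) \<C> v u" using uv by simp
  have 2: "rev ` s \<in> Yext (opcat \<A>) \<C> (Suc t) G (Dom (opcat \<A>) v)" using Yext_opcat[OF s] by simp
  have 3: "push (opcat \<A>) \<C> v (rev ` s) = yzero (opcat \<A>) \<C> (Suc t) G (Cod (opcat \<A>) v)"
    using z c G by (simp add: push_opcat yzero_opcat)
  obtain e where e: "e \<in> Yext (opcat \<A>) \<C> t G (Cod (opcat \<A>) u)"
    "rev ` s = splice (opcat \<A>) \<C> (v, u) e"
    by (rule op.push_exact_splice[OF 1 t 2 3])
  have "rev ` e \<in> YE t (Dom \<A> u) G" using Yext_opcatD[OF e(1) t] by simp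
  moreover have "s = rsplice \<A> \<C> (rev ` e) (u, v)"
    by (rule rev_image_eq) (use e(2) splice_opcat[of v u "rev ` e"] in simp)
  ultimately show ?thesis using that by blast
qed

lemma rsplice_in:
  assumes uv: "conflation \<A> \<C> u v" and t: "0 < t" and s: "s \<in> YE t (Dom \<A> u) G"
  shows "rsplice \<A> \<C> s (u, v) \<in> YE (Suc t) (Cod \<A> v) G"
proof -
  interpret op: extension_closed_subcategory "opcat \<A>" \<C> by (rule extension_closed_opcat)
  have "splice (opcat \<A>) \<C> (v, u) (rev ` s) \<in> Yext (opcat \<A>) \<C> (Suc t) G (Cod \<A> v)"
    using op.splice_in[of "(v, u)" "rev ` s" t G] Yext_opcat[OF s t] uv t by simp
  then show ?thesis using Yext_opcatD[of _ "Suc t" G "Cod \<A> v"] by (simp add: rsplice_def)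
qed

lemma push_rsplice:
  assumes uv: "conflation \<A> \<C> u v" and t: "0 < t" and s: "s \<in> YE t (Dom \<A> u) G"
    and f: "f \<in> Hom \<A> G G'" "G' \<in> \<C>"
  shows "f \<rhd> rsplice \<A> \<C> s (u, v) = rsplice \<A> \<C> (f \<rhd> s) (u, v)"
proof -
  interpret op: extension_closed_subcategory "opcat \<A>" \<C> by (rule extension_closed_opcat)
  have "pull (opcat \<A>) \<C> f (splice (opcat \<A>) \<C> (v, u) (rev ` s))
      = splice (opcat \<A>) \<C> (v, u) (pull (opcat \<A>) \<C> f (rev ` s))"
    using op.splice_pull[of "(v, u)" "rev ` s" t G f G'] Yext_opcat[OF s t] uv t f by simp
  then have "rev ` (f \<rhd> rsplice \<A> \<C> s (u, v)) = rev ` rsplice \<A> \<C> (f \<rhd> s) (u, v)"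
    by (simp add: splice_opcat pull_opcat)
  then show ?thesis by (rule rev_image_eq)
qed

lemma rsplice_yz:
  assumes uv: "conflation \<A> \<C> u v" and t: "0 < t" "G \<in> \<C>"
  shows "rsplice \<A> \<C> (yz t (Dom \<A> u) G) (u, v) = yz (Suc t) (Cod \<A> v) G"
proof -
  interpret op: extension_closed_subcategory "opcat \<A>" \<C> by (rule extension_closed_opcat)
  note c = conflationD[OF uv]
  have "splice (opcat \<A>) \<C> (v, u) (yzero (opcat \<A>) \<C> t G (Dom \<A> u))
      = yzero (opcat \<A>) \<C> (Suc t) G (Cod \<A> v)"
    using op.splice_yz[of "(v, u)" t G] uv t by simp
  then have "rev ` rsplice \<A> \<C> (yz t (Dom \<A> u) G) (u, v) = rev ` yz (Suc t) (Cod \<A> v) G"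
    using c t by (simp add: splice_opcat yzero_opcat)
  then show ?thesis by (rule rev_image_eq)
qed

end

section \<open>Comparison with the groups Ext\<close>

lemma seq_pushoutI:
  assumes "E = i # d # ds" "F = i' # d' # ds" "pushout \<A> i f f' i'"
    "d' \<in> Hom \<A> (Cod \<A> i') (Cod \<A> d)" "d' \<cdot>\<^bsub>\<A>\<^esub> f' = d"
    "d' \<cdot>\<^bsub>\<A>\<^esub> i' = Zero \<A> (Dom \<A> i') (Cod \<A> d)"
  shows "seq_pushout \<A> f E F"
  using assms unfolding seq_pushout_def by blast

lemma seq_pullbackI:
  assumes "E = ds @ [d, p]" "F = ds @ [d', p']" "pullback \<A> p f f' p'"
    "d' \<in> Hom \<A> (Dom \<A> d) (Dom \<A> p')" "f' \<cdot>\<^bsub>\<A>\<^esub> d' = d"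
    "p' \<cdot>\<^bsub>\<A>\<^esub> d' = Zero \<A> (Dom \<A> d) (Cod \<A> p')"
  shows "seq_pullback \<A> f E F"
  using assms unfolding seq_pullback_def by blast

lemma seq_pullback_opcat:
  "seq_pullback \<A> f E F \<longleftrightarrow> seq_pushout (opcat \<A>) f (rev E) (rev F)"
proof
  assume "seq_pullback \<A> f E F"
  then obtain ds d p d' p' f' where *: "E = ds @ [d, p]" "F = ds @ [d', p']" "pullback \<A> p f f' p'"
    "d' \<in> Hom \<A> (Dom \<A> d) (Dom \<A> p')" "f' \<cdot>\<^bsub>\<A>\<^esub> d' = d"
    "p' \<cdot>\<^bsub>\<A>\<^esub> d' = Zero \<A> (Dom \<A> d) (Cod \<A> p')"
    unfolding seq_pullback_def by blast
  show "seq_pushout (opcat \<A>) f (rev E) (rev F)"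
    by (rule seq_pushoutI[of _ p d "rev ds" _ p' d' _ _ f']) (use * in simp_all)
next
  assume "seq_pushout (opcat \<A>) f (rev E) (rev F)"
  then obtain p d ds p' d' f' where
    *: "rev E = p # d # ds" "rev F = p' # d' # ds" "pushout (opcat \<A>) p f f' p'"
      "d' \<in> Hom (opcat \<A>) (Cod (opcat \<A>) p') (Cod (opcat \<A>) d)" "d' \<cdot>\<^bsub>opcat \<A>\<^esub> f' = d"
      "d' \<cdot>\<^bsub>opcat \<A>\<^esub> p' = Zero (opcat \<A>) (Dom (opcat \<A>) p') (Cod (opcat \<A>) d)"
    unfolding seq_pushout_def by blast
  have "E = rev ds @ [d, p]" "F = rev ds @ [d', p']"
    using arg_cong[OF *(1), of rev] arg_cong[OF *(2), of rev] by simp_all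
  then show "seq_pullback \<A> f E F"
    by (rule seq_pullbackI[of _ _ _ _ _ _ _ _ _ f']) (use *(3-) in simp_all)
qed

lemma seq_baer_sumI:
  assumes "\<And>k. k \<le> t \<Longrightarrow> biproduct \<A> (Dom \<A> (E ! k)) (Dom \<A> (E' ! k)) (S k) (j1 k) (j2 k) (p1 k) (p2 k)"
    "biproduct \<A> A A (S (Suc t)) (j1 (Suc t)) (j2 (Suc t)) (p1 (Suc t)) (p2 (Suc t))"
    "seq_pushout \<A> (p1 0 \<boxplus>\<^bsub>\<A>\<^esub> p2 0)
      (map (\<lambda>k. j1 (Suc k) \<cdot>\<^bsub>\<A>\<^esub> (E ! k \<cdot>\<^bsub>\<A>\<^esub> p1 k) \<boxplus>\<^bsub>\<A>\<^esub>
        j2 (Suc k) \<cdot>\<^bsub>\<A>\<^esub> (E' ! k \<cdot>\<^bsub>\<A>\<^esub> p2 k)) [0..<Suc t]) G"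
    "seq_pullback \<A> (j1 (Suc t) \<boxplus>\<^bsub>\<A>\<^esub> j2 (Suc t)) G F"
  shows "seq_baer_sum \<A> t A E E' F"
  unfolding seq_baer_sum_def using assms by blast

context extension_closed_subcategory
begin

lemma sum_relI:
  assumes "biproduct \<A> B B S j1 j2 p1 p2" "biproduct \<A> A A T k1 k2 q1 q2" "chn es S T"
    "length es = length cs" "is_sum cs ds es j1 j2 p1 p2 k1 k2 q1 q2"
    "z = ((p1 \<boxplus> p2) \<rhd> cl es) \<lhd> (k1 \<boxplus> k2)"
  shows "sum_rel cs ds B A z"
  using assms unfolding sum_rel_def by blast

lemma cls_ext_rel:
  assumes "chn cs B A" "cs \<noteq> []"
  shows "cl cs = ext_rel \<A> \<C> (length cs) A B `` {seqof \<A> cs}"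
  using chain_hd_last[OF assms] by (simp add: cls_def)

lemma carrier_Ext:
  assumes "0 < t"
  shows "carrier (Ext \<A> \<C> t A B) = YE t A B"
proof -
  have "carrier (Ext \<A> \<C> t A B) = {E. exact_seq \<A> \<C> t A B E} // ext_rel \<A> \<C> t A B"
    by (simp add: Ext_def)
  also have "\<dots> = YE t A B"
  proof (intro equalityI subsetI)
    fix x
    assume "x \<in> {E. exact_seq \<A> \<C> t A B E} // ext_rel \<A> \<C> t A B"
    then obtain E where E: "exact_seq \<A> \<C> t A B E" "x = ext_rel \<A> \<C> t A B `` {E}"
      by (auto elim: quotientE)
    obtain cs where "cs \<noteq> []" "length cs = t" "chn cs B A" "E = seqof \<A> cs"
      by (rule exact_seq_chain[OF E(1)])
    then show "x \<in> YE t A B" using cls_ext_rel[of cs B A] YextI[of cs B A] E(2) by simp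
  next
    fix x
    assume "x \<in> YE t A B"
    then obtain cs where cs: "chn cs B A" "length cs = t" "cs \<noteq> []" "x = cl cs"
      by (rule YextE) (rule assms)
    then show "x \<in> {E. exact_seq \<A> \<C> t A B E} // ext_rel \<A> \<C> t A B"
      using quotientI[of "seqof \<A> cs" _ "ext_rel \<A> \<C> t A B"] cls_ext_rel[OF cs(1,3)]
        chain_exact_seq[OF cs(1,3)] by simp
  qed
  finally show ?thesis .
qed

lemma Yext_memE:
  assumes "x \<in> YE t A B" "0 < t" "E \<in> x"
  obtains cs where "chn cs B A" "length cs = t" "cs \<noteq> []" "E = seqof \<A> cs" "x = cl cs"
proof -
  obtain cs where cs: "chn cs B A" "length cs = t" "cs \<noteq> []" "x = cl cs" by (rule YextE[OF assms(1,2)])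
  have e: "equivclp (seq_morphism \<A> \<C> t A B) (seqof \<A> cs) E"
    using assms(3) cls_alt[OF cs(1,3)] cs by simp
  have "exact_seq \<A> \<C> t A B E"
    using equivclp_exact[OF e] chain_exact_seq[OF cs(1,3)] cs by simp
  then obtain ds where ds: "ds \<noteq> []" "length ds = t" "chn ds B A" "E = seqof \<A> ds"
    by (rule exact_seq_chain)
  have "cl ds = cl cs"
    unfolding cls_alt[OF cs(1,3)] cls_alt[OF ds(3,1)]
    using e ds(2,4) cs(2) by (auto intro: equivclp_trans equivclp_sym)
  then show ?thesis using that[OF ds(3,2,1,4)] cs(4) by simp
qed

text \<open>The operations on \<open>Ext\<close> are closures of sets of sequences built from all
  representatives. To evaluate one, it suffices that the set is nonempty and lies in a single class;
  each comparison below has these two halves.\<close>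

lemma ext_rel_Image:
  assumes "x \<in> YE t A B" "0 < t" "S \<noteq> {}" "S \<subseteq> x"
  shows "ext_rel \<A> \<C> t A B `` S = x"
proof -
  have "ext_rel \<A> \<C> t A B `` {E} = x" if "E \<in> S" for E
  proof -
    have "E \<in> x" using that assms(4) by blast
    then obtain cs where "chn cs B A" "length cs = t" "cs \<noteq> []" "E = seqof \<A> cs" "x = cl cs"
      by (rule Yext_memE[OF assms(1,2)])
    then show ?thesis using cls_ext_rel[of cs B A] by simp
  qed
  moreover have "ext_rel \<A> \<C> t A B `` S = (\<Union>E\<in>S. ext_rel \<A> \<C> t A B `` {E})" by blast
  ultimately show ?thesis using assms(3) by auto
qed

text \<open>Push-outs of sequences are given by equations for the second arrow \<open>d'\<close>. By
  the universal property these determine it, and the deflation of the pushed-out conflation,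
  composed with the next inflation if there is one, satisfies them.\<close>

lemma seq_pushout_chain:
  assumes ch: "chn cs B A" "cs \<noteq> []" and f: "f \<in> Hom \<A> B B'" "B' \<in> \<C>"
    and po: "seq_pushout \<A> f (seqof \<A> cs) F"
  obtains ds where "chn ds B' A" "length ds = length cs" "F = seqof \<A> ds" "ladder \<A> cs ds f (Id \<A> A)"
proof -
  obtain i p es where cs: "cs = (i, p) # es" using ch(2) by (cases cs) auto
  have c: "conflation \<A> \<C> i p" "Dom \<A> i = B" "chn es (Cod \<A> p) A" using ch(1) cs by auto
  note cd = conflationD[OF c(1)]
  define e where "e = (if es = [] then p else fst (hd es) \<cdot> p)"
  define tl' where "tl' = (if es = [] then [] else tl (seqof \<A> es))"
  have sq: "seqof \<A> cs = i # e # tl'" using cs by (simp add: e_def tl'_def)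
  obtain i' d' f' where F: "F = i' # d' # tl'" "pushout \<A> i f f' i'"
    "d' \<in> Hom \<A> (Cod \<A> i') (Cod \<A> e)" "d' \<cdot> f' = e" "d' \<cdot> i' = Zero \<A> (Dom \<A> i') (Cod \<A> e)"
    using po unfolding seq_pushout_def sq by auto
  obtain p' where P: "ses (Cod \<A> f) (Cod \<A> i') (Cod \<A> p) i' p'" "p' \<cdot> f' = p"
    by (rule pushout_ses[OF conflation_ses[OF c(1)] F(2)])
  note po = pushoutD[OF F(2)] and s = sesD[OF P(1)]
  note t = s(1,2)[unfolded hom_iff] F(3)[unfolded hom_iff] f(1)[unfolded hom_iff]
  have f': "f' \<in> Hom \<A> (Cod \<A> i) (Cod \<A> i')" "i' \<in> Hom \<A> (Cod \<A> f) (Cod \<A> i')"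
    using po by (simp_all add: hom_iff)
  have o: "B \<in> Obj \<A>" "B' \<in> Obj \<A>" "Cod \<A> p \<in> Obj \<A>" using c cd f C_obj by auto
  have c': "conflation \<A> \<C> i' p'" using ses_conflation(1)[OF P(1)] f t cd by simp
  have m: "cmor \<A> (i, p) (i', p') f (Id \<A> (Cod \<A> p))"
    unfolding cmor_def by (rule exI[of _ f']) (use f' c cd po t o P in \<open>simp add: hom_iff\<close>)
  define ds where "ds = (i', p') # es"
  have "F = seqof \<A> ds"
  proof (cases "es = []")
    case True
    have "d' = p'"
      by (rule pushout_eqI[OF F(2) f' _ s(2)]) (use True F(3-5) P(2) s(5) t in \<open>simp_all add: e_def hom_iff\<close>)
    then show ?thesis using F(1) True by (simp add: ds_def tl'_def)
  next
    case False
    define j where "j = fst (hd es)"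
    have tj: "j \<in> Arr \<A>" "Dom \<A> j = Cod \<A> p"
      using seqof_types(1)[OF c(3) False, of 0] seqof_types(3)[OF c(3) False] seqof_nth_0[OF False]
      by (simp_all add: j_def)
    have e: "e = j \<cdot> p" using False by (simp add: e_def j_def)
    have "d' = j \<cdot> p'"
    proof (rule pushout_eqI[OF F(2) f' F(3)])
      show "j \<cdot> p' \<in> Hom \<A> (Cod \<A> i') (Cod \<A> e)" using tj t cd e by (simp add: hom_iff)
      show "d' \<cdot> f' = (j \<cdot> p') \<cdot> f'" using F(4) e P(2) tj t po by simp
      show "d' \<cdot> i' = (j \<cdot> p') \<cdot> i'" using F(5) e s(5) tj t po cd o by simp
    qed
    then show ?thesis using F(1) False by (simp add: ds_def tl'_def j_def)
  qed
  moreover have "ladder \<A> cs ds f (Id \<A> A)"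
    using m ladder_refl[OF c(3)] cs by (auto simp: ds_def)
  moreover have "chn ds B' A" "length ds = length cs" using c' c t cs by (simp_all add: ds_def)
  ultimately show ?thesis using that by blast
qed

lemma seq_pushout_exists:
  assumes ch: "chn cs B A" "cs \<noteq> []" and f: "f \<in> Hom \<A> B B'" "B' \<in> \<C>"
  obtains F where "seq_pushout \<A> f (seqof \<A> cs) F"
proof -
  obtain i p es where cs: "cs = (i, p) # es" using ch(2) by (cases cs) auto
  have c: "conflation \<A> \<C> i p" "Dom \<A> i = B" "chn es (Cod \<A> p) A" using ch(1) cs by auto
  have f': "f \<in> Hom \<A> (Dom \<A> i) B'" using f c by simp
  obtain P i' p' y where P: "ses B' P (Cod \<A> p) i' p'" "y \<in> Hom \<A> (Cod \<A> i) P" "p' \<cdot> y = p"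
    "pushout \<A> i f y i'"
    by (rule pushout_ses_exists[OF conflation_ses[OF c(1)] f'])
  note cd = conflationD[OF c(1)] and s = sesD[OF P(1)]
  note t = s(1,2)[unfolded hom_iff] P(2)[unfolded hom_iff]
  have o: "B' \<in> Obj \<A>" using C_obj f by blast
  show ?thesis
  proof (cases "es = []")
    case True
    have "seq_pushout \<A> f (seqof \<A> cs) [i', p']"
      unfolding cs
      by (rule seq_pushoutI[of _ i p "[]" _ i' p' _ _ y])
        (use True P t s(5) in \<open>simp_all add: hom_iff\<close>)
    then show ?thesis by (rule that)
  next
    case False
    define j where "j = fst (hd es)"
    have tj: "j \<in> Arr \<A>" "Dom \<A> j = Cod \<A> p"
      using seqof_types(1)[OF c(3) False, of 0] seqof_types(3)[OF c(3) False] seqof_nth_0[OF False]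
      by (simp_all add: j_def)
    have d: "(j \<cdot> p') \<cdot> y = j \<cdot> p" "(j \<cdot> p') \<cdot> i' = Zero \<A> B' (Cod \<A> j)"
      using tj t P(3) s(5) o by simp_all
    have "seq_pushout \<A> f (seqof \<A> cs) (i' # (j \<cdot> p') # tl (seqof \<A> es))"
      unfolding cs
      by (rule seq_pushoutI[of _ i "j \<cdot> p" "tl (seqof \<A> es)" _ i' "j \<cdot> p'" _ _ y])
        (use False P t tj cd d in \<open>simp_all add: hom_iff flip: j_def\<close>)
    then show ?thesis by (rule that)
  qed
qed

lemma seq_pullback_chain:
  assumes ch: "chn cs B A" "cs \<noteq> []" and f: "f \<in> Hom \<A> A' A" "A' \<in> \<C>"
    and pb: "seq_pullback \<A> f (seqof \<A> cs) F"
  obtains ds where "chn ds B A'" "length ds = length cs" "F = seqof \<A> ds" "ladder \<A> ds cs (Id \<A> B) f"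
proof -
  interpret op: extension_closed_subcategory "opcat \<A>" \<C> by (rule extension_closed_opcat)
  have 1: "chain (opcat \<A>) \<C> (dch cs) A B" "dch cs \<noteq> []" "f \<in> Hom (opcat \<A>) A A'"
    "seq_pushout (opcat \<A>) f (seqof (opcat \<A>) (dch cs)) (rev F)"
    using ch f(1) pb by (simp_all add: seqof_opcat seq_pullback_opcat)
  obtain ds where ds: "chain (opcat \<A>) \<C> ds A' B" "length ds = length (dch cs)"
    "rev F = seqof (opcat \<A>) ds" "ladder (opcat \<A>) (dch cs) ds f (Id (opcat \<A>) B)"
    by (rule op.seq_pushout_chain[OF 1(1-3) f(2) 1(4)])
  have 2: "chn (dch ds) B A'" using ds(1) chain_opcat[of \<A> \<C> "dch ds" A' B] by simp
  have "F = seqof \<A> (dch ds)"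
    using ds(3) seqof_opcat[of \<A> "dch ds"] by simp
  moreover have "ladder \<A> (dch ds) cs (Id \<A> B) f"
    using ds(4) ladder_opcat[OF 2 ch(1), of f "Id \<A> B"] by simp
  ultimately show ?thesis using that[OF 2] ds(2) by simp
qed

lemma seq_pullback_exists:
  assumes ch: "chn cs B A" "cs \<noteq> []" and f: "f \<in> Hom \<A> A' A" "A' \<in> \<C>"
  obtains F where "seq_pullback \<A> f (seqof \<A> cs) F"
proof -
  interpret op: extension_closed_subcategory "opcat \<A>" \<C> by (rule extension_closed_opcat)
  have 1: "chain (opcat \<A>) \<C> (dch cs) A B" "dch cs \<noteq> []" "f \<in> Hom (opcat \<A>) A A'"
    using ch f(1) by simp_all
  obtain F where "seq_pushout (opcat \<A>) f (seqof (opcat \<A>) (dch cs)) F"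
    by (rule op.seq_pushout_exists[OF 1 f(2)])
  then have "seq_pullback \<A> f (seqof \<A> cs) (rev F)" by (simp add: seqof_opcat seq_pullback_opcat)
  then show ?thesis by (rule that)
qed

lemma Ext_pushout_eq:
  assumes x: "x \<in> YE t X B" "0 < t" and f: "f \<in> Hom \<A> B B'" "B' \<in> \<C>"
  shows "Ext_pushout \<A> \<C> t X f x = f \<rhd> x"
proof -
  have "{F. \<exists>E\<in>x. seq_pushout \<A> f E F} \<subseteq> f \<rhd> x"
  proof clarify
    fix E F
    assume "E \<in> x" and po: "seq_pushout \<A> f E F"
    then obtain cs where cs: "chn cs B X" "length cs = t" "cs \<noteq> []" "E = seqof \<A> cs" "x = cl cs"
      by (elim Yext_memE[OF x])
    obtain ds where ds: "chn ds B' X" "length ds = length cs" "F = seqof \<A> ds" "ladder \<A> cs ds f (Id \<A> X)"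
      by (rule seq_pushout_chain[OF cs(1,3) f po[unfolded cs(4)]])
    show "F \<in> f \<rhd> x" using push_cls[OF ds(4) cs(1) ds(1) cs(3)] cls_self[of ds] cs(5) ds(3) by simp
  qed
  moreover have "{F. \<exists>E\<in>x. seq_pushout \<A> f E F} \<noteq> {}"
  proof -
    obtain cs where cs: "chn cs B X" "length cs = t" "cs \<noteq> []" "x = cl cs" by (rule YextE[OF x])
    obtain F where "seq_pushout \<A> f (seqof \<A> cs) F" by (rule seq_pushout_exists[OF cs(1,3) f])
    then show ?thesis using cls_self[of cs] cs(4) by blast
  qed
  ultimately show ?thesis
    unfolding Ext_pushout_def using ext_rel_Image[OF push_in[OF x f] x(2)] f(1) by (simp add: hom_iff)
qed

lemma Ext_pullback_eq:
  assumes x: "x \<in> YE t A X" "0 < t" and f: "f \<in> Hom \<A> A' A" "A' \<in> \<C>"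
  shows "Ext_pullback \<A> \<C> t X f x = x \<lhd> f"
proof -
  have "{F. \<exists>E\<in>x. seq_pullback \<A> f E F} \<subseteq> x \<lhd> f"
  proof clarify
    fix E F
    assume "E \<in> x" and po: "seq_pullback \<A> f E F"
    then obtain cs where cs: "chn cs X A" "length cs = t" "cs \<noteq> []" "E = seqof \<A> cs" "x = cl cs"
      by (elim Yext_memE[OF x])
    obtain ds where ds: "chn ds X A'" "length ds = length cs" "F = seqof \<A> ds" "ladder \<A> ds cs (Id \<A> X) f"
      by (rule seq_pullback_chain[OF cs(1,3) f po[unfolded cs(4)]])
    have "ds \<noteq> []" using ds(2) cs(3) by auto
    then show "F \<in> x \<lhd> f" using pull_cls[OF ds(4,1) cs(1)] cls_self[of ds] cs(5) ds(3) by simp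
  qed
  moreover have "{F. \<exists>E\<in>x. seq_pullback \<A> f E F} \<noteq> {}"
  proof -
    obtain cs where cs: "chn cs X A" "length cs = t" "cs \<noteq> []" "x = cl cs" by (rule YextE[OF x])
    obtain F where "seq_pullback \<A> f (seqof \<A> cs) F" by (rule seq_pullback_exists[OF cs(1,3) f])
    then show ?thesis using cls_self[of cs] cs(4) by blast
  qed
  ultimately show ?thesis
    unfolding Ext_pullback_def using ext_rel_Image[OF pull_in[OF x f] x(2)] f(1) by (simp add: hom_iff)
qed

text \<open>Direct sum, push-out along the codiagonal and pull-back along the diagonal are followed
  on chains, where they produce the class described by \<open>sum_rel\<close>.\<close>

lemma seq_baer_sum_mem:
  assumes cs: "chn cs B A" "length cs = t" "cs \<noteq> []" and ds: "chn ds B A" "length ds = t"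
    and b: "seq_baer_sum \<A> t A (seqof \<A> cs) (seqof \<A> ds) F"
  shows "F \<in> cl cs \<oplus> cl ds"
proof -
  obtain S j1 j2 p1 p2 G where 1:
    "\<And>k. k \<le> t \<Longrightarrow> biproduct \<A> (Dom \<A> (seqof \<A> cs ! k)) (Dom \<A> (seqof \<A> ds ! k)) (S k) (j1 k) (j2 k) (p1 k) (p2 k)"
    "biproduct \<A> A A (S (Suc t)) (j1 (Suc t)) (j2 (Suc t)) (p1 (Suc t)) (p2 (Suc t))"
    "seq_pushout \<A> (p1 0 \<boxplus> p2 0)
          (map (\<lambda>k. j1 (Suc k) \<cdot> (seqof \<A> cs ! k \<cdot> p1 k) \<boxplus> j2 (Suc k) \<cdot> (seqof \<A> ds ! k \<cdot> p2 k)) [0..<Suc t]) G"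
    "seq_pullback \<A> (j1 (Suc t) \<boxplus> j2 (Suc t)) G F"
    using b unfolding seq_baer_sum_def by blast
  have ne: "ds \<noteq> []" "length ds = length cs" using cs ds by auto
  obtain es where es: "chn es (S 0) (S (Suc t))" "length es = t"
    "seqof \<A> es = map (\<lambda>k. j1 (Suc k) \<cdot> (seqof \<A> cs ! k \<cdot> p1 k) \<boxplus> j2 (Suc k) \<cdot> (seqof \<A> ds ! k \<cdot> p2 k)) [0..<Suc t]"
    "is_sum cs ds es (j1 0) (j2 0) (p1 0) (p2 0) (j1 (Suc t)) (j2 (Suc t)) (p1 (Suc t)) (p2 (Suc t))"
    using chain_sum[OF cs(1) ds(1) cs(3) ne(2), of S j1 j2 p1 p2] 1(1,2) cs(2) unfolding is_sum_def by blast
  have S0: "biproduct \<A> B B (S 0) (j1 0) (j2 0) (p1 0) (p2 0)"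
    using 1(1)[of 0] seqof_types(3)[OF cs(1,3)] seqof_types(3)[OF ds(1) ne(1)] by simp
  have h: "p1 0 \<boxplus> p2 0 \<in> Hom \<A> (S 0) B" "j1 (Suc t) \<boxplus> j2 (Suc t) \<in> Hom \<A> A (S (Suc t))"
    using biproductD(1-4)[OF S0] biproductD(1-4)[OF 1(2)] by (simp_all add: hom_iff)
  note C = chain_ends[OF cs(1)]
  have nes: "es \<noteq> []" using es(2) cs by auto
  obtain gs where gs: "chn gs B (S (Suc t))" "length gs = length es" "G = seqof \<A> gs"
    "ladder \<A> es gs (p1 0 \<boxplus> p2 0) (Id \<A> (S (Suc t)))"
    by (rule seq_pushout_chain[OF es(1) nes h(1) C(1) 1(3)[folded es(3)]])
  have ngs: "gs \<noteq> []" using gs(2) nes by auto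
  obtain fs where fs: "chn fs B A" "length fs = length gs" "F = seqof \<A> fs"
    "ladder \<A> fs gs (Id \<A> B) (j1 (Suc t) \<boxplus> j2 (Suc t))"
    by (rule seq_pullback_chain[OF gs(1) ngs h(2) C(2) 1(4)[unfolded gs(3)]])
  have nfs: "fs \<noteq> []" using fs(2) ngs by auto
  have fg: "cl fs = ((p1 0 \<boxplus> p2 0) \<rhd> cl es) \<lhd> (j1 (Suc t) \<boxplus> j2 (Suc t))"
    using pull_cls[OF fs(4,1) gs(1) nfs] push_cls[OF gs(4) es(1) gs(1) nes] by simp
  have "sum_rel cs ds B A (cl fs)"
    by (rule sum_relI[OF S0 1(2) es(1) _ es(4) fg]) (use es(2) cs(2) in simp)
  then have "cl cs \<oplus> cl ds = cl fs" by (rule yadd_cls[OF _ cs(1) ds(1) cs(3) ne(2)])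
  then show ?thesis using cls_self[of fs] fs(3) by simp
qed

lemma seq_baer_sum_exists:
  assumes cs: "chn cs B A" "length cs = t" "cs \<noteq> []" and ds: "chn ds B A" "length ds = t"
  obtains F where "seq_baer_sum \<A> t A (seqof \<A> cs) (seqof \<A> ds) F"
proof -
  have ne: "ds \<noteq> []" "length ds = length cs" using cs ds by auto
  obtain S j1 j2 p1 p2 where f:
    "\<forall>k\<le>length cs. biproduct \<A> (Dom \<A> (seqof \<A> cs ! k)) (Dom \<A> (seqof \<A> ds ! k)) (S k) (j1 k) (j2 k) (p1 k) (p2 k)"
    "biproduct \<A> A A (S (Suc (length cs))) (j1 (Suc (length cs))) (j2 (Suc (length cs)))
      (p1 (Suc (length cs))) (p2 (Suc (length cs)))"
    by (rule biproduct_family[OF cs(1) ds(1) cs(3) ne(2)])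
  note 1 = f(1)[rule_format] f(2)
  obtain es where es: "chn es (S 0) (S (Suc t))" "length es = t"
    "seqof \<A> es = map (\<lambda>k. j1 (Suc k) \<cdot> (seqof \<A> cs ! k \<cdot> p1 k) \<boxplus> j2 (Suc k) \<cdot> (seqof \<A> ds ! k \<cdot> p2 k)) [0..<Suc t]"
    using chain_sum[OF cs(1) ds(1) cs(3) ne(2), of S j1 j2 p1 p2] 1 cs(2) by blast
  have S0: "biproduct \<A> B B (S 0) (j1 0) (j2 0) (p1 0) (p2 0)"
    using 1(1)[of 0] seqof_types(3)[OF cs(1,3)] seqof_types(3)[OF ds(1) ne(1)] by simp
  have h: "p1 0 \<boxplus> p2 0 \<in> Hom \<A> (S 0) B" "j1 (Suc t) \<boxplus> j2 (Suc t) \<in> Hom \<A> A (S (Suc t))"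
    using biproductD(1-4)[OF S0] biproductD(1-4)[OF 1(2)] cs(2) by (simp_all add: hom_iff)
  note C = chain_ends[OF cs(1)]
  have nes: "es \<noteq> []" using es(2) cs by auto
  obtain G where G: "seq_pushout \<A> (p1 0 \<boxplus> p2 0) (seqof \<A> es) G"
    by (rule seq_pushout_exists[OF es(1) nes h(1) C(1)])
  obtain gs where gs: "chn gs B (S (Suc t))" "length gs = length es" "G = seqof \<A> gs"
    by (rule seq_pushout_chain[OF es(1) nes h(1) C(1) G])
  have ngs: "gs \<noteq> []" using gs(2) nes by auto
  obtain F where F: "seq_pullback \<A> (j1 (Suc t) \<boxplus> j2 (Suc t)) G F"
    using seq_pullback_exists[OF gs(1) ngs h(2) C(2)] gs(3) by blast
  have "seq_baer_sum \<A> t A (seqof \<A> cs) (seqof \<A> ds) F"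
    by (rule seq_baer_sumI[where S = S and ?j1.0 = j1 and ?j2.0 = j2 and ?p1.0 = p1 and ?p2.0 = p2 and G = G]) (use 1 cs(2) G[unfolded es(3)] F in simp_all)
  then show ?thesis by (rule that)
qed

lemma mult_Ext:
  assumes x: "x \<in> YE t A B" and y: "y \<in> YE t A B" and t: "0 < t"
  shows "x \<otimes>\<^bsub>Ext \<A> \<C> t A B\<^esub> y = x \<oplus> y"
proof -
  have "{F. \<exists>E\<in>x. \<exists>E'\<in>y. seq_baer_sum \<A> t A E E' F} \<subseteq> x \<oplus> y"
  proof clarify
    fix E E' F
    assume "E \<in> x" "E' \<in> y" and b: "seq_baer_sum \<A> t A E E' F"
    obtain cs where cs: "chn cs B A" "length cs = t" "cs \<noteq> []" "E = seqof \<A> cs" "x = cl cs"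
      by (rule Yext_memE[OF x t \<open>E \<in> x\<close>])
    obtain ds where ds: "chn ds B A" "length ds = t" "ds \<noteq> []" "E' = seqof \<A> ds" "y = cl ds"
      by (rule Yext_memE[OF y t \<open>E' \<in> y\<close>])
    show "F \<in> x \<oplus> y"
      using seq_baer_sum_mem[OF cs(1-3) ds(1,2)] b cs ds by simp
  qed
  moreover have "{F. \<exists>E\<in>x. \<exists>E'\<in>y. seq_baer_sum \<A> t A E E' F} \<noteq> {}"
  proof -
    obtain cs where cs: "chn cs B A" "length cs = t" "cs \<noteq> []" "x = cl cs" by (rule YextE[OF x t])
    obtain ds where ds: "chn ds B A" "length ds = t" "ds \<noteq> []" "y = cl ds" by (rule YextE[OF y t])
    obtain F where "seq_baer_sum \<A> t A (seqof \<A> cs) (seqof \<A> ds) F"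
      by (rule seq_baer_sum_exists[OF cs(1-3) ds(1,2)])
    then show ?thesis using cls_self[of cs] cls_self[of ds] cs(4) ds(4) by blast
  qed
  ultimately show ?thesis
    using ext_rel_Image[OF yadd_in[OF x y t] t] by (simp add: Ext_def)
qed

text \<open>Additivity holds for every arrow by \<open>push_yadd\<close>, so being an isomorphism is
  the same as being bijective.\<close>

lemma invertible_from_left_iff:
  assumes f: "f \<in> Hom \<A> M N" and C: "M \<in> \<C>" "N \<in> \<C>" and t: "0 < t"
  shows "invertible_from_left \<A> \<C> t f \<longleftrightarrow> (\<forall>X\<in>\<C>. bij_betw (push \<A> \<C> f) (YE t X M) (YE t X N))"
proof -
  have D: "Dom \<A> f = M" "Cod \<A> f = N" using f by (simp_all add: hom_iff)
  have "Ext_pushout \<A> \<C> t X f \<in> iso (Ext \<A> \<C> t X M) (Ext \<A> \<C> t X N)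
    \<longleftrightarrow> bij_betw (push \<A> \<C> f) (YE t X M) (YE t X N)" for X
  proof -
    have e: "Ext_pushout \<A> \<C> t X f x = f \<rhd> x" if "x \<in> YE t X M" for x
      by (rule Ext_pushout_eq[OF that t f C(2)])
    have "Ext_pushout \<A> \<C> t X f \<in> hom (Ext \<A> \<C> t X M) (Ext \<A> \<C> t X N)"
    proof (rule homI)
      fix x y
      assume "x \<in> carrier (Ext \<A> \<C> t X M)" "y \<in> carrier (Ext \<A> \<C> t X M)"
      then have xy: "x \<in> YE t X M" "y \<in> YE t X M" by (simp_all add: carrier_Ext[OF t])
      note i = push_in[OF xy(1) t f C(2)] push_in[OF xy(2) t f C(2)]
      show "Ext_pushout \<A> \<C> t X f x \<in> carrier (Ext \<A> \<C> t X N)"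
        using e[OF xy(1)] i(1) by (simp add: carrier_Ext[OF t])
      show "Ext_pushout \<A> \<C> t X f (x \<otimes>\<^bsub>Ext \<A> \<C> t X M\<^esub> y)
        = Ext_pushout \<A> \<C> t X f x \<otimes>\<^bsub>Ext \<A> \<C> t X N\<^esub> Ext_pushout \<A> \<C> t X f y"
        using mult_Ext[OF xy t] mult_Ext[OF i t] e[OF xy(1)] e[OF xy(2)] e[OF yadd_in[OF xy t]]
          push_yadd[OF xy t f C(2)] by simp
    qed
    moreover have "bij_betw (Ext_pushout \<A> \<C> t X f) (YE t X M) (YE t X N)
      \<longleftrightarrow> bij_betw (push \<A> \<C> f) (YE t X M) (YE t X N)"
      by (rule bij_betw_cong) (rule e)
    ultimately show ?thesis by (simp add: iso_def carrier_Ext[OF t])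
  qed
  then show ?thesis by (simp add: invertible_from_left_def D)
qed

lemma invertible_from_right_iff:
  assumes f: "f \<in> Hom \<A> M N" and C: "M \<in> \<C>" "N \<in> \<C>" and t: "0 < t"
  shows "invertible_from_right \<A> \<C> t f \<longleftrightarrow> (\<forall>X\<in>\<C>. bij_betw (pull \<A> \<C> f) (YE t N X) (YE t M X))"
proof -
  have D: "Dom \<A> f = M" "Cod \<A> f = N" using f by (simp_all add: hom_iff)
  have "Ext_pullback \<A> \<C> t X f \<in> iso (Ext \<A> \<C> t N X) (Ext \<A> \<C> t M X)
    \<longleftrightarrow> bij_betw (pull \<A> \<C> f) (YE t N X) (YE t M X)" for X
  proof -
    have e: "Ext_pullback \<A> \<C> t X f x = x \<lhd> f" if "x \<in> YE t N X" for x
      by (rule Ext_pullback_eq[OF that t f C(1)])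
    have "Ext_pullback \<A> \<C> t X f \<in> hom (Ext \<A> \<C> t N X) (Ext \<A> \<C> t M X)"
    proof (rule homI)
      fix x y
      assume "x \<in> carrier (Ext \<A> \<C> t N X)" "y \<in> carrier (Ext \<A> \<C> t N X)"
      then have xy: "x \<in> YE t N X" "y \<in> YE t N X" by (simp_all add: carrier_Ext[OF t])
      note i = pull_in[OF xy(1) t f C(1)] pull_in[OF xy(2) t f C(1)]
      show "Ext_pullback \<A> \<C> t X f x \<in> carrier (Ext \<A> \<C> t M X)"
        using e[OF xy(1)] i(1) by (simp add: carrier_Ext[OF t])
      show "Ext_pullback \<A> \<C> t X f (x \<otimes>\<^bsub>Ext \<A> \<C> t N X\<^esub> y)
        = Ext_pullback \<A> \<C> t X f x \<otimes>\<^bsub>Ext \<A> \<C> t M X\<^esub> Ext_pullback \<A> \<C> t X f y"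
        using mult_Ext[OF xy t] mult_Ext[OF i t] e[OF xy(1)] e[OF xy(2)] e[OF yadd_in[OF xy t]]
          pull_yadd[OF xy t f C(1)] by simp
    qed
    moreover have "bij_betw (Ext_pullback \<A> \<C> t X f) (YE t N X) (YE t M X)
      \<longleftrightarrow> bij_betw (pull \<A> \<C> f) (YE t N X) (YE t M X)"
      by (rule bij_betw_cong) (rule e)
    ultimately show ?thesis by (simp add: iso_def carrier_Ext[OF t])
  qed
  then show ?thesis by (simp add: invertible_from_right_def D)
qed

text \<open>For \<open>t \<ge> 2\<close> the sequence is spliced from
  \<open>B = B \<rightarrow> 0\<close>, copies of \<open>0 = 0 \<rightarrow> 0\<close>, and
  \<open>0 \<rightarrow> A = A\<close>; arrows through a splicing object \<open>0\<close> compose to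
  the zero arrows of the list.\<close>

lemma seq_zero_exact:
  assumes "seq_zero \<A> t A B E" "0 < t" "A \<in> \<C>" "B \<in> \<C>"
  shows "exact_seq \<A> \<C> t A B E"
proof (cases "t = 1")
  case True
  then obtain S j1 j2 p1 p2 where S: "biproduct \<A> B A S j1 j2 p1 p2" "E = [j1, p2]"
    using assms(1) unfolding seq_zero_def by auto
  note b = biproductD(1-4)[OF S(1)]
  show ?thesis
    using exact_seq.base[OF conflation_split[OF S(1) assms(4,3)]] b S(2) True by (simp add: hom_iff)
next
  case False
  then obtain m where m: "t = Suc (Suc m)"
    using assms(2) by (metis One_nat_def gr0_implies_Suc not0_implies_Suc)
  obtain Z where Z: "zero_object \<A> Z"
    and E: "E = (let Xs = B # replicate (t - 2) Z @ [A] in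
           Id \<A> B # map (\<lambda>k. Zero \<A> (Xs ! k) (Xs ! Suc k)) [0..<t - 1] @ [Id \<A> A])"
    using assms(1) False unfolding seq_zero_def by (auto simp: Let_def)
  note ZC = zero_object_C[OF Z]
  have o: "A \<in> Obj \<A>" "B \<in> Obj \<A>" "Z \<in> Obj \<A>" using assms(3,4) ZC C_obj by auto
  have idZ: "Id \<A> Z = Zero \<A> Z Z"
  proof -
    have "\<exists>!f. f \<in> Hom \<A> Z Z" using Z o unfolding zero_object_def by blast
    then show ?thesis using id_hom[OF o(3)] zero_hom[OF o(3,3)] by blast
  qed
  \<comment> \<open>There are \<open>m\<close> zero terms between the ends but \<open>m + 1\<close>
    splicing objects, all equal to \<open>Z\<close>. The left end is general because it becomes
    \<open>Z\<close> in the induction.\<close>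
  have seq: "exact_seq \<A> \<C> (Suc (Suc m)) A X
      (Id \<A> X # map (\<lambda>k. Zero \<A> ((X # replicate m Z @ [A]) ! k) ((X # replicate m Z @ [A]) ! Suc k)) [0..<Suc m] @ [Id \<A> A])"
    if "X \<in> \<C>" for X m
    using that
  proof (induction m arbitrary: X)
    case 0
    note t1 = conflation_trivial(1)[OF Z 0] and t2 = conflation_trivial(2)[OF Z assms(3)]
    have "exact_seq \<A> \<C> (Suc 0) A Z [Zero \<A> Z A, Id \<A> A]"
      by (rule exact_seq.base[OF t2]) (use o in simp_all)
    then have "exact_seq \<A> \<C> (Suc (Suc 0)) A X (Id \<A> X # (Zero \<A> Z A \<cdot> Zero \<A> X Z) # [Id \<A> A])"
      by (rule exact_seq.step[OF t1, rotated 2]) (use o C_obj[OF 0] in simp_all)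
    then show ?case using o C_obj[OF 0] by simp
  next
    case (Suc m)
    note t1 = conflation_trivial(1)[OF Z Suc.prems] and oX = C_obj[OF Suc.prems]
    let ?R = "map (\<lambda>k. Zero \<A> ((Z # replicate m Z @ [A]) ! k) ((Z # replicate m Z @ [A]) ! Suc k)) [0..<Suc m] @ [Id \<A> A]"
    have ex: "exact_seq \<A> \<C> (Suc (Suc (Suc m))) A X (Id \<A> X # (Id \<A> Z \<cdot> Zero \<A> X Z) # ?R)"
      by (rule exact_seq.step[OF t1 _ _ Suc.IH[OF ZC]]) (use o oX in simp_all)
    have eq: "map (\<lambda>k. Zero \<A> ((X # replicate (Suc m) Z @ [A]) ! k) ((X # replicate (Suc m) Z @ [A]) ! Suc k)) [0..<Suc (Suc m)] @ [Id \<A> A]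
      = (Id \<A> Z \<cdot> Zero \<A> X Z) # ?R"
      using o oX by (simp add: map_upt_Suc del: upt_Suc)
    show ?case unfolding eq by (rule ex)
  qed
  show ?thesis using seq[OF assms(4), of m] E m by (simp add: Let_def)
qed

lemma seq_zero_exists:
  assumes "0 < t" "A \<in> \<C>" "B \<in> \<C>"
  obtains E where "seq_zero \<A> t A B E"
proof (cases "t = 1")
  case True
  obtain S j1 j2 p1 p2 where "biproduct \<A> B A S j1 j2 p1 p2" using sub_biproduct[OF assms(3,2)] by blast
  then have "seq_zero \<A> t A B [j1, p2]" using True unfolding seq_zero_def by auto
  then show ?thesis by (rule that)
next
  case False
  obtain Z where Z: "zero_object \<A> Z" using ex_zero_object by blast
  then show ?thesis using that False unfolding seq_zero_def by auto
qed

text \<open>If all classes are equal to \<open>yz\<close>, so is the class of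
  \<open>seq_zero\<close>, since it is the class of an exact sequence. Hence the unit of
  \<open>Ext\<close> is \<open>yz\<close> in that case.\<close>

lemma Ext_trivial_iff:
  assumes "0 < t" "A \<in> \<C>" "B \<in> \<C>"
  shows "carrier (Ext \<A> \<C> t A B) = {\<one>\<^bsub>Ext \<A> \<C> t A B\<^esub>} \<longleftrightarrow> (\<forall>x\<in>YE t A B. x = yz t A B)"
proof
  assume "carrier (Ext \<A> \<C> t A B) = {\<one>\<^bsub>Ext \<A> \<C> t A B\<^esub>}"
  then show "\<forall>x\<in>YE t A B. x = yz t A B"
    using yz_in[OF assms] carrier_Ext[OF assms(1)] by (metis singletonD)
next
  assume *: "\<forall>x\<in>YE t A B. x = yz t A B"
  have "{E. seq_zero \<A> t A B E} \<subseteq> yz t A B"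
  proof clarify
    fix E
    assume "seq_zero \<A> t A B E"
    then obtain cs where cs: "cs \<noteq> []" "length cs = t" "chn cs B A" "E = seqof \<A> cs"
      using exact_seq_chain[OF seq_zero_exact[OF _ assms]] by metis
    then have "cl cs = yz t A B" using * YextI[OF cs(3)] by simp
    then show "E \<in> yz t A B" using cls_self[of cs] cs(4) by simp
  qed
  moreover have "{E. seq_zero \<A> t A B E} \<noteq> {}" using seq_zero_exists[OF assms] by auto
  ultimately have "\<one>\<^bsub>Ext \<A> \<C> t A B\<^esub> = yz t A B"
    using ext_rel_Image[OF yz_in[OF assms] assms(1)] by (simp add: Ext_def)
  moreover have "YE t A B = {yz t A B}"
  proof (intro equalityI subsetI)
    fix x
    assume "x \<in> YE t A B"
    then show "x \<in> {yz t A B}" using bspec[OF *] by blast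
  qed (use yz_in[OF assms] in blast)
  ultimately show "carrier (Ext \<A> \<C> t A B) = {\<one>\<^bsub>Ext \<A> \<C> t A B\<^esub>}"
    unfolding carrier_Ext[OF assms(1)] by simp
qed

lemma n_projective_iff:
  "n_projective \<A> \<C> n P \<longleftrightarrow> P \<in> \<C> \<and> (\<forall>i>n. \<forall>X\<in>\<C>. \<forall>x\<in>YE i P X. x = yz i P X)"
  unfolding n_projective_def using Ext_trivial_iff by (metis not_less_zero gr0I)

lemma n_injective_iff:
  "n_injective \<A> \<C> n P \<longleftrightarrow> P \<in> \<C> \<and> (\<forall>i>n. \<forall>X\<in>\<C>. \<forall>x\<in>YE i X P. x = yz i X P)"
  unfolding n_injective_def using Ext_trivial_iff by (metis not_less_zero gr0I)

lemma n_injective_opcat: "n_injective (opcat \<A>) \<C> n P \<longleftrightarrow> n_projective \<A> \<C> n P"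
proof -
  interpret op: extension_closed_subcategory "opcat \<A>" \<C> by (rule extension_closed_opcat)
  have eq: "(\<forall>x\<in>Yext (opcat \<A>) \<C> i X P. x = yzero (opcat \<A>) \<C> i X P) \<longleftrightarrow> (\<forall>x\<in>YE i P X. x = yz i P X)"
    if "n < i" "X \<in> \<C>" "P \<in> \<C>" for i X
  proof -
    have i: "0 < i" using that by simp
    show ?thesis
      unfolding yzero_opcat[OF i that(3,2)]
    proof (intro iffI ballI)
      fix x
      assume *: "\<forall>x\<in>Yext (opcat \<A>) \<C> i X P. x = rev ` yz i P X" and x: "x \<in> YE i P X"
      have "rev ` x = rev ` yz i P X" by (rule bspec[OF * Yext_opcat[OF x i]])
      then show "x = yz i P X" by (rule rev_image_eq)
    next
      fix x
      assume *: "\<forall>x\<in>YE i P X. x = yz i P X" and x: "x \<in> Yext (opcat \<A>) \<C> i X P"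
      have "rev ` x = yz i P X" by (rule bspec[OF * Yext_opcatD[OF x i]])
      then show "x = rev ` yz i P X" using rev_rev_image[of x] by simp
    qed
  qed
  have cong: "(\<forall>i>n. \<forall>X\<in>\<C>. L i X) \<longleftrightarrow> (\<forall>i>n. \<forall>X\<in>\<C>. R i X)"
    if "\<And>i X. n < i \<Longrightarrow> X \<in> \<C> \<Longrightarrow> L i X \<longleftrightarrow> R i X" for L R :: "nat \<Rightarrow> 'o \<Rightarrow> bool"
    using that by simp
  show ?thesis
    unfolding op.n_injective_iff n_projective_iff
    by (rule conj_cong[OF refl], rule cong, rule eq, assumption+)
qed

lemma n_projective_opcat: "n_projective (opcat \<A>) \<C> n P \<longleftrightarrow> n_injective \<A> \<C> n P"
proof -
  interpret op: extension_closed_subcategory "opcat \<A>" \<C> by (rule extension_closed_opcat)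
  show ?thesis using op.n_injective_opcat[of n P] by simp
qed

end

lemma n_Frobenius_category_opcat:
  assumes "n_Frobenius_category \<A> \<C> n"
  shows "n_Frobenius_category (opcat \<A>) \<C> n"
proof -
  interpret n_Frobenius_category \<A> \<C> n by fact
  interpret op: extension_closed_subcategory "opcat \<A>" \<C> by (rule extension_closed_opcat)
  show ?thesis
  proof unfold_locales
    fix X
    assume X: "X \<in> \<C>"
    obtain i where "inflation \<A> \<C> i" "Dom \<A> i = X" "n_injective \<A> \<C> n (Cod \<A> i)"
      using enough_n_injectives[OF X] by blast
    then show "\<exists>p. deflation (opcat \<A>) \<C> p \<and> n_projective (opcat \<A>) \<C> n (Dom (opcat \<A>) p) \<and>
        Cod (opcat \<A>) p = X"
      by (auto simp: deflation_def inflation_def n_projective_opcat)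
    obtain p where "deflation \<A> \<C> p" "n_projective \<A> \<C> n (Dom \<A> p)" "Cod \<A> p = X"
      using enough_n_projectives[OF X] by blast
    then show "\<exists>i. inflation (opcat \<A>) \<C> i \<and> Dom (opcat \<A>) i = X \<and>
        n_injective (opcat \<A>) \<C> n (Cod (opcat \<A>) i)"
      by (auto simp: deflation_def inflation_def n_injective_opcat)
  next
    show "n_projective (opcat \<A>) \<C> n X \<longleftrightarrow> n_injective (opcat \<A>) \<C> n X" for X
      using n_projective_iff_n_injective by (simp add: n_injective_opcat n_projective_opcat)
  qed
qed

section \<open>Invertible actions in \<open>n\<close>-Frobenius categories\<close>

context n_Frobenius_category
begin

lemma n_projective_zero:
  "\<lbrakk>n_projective \<A> \<C> n P; n < i; x \<in> YE i P X\<rbrakk> \<Longrightarrow> x = yz i P X"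
  using n_projective_iff Yext_ends(2) by blast

lemma n_injective_zero:
  "\<lbrakk>n_injective \<A> \<C> n P; n < i; x \<in> YE i X P\<rbrakk> \<Longrightarrow> x = yz i X P"
  using n_injective_iff Yext_ends(1) by blast

lemma syzygy:
  assumes "X \<in> \<C>"
  obtains u v where "conflation \<A> \<C> u v" "Cod \<A> v = X" "n_projective \<A> \<C> n (Cod \<A> u)"
proof -
  obtain p where p: "deflation \<A> \<C> p" "n_projective \<A> \<C> n (Dom \<A> p)" "Cod \<A> p = X"
    using enough_n_projectives[OF assms] by blast
  then obtain i where "conflation \<A> \<C> i p" unfolding deflation_def by blast
  then show ?thesis using that p conflationD(4) by metis
qed

text \<open>The surjective half of dimension shifting. It uses that \<open>Ext\<close> of the middle
  term vanishes in degree \<open>i + 1\<close>, which is the case from \<open>i = n\<close>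
  on.\<close>

lemma rsplice_surj:
  assumes uv: "conflation \<A> \<C> u v" "n_projective \<A> \<C> n (Cod \<A> u)" and i: "n \<le> i" "0 < i"
    and x: "x \<in> YE (Suc i) (Cod \<A> v) Y"
  obtains s where "s \<in> YE i (Dom \<A> u) Y" "x = rsplice \<A> \<C> s (u, v)"
proof -
  note c = conflationD[OF uv(1)]
  have v: "v \<in> Hom \<A> (Cod \<A> u) (Cod \<A> v)" using c by (simp add: hom_iff)
  have "x \<lhd> v \<in> YE (Suc i) (Cod \<A> u) Y" using pull_in[OF x _ v c(2)] by simp
  then have "x \<lhd> v = yz (Suc i) (Cod \<A> u) Y" using n_projective_zero[OF uv(2)] i by simp
  then show ?thesis using pull_exact_splice[OF uv(1) i(2) x] that by blast
qed

text \<open>The injective half of dimension shifting. Here \<open>Ext\<close> of the middle term has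
  to vanish in degree \<open>i\<close> itself, whence the strict bound.\<close>

lemma rsplice_eq_zero:
  assumes uv: "conflation \<A> \<C> u v" "n_projective \<A> \<C> n (Cod \<A> u)" and i: "n < i"
    and s: "s \<in> YE i (Dom \<A> u) Y" and z: "rsplice \<A> \<C> s (u, v) = yz (Suc i) (Cod \<A> v) Y"
  shows "s = yz i (Dom \<A> u) Y"
proof -
  note c = conflationD[OF uv(1)]
  have u: "u \<in> Hom \<A> (Dom \<A> u) (Cod \<A> u)" using c by (simp add: hom_iff)
  have i0: "0 < i" using i by simp
  obtain s' where s': "s' \<in> YE i (Cod \<A> u) Y" "s = s' \<lhd> u"
    by (rule pull_exact_connecting[OF uv(1) i0 s z])
  then show ?thesis
    using n_projective_zero[OF uv(2) i s'(1)] pull_yz[OF i0 u c(2,1) Yext_ends(2)[OF s]] by simp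
qed

lemma invertible_from_left_imp_right:
  assumes f: "f \<in> Hom \<A> M N" and C: "M \<in> \<C>" "N \<in> \<C>"
    and inv: "\<And>X. X \<in> \<C> \<Longrightarrow> bij_betw (push \<A> \<C> f) (YE (Suc n) X M) (YE (Suc n) X N)"
    and X: "X \<in> \<C>"
  shows "bij_betw (pull \<A> \<C> f) (YE (Suc n) N X) (YE (Suc n) M X)"
proof -
  obtain a where a: "inflation \<A> \<C> a" "Dom \<A> a = M" "n_injective \<A> \<C> n (Cod \<A> a)"
    using enough_n_injectives[OF C(1)] by blast
  obtain b where ab: "conflation \<A> \<C> a b" using a(1) unfolding inflation_def by blast
  define I where "I = Cod \<A> a"
  have I: "n_injective \<A> \<C> n I" "n_projective \<A> \<C> n I" "I \<in> \<C>"
    using a(3) n_projective_iff_n_injective conflationD(2)[OF ab] by (simp_all add: I_def)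
  obtain S j1 j2 p1 p2 where S: "biproduct \<A> N I S j1 j2 p1 p2" "S \<in> \<C>"
    using sub_biproduct[OF C(2) I(3)] by blast
  note bi = biproductD[OF S(1)] and ty = biproductD(1-4)[OF S(1), unfolded hom_iff]
  have "ses M I (Cod \<A> b) a b" using conflation_ses[OF ab] a(2) by (simp add: I_def)
  then obtain L i' p' u v where L: "ses N L (Cod \<A> b) i' p'" and uvs: "ses M S L u v" and pu: "p1 \<cdot> u = f"
    by (rule ses_graph[OF _ f S(1)])
  have LC: "L \<in> \<C>" using ses_conflation(2)[OF L C(2)] conflationD(3)[OF ab] by blast
  note uv = ses_conflation(1)[OF uvs C(1) LC] and u = sesD(1)[OF uvs] and v = sesD(2)[OF uvs]
  have D: "Dom \<A> u = M" "Cod \<A> u = S" "Cod \<A> v = L" using u v by (simp_all add: hom_iff)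
  have n0: "0 < Suc n" by simp
  \<comment> \<open>\<open>Ext\<close> into \<open>I\<close> vanishes in degree
    \<open>n + 1\<close>, so a class into the sum \<open>S\<close> is determined by its component in
    \<open>N\<close>.\<close>
  have p1_inj: "z = j1 \<rhd> p1 \<rhd> z" if z: "z \<in> YE (Suc n) G S" for z G
  proof -
    note pz = push_in[OF z n0 bi(3) C(2)] push_in[OF z n0 bi(4) I(3)]
    have "z = (j1 \<cdot> p1 \<boxplus> j2 \<cdot> p2) \<rhd> z" using push_id[OF z n0] bi(9) by simp
    also have "\<dots> = (j1 \<cdot> p1) \<rhd> z \<oplus> (j2 \<cdot> p2) \<rhd> z"
      using push_plus[OF z n0 _ _ S(2), of "j1 \<cdot> p1" "j2 \<cdot> p2"] ty by (simp add: hom_iff)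
    also have "\<dots> = j1 \<rhd> p1 \<rhd> z \<oplus> j2 \<rhd> p2 \<rhd> z"
      using push_comp[OF z n0 bi(3) C(2) bi(1) S(2)] push_comp[OF z n0 bi(4) I(3) bi(2) S(2)] by simp
    also have "p2 \<rhd> z = yz (Suc n) G I" by (rule n_injective_zero[OF I(1) _ pz(2)]) simp
    also have "j2 \<rhd> yz (Suc n) G I = yz (Suc n) G S"
      by (rule push_yz[OF n0 Yext_ends(1)[OF z] bi(2) I(3) S(2)])
    also have "j1 \<rhd> p1 \<rhd> z \<oplus> yz (Suc n) G S = j1 \<rhd> p1 \<rhd> z"
      by (rule yadd_zero(1)[OF push_in[OF pz(1) n0 bi(1) S(2)] n0])
    finally show ?thesis .
  qed
  have fu: "f \<rhd> x = p1 \<rhd> u \<rhd> x" if "x \<in> YE (Suc n) G M" for x G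
    using push_comp[OF that n0 u S(2) bi(3) C(2)] pu by simp
  have u_inj: "x = yz (Suc n) G M" if x: "x \<in> YE (Suc n) G M" "u \<rhd> x = yz (Suc n) G S" for x G
  proof -
    note G = Yext_ends(1)[OF x(1)]
    have "f \<rhd> x = f \<rhd> yz (Suc n) G M"
      using fu[OF x(1)] x(2) push_yz[OF n0 G bi(3) S(2) C(2)] push_yz[OF n0 G f C] by simp
    then show ?thesis
      using inv[OF G] x(1) yz_in[OF n0 G C(1)] unfolding bij_betw_def inj_on_def by blast
  qed
  have u_surj: "\<exists>x\<in>YE (Suc n) G M. z = u \<rhd> x" if z: "z \<in> YE (Suc n) G S" for z G
  proof -
    have "p1 \<rhd> z \<in> push \<A> \<C> f ` YE (Suc n) G M"
      using inv[OF Yext_ends(1)[OF z]] push_in[OF z n0 bi(3) C(2)] unfolding bij_betw_def by simp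
    then obtain x where x: "x \<in> YE (Suc n) G M" "p1 \<rhd> z = f \<rhd> x" by blast
    have "z = u \<rhd> x"
      using p1_inj[OF z] p1_inj[OF push_in[OF x(1) n0 u S(2)]] x(2) fu[OF x(1)] by simp
    then show ?thesis using x(1) by blast
  qed
  \<comment> \<open>The shift along a syzygy is natural in the coefficients. A class in degree
    \<open>n + 2\<close> at \<open>G\<close> comes from some \<open>s\<close> in degree
    \<open>n + 1\<close> at the kernel of \<open>q\<close>; injectivity of the shift with
    coefficients \<open>S\<close> gives \<open>u \<rhd> s = 0\<close>, and \<open>u_inj\<close>
    applies.\<close>
  have u_inj2: "x = yz (Suc (Suc n)) G M"
    if x: "x \<in> YE (Suc (Suc n)) G M" "u \<rhd> x = yz (Suc (Suc n)) G S" for x G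
  proof -
    note G = Yext_ends(1)[OF x(1)]
    obtain k q where kq: "conflation \<A> \<C> k q" "Cod \<A> q = G" "n_projective \<A> \<C> n (Cod \<A> k)"
      by (rule syzygy[OF G])
    note K = conflationD(1)[OF kq(1)]
    have "x \<in> YE (Suc (Suc n)) (Cod \<A> q) M" using x kq by simp
    then obtain s where s: "s \<in> YE (Suc n) (Dom \<A> k) M" "x = rsplice \<A> \<C> s (k, q)"
      by (rule rsplice_surj[OF kq(1,3), rotated 2]) simp_all
    have "rsplice \<A> \<C> (u \<rhd> s) (k, q) = yz (Suc (Suc n)) (Cod \<A> q) S"
      using push_rsplice[OF kq(1) n0 s(1) u S(2)] s(2) x(2) kq(2) by simp
    then have "u \<rhd> s = yz (Suc n) (Dom \<A> k) S"
      by (rule rsplice_eq_zero[OF kq(1,3) _ push_in[OF s(1) n0 u S(2)], rotated 1]) simp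
    then have "s = yz (Suc n) (Dom \<A> k) M" by (rule u_inj[OF s(1)])
    then show ?thesis using s(2) rsplice_yz[OF kq(1) n0 C(1)] kq(2) by simp
  qed
  have L1: "e = yz (Suc n) G L" if e: "e \<in> YE (Suc n) G L" for e G
  proof -
    note G = Yext_ends(1)[OF e]
    have e': "e \<in> YE (Suc n) G (Cod \<A> v)" using e D by simp
    have de: "(u, v) \<star> e \<in> YE (Suc (Suc n)) G M" using splice_in[of "(u, v)" e "Suc n" G] uv e' D by simp
    obtain Z where Z: "zero_object \<A> Z" using ex_zero_object by blast
    note ZC = zero_object_C[OF Z]
    have o: "Z \<in> Obj \<A>" "S \<in> Obj \<A>" "L \<in> Obj \<A>" using ZC S LC C_obj by auto
    \<comment> \<open>Consecutive maps compose to zero: pushed out along \<open>u\<close>, the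
      splice with \<open>(u, v)\<close> becomes a splice with the trivial conflation on
      \<open>S\<close>, whose quotient is zero.\<close>
    have "cmor \<A> (u, v) (Id \<A> S, Zero \<A> S Z) u (Zero \<A> L Z)"
      unfolding cmor_def by (rule exI[of _ "Id \<A> S"]) (use u v o in \<open>simp add: hom_iff\<close>)
    then have "u \<rhd> ((u, v) \<star> e) = (Id \<A> S, Zero \<A> S Z) \<star> (Zero \<A> L Z \<rhd> e)"
      using push_splice[of "(u, v)" "(Id \<A> S, Zero \<A> S Z)" e "Suc n" G] uv
        conflation_trivial(1)[OF Z S(2)] e' by simp
    also have "\<dots> = yz (Suc (Suc n)) G S"
      using push_Zero[OF e n0 ZC] splice_yz[of "(Id \<A> S, Zero \<A> S Z)" "Suc n" G]
        conflation_trivial(1)[OF Z S(2)] G o by simp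
    finally have "(u, v) \<star> e = yz (Suc (Suc n)) G (Dom \<A> u)" using u_inj2[OF de] D by simp
    then obtain e1 where e1: "e1 \<in> YE (Suc n) G S" "e = v \<rhd> e1"
      using push_exact_connecting[OF uv n0 e'] D by metis
    obtain x where x: "x \<in> YE (Suc n) G M" "e1 = u \<rhd> x" using u_surj[OF e1(1)] by blast
    have "e = (v \<cdot> u) \<rhd> x" using push_comp[OF x(1) n0 u S(2) v LC] e1 x by simp
    then show ?thesis using sesD(5)[OF uvs] push_Zero[OF x(1) n0 LC] by simp
  qed
  \<comment> \<open>\<open>m\<close> is the distance from degree \<open>n + 1\<close>. The object
    \<open>G\<close> is arbitrary because the shift replaces it by its syzygy; the surjective half
    is enough here.\<close>
  have "e = yz (Suc n + m) G L" if "e \<in> YE (Suc n + m) G L" for e G m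
    using that
  proof (induction m arbitrary: e G)
    case 0
    then show ?case using L1 by simp
  next
    case (Suc m)
    note G = Yext_ends(1)[OF Suc.prems]
    obtain k q where kq: "conflation \<A> \<C> k q" "Cod \<A> q = G" "n_projective \<A> \<C> n (Cod \<A> k)"
      by (rule syzygy[OF G])
    have "e \<in> YE (Suc (Suc n + m)) (Cod \<A> q) L" using Suc.prems kq by simp
    then obtain s where s: "s \<in> YE (Suc n + m) (Dom \<A> k) L" "e = rsplice \<A> \<C> s (k, q)"
      by (rule rsplice_surj[OF kq(1,3), rotated 2]) simp_all
    have "s = yz (Suc n + m) (Dom \<A> k) L" by (rule Suc.IH[OF s(1)])
    then show ?case using s(2) rsplice_yz[OF kq(1) _ LC, of "Suc n + m"] kq(2) by simp
  qed
  then have "n_injective \<A> \<C> n L"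
    unfolding n_injective_iff using LC by (metis Suc_leI le_Suc_ex)
  then have Lp: "n_projective \<A> \<C> n L" using n_projective_iff_n_injective by blast
  \<comment> \<open>The same use of \<open>I\<close> in the contravariant variable, where it counts
    as \<open>n\<close>-projective.\<close>
  have p1_pull: "z = z \<lhd> j1 \<lhd> p1" if z: "z \<in> YE (Suc n) S X" for z
  proof -
    note pz = pull_in[OF z n0 bi(1) C(2)] pull_in[OF z n0 bi(2) I(3)]
    have "z = z \<lhd> (j1 \<cdot> p1 \<boxplus> j2 \<cdot> p2)" using pull_id[OF z n0] bi(9) by simp
    also have "\<dots> = z \<lhd> (j1 \<cdot> p1) \<oplus> z \<lhd> (j2 \<cdot> p2)"
      using pull_plus[OF z n0 _ _ S(2), of "j1 \<cdot> p1" "j2 \<cdot> p2"] ty by (simp add: hom_iff)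
    also have "\<dots> = z \<lhd> j1 \<lhd> p1 \<oplus> z \<lhd> j2 \<lhd> p2"
      using pull_comp[OF z n0 bi(1) C(2) bi(3) S(2)] pull_comp[OF z n0 bi(2) I(3) bi(4) S(2)] by simp
    also have "z \<lhd> j2 = yz (Suc n) I X" by (rule n_projective_zero[OF I(2) _ pz(2)]) simp
    also have "yz (Suc n) I X \<lhd> p2 = yz (Suc n) S X" by (rule pull_yz[OF n0 bi(4) I(3) S(2) X])
    also have "z \<lhd> j1 \<lhd> p1 \<oplus> yz (Suc n) S X = z \<lhd> j1 \<lhd> p1"
      by (rule yadd_zero(1)[OF pull_in[OF pz(1) n0 bi(3) S(2)] n0])
    finally show ?thesis .
  qed
  have fp: "x \<lhd> f = x \<lhd> p1 \<lhd> u" if "x \<in> YE (Suc n) N X" for x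
    using pull_comp[OF that n0 bi(3) S(2) u C(1)] pu by simp
  \<comment> \<open>A class at \<open>S\<close> that \<open>u\<close> kills comes from
    \<open>Ext\<close> of \<open>L\<close> in degree \<open>n + 1\<close>, which vanishes as
    \<open>L\<close> is \<open>n\<close>-projective.\<close>
  have pu_zero: "z = yz (Suc n) S X" if z: "z \<in> YE (Suc n) S X" "z \<lhd> u = yz (Suc n) M X" for z
  proof -
    obtain s where s: "s \<in> YE (Suc n) L X" "z = s \<lhd> v"
      using pull_exact_middle[OF uv n0, of z X] z D by metis
    then show ?thesis
      using n_projective_zero[OF Lp _ s(1)] pull_yz[OF n0 v LC S(2) X] by simp
  qed
  have f_zero: "x = yz (Suc n) N X" if x: "x \<in> YE (Suc n) N X" "x \<lhd> f = yz (Suc n) M X" for x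
  proof -
    note xp = pull_in[OF x(1) n0 bi(3) S(2)]
    have "x = x \<lhd> p1 \<lhd> j1" using pull_comp[OF x(1) n0 bi(3) S(2) bi(1) C(2)] bi(5) pull_id[OF x(1) n0] by simp
    also have "x \<lhd> p1 = yz (Suc n) S X" using pu_zero[OF xp] fp[OF x(1)] x(2) by simp
    also have "yz (Suc n) S X \<lhd> j1 = yz (Suc n) N X" by (rule pull_yz[OF n0 bi(1) S(2) C(2) X])
    finally show ?thesis .
  qed
  \<comment> \<open>Pulling back is additive, so a trivial kernel is enough; \<open>y'\<close> is
    the negative of \<open>y\<close>.\<close>
  have inj: "x = y" if xy: "x \<in> YE (Suc n) N X" "y \<in> YE (Suc n) N X" "x \<lhd> f = y \<lhd> f" for x y
  proof -
    obtain y' where y': "y' \<in> YE (Suc n) N X" "y \<oplus> y' = yz (Suc n) N X"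
      by (rule yadd_neg[OF xy(2) n0])
    have "(x \<oplus> y') \<lhd> f = (y \<oplus> y') \<lhd> f"
      using pull_yadd[OF xy(1) y'(1) n0 f C(1)] pull_yadd[OF xy(2) y'(1) n0 f C(1)] xy(3) by simp
    also have "\<dots> = yz (Suc n) N X \<lhd> f" using y'(2) by simp
    also have "\<dots> = yz (Suc n) M X" by (rule pull_yz[OF n0 f C(2,1) X])
    finally have "x \<oplus> y' = yz (Suc n) N X" by (rule f_zero[OF yadd_in[OF xy(1) y'(1) n0]])
    then show ?thesis using yadd_zero_eq[OF xy(1,2) y'(1) n0] y'(2) by blast
  qed
  \<comment> \<open>The obstruction to extending \<open>s\<close> along \<open>u\<close> lies in
    degree \<open>n + 2\<close> at \<open>L\<close>, where everything vanishes. The extension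
    \<open>z\<close> at \<open>S\<close> is then replaced by its restriction to
    \<open>N\<close>.\<close>
  have surj: "\<exists>x\<in>YE (Suc n) N X. s = x \<lhd> f" if s: "s \<in> YE (Suc n) M X" for s
  proof -
    have "rsplice \<A> \<C> s (u, v) \<in> YE (Suc (Suc n)) (Cod \<A> v) X"
      using rsplice_in[OF uv n0, of s X] s D by simp
    then have "rsplice \<A> \<C> s (u, v) = yz (Suc (Suc n)) (Cod \<A> v) X"
      using n_projective_zero[OF Lp, of "Suc (Suc n)"] D by simp
    then obtain z where z: "z \<in> YE (Suc n) S X" "s = z \<lhd> u"
      using pull_exact_connecting[OF uv n0, of s X] s D by metis
    note zj = pull_in[OF z(1) n0 bi(1) C(2)]
    have "s = z \<lhd> j1 \<lhd> f" using fp[OF zj] p1_pull[OF z(1)] z(2) by simp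
    then show ?thesis using zj by blast
  qed
  show ?thesis
    unfolding bij_betw_def
  proof
    show "inj_on (pull \<A> \<C> f) (YE (Suc n) N X)" using inj by (rule inj_onI)
    show "pull \<A> \<C> f ` YE (Suc n) N X = YE (Suc n) M X"
    proof (intro equalityI subsetI)
      fix y
      assume "y \<in> pull \<A> \<C> f ` YE (Suc n) N X"
      then show "y \<in> YE (Suc n) M X" using pull_in[OF _ n0 f C(1)] by blast
    qed (use surj in blast)
  qed
qed

text \<open>Reversing all lists is an involution that carries the classes of one category
  bijectively to those of the other and conjugates \<open>push\<close> with
  \<open>pull\<close>.\<close>

lemma bij_betw_opcat:
  assumes t: "0 < t"
  shows "bij_betw (push (opcat \<A>) \<C> f) (Yext (opcat \<A>) \<C> t X N) (Yext (opcat \<A>) \<C> t X M)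
    \<longleftrightarrow> bij_betw (pull \<A> \<C> f) (YE t N X) (YE t M X)"
    and "bij_betw (pull (opcat \<A>) \<C> f) (Yext (opcat \<A>) \<C> t M X) (Yext (opcat \<A>) \<C> t N X)
    \<longleftrightarrow> bij_betw (push \<A> \<C> f) (YE t X M) (YE t X N)"
proof -
  have Y: "Yext (opcat \<A>) \<C> t P Q = (`) rev ` YE t Q P" for P Q
  proof (intro equalityI subsetI)
    fix x
    assume "x \<in> Yext (opcat \<A>) \<C> t P Q"
    then have "rev ` x \<in> YE t Q P" by (rule Yext_opcatD[OF _ t])
    then show "x \<in> (`) rev ` YE t Q P" using image_eqI[of x "(`) rev" "rev ` x"] by simp
  qed (use Yext_opcat[OF _ t] in blast)
  have r: "bij_betw ((`) rev) A ((`) rev ` A)" for A :: "'b list set set"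
    by (rule inj_on_imp_bij_betw) (auto intro!: inj_onI dest: rev_image_eq)
  have key: "bij_betw g ((`) rev ` A) ((`) rev ` B) \<longleftrightarrow> bij_betw h A B"
    if "\<And>x. g (rev ` x) = rev ` h x" for g h and A B :: "'b list set set"
  proof -
    have "bij_betw g ((`) rev ` A) ((`) rev ` B) \<longleftrightarrow> bij_betw (g \<circ> (`) rev) A ((`) rev ` B)"
      by (rule bij_betw_comp_iff[OF r])
    also have "g \<circ> (`) rev = (`) rev \<circ> h" using that by (auto simp: fun_eq_iff)
    also have "bij_betw ((`) rev \<circ> h) A ((`) rev ` B) \<longleftrightarrow> bij_betw h A B"
    proof
      assume "bij_betw ((`) rev \<circ> h) A ((`) rev ` B)"
      moreover have "bij_betw ((`) rev) ((`) rev ` B) B"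
      proof -
        have "(`) rev ` (`) rev ` B = B" by (simp add: image_comp comp_def)
        then show ?thesis using r[of "(`) rev ` B"] by simp
      qed
      ultimately have "bij_betw ((`) rev \<circ> ((`) rev \<circ> h)) A B" by (rule bij_betw_trans)
      then show "bij_betw h A B" by (simp add: comp_def)
    next
      assume "bij_betw h A B"
      then show "bij_betw ((`) rev \<circ> h) A ((`) rev ` B)" using r[of B] by (rule bij_betw_trans)
    qed
    finally show ?thesis .
  qed
  show "bij_betw (push (opcat \<A>) \<C> f) (Yext (opcat \<A>) \<C> t X N) (Yext (opcat \<A>) \<C> t X M)
    \<longleftrightarrow> bij_betw (pull \<A> \<C> f) (YE t N X) (YE t M X)"
    unfolding Y by (rule key) (rule push_opcat)
  show "bij_betw (pull (opcat \<A>) \<C> f) (Yext (opcat \<A>) \<C> t M X) (Yext (opcat \<A>) \<C> t N X)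
    \<longleftrightarrow> bij_betw (push \<A> \<C> f) (YE t X M) (YE t X N)"
    unfolding Y by (rule key) (rule pull_opcat)
qed

end

theorem corollary3p4:
  fixes \<A> :: "('o, 'm, 'z) cat_scheme" and \<C> :: "'o set" and n :: nat
    and f :: 'm and M N :: 'o
  assumes "n_Frobenius_category \<A> \<C> n"
    and "M \<in> \<C>" and "N \<in> \<C>" and "f \<in> Hom \<A> M N"
  shows "invertible_from_left \<A> \<C> (n + 1) f \<longleftrightarrow> invertible_from_right \<A> \<C> (n + 1) f"
proof -
  interpret n_Frobenius_category \<A> \<C> n by (rule assms(1))
  interpret op: n_Frobenius_category "opcat \<A>" \<C> n by (rule n_Frobenius_category_opcat[OF assms(1)])
  have n0: "0 < Suc n" by simp
  \<comment> \<open>In the opposite category \<open>f\<close> goes from \<open>N\<close> to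
    \<open>M\<close>, and acting from the left there is acting from the right here. The implication
    already proved thus yields the converse.\<close>
  have fo: "f \<in> Hom (opcat \<A>) N M" using assms(4) by simp
  have "(\<forall>X\<in>\<C>. bij_betw (push \<A> \<C> f) (YE (Suc n) X M) (YE (Suc n) X N)) \<longleftrightarrow>
    (\<forall>X\<in>\<C>. bij_betw (pull \<A> \<C> f) (YE (Suc n) N X) (YE (Suc n) M X))"
    using invertible_from_left_imp_right[OF assms(4,2,3)]
      op.invertible_from_left_imp_right[OF fo assms(3,2)] bij_betw_opcat[OF n0] by blast
  then show ?thesis
    using invertible_from_left_iff[OF assms(4,2,3) n0] invertible_from_right_iff[OF assms(4,2,3) n0] by simp
qed

end
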